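(* Let $\mathbb{E}$ be a higher equipment, $\mathcal{J}$ an indexing category and $F:\mathcal{J}\to\mathbb{E}_0$ a functor. Then $$\operatorname{dcolim}F^*\cong\operatorname{hocolim}F,$$ where $F^*$ is the composite $\mathcal{J}\xrightarrow{F}\mathbb{E}_0\xrightarrow{(\cdot)^*}\mathbb{E}$ of $F$ with the companion map, and the homotopy colimit on the right is taken in the simplicially enriched category $\mathbb{E}_v$.
   Context: Simplicial categories. $\Delta$ is the category of finite ordinals $[n]=\{0,\dots,n\}$ and order-preserving maps. A simplicial category is a (possibly weak) functor $\mathbb{E}:\Delta^{op}\to\mathbf{Cat}$, i.e. a simplicial object in categories whose simplicial identities may hold only up to coherent natural isomorphism; in the weak case identities between iterated faces and degeneracies are read through these isomorphisms. Write $\mathbb{E}_n=\mathbb{E}([n])$, $d_i,s_i$ for the face and degeneracy functors, $\theta:\mathbb{E}_n\to\mathbb{E}_m$ for the functor induced by $\theta:[m]\to[n]$ in $\Delta$ (same convention for simplicial sets), and $s^n:\mathbb{E}_0\to\mathbb{E}_n$ for the iterated degeneracy $\mathbb{E}_0\xrightarrow{s_0}\mathbb{E}_1\xrightarrow{s_0}\cdots\xrightarrow{s_0}\mathbb{E}_n$. Categories are regarded as simplicial sets via the nerve. Higher equipments. $\mathbb{E}$ is a (higher) equipment if, given any $x\in\mathbb{E}_n$ and morphisms $f^i:d_ix\to y^i$ in $\mathbb{E}_{n-1}$ ($i=0,\dots,n$) with $d_if^j=d_{j-1}f^i$ for all $i<j$, there is an object $y\in\mathbb{E}_n$ with a morphism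 $f:x\to y$ such that: (i) $d_iy=y^i$ and $d_if=f^i$ for $i=0,\dots,n$; (ii) given any $h:x\to z$ in $\mathbb{E}_n$ such that $d_ih=g^if^i$ for some $g^i:y^i\to d_iz$ in $\mathbb{E}_{n-1}$, there is a unique $g:y\to z$ with $h=gf$ and $d_ig=g^i$. The object $y$ with $f$ is called the universal extension of $x$ along the $f^i$, denoted $x(f^n,\dots,f^0)$. Companions. Let $\sigma=(x_0\xrightarrow{f_1}x_1\xrightarrow{f_2}\cdots\xrightarrow{f_n}x_n)$ be an $n$-simplex in the category $\mathbb{E}_0$, with faces $d_i\sigma$ taken in the nerve. Its companion $\sigma^*\in\mathbb{E}_n$ and a morphism $\phi_\sigma:s^nx_0\to\sigma^*$ are defined recursively: for $n=0$, $\sigma^*=\sigma$ and $\phi_\sigma=1_\sigma$; for $n>0$, $\sigma^*=s^nx_0(\phi_{d_n\sigma},\dots,\phi_{d_0\sigma})$ and $\phi_\sigma$ is the induced morphism $s^nx_0\to\sigma^*$, where on the $0$-th face $\phi_{d_0\sigma}:s^{n-1}x_1\to(d_0\sigma)^*$ is precomposed with $s^{n-1}f_1:s^{n-1}x_0\to s^{n-1}x_1$. Then $d_i\sigma^*=(d_i\sigma)^*$, and for degeneracies there are comparison morphisms $\alpha_i:(s_i\sigma)^*\to s_i\sigma^*$ with $\alpha_i\circ\phi_{s_i\sigma}=s_i\phi_\sigma$, constructed recursively (starting from identities for objects of $\mathbb{E}_0$) from the universal property of $\phi_{s_i\sigma}$. This makes the companion construction an oplax transformation $(\cdot)^*:\mathbb{E}_0\to\mathbb{E}$.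 Double colimits. An oplax horizontal diagram $(G,\psi):\mathcal{J}\to\mathbb{E}$ assigns to each $n$-simplex $\sigma$ of $\mathcal{J}$ an object $G(\sigma)\in\mathbb{E}_n$, and to each $\theta:[m]\to[n]$ a structure morphism $\psi_\theta:G(\theta(\sigma))\to\theta(G(\sigma))$ in $\mathbb{E}_m$, satisfying coherence laws. An object $c\in\mathbb{E}_0$ gives the constant diagram $\sigma\mapsto s^nc$; a map $\eta:G\Rightarrow c$ is a family $\eta_\sigma:G(\sigma)\to s^nc$ in $\mathbb{E}_n$ compatible with the structure morphisms. The double colimit $\operatorname{dcolim}G$ is an object of $\mathbb{E}_0$ with a map $\eta:G\Rightarrow\operatorname{dcolim}G$ such that for any $\eta':G\Rightarrow c$ with $c\in\mathbb{E}_0$ there is a unique $f:\operatorname{dcolim}G\to c$ in $\mathbb{E}_0$ with $f\circ\eta=\eta'$ (i.e. $s^n(f)\circ\eta_\sigma=\eta'_\sigma$ for all $\sigma$). The simplicially enriched category $\mathbb{E}_v$ has the objects of $\mathbb{E}_0$ and mapping simplicial sets $\mathbb{E}_v(x,y)_n=\mathbb{E}_n(s^nx,s^ny)$, with simplicial operators induced by those of $\mathbb{E}$ and composition given by composition in the categories $\mathbb{E}_n$; its underlying category is $\mathbb{E}_0$. The tensor $K\odot x$ of an object $x$ with a simplicial set $K$ is characterised by natural isomorphisms $\mathbb{E}_0(K\odot x,y)\cong\mathbf{sSet}(K,\mathbb{E}_v(x,y))$. The homotopy colimit is defined by the coend $$\operatorname{hocolim}F=\int^{i\in\mathcal{J}}(i/\mathcal{J})\odot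 F(i),$$ where $i/\mathcal{J}$ is the category of pairs $(j,f:i\to j)$ with morphisms the commutative triangles under $i$. *)

theory Defs
  imports Main "HOL-Library.FuncSet"
begin

section \<open>Categories and functors\<close>

record ('o, 'a) cat =
  Obj :: "'o set"
  Arr :: "'a set"
  Dom :: "'a \<Rightarrow> 'o"
  Cod :: "'a \<Rightarrow> 'o"
  Ide :: "'o \<Rightarrow> 'a"
  Comp :: "'a \<Rightarrow> 'a \<Rightarrow> 'a"  (infixr "\<cdot>\<index>" 70)

definition hom :: "('o, 'a) cat \<Rightarrow> 'o \<Rightarrow> 'o \<Rightarrow> 'a set" where
  "hom C x y = {f \<in> Arr C. Dom C f = x \<and> Cod C f = y}"

locale category =
  fixes C :: "('o, 'a) cat" (structure)
  assumes Dom_in: "f \<in> Arr C \<Longrightarrow> Dom C f \<in> Obj C"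
    and Cod_in: "f \<in> Arr C \<Longrightarrow> Cod C f \<in> Obj C"
    and Ide_in: "x \<in> Obj C \<Longrightarrow> Ide C x \<in> hom C x x"
    and Comp_in: "f \<in> hom C x y \<Longrightarrow> g \<in> hom C y z \<Longrightarrow> g \<cdot> f \<in> hom C x z"
    and Comp_Ide: "f \<in> hom C x y \<Longrightarrow> f \<cdot> Ide C x = f"
    and Ide_Comp: "f \<in> hom C x y \<Longrightarrow> Ide C y \<cdot> f = f"
    and Comp_assoc: "f \<in> hom C w x \<Longrightarrow> g \<in> hom C x y \<Longrightarrow> h \<in> hom C y z \<Longrightarrow>
      h \<cdot> (g \<cdot> f) = (h \<cdot> g) \<cdot> f"

definition inverse_arrows :: "('o, 'a) cat \<Rightarrow> 'a \<Rightarrow> 'a \<Rightarrow> bool" where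
  "inverse_arrows C f g \<longleftrightarrow> f \<in> Arr C \<and> g \<in> hom C (Cod C f) (Dom C f) \<and>
     g \<cdot>\<^bsub>C\<^esub> f = Ide C (Dom C f) \<and> f \<cdot>\<^bsub>C\<^esub> g = Ide C (Cod C f)"

definition iso_arrow :: "('o, 'a) cat \<Rightarrow> 'a \<Rightarrow> bool" where
  "iso_arrow C f \<longleftrightarrow> (\<exists>g. inverse_arrows C f g)"

definition inv_arrow :: "('o, 'a) cat \<Rightarrow> 'a \<Rightarrow> 'a" where
  "inv_arrow C f = (THE g. inverse_arrows C f g)"

definition isomorphic :: "('o, 'a) cat \<Rightarrow> 'o \<Rightarrow> 'o \<Rightarrow> bool" where
  "isomorphic C x y \<longleftrightarrow> (\<exists>f \<in> hom C x y. iso_arrow C f)"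

locale is_functor = A: category A + B: category B
  for A :: "('o, 'a) cat" and B :: "('p, 'b) cat" and Fo :: "'o \<Rightarrow> 'p" and Fa :: "'a \<Rightarrow> 'b" +
  assumes Fo_in: "x \<in> Obj A \<Longrightarrow> Fo x \<in> Obj B"
    and Fa_in: "f \<in> hom A x y \<Longrightarrow> Fa f \<in> hom B (Fo x) (Fo y)"
    and Fa_Ide: "x \<in> Obj A \<Longrightarrow> Fa (Ide A x) = Ide B (Fo x)"
    and Fa_Comp: "f \<in> hom A x y \<Longrightarrow> g \<in> hom A y z \<Longrightarrow> Fa (g \<cdot>\<^bsub>A\<^esub> f) = Fa g \<cdot>\<^bsub>B\<^esub> Fa f"


section \<open>The simplex category\<close>

text \<open>A morphism from \<open>[m]\<close> to \<open>[n]\<close> is represented by its extensional function on \<open>{..m}\<close>;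
  composition is \<^const>\<open>compose\<close> and the identity of \<open>[n]\<close> is \<open>restrict id {..n}\<close>.\<close>

definition Delta :: "nat \<Rightarrow> nat \<Rightarrow> (nat \<Rightarrow> nat) set" where
  "Delta m n = {\<theta> \<in> {..m} \<rightarrow>\<^sub>E {..n}. mono_on {..m} \<theta>}"

text \<open>The coface map from \<open>[n - 1]\<close> to \<open>[n]\<close> omitting \<open>i\<close>, only used for \<open>n \<ge> 1\<close>, and the
  codegeneracy map from \<open>[n + 1]\<close> to \<open>[n]\<close> repeating \<open>i\<close>.\<close>

definition coface :: "nat \<Rightarrow> nat \<Rightarrow> nat \<Rightarrow> nat" where
  "coface n i = (\<lambda>k\<in>{..n - 1}. if k < i then k else Suc k)"

definition codegen :: "nat \<Rightarrow> nat \<Rightarrow> nat \<Rightarrow> nat" where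
  "codegen n i = (\<lambda>k\<in>{..Suc n}. if k \<le> i then k else k - 1)"

definition terminal_map :: "nat \<Rightarrow> nat \<Rightarrow> nat" where
  "terminal_map n = (\<lambda>k\<in>{..n}. 0)"


section \<open>Simplicial categories\<close>

text \<open>Data of a pseudofunctor from the opposite of the simplex category to categories. For
  \<open>\<theta>\<close> from \<open>[m]\<close> to \<open>[n]\<close>, the functor from level \<open>n\<close> to level \<open>m\<close> is \<open>opo E m n \<theta>\<close>,
  \<open>opa E m n \<theta>\<close>. For \<open>\<tau>\<close> from \<open>[l]\<close> to \<open>[m]\<close>, \<open>cmp E l m n \<tau> \<theta> x\<close> is the coherence isomorphism
  from \<open>\<tau> (\<theta> x)\<close> to \<open>(\<theta> \<circ> \<tau>) x\<close>, and \<open>unt E n x\<close> is the one from \<open>x\<close> to \<open>id x\<close>. A strict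
  simplicial category is the case where all of these are identities.\<close>

record ('o, 'a) scat =
  lev :: "nat \<Rightarrow> ('o, 'a) cat"
  opo :: "nat \<Rightarrow> nat \<Rightarrow> (nat \<Rightarrow> nat) \<Rightarrow> 'o \<Rightarrow> 'o"
  opa :: "nat \<Rightarrow> nat \<Rightarrow> (nat \<Rightarrow> nat) \<Rightarrow> 'a \<Rightarrow> 'a"
  cmp :: "nat \<Rightarrow> nat \<Rightarrow> nat \<Rightarrow> (nat \<Rightarrow> nat) \<Rightarrow> (nat \<Rightarrow> nat) \<Rightarrow> 'o \<Rightarrow> 'a"
  unt :: "nat \<Rightarrow> 'o \<Rightarrow> 'a"

locale simplicial_category =
  fixes E :: "('o, 'a) scat"
  assumes lev_category: "category (lev E n)"
    and op_functor: "\<theta> \<in> Delta m n \<Longrightarrow>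
      is_functor (lev E n) (lev E m) (opo E m n \<theta>) (opa E m n \<theta>)"
    and cmp_in: "\<tau> \<in> Delta l m \<Longrightarrow> \<theta> \<in> Delta m n \<Longrightarrow> x \<in> Obj (lev E n) \<Longrightarrow>
      cmp E l m n \<tau> \<theta> x \<in>
        hom (lev E l) (opo E l m \<tau> (opo E m n \<theta> x)) (opo E l n (compose {..l} \<theta> \<tau>) x)"
    and cmp_iso: "\<tau> \<in> Delta l m \<Longrightarrow> \<theta> \<in> Delta m n \<Longrightarrow> x \<in> Obj (lev E n) \<Longrightarrow>
      iso_arrow (lev E l) (cmp E l m n \<tau> \<theta> x)"
    and cmp_natural: "\<tau> \<in> Delta l m \<Longrightarrow> \<theta> \<in> Delta m n \<Longrightarrow> f \<in> hom (lev E n) x y \<Longrightarrow>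
      cmp E l m n \<tau> \<theta> y \<cdot>\<^bsub>lev E l\<^esub> opa E l m \<tau> (opa E m n \<theta> f)
      = opa E l n (compose {..l} \<theta> \<tau>) f \<cdot>\<^bsub>lev E l\<^esub> cmp E l m n \<tau> \<theta> x"
    and unt_in: "x \<in> Obj (lev E n) \<Longrightarrow>
      unt E n x \<in> hom (lev E n) x (opo E n n (restrict id {..n}) x)"
    and unt_iso: "x \<in> Obj (lev E n) \<Longrightarrow> iso_arrow (lev E n) (unt E n x)"
    and unt_natural: "f \<in> hom (lev E n) x y \<Longrightarrow>
      unt E n y \<cdot>\<^bsub>lev E n\<^esub> f = opa E n n (restrict id {..n}) f \<cdot>\<^bsub>lev E n\<^esub> unt E n x"
    and cmp_assoc: "\<rho> \<in> Delta k l \<Longrightarrow> \<tau> \<in> Delta l m \<Longrightarrow> \<theta> \<in> Delta m n \<Longrightarrow>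
      x \<in> Obj (lev E n) \<Longrightarrow>
      cmp E k l n \<rho> (compose {..l} \<theta> \<tau>) x \<cdot>\<^bsub>lev E k\<^esub> opa E k l \<rho> (cmp E l m n \<tau> \<theta> x)
      = cmp E k m n (compose {..k} \<tau> \<rho>) \<theta> x \<cdot>\<^bsub>lev E k\<^esub> cmp E k l m \<rho> \<tau> (opo E m n \<theta> x)"
    and cmp_unt_left: "\<theta> \<in> Delta m n \<Longrightarrow> x \<in> Obj (lev E n) \<Longrightarrow>
      cmp E m m n (restrict id {..m}) \<theta> x \<cdot>\<^bsub>lev E m\<^esub> unt E m (opo E m n \<theta> x)
      = Ide (lev E m) (opo E m n \<theta> x)"
    and cmp_unt_right: "\<theta> \<in> Delta m n \<Longrightarrow> x \<in> Obj (lev E n) \<Longrightarrow>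
      cmp E m n n \<theta> (restrict id {..n}) x \<cdot>\<^bsub>lev E m\<^esub> opa E m n \<theta> (unt E n x)
      = Ide (lev E m) (opo E m n \<theta> x)"

abbreviation face_o :: "('o, 'a) scat \<Rightarrow> nat \<Rightarrow> nat \<Rightarrow> 'o \<Rightarrow> 'o" where
  "face_o E n i \<equiv> opo E (n - 1) n (coface n i)"

abbreviation face_a :: "('o, 'a) scat \<Rightarrow> nat \<Rightarrow> nat \<Rightarrow> 'a \<Rightarrow> 'a" where
  "face_a E n i \<equiv> opa E (n - 1) n (coface n i)"

text \<open>For \<open>n \<ge> 2\<close> and \<open>i < j \<le> n\<close>, the coherence isomorphism \<open>d\<^sub>i d\<^sub>j x \<cong> d\<^sub>j\<^sub>-\<^sub>1 d\<^sub>i x\<close> at an object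
  \<open>x\<close> of level \<open>n\<close>.\<close>

definition face_swap :: "('o, 'a) scat \<Rightarrow> nat \<Rightarrow> nat \<Rightarrow> nat \<Rightarrow> 'o \<Rightarrow> 'a" where
  "face_swap E n i j x =
     inv_arrow (lev E (n - 2)) (cmp E (n - 2) (n - 1) n (coface (n - 1) (j - 1)) (coface n i) x)
     \<cdot>\<^bsub>lev E (n - 2)\<^esub> cmp E (n - 2) (n - 1) n (coface (n - 1) i) (coface n j) x"

inductive coherence_arrow :: "('o, 'a) scat \<Rightarrow> nat \<Rightarrow> 'a \<Rightarrow> bool" for E where
  ide: "x \<in> Obj (lev E n) \<Longrightarrow> coherence_arrow E n (Ide (lev E n) x)"
| cmp: "\<tau> \<in> Delta l m \<Longrightarrow> \<theta> \<in> Delta m n \<Longrightarrow> x \<in> Obj (lev E n) \<Longrightarrow>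
    coherence_arrow E l (cmp E l m n \<tau> \<theta> x)"
| unt: "x \<in> Obj (lev E n) \<Longrightarrow> coherence_arrow E n (unt E n x)"
| inverse: "coherence_arrow E n u \<Longrightarrow> inverse_arrows (lev E n) u v \<Longrightarrow> coherence_arrow E n v"
| comp: "coherence_arrow E n u \<Longrightarrow> coherence_arrow E n v \<Longrightarrow>
    Cod (lev E n) u = Dom (lev E n) v \<Longrightarrow> coherence_arrow E n (v \<cdot>\<^bsub>lev E n\<^esub> u)"
| op: "coherence_arrow E n u \<Longrightarrow> \<theta> \<in> Delta m n \<Longrightarrow> coherence_arrow E m (opa E m n \<theta> u)"


section \<open>Higher equipments\<close>

text \<open>A family \<open>f i : d\<^sub>i x \<rightarrow> Y i\<close> with \<open>d\<^sub>i (f j) = d\<^sub>j\<^sub>-\<^sub>1 (f i)\<close> for \<open>i < j\<close>, this equality being read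
  through coherence isomorphisms: \<open>face_swap\<close> between the domains, and \<open>\<theta> i j\<close> from \<open>d\<^sub>i (Y j)\<close> to
  \<open>d\<^sub>j\<^sub>-\<^sub>1 (Y i)\<close> between the codomains. The hexagon in the last clause holds automatically for the
  \<open>face_swap\<close> isomorphisms of an object with faces \<open>Y\<close>. In a strict simplicial category every
  coherence arrow is an identity, so that \<open>\<theta>\<close> and the hexagon carry no information beyond
  \<open>d\<^sub>i (Y j) = d\<^sub>j\<^sub>-\<^sub>1 (Y i)\<close>.\<close>

definition matching_family ::
  "('o, 'a) scat \<Rightarrow> nat \<Rightarrow> 'o \<Rightarrow> (nat \<Rightarrow> 'o) \<Rightarrow> (nat \<Rightarrow> 'a) \<Rightarrow> (nat \<Rightarrow> nat \<Rightarrow> 'a) \<Rightarrow> bool" where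
  "matching_family E n x Y f \<theta> \<longleftrightarrow>
     x \<in> Obj (lev E n) \<and>
     (\<forall>i\<le>n. f i \<in> hom (lev E (n - 1)) (face_o E n i x) (Y i)) \<and>
     (\<forall>i j. 2 \<le> n \<and> i < j \<and> j \<le> n \<longrightarrow>
        coherence_arrow E (n - 2) (\<theta> i j) \<and>
        \<theta> i j \<in> hom (lev E (n - 2)) (face_o E (n - 1) i (Y j)) (face_o E (n - 1) (j - 1) (Y i)) \<and>
        \<theta> i j \<cdot>\<^bsub>lev E (n - 2)\<^esub> face_a E (n - 1) i (f j)
        = face_a E (n - 1) (j - 1) (f i) \<cdot>\<^bsub>lev E (n - 2)\<^esub> face_swap E n i j x) \<and>
     (\<forall>i j k. 3 \<le> n \<and> i < j \<and> j < k \<and> k \<le> n \<longrightarrow>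
        face_swap E (n - 1) (j - 1) (k - 1) (Y i) \<cdot>\<^bsub>lev E (n - 3)\<^esub>
          face_a E (n - 2) (j - 1) (\<theta> i k) \<cdot>\<^bsub>lev E (n - 3)\<^esub> face_swap E (n - 1) i j (Y k)
        = face_a E (n - 2) (k - 2) (\<theta> i j) \<cdot>\<^bsub>lev E (n - 3)\<^esub>
          face_swap E (n - 1) i (k - 1) (Y j) \<cdot>\<^bsub>lev E (n - 3)\<^esub> face_a E (n - 2) i (\<theta> j k))"

text \<open>The family \<open>g i\<close> in the universal property has to match in the same sense as \<open>f\<close>, since it is
  to be the family of faces of an arrow.\<close>

definition universal_extension ::
  "('o, 'a) scat \<Rightarrow> nat \<Rightarrow> 'o \<Rightarrow> (nat \<Rightarrow> 'o) \<Rightarrow> (nat \<Rightarrow> 'a) \<Rightarrow> (nat \<Rightarrow> nat \<Rightarrow> 'a) \<Rightarrow> 'o \<Rightarrow> 'a \<Rightarrow> bool"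
  where
  "universal_extension E n x Y f \<theta> y \<phi> \<longleftrightarrow>
     \<phi> \<in> hom (lev E n) x y \<and> y \<in> Obj (lev E n) \<and>
     (\<forall>i\<le>n. face_o E n i y = Y i \<and> face_a E n i \<phi> = f i) \<and>
     (\<forall>i j. 2 \<le> n \<and> i < j \<and> j \<le> n \<longrightarrow> face_swap E n i j y = \<theta> i j) \<and>
     (\<forall>z h g.
        h \<in> hom (lev E n) x z \<and>
        (\<forall>i\<le>n. g i \<in> hom (lev E (n - 1)) (Y i) (face_o E n i z) \<and>
                face_a E n i h = g i \<cdot>\<^bsub>lev E (n - 1)\<^esub> f i) \<and>
        (\<forall>i j. 2 \<le> n \<and> i < j \<and> j \<le> n \<longrightarrow>
           face_swap E n i j z \<cdot>\<^bsub>lev E (n - 2)\<^esub> face_a E (n - 1) i (g j)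
           = face_a E (n - 1) (j - 1) (g i) \<cdot>\<^bsub>lev E (n - 2)\<^esub> \<theta> i j)
        \<longrightarrow> (\<exists>!u. u \<in> hom (lev E n) y z \<and> h = u \<cdot>\<^bsub>lev E n\<^esub> \<phi> \<and> (\<forall>i\<le>n. face_a E n i u = g i)))"

locale equipment = simplicial_category E for E :: "('o, 'a) scat" +
  assumes extension: "1 \<le> n \<Longrightarrow> matching_family E n x Y f \<theta> \<Longrightarrow>
    \<exists>y \<phi>. universal_extension E n x Y f \<theta> y \<phi>"


section \<open>Iterated degeneracies\<close>

primrec degen_o :: "('o, 'a) scat \<Rightarrow> nat \<Rightarrow> 'o \<Rightarrow> 'o" where
  "degen_o E 0 x = x"
| "degen_o E (Suc n) x = opo E (Suc n) n (codegen n 0) (degen_o E n x)"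

primrec degen_a :: "('o, 'a) scat \<Rightarrow> nat \<Rightarrow> 'a \<Rightarrow> 'a" where
  "degen_a E 0 f = f"
| "degen_a E (Suc n) f = opa E (Suc n) n (codegen n 0) (degen_a E n f)"

text \<open>The coherence isomorphism from \<open>s\<^sup>n x\<close> to the image of \<open>x\<close> under the functor induced by
  \<open>[n] \<rightarrow> [0]\<close>, and the resulting isomorphism from \<open>\<theta> (s\<^sup>n x)\<close> to \<open>s\<^sup>m x\<close> for \<open>\<theta>\<close> from \<open>[m]\<close> to
  \<open>[n]\<close>. Both are identities in the strict case.\<close>

primrec degen_iso :: "('o, 'a) scat \<Rightarrow> nat \<Rightarrow> 'o \<Rightarrow> 'a" where
  "degen_iso E 0 x = unt E 0 x"
| "degen_iso E (Suc n) x =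
     cmp E (Suc n) n 0 (codegen n 0) (terminal_map n) x
     \<cdot>\<^bsub>lev E (Suc n)\<^esub> opa E (Suc n) n (codegen n 0) (degen_iso E n x)"

definition const_iso :: "('o, 'a) scat \<Rightarrow> nat \<Rightarrow> nat \<Rightarrow> (nat \<Rightarrow> nat) \<Rightarrow> 'o \<Rightarrow> 'a" where
  "const_iso E m n \<theta> x =
     inv_arrow (lev E m) (degen_iso E m x) \<cdot>\<^bsub>lev E m\<^esub>
     cmp E m n 0 \<theta> (terminal_map n) x \<cdot>\<^bsub>lev E m\<^esub> opa E m n \<theta> (degen_iso E n x)"


section \<open>Simplicial sets and nerves\<close>

record 'k sset =
  simp :: "nat \<Rightarrow> 'k set"
  sact :: "nat \<Rightarrow> nat \<Rightarrow> (nat \<Rightarrow> nat) \<Rightarrow> 'k \<Rightarrow> 'k"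

definition sset_maps :: "'k sset \<Rightarrow> 'l sset \<Rightarrow> (nat \<Rightarrow> 'k \<Rightarrow> 'l) set" where
  "sset_maps K L = {p. (\<forall>n. p n \<in> simp K n \<rightarrow>\<^sub>E simp L n) \<and>
     (\<forall>m n. \<forall>\<theta> \<in> Delta m n. \<forall>a \<in> simp K n. p m (sact K m n \<theta> a) = sact L m n \<theta> (p n a))}"

text \<open>An \<open>n\<close>-simplex of the nerve is a functor \<open>\<sigma>\<close> from the poset \<open>[n]\<close> to the category, given by
  its arrows \<open>\<sigma> (i, j)\<close> for \<open>i \<le> j \<le> n\<close>; the corresponding string of composable arrows is
  \<open>\<sigma> (0, 1), \<dots>, \<sigma> (n - 1, n)\<close>.\<close>

definition tri :: "nat \<Rightarrow> (nat \<times> nat) set" where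
  "tri n = {(i, j). i \<le> j \<and> j \<le> n}"

definition vert :: "('o, 'a) cat \<Rightarrow> (nat \<times> nat \<Rightarrow> 'a) \<Rightarrow> nat \<Rightarrow> 'o" where
  "vert C \<sigma> i = Dom C (\<sigma> (i, i))"

definition nerve_simp :: "('o, 'a) cat \<Rightarrow> nat \<Rightarrow> (nat \<times> nat \<Rightarrow> 'a) set" where
  "nerve_simp C n = {\<sigma> \<in> tri n \<rightarrow>\<^sub>E Arr C.
     (\<forall>i j. i \<le> j \<and> j \<le> n \<longrightarrow> \<sigma> (i, j) \<in> hom C (vert C \<sigma> i) (vert C \<sigma> j)) \<and>
     (\<forall>i\<le>n. \<sigma> (i, i) = Ide C (vert C \<sigma> i)) \<and>
     (\<forall>i j k. i \<le> j \<and> j \<le> k \<and> k \<le> n \<longrightarrow> \<sigma> (j, k) \<cdot>\<^bsub>C\<^esub> \<sigma> (i, j) = \<sigma> (i, k))}"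

definition nerve_act :: "nat \<Rightarrow> (nat \<Rightarrow> nat) \<Rightarrow> (nat \<times> nat \<Rightarrow> 'a) \<Rightarrow> nat \<times> nat \<Rightarrow> 'a" where
  "nerve_act m \<theta> \<sigma> = (\<lambda>(i, j) \<in> tri m. \<sigma> (\<theta> i, \<theta> j))"

definition nerve :: "('o, 'a) cat \<Rightarrow> (nat \<times> nat \<Rightarrow> 'a) sset" where
  "nerve C = \<lparr>simp = nerve_simp C, sact = (\<lambda>m n \<theta> \<sigma>. nerve_act m \<theta> \<sigma>)\<rparr>"

definition nerve_map :: "('a \<Rightarrow> 'b) \<Rightarrow> nat \<Rightarrow> (nat \<times> nat \<Rightarrow> 'a) \<Rightarrow> nat \<times> nat \<Rightarrow> 'b" where
  "nerve_map Fa n \<sigma> = (\<lambda>p \<in> tri n. Fa (\<sigma> p))"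


section \<open>Oplax horizontal diagrams and double colimits\<close>

text \<open>\<open>G n \<sigma>\<close> is the object assigned to the \<open>n\<close>-simplex \<open>\<sigma>\<close>, and \<open>\<psi> m n \<theta> \<sigma>\<close> is the structure arrow
  from \<open>G (\<theta> \<sigma>)\<close> to \<open>\<theta> (G \<sigma>)\<close> for \<open>\<theta>\<close> from \<open>[m]\<close> to \<open>[n]\<close>.\<close>

definition oplax_diagram ::
  "('o, 'a) scat \<Rightarrow> ('j, 'k) cat \<Rightarrow> (nat \<Rightarrow> (nat \<times> nat \<Rightarrow> 'k) \<Rightarrow> 'o) \<Rightarrow>
    (nat \<Rightarrow> nat \<Rightarrow> (nat \<Rightarrow> nat) \<Rightarrow> (nat \<times> nat \<Rightarrow> 'k) \<Rightarrow> 'a) \<Rightarrow> bool" where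
  "oplax_diagram E J G \<psi> \<longleftrightarrow>
     (\<forall>n. \<forall>\<sigma> \<in> nerve_simp J n. G n \<sigma> \<in> Obj (lev E n)) \<and>
     (\<forall>m n. \<forall>\<theta> \<in> Delta m n. \<forall>\<sigma> \<in> nerve_simp J n.
        \<psi> m n \<theta> \<sigma> \<in> hom (lev E m) (G m (nerve_act m \<theta> \<sigma>)) (opo E m n \<theta> (G n \<sigma>))) \<and>
     (\<forall>n. \<forall>\<sigma> \<in> nerve_simp J n. \<psi> n n (restrict id {..n}) \<sigma> = unt E n (G n \<sigma>)) \<and>
     (\<forall>l m n. \<forall>\<tau> \<in> Delta l m. \<forall>\<theta> \<in> Delta m n. \<forall>\<sigma> \<in> nerve_simp J n.
        \<psi> l n (compose {..l} \<theta> \<tau>) \<sigma>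
        = cmp E l m n \<tau> \<theta> (G n \<sigma>) \<cdot>\<^bsub>lev E l\<^esub> opa E l m \<tau> (\<psi> m n \<theta> \<sigma>)
          \<cdot>\<^bsub>lev E l\<^esub> \<psi> l m \<tau> (nerve_act m \<theta> \<sigma>))"

definition diagram_cocone ::
  "('o, 'a) scat \<Rightarrow> ('j, 'k) cat \<Rightarrow> (nat \<Rightarrow> (nat \<times> nat \<Rightarrow> 'k) \<Rightarrow> 'o) \<Rightarrow>
    (nat \<Rightarrow> nat \<Rightarrow> (nat \<Rightarrow> nat) \<Rightarrow> (nat \<times> nat \<Rightarrow> 'k) \<Rightarrow> 'a) \<Rightarrow> 'o \<Rightarrow>
    (nat \<Rightarrow> (nat \<times> nat \<Rightarrow> 'k) \<Rightarrow> 'a) \<Rightarrow> bool" where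
  "diagram_cocone E J G \<psi> c \<eta> \<longleftrightarrow> c \<in> Obj (lev E 0) \<and>
     (\<forall>n. \<forall>\<sigma> \<in> nerve_simp J n. \<eta> n \<sigma> \<in> hom (lev E n) (G n \<sigma>) (degen_o E n c)) \<and>
     (\<forall>m n. \<forall>\<theta> \<in> Delta m n. \<forall>\<sigma> \<in> nerve_simp J n.
        \<eta> m (nerve_act m \<theta> \<sigma>)
        = const_iso E m n \<theta> c \<cdot>\<^bsub>lev E m\<^esub> opa E m n \<theta> (\<eta> n \<sigma>) \<cdot>\<^bsub>lev E m\<^esub> \<psi> m n \<theta> \<sigma>)"

definition is_dcolim ::
  "('o, 'a) scat \<Rightarrow> ('j, 'k) cat \<Rightarrow> (nat \<Rightarrow> (nat \<times> nat \<Rightarrow> 'k) \<Rightarrow> 'o) \<Rightarrow>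
    (nat \<Rightarrow> nat \<Rightarrow> (nat \<Rightarrow> nat) \<Rightarrow> (nat \<times> nat \<Rightarrow> 'k) \<Rightarrow> 'a) \<Rightarrow> 'o \<Rightarrow> bool" where
  "is_dcolim E J G \<psi> D \<longleftrightarrow> oplax_diagram E J G \<psi> \<and>
     (\<exists>\<eta>. diagram_cocone E J G \<psi> D \<eta> \<and>
       (\<forall>c \<eta>'. diagram_cocone E J G \<psi> c \<eta>' \<longrightarrow>
          (\<exists>!f. f \<in> hom (lev E 0) D c \<and>
             (\<forall>n. \<forall>\<sigma> \<in> nerve_simp J n. degen_a E n f \<cdot>\<^bsub>lev E n\<^esub> \<eta> n \<sigma> = \<eta>' n \<sigma>))))"


section \<open>Companions\<close>

text \<open>The arrow \<open>d\<^sub>i (s\<^sup>n x\<^sub>0) \<rightarrow> (d\<^sub>i \<sigma>)\<^sup>*\<close> along which \<open>s\<^sup>n x\<^sub>0\<close> is extended.\<close>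

definition companion_leg ::
  "('o, 'a) scat \<Rightarrow> (nat \<Rightarrow> (nat \<times> nat \<Rightarrow> 'a) \<Rightarrow> 'a) \<Rightarrow> nat \<Rightarrow> (nat \<times> nat \<Rightarrow> 'a) \<Rightarrow> nat \<Rightarrow> 'a" where
  "companion_leg E \<phi> n \<sigma> i =
     (if i = 0
      then \<phi> (n - 1) (nerve_act (n - 1) (coface n 0) \<sigma>) \<cdot>\<^bsub>lev E (n - 1)\<^esub> degen_a E (n - 1) (\<sigma> (0, 1))
      else \<phi> (n - 1) (nerve_act (n - 1) (coface n i) \<sigma>))
     \<cdot>\<^bsub>lev E (n - 1)\<^esub> const_iso E (n - 1) n (coface n i) (vert (lev E 0) \<sigma> 0)"

text \<open>\<open>C n \<sigma>\<close> is the companion of \<open>\<sigma>\<close> and \<open>\<phi> n \<sigma>\<close> its universal arrow; they depend on a choice of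
  universal extensions. As \<open>d\<^sub>i (d\<^sub>j \<sigma>)\<^sup>*\<close> and \<open>d\<^sub>j\<^sub>-\<^sub>1 (d\<^sub>i \<sigma>)\<^sup>*\<close> are both the companion of
  \<open>d\<^sub>i (d\<^sub>j \<sigma>)\<close>, they are identified by the identity. The structure arrows \<open>\<psi>\<close> are identities on faces
  and the comparison arrows \<open>(s\<^sub>i \<sigma>)\<^sup>* \<rightarrow> s\<^sub>i \<sigma>\<^sup>*\<close> on degeneracies. The coherence law for
  \<open>codegen n i \<circ> coface (n + 1) j\<close> determines the faces of a comparison arrow by comparison arrows
  in lower dimension, and with the last clause this is its recursive construction from the universal
  property.\<close>

definition is_companion ::
  "('o, 'a) scat \<Rightarrow> (nat \<Rightarrow> (nat \<times> nat \<Rightarrow> 'a) \<Rightarrow> 'o) \<Rightarrow> (nat \<Rightarrow> (nat \<times> nat \<Rightarrow> 'a) \<Rightarrow> 'a) \<Rightarrow>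
    (nat \<Rightarrow> nat \<Rightarrow> (nat \<Rightarrow> nat) \<Rightarrow> (nat \<times> nat \<Rightarrow> 'a) \<Rightarrow> 'a) \<Rightarrow> bool" where
  "is_companion E C \<phi> \<psi> \<longleftrightarrow>
     (\<forall>\<sigma> \<in> nerve_simp (lev E 0) 0.
        C 0 \<sigma> = vert (lev E 0) \<sigma> 0 \<and> \<phi> 0 \<sigma> = Ide (lev E 0) (vert (lev E 0) \<sigma> 0)) \<and>
     (\<forall>n\<ge>1. \<forall>\<sigma> \<in> nerve_simp (lev E 0) n.
        universal_extension E n (degen_o E n (vert (lev E 0) \<sigma> 0))
          (\<lambda>i. C (n - 1) (nerve_act (n - 1) (coface n i) \<sigma>))
          (companion_leg E \<phi> n \<sigma>)
          (\<lambda>i j. Ide (lev E (n - 2))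
             (face_o E (n - 1) i (C (n - 1) (nerve_act (n - 1) (coface n j) \<sigma>))))
          (C n \<sigma>) (\<phi> n \<sigma>)) \<and>
     oplax_diagram E (lev E 0) C \<psi> \<and>
     (\<forall>n\<ge>1. \<forall>\<sigma> \<in> nerve_simp (lev E 0) n. \<forall>i\<le>n.
        \<psi> (n - 1) n (coface n i) \<sigma> = Ide (lev E (n - 1)) (face_o E n i (C n \<sigma>))) \<and>
     (\<forall>n. \<forall>\<sigma> \<in> nerve_simp (lev E 0) n. \<forall>i\<le>n.
        \<psi> (Suc n) n (codegen n i) \<sigma>
          \<cdot>\<^bsub>lev E (Suc n)\<^esub> \<phi> (Suc n) (nerve_act (Suc n) (codegen n i) \<sigma>)
          \<cdot>\<^bsub>lev E (Suc n)\<^esub> const_iso E (Suc n) n (codegen n i) (vert (lev E 0) \<sigma> 0)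
        = opa E (Suc n) n (codegen n i) (\<phi> n \<sigma>))"

definition companion_diagram_obj ::
  "(nat \<Rightarrow> (nat \<times> nat \<Rightarrow> 'a) \<Rightarrow> 'o) \<Rightarrow> ('k \<Rightarrow> 'a) \<Rightarrow> nat \<Rightarrow> (nat \<times> nat \<Rightarrow> 'k) \<Rightarrow> 'o" where
  "companion_diagram_obj C Fa n \<sigma> = C n (nerve_map Fa n \<sigma>)"

definition companion_diagram_str ::
  "(nat \<Rightarrow> nat \<Rightarrow> (nat \<Rightarrow> nat) \<Rightarrow> (nat \<times> nat \<Rightarrow> 'a) \<Rightarrow> 'a) \<Rightarrow> ('k \<Rightarrow> 'a) \<Rightarrow>
    nat \<Rightarrow> nat \<Rightarrow> (nat \<Rightarrow> nat) \<Rightarrow> (nat \<times> nat \<Rightarrow> 'k) \<Rightarrow> 'a" where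
  "companion_diagram_str \<psi> Fa m n \<theta> \<sigma> = \<psi> m n \<theta> (nerve_map Fa n \<sigma>)"


section \<open>Mapping spaces, tensors and homotopy colimits\<close>

definition mapping_sset :: "('o, 'a) scat \<Rightarrow> 'o \<Rightarrow> 'o \<Rightarrow> 'a sset" where
  "mapping_sset E x y =
     \<lparr>simp = (\<lambda>n. hom (lev E n) (degen_o E n x) (degen_o E n y)),
      sact = (\<lambda>m n \<theta> h. const_iso E m n \<theta> y \<cdot>\<^bsub>lev E m\<^esub> opa E m n \<theta> h
                        \<cdot>\<^bsub>lev E m\<^esub> inv_arrow (lev E m) (const_iso E m n \<theta> x))\<rparr>"

text \<open>\<open>T\<close> is a tensor of \<open>x\<close> with \<open>K\<close>, the isomorphism natural in \<open>y\<close> being \<open>\<Phi> y\<close>.\<close>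

definition is_tensor ::
  "('o, 'a) scat \<Rightarrow> 'k sset \<Rightarrow> 'o \<Rightarrow> 'o \<Rightarrow> ('o \<Rightarrow> 'a \<Rightarrow> nat \<Rightarrow> 'k \<Rightarrow> 'a) \<Rightarrow> bool" where
  "is_tensor E K x T \<Phi> \<longleftrightarrow> T \<in> Obj (lev E 0) \<and>
     (\<forall>y \<in> Obj (lev E 0). bij_betw (\<Phi> y) (hom (lev E 0) T y) (sset_maps K (mapping_sset E x y))) \<and>
     (\<forall>y z. \<forall>g \<in> hom (lev E 0) y z. \<forall>f \<in> hom (lev E 0) T y.
        \<Phi> z (g \<cdot>\<^bsub>lev E 0\<^esub> f) = (\<lambda>n. \<lambda>a \<in> simp K n. degen_a E n g \<cdot>\<^bsub>lev E n\<^esub> \<Phi> y f n a))"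

text \<open>The arrow \<open>T \<rightarrow> T'\<close> between tensors of \<open>x\<close> with \<open>K\<close> and of \<open>x'\<close> with \<open>K'\<close> that corresponds
  to \<open>p : K \<rightarrow> K'\<close> and \<open>b : x \<rightarrow> x'\<close> under the representing isomorphisms.\<close>

definition tensor_map ::
  "('o, 'a) scat \<Rightarrow> 'k sset \<Rightarrow> 'o \<Rightarrow> ('o \<Rightarrow> 'a \<Rightarrow> nat \<Rightarrow> 'k \<Rightarrow> 'a) \<Rightarrow> 'o \<Rightarrow>
    ('o \<Rightarrow> 'a \<Rightarrow> nat \<Rightarrow> 'l \<Rightarrow> 'a) \<Rightarrow> (nat \<Rightarrow> 'k \<Rightarrow> 'l) \<Rightarrow> 'a \<Rightarrow> 'a" where
  "tensor_map E K T \<Phi> T' \<Phi>' p b =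
     (THE t. t \<in> hom (lev E 0) T T' \<and>
        (\<forall>y. \<forall>f \<in> hom (lev E 0) T' y.
           \<Phi> y (f \<cdot>\<^bsub>lev E 0\<^esub> t)
           = (\<lambda>n. \<lambda>a \<in> simp K n. \<Phi>' y f n (p n a) \<cdot>\<^bsub>lev E n\<^esub> degen_a E n b)))"

definition coslice :: "('j, 'k) cat \<Rightarrow> 'j \<Rightarrow> ('j \<times> 'k, ('j \<times> 'k) \<times> 'k \<times> ('j \<times> 'k)) cat" where
  "coslice J i =
     \<lparr>Obj = {(j, f). f \<in> hom J i j},
      Arr = {((j, f), u, (k, g)). f \<in> hom J i j \<and> g \<in> hom J i k \<and> u \<in> hom J j k \<and> u \<cdot>\<^bsub>J\<^esub> f = g},
      Dom = (\<lambda>(a, u, b). a),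
      Cod = (\<lambda>(a, u, b). b),
      Ide = (\<lambda>(j, f). ((j, f), Ide J j, (j, f))),
      Comp = (\<lambda>(b, v, c) (a, u, b'). (a, v \<cdot>\<^bsub>J\<^esub> u, c))\<rparr>"

text \<open>The functor \<open>i'/J \<rightarrow> i/J\<close> precomposing with \<open>w : i \<rightarrow> i'\<close>.\<close>

definition coslice_map ::
  "('j, 'k) cat \<Rightarrow> 'k \<Rightarrow> ('j \<times> 'k) \<times> 'k \<times> ('j \<times> 'k) \<Rightarrow> ('j \<times> 'k) \<times> 'k \<times> ('j \<times> 'k)" where
  "coslice_map J w = (\<lambda>((j, f), u, (k, g)). ((j, f \<cdot>\<^bsub>J\<^esub> w), u, (k, g \<cdot>\<^bsub>J\<^esub> w)))"

text \<open>\<open>P\<close> and \<open>PA\<close> give a functor of two variables, contravariant in the first: \<open>PA u v\<close> is the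
  arrow \<open>P i' j \<rightarrow> P i j'\<close> induced by \<open>u : i \<rightarrow> i'\<close> and \<open>v : j \<rightarrow> j'\<close>.\<close>

definition cowedge ::
  "('o, 'a) cat \<Rightarrow> ('j, 'k) cat \<Rightarrow> ('j \<Rightarrow> 'j \<Rightarrow> 'o) \<Rightarrow> ('k \<Rightarrow> 'k \<Rightarrow> 'a) \<Rightarrow> 'o \<Rightarrow> ('j \<Rightarrow> 'a) \<Rightarrow> bool" where
  "cowedge A J P PA H w \<longleftrightarrow> H \<in> Obj A \<and> (\<forall>i \<in> Obj J. w i \<in> hom A (P i i) H) \<and>
     (\<forall>i i'. \<forall>u \<in> hom J i i'.
        w i \<cdot>\<^bsub>A\<^esub> PA u (Ide J i) = w i' \<cdot>\<^bsub>A\<^esub> PA (Ide J i') u)"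

definition is_coend ::
  "('o, 'a) cat \<Rightarrow> ('j, 'k) cat \<Rightarrow> ('j \<Rightarrow> 'j \<Rightarrow> 'o) \<Rightarrow> ('k \<Rightarrow> 'k \<Rightarrow> 'a) \<Rightarrow> 'o \<Rightarrow> bool" where
  "is_coend A J P PA H \<longleftrightarrow>
     (\<exists>w. cowedge A J P PA H w \<and>
       (\<forall>H' w'. cowedge A J P PA H' w' \<longrightarrow>
          (\<exists>!t. t \<in> hom A H H' \<and> (\<forall>i \<in> Obj J. t \<cdot>\<^bsub>A\<^esub> w i = w' i))))"

definition is_hocolim ::
  "('o, 'a) scat \<Rightarrow> ('j, 'k) cat \<Rightarrow> ('j \<Rightarrow> 'o) \<Rightarrow> ('k \<Rightarrow> 'a) \<Rightarrow> 'o \<Rightarrow> bool" where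
  "is_hocolim E J Fo Fa H \<longleftrightarrow>
     (\<exists>T \<Phi>.
        (\<forall>i \<in> Obj J. \<forall>j \<in> Obj J. is_tensor E (nerve (coslice J i)) (Fo j) (T i j) (\<Phi> i j)) \<and>
        is_coend (lev E 0) J T
          (\<lambda>u v. tensor_map E (nerve (coslice J (Cod J u)))
             (T (Cod J u) (Dom J v)) (\<Phi> (Cod J u) (Dom J v))
             (T (Dom J u) (Cod J v)) (\<Phi> (Dom J u) (Cod J v))
             (nerve_map (coslice_map J u)) (Fa v))
          H)"

end

theory Submission
  imports Defs
begin

text \<open>A weak simplicial category is replaced by its Grothendieck construction over the simplex
  category, an ordinary category in which the oplax structure of the companions is functoriality and
  \<open>\<sigma>\<^sup>*\<close> has a universal property determined by its faces and \<open>\<phi>\<^sub>\<sigma>\<close>. By induction on the dimension a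
  cocone from \<open>F\<^sup>*\<close> to \<open>c\<close> is therefore the same as a family of arrows \<open>s\<^sup>n (F (\<sigma> 0)) \<rightarrow> c\<close>, one for each
  simplex \<open>\<sigma>\<close> of \<open>J\<close>, that is simplicial up to composition with the image of the initial edge
  \<open>\<sigma> 0 \<rightarrow> \<sigma> (\<theta> 0)\<close>. An \<open>n\<close>-simplex of \<open>i/J\<close> is a simplex \<open>\<sigma>\<close> of \<open>J\<close> with an arrow \<open>i \<rightarrow> \<sigma> 0\<close>, so that by
  naturality in \<open>i\<close> a cowedge on the tensors \<open>(i/J) \<odot> F i\<close> is also such a family. Hence both sides
  represent the same functor of \<open>c\<close>.\<close>

section \<open>Categories and functors\<close>

text \<open>As \<open>degen_iso\<close> is invertible, \<open>point\<close> is a cartesian arrow (n,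
  s^n c) -> (0, c). Families of arrows into the s^n c that are compatible through
  \<open>const_iso\<close> thus become arrows into the single object (0, c), and the coherence of
  constant diagrams disappears. The initial edge enters because \<phi>_\<sigma> starts at s^n of
  vertex 0, while \<theta>\<sigma> starts at vertex \<theta> 0. It is an identity for surjective
  \<theta>, which fix 0. Hence a recurring split: a map that misses a value factors through a
  coface, where structure arrows are identities, and a surjective map is controlled by \<phi>. The
  obstacle is that an equipment supplies extensions only. The structure arrows for all \<theta> have
  to be built by recursion, the factorisation through a coface is not unique, and the universal
  property asks for faces that already match. Independence of the factorisation, compatibility with
  \<phi> and compatibility with faces are therefore proved in one induction. For a given companion,
  by contrast, compatibility with \<phi> is known on cofaces and codegeneracies and follows for all
  maps because these generate the simplex category.\<close>

context category
begin

text \<open>The axioms are stated with \<open>hom\<close>, whose source and target the simplifier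
  would have to guess. Conditions on \<open>Dom\<close> and \<open>Cod\<close> can be discharged by
  rewriting; with the right-bracketed normal form of \<open>Comp_assoc_right\<close> this settles
  most typing and associativity goals below.\<close>

lemma Comp_simps [simp]:
  assumes "f \<in> Arr C" "g \<in> Arr C" "Dom C g = Cod C f"
  shows Comp_Arr: "g \<cdot> f \<in> Arr C"
    and Dom_Comp: "Dom C (g \<cdot> f) = Dom C f"
    and Cod_Comp: "Cod C (g \<cdot> f) = Cod C g"
  using Comp_in[of f "Dom C f" "Cod C f" g "Cod C g"] assms by (auto simp: hom_def)

lemma Comp_assoc_right [simp]:
  assumes "f \<in> Arr C" "g \<in> Arr C" "h \<in> Arr C" "Dom C g = Cod C f" "Dom C h = Cod C g"
  shows "(h \<cdot> g) \<cdot> f = h \<cdot> g \<cdot> f"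
  using Comp_assoc[of f "Dom C f" "Cod C f" g "Cod C g" h "Cod C h"] assms by (auto simp: hom_def)

lemma Ide_simps [simp]:
  assumes "x \<in> Obj C"
  shows Ide_Arr: "Ide C x \<in> Arr C" and Dom_Ide: "Dom C (Ide C x) = x"
    and Cod_Ide: "Cod C (Ide C x) = x"
  using Ide_in[OF assms] by (auto simp: hom_def)

lemma Comp_Ide_Dom [simp]: "f \<in> Arr C \<Longrightarrow> Dom C f = x \<Longrightarrow> f \<cdot> Ide C x = f"
  using Comp_Ide[of f x "Cod C f"] by (auto simp: hom_def)

lemma Ide_Cod_Comp [simp]: "f \<in> Arr C \<Longrightarrow> Cod C f = y \<Longrightarrow> Ide C y \<cdot> f = f"
  using Ide_Comp[of f "Dom C f" y] by (auto simp: hom_def)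

lemmas Dom_Obj [simp] = Dom_in and Cod_Obj [simp] = Cod_in

text \<open>In right-bracketed normal form \<open>g \<cdot> f\<close> is no longer a subterm once
  something is composed on the right. This form applies an equation of two-fold composites at the
  head of a longer chain.\<close>

lemma Comp_eq_right:
  assumes "g \<cdot> f = g' \<cdot> f'" "e \<in> Arr C" "f \<in> Arr C" "f' \<in> Arr C" "g \<in> Arr C" "g' \<in> Arr C"
    "Dom C f = Cod C e" "Dom C f' = Cod C e" "Dom C g = Cod C f" "Dom C g' = Cod C f'"
  shows "g \<cdot> f \<cdot> e = g' \<cdot> f' \<cdot> e"
proof -
  have "g \<cdot> f \<cdot> e = (g \<cdot> f) \<cdot> e" "(g' \<cdot> f') \<cdot> e = g' \<cdot> f' \<cdot> e"
    using assms(2-) by simp_all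
  then show ?thesis by (simp only: assms(1))
qed

lemma inverse_arrows_unique:
  assumes "inverse_arrows C f g" "inverse_arrows C f g'"
  shows "g = g'"
proof -
  have *: "f \<in> Arr C" "g \<in> Arr C" "g' \<in> Arr C" "Dom C g = Cod C f" "Dom C g' = Cod C f"
    "Cod C g = Dom C f" "Cod C g' = Dom C f"
    using assms by (auto simp: inverse_arrows_def hom_def)
  have "g = g \<cdot> (f \<cdot> g')"
    using assms(2) * by (simp add: inverse_arrows_def)
  also have "\<dots> = (g \<cdot> f) \<cdot> g'"
    using * by simp
  also have "\<dots> = g'"
    unfolding assms(1)[unfolded inverse_arrows_def, THEN conjunct2, THEN conjunct2, THEN conjunct1]
    using * by simp
  finally show ?thesis .
qed

lemma inv_arrow:
  assumes "iso_arrow C f"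
  shows "inverse_arrows C f (inv_arrow C f)"
proof -
  obtain g where "inverse_arrows C f g"
    using assms by (auto simp: iso_arrow_def)
  then show ?thesis
    unfolding inv_arrow_def using inverse_arrows_unique by (blast intro: theI)
qed

lemma iso_Arr: "iso_arrow C f \<Longrightarrow> f \<in> Arr C"
  by (auto simp: iso_arrow_def inverse_arrows_def)

lemma inv_arrow_simps [simp]:
  assumes "iso_arrow C f"
  shows "inv_arrow C f \<in> Arr C" "Dom C (inv_arrow C f) = Cod C f" "Cod C (inv_arrow C f) = Dom C f"
    and "inv_arrow C f \<cdot> f = Ide C (Dom C f)" "f \<cdot> inv_arrow C f = Ide C (Cod C f)"
  using inv_arrow[OF assms] by (auto simp: inverse_arrows_def hom_def)

lemma inv_arrow_Comp [simp]:
  assumes "iso_arrow C f" "h \<in> Arr C"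
  shows "Cod C h = Dom C f \<Longrightarrow> inv_arrow C f \<cdot> f \<cdot> h = h"
    and "Cod C h = Cod C f \<Longrightarrow> f \<cdot> inv_arrow C f \<cdot> h = h"
proof -
  note * = inv_arrow_simps[OF assms(1)]
  show "inv_arrow C f \<cdot> f \<cdot> h = h" if "Cod C h = Dom C f"
    using Comp_assoc_right[of h f "inv_arrow C f"] assms(2) that * iso_Arr[OF assms(1)] by simp
  show "f \<cdot> inv_arrow C f \<cdot> h = h" if "Cod C h = Cod C f"
    using Comp_assoc_right[of h "inv_arrow C f" f] assms(2) that * iso_Arr[OF assms(1)] by simp
qed

lemma iso_cancel:
  assumes "iso_arrow C f" "f \<cdot> a = f \<cdot> b" "a \<in> Arr C" "b \<in> Arr C" "Cod C a = Dom C f" "Cod C b = Dom C f"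
  shows "a = b"
  using arg_cong[OF assms(2), of "Comp C (inv_arrow C f)"] inv_arrow_Comp(1)[OF assms(1)] assms(3-)
  by metis

lemma inverse_arrows_sym: "inverse_arrows C f g \<Longrightarrow> inverse_arrows C g f"
  by (auto simp: inverse_arrows_def hom_def)

lemma iso_inv_arrow: "iso_arrow C f \<Longrightarrow> iso_arrow C (inv_arrow C f)"
  unfolding iso_arrow_def[of C "inv_arrow C f"]
  by (rule exI, rule inverse_arrows_sym, rule inv_arrow)

lemma iso_Comp:
  assumes "iso_arrow C f" "iso_arrow C g" "Dom C g = Cod C f"
  shows "iso_arrow C (g \<cdot> f)"
proof -
  have "inverse_arrows C (g \<cdot> f) (inv_arrow C f \<cdot> inv_arrow C g)"
    using assms assms(1,2)[THEN iso_Arr] by (simp add: inverse_arrows_def hom_def)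
  then show ?thesis by (auto simp: iso_arrow_def)
qed

end

context is_functor
begin

lemma Fa_simps [simp]:
  assumes "f \<in> Arr A"
  shows "Fa f \<in> Arr B" "Dom B (Fa f) = Fo (Dom A f)" "Cod B (Fa f) = Fo (Cod A f)"
  using Fa_in[of f "Dom A f" "Cod A f"] assms by (auto simp: hom_def)

lemma Fa_Comp_simp [simp]:
  "f \<in> Arr A \<Longrightarrow> g \<in> Arr A \<Longrightarrow> Dom A g = Cod A f \<Longrightarrow> Fa (g \<cdot>\<^bsub>A\<^esub> f) = Fa g \<cdot>\<^bsub>B\<^esub> Fa f"
  using Fa_Comp[of f "Dom A f" "Cod A f" g "Cod A g"] by (auto simp: hom_def)

lemma iso_Fa: "iso_arrow A f \<Longrightarrow> iso_arrow B (Fa f)"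
proof -
  assume *: "iso_arrow A f"
  then have "inverse_arrows B (Fa f) (Fa (inv_arrow A f))"
    using Fa_Comp_simp[of f "inv_arrow A f"] Fa_Comp_simp[of "inv_arrow A f" f]
    A.iso_Arr[OF *]
    by (simp add: inverse_arrows_def hom_def Fa_Ide)
  then show ?thesis by (auto simp: iso_arrow_def)
qed

end

section \<open>The simplex category\<close>

abbreviation id_map :: "nat \<Rightarrow> nat \<Rightarrow> nat" where
  "id_map n \<equiv> restrict id {..n}"

lemma Delta_le: "\<theta> \<in> Delta m n \<Longrightarrow> i \<le> m \<Longrightarrow> \<theta> i \<le> n"
  by (auto simp: Delta_def)

lemma Delta_mono: "\<theta> \<in> Delta m n \<Longrightarrow> i \<le> j \<Longrightarrow> j \<le> m \<Longrightarrow> \<theta> i \<le> \<theta> j"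
  by (auto simp: Delta_def mono_on_def)

lemma Delta_eqI: "\<theta> \<in> Delta m n \<Longrightarrow> \<tau> \<in> Delta m k \<Longrightarrow> (\<And>i. i \<le> m \<Longrightarrow> \<theta> i = \<tau> i) \<Longrightarrow> \<theta> = \<tau>"
  unfolding Delta_def by (intro extensionalityI[of _ "{..m}"]) (auto simp: PiE_def)

lemma DeltaI:
  assumes "\<And>i. i \<le> m \<Longrightarrow> f i \<le> n" "\<And>i. i < m \<Longrightarrow> f i \<le> f (Suc i)"
  shows "restrict f {..m} \<in> Delta m n"
proof -
  have "f i \<le> f j" if "i \<le> j" "j \<le> m" for i j
    using that
  proof (induction j)
    case (Suc j)
    then show ?case
      using assms(2)[of j] by (cases "i = Suc j") auto
  qed simp
  then show ?thesis
    using assms(1) by (auto simp: Delta_def mono_on_def)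
qed

lemma id_Delta [simp]: "id_map n \<in> Delta n n"
  by (rule DeltaI) auto

lemma coface_Delta [simp]: "coface (Suc n) i \<in> Delta n (Suc n)"
  unfolding coface_def diff_Suc_1 by (rule DeltaI) auto

lemma codegen_Delta [simp]: "i \<le> n \<Longrightarrow> codegen n i \<in> Delta (Suc n) n"
  unfolding codegen_def by (rule DeltaI) auto

lemma terminal_Delta [simp]: "terminal_map n \<in> Delta n 0"
  unfolding terminal_map_def by (rule DeltaI) auto

lemma compose_Delta [simp]: "\<tau> \<in> Delta l m \<Longrightarrow> \<theta> \<in> Delta m n \<Longrightarrow> compose {..l} \<theta> \<tau> \<in> Delta l n"
  unfolding compose_def
  by (rule DeltaI) (auto intro!: Delta_mono[of \<theta> m n] Delta_mono[of \<tau> l m] intro: Delta_le)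

lemma compose_coface_Delta [simp]:
  "\<theta> \<in> Delta (Suc l) n \<Longrightarrow> compose {..l} \<theta> (coface (Suc l) j) \<in> Delta l n"
  "\<tau> \<in> Delta l m \<Longrightarrow> compose {..l} (coface (Suc m) j) \<tau> \<in> Delta l (Suc m)"
  by (rule compose_Delta, simp_all)+

lemma terminal_unique: "\<theta> \<in> Delta m 0 \<Longrightarrow> \<theta> = terminal_map m"
  by (rule Delta_eqI[OF _ terminal_Delta]) (auto simp: terminal_map_def dest: Delta_le)

lemma terminal_compose [simp]: "\<theta> \<in> Delta m n \<Longrightarrow> compose {..m} (terminal_map n) \<theta> = terminal_map m"
  by (rule terminal_unique) simp

lemma compose_id [simp]: "\<theta> \<in> Delta m n \<Longrightarrow> compose {..m} \<theta> (id_map m) = \<theta>"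
  by (rule Delta_eqI[OF compose_Delta[OF id_Delta]]) (auto simp: compose_def)

lemma id_compose [simp]: "\<theta> \<in> Delta m n \<Longrightarrow> compose {..m} (id_map n) \<theta> = \<theta>"
  by (rule Delta_eqI[OF compose_Delta[OF _ id_Delta]]) (auto simp: compose_def dest: Delta_le)

lemma Delta_assoc:
  assumes "\<rho> \<in> Delta k l" "\<tau> \<in> Delta l m" "\<theta> \<in> Delta m n"
  shows "compose {..k} \<theta> (compose {..k} \<tau> \<rho>) = compose {..k} (compose {..l} \<theta> \<tau>) \<rho>"
  using assms by (intro compose_assoc) (auto simp: Delta_def)

lemma coface_coface:
  assumes "i < j" "j \<le> Suc (Suc n)"
  shows "compose {..n} (coface (Suc (Suc n)) j) (coface (Suc n) i)
    = compose {..n} (coface (Suc (Suc n)) i) (coface (Suc n) (j - 1))"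
  using assms by (auto simp: compose_def coface_def restrict_def fun_eq_iff)

text \<open>The factor lowers all values above the missed \<open>j\<close> by one, which inverts the
  coface on its image.\<close>

lemma coface_factor:
  assumes "\<theta> \<in> Delta m (Suc n)" "j \<notin> \<theta> ` {..m}" "j \<le> Suc n"
  obtains \<tau> where "\<tau> \<in> Delta m n" "\<theta> = compose {..m} (coface (Suc n) j) \<tau>"
proof
  let ?\<tau> = "\<lambda>k\<in>{..m}. if \<theta> k < j then \<theta> k else \<theta> k - 1"
  show *: "?\<tau> \<in> Delta m n"
  proof (rule DeltaI)
    fix i assume "i \<le> m"
    then show "(if \<theta> i < j then \<theta> i else \<theta> i - 1) \<le> n"
      using assms Delta_le[OF assms(1)] by fastforce
  next
    fix i assume "i < m"
    then have "\<theta> i \<le> \<theta> (Suc i)"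
      by (intro Delta_mono[OF assms(1)]) auto
    then show "(if \<theta> i < j then \<theta> i else \<theta> i - 1)
      \<le> (if \<theta> (Suc i) < j then \<theta> (Suc i) else \<theta> (Suc i) - 1)"
      by auto
  qed
  show "\<theta> = compose {..m} (coface (Suc n) j) ?\<tau>"
  proof (rule Delta_eqI[OF assms(1)])
    fix i assume i: "i \<le> m"
    then have "\<theta> i \<noteq> j" "\<theta> i \<le> Suc n" "?\<tau> i \<le> n"
      using assms Delta_le[OF assms(1)] Delta_le[OF *] by auto
    then show "\<theta> i = compose {..m} (coface (Suc n) j) ?\<tau> i"
      using i by (auto simp: compose_def coface_def)
  qed (rule compose_Delta[OF * coface_Delta])
qed

lemma coface_inj:
  assumes "compose {..m} (coface (Suc n) j) \<tau> = compose {..m} (coface (Suc n) j) \<tau>'"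
    "\<tau> \<in> Delta m n" "\<tau>' \<in> Delta m n"
  shows "\<tau> = \<tau>'"
proof (rule Delta_eqI[OF assms(2,3)])
  fix i assume i: "i \<le> m"
  have "coface (Suc n) j (\<tau> i) = coface (Suc n) j (\<tau>' i)"
    using fun_cong[OF assms(1), of i] i by (simp add: compose_def)
  then show "\<tau> i = \<tau>' i"
    using Delta_le[OF assms(2) i] Delta_le[OF assms(3) i]
    by (auto simp: coface_def split: if_splits)
qed

lemma coface_missed: "\<tau> \<in> Delta m n \<Longrightarrow> j \<notin> compose {..m} (coface (Suc n) j) \<tau> ` {..m}"
  by (auto simp: compose_def coface_def dest: Delta_le)

section \<open>Surjective maps, and generation of the simplex category\<close>

definition surj_map :: "nat \<Rightarrow> nat \<Rightarrow> (nat \<Rightarrow> nat) \<Rightarrow> bool" where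
  "surj_map m n \<theta> \<longleftrightarrow> {..n} \<subseteq> \<theta> ` {..m}"

text \<open>Some index has value 0, and by monotonicity so has the first one. This makes the initial
  edge \<sigma> (0, \<theta> 0) an identity for surjective maps.\<close>

lemma surj_zero: "\<theta> \<in> Delta m n \<Longrightarrow> surj_map m n \<theta> \<Longrightarrow> \<theta> 0 = 0"
proof -
  assume *: "\<theta> \<in> Delta m n" "surj_map m n \<theta>"
  then obtain i where "i \<le> m" "\<theta> i = 0"
    unfolding surj_map_def by (metis atMost_iff imageE le0 subsetD)
  then show "\<theta> 0 = 0"
    using Delta_mono[OF *(1), of 0 i] by simp
qed

lemma surj_terminal: "\<theta> \<in> Delta m 0 \<Longrightarrow> surj_map m 0 \<theta>"
  by (auto simp: surj_map_def image_iff dest: Delta_le intro!: bexI[of _ 0])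

lemma surj_from_0: "\<theta> \<in> Delta 0 n \<Longrightarrow> surj_map 0 n \<theta> \<Longrightarrow> n = 0"
  using card_mono[of "\<theta> ` {..0}" "{..n}"] by (simp add: surj_map_def)

lemma not_surj_factor:
  assumes "\<theta> \<in> Delta m n" "\<not> surj_map m n \<theta>"
  obtains n' j \<tau> where "n = Suc n'" "j \<le> Suc n'" "\<tau> \<in> Delta m n'" "\<theta> = compose {..m} (coface (Suc n') j) \<tau>"
proof (cases n)
  case 0
  then show ?thesis using assms surj_terminal by blast
next
  case (Suc n')
  then obtain j where j: "j \<le> Suc n'" "j \<notin> \<theta> ` {..m}"
    using assms(2) by (auto simp: surj_map_def)
  show ?thesis
    using assms(1) Suc j(2,1) that[OF Suc j(1)] by (auto elim: coface_factor[of \<theta> m n' j])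
qed

text \<open>The factor is the restriction of \<theta> along a section of the codegeneracy:
  \<open>coface (Suc m) (Suc i)\<close> skips the index \<open>Suc i\<close>, at which \<theta> has
  the same value as at \<open>i\<close>.\<close>

lemma codegen_factor:
  assumes "\<theta> \<in> Delta (Suc m) n" "i \<le> m" "\<theta> i = \<theta> (Suc i)"
  obtains \<tau> where "\<tau> \<in> Delta m n" "\<theta> = compose {..Suc m} \<tau> (codegen m i)"
proof
  let ?\<tau> = "compose {..m} \<theta> (coface (Suc m) (Suc i))"
  show *: "?\<tau> \<in> Delta m n"
    by (rule compose_Delta[OF coface_Delta assms(1)])
  show "\<theta> = compose {..Suc m} ?\<tau> (codegen m i)"
  proof (rule Delta_eqI[OF assms(1)])
    fix k assume "k \<le> Suc m"
    then show "\<theta> k = compose {..Suc m} ?\<tau> (codegen m i) k"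
      using assms(2,3) by (cases "k = Suc i") (auto simp: compose_def codegen_def coface_def)
  qed (rule compose_Delta[OF codegen_Delta[OF assms(2)] *])
qed

text \<open>Generation by cofaces and codegeneracies, without normal forms or relations. It turns
  the clauses of \<open>is_companion\<close>, which relate \<psi> and \<phi> on generators only,
  into statements about all maps.\<close>

lemma Delta_induct [consumes 1, case_names id coface codegen compose]:
  assumes "\<theta> \<in> Delta m n"
    and id: "\<And>n. P n n (id_map n)"
    and coface: "\<And>n i. i \<le> Suc n \<Longrightarrow> P n (Suc n) (coface (Suc n) i)"
    and codegen: "\<And>n i. i \<le> n \<Longrightarrow> P (Suc n) n (codegen n i)"
    and compose: "\<And>l m n \<tau> \<theta>. \<tau> \<in> Delta l m \<Longrightarrow> \<theta> \<in> Delta m n \<Longrightarrow> P l m \<tau> \<Longrightarrow> P m n \<theta> \<Longrightarrow>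
      P l n (compose {..l} \<theta> \<tau>)"
  shows "P m n \<theta>"
  using assms(1)
proof (induction "m + n" arbitrary: m n \<theta> rule: less_induct)
  case less
  show ?case
  proof (cases "surj_map m n \<theta>")
    case False
    then obtain n' j \<tau> where *: "n = Suc n'" "j \<le> Suc n'" "\<tau> \<in> Delta m n'"
      "\<theta> = compose {..m} (coface (Suc n') j) \<tau>"
      using not_surj_factor less.prems by blast
    then show ?thesis
      using compose[OF *(3) coface_Delta less.hyps coface] by simp
  next
    case True
    show ?thesis
    proof (cases "\<exists>i<m. \<theta> i = \<theta> (Suc i)")
      case True
      then obtain i m' where i: "i \<le> m'" "m = Suc m'" "\<theta> i = \<theta> (Suc i)"
        by (metis Suc_le_D less_Suc_eq_le Suc_leI)
      then obtain \<tau> where *: "\<tau> \<in> Delta m' n" "\<theta> = compose {..Suc m'} \<tau> (codegen m' i)"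
        using codegen_factor less.prems by blast
      show ?thesis
        using compose[OF codegen_Delta[OF i(1)] *(1) codegen[OF i(1)] less.hyps] * i by simp
    next
      case False
      \<comment> \<open>No value is missed and none is repeated, so the map is a strictly increasing
        surjection. Counting forces m = n, and the growth bound \<open>ge\<close> then leaves only
        the identity.\<close>
      have inc: "\<theta> i < \<theta> (Suc i)" if "i < m" for i
        using Delta_mono[OF less.prems, of i "Suc i"] that False by (metis Suc_leI le_less le_Suc_eq order_refl)
      have ge: "\<theta> (i + k) \<ge> \<theta> i + k" if "i + k \<le> m" for i k
        using that
      proof (induction k)
        case (Suc k)
        then show ?case
          using inc[of "i + k"] by simp
      qed simp
      have "n \<le> m"
        using True card_mono[of "\<theta> ` {..m}" "{..n}"] card_image_le[of "{..m}" \<theta>]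
        by (simp add: surj_map_def)
      have "\<theta> m \<ge> m" using ge[of 0 m] by simp
      then have mn: "m = n" using Delta_le[OF less.prems, of m] \<open>n \<le> m\<close> by simp
      have "\<theta> i = i" if "i \<le> m" for i
        using ge[of 0 i] ge[of i "m - i"] Delta_le[OF less.prems, of m] that mn by simp
      then have "\<theta> = id_map n"
        using less.prems mn by (intro Delta_eqI[of _ m n _ n]) auto
      then show ?thesis using id mn by simp
    qed
  qed
qed

section \<open>Nerves\<close>

lemma nerve_act_act [simp]:
  "\<tau> \<in> Delta l m \<Longrightarrow> nerve_act l \<tau> (nerve_act m \<theta> \<sigma>) = nerve_act l (compose {..l} \<theta> \<tau>) \<sigma>"
  by (auto simp: nerve_act_def tri_def fun_eq_iff restrict_def compose_def
      intro: Delta_le Delta_mono)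

lemma nerve_act_apply [simp]: "i \<le> j \<Longrightarrow> j \<le> m \<Longrightarrow> nerve_act m \<theta> \<sigma> (i, j) = \<sigma> (\<theta> i, \<theta> j)"
  by (simp add: nerve_act_def tri_def)

lemma vert_nerve_act [simp]: "i \<le> m \<Longrightarrow> vert C (nerve_act m \<theta> \<sigma>) i = vert C \<sigma> (\<theta> i)"
  by (simp add: vert_def)

lemma nerve_simp_hom [simp]:
  assumes "\<sigma> \<in> nerve_simp C n" "i \<le> j" "j \<le> n"
  shows nerve_arr: "\<sigma> (i, j) \<in> Arr C"
    and nerve_Dom: "Dom C (\<sigma> (i, j)) = vert C \<sigma> i" and nerve_Cod: "Cod C (\<sigma> (i, j)) = vert C \<sigma> j"
  using assms by (auto simp: nerve_simp_def hom_def)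

lemma nerve_simp_Ide: "\<sigma> \<in> nerve_simp C n \<Longrightarrow> i \<le> n \<Longrightarrow> \<sigma> (i, i) = Ide C (vert C \<sigma> i)"
  by (auto simp: nerve_simp_def)

lemma nerve_simp_Comp:
  "\<sigma> \<in> nerve_simp C n \<Longrightarrow> i \<le> j \<Longrightarrow> j \<le> k \<Longrightarrow> k \<le> n \<Longrightarrow> \<sigma> (j, k) \<cdot>\<^bsub>C\<^esub> \<sigma> (i, j) = \<sigma> (i, k)"
  by (auto simp: nerve_simp_def)

lemma (in category) vert_Obj [simp]: "\<sigma> \<in> nerve_simp C n \<Longrightarrow> i \<le> n \<Longrightarrow> vert C \<sigma> i \<in> Obj C"
  unfolding vert_def by (rule Dom_Obj) simp

lemma nerve_act_in [simp]:
  assumes "\<sigma> \<in> nerve_simp C n" "\<theta> \<in> Delta m n"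
  shows "nerve_act m \<theta> \<sigma> \<in> nerve_simp C m"
proof -
  have "nerve_act m \<theta> \<sigma> \<in> tri m \<rightarrow>\<^sub>E Arr C"
    using assms by (auto simp: nerve_act_def tri_def Delta_le Delta_mono)
  then show ?thesis
    using assms
    by (auto simp: nerve_simp_def[of _ m] hom_def Delta_le Delta_mono nerve_simp_Ide nerve_simp_Comp)
qed

lemma nerve_act_id [simp]: "\<sigma> \<in> nerve_simp C n \<Longrightarrow> nerve_act n (id_map n) \<sigma> = \<sigma>"
  by (auto simp: nerve_act_def tri_def nerve_simp_def PiE_def extensional_def fun_eq_iff)

lemma nerve_simp_eqI:
  assumes "\<sigma> \<in> nerve_simp C n" "\<tau> \<in> nerve_simp C n" "\<And>i j. i \<le> j \<Longrightarrow> j \<le> n \<Longrightarrow> \<sigma> (i, j) = \<tau> (i, j)"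
  shows "\<sigma> = \<tau>"
  using assms unfolding nerve_simp_def
  by (intro extensionalityI[of _ "tri n"]) (auto simp: PiE_def tri_def)

lemma nerve_act_map:
  "\<theta> \<in> Delta m n \<Longrightarrow> nerve_act m \<theta> (nerve_map f n \<sigma>) = nerve_map f m (nerve_act m \<theta> \<sigma>)"
  by (auto simp: nerve_act_def nerve_map_def tri_def fun_eq_iff restrict_def Delta_le Delta_mono)

lemma nerve_map_apply [simp]: "i \<le> j \<Longrightarrow> j \<le> n \<Longrightarrow> nerve_map f n \<sigma> (i, j) = f (\<sigma> (i, j))"
  by (simp add: nerve_map_def tri_def)

context is_functor
begin

lemma vert_nerve_map [simp]:
  "\<sigma> \<in> nerve_simp A n \<Longrightarrow> i \<le> n \<Longrightarrow> vert B (nerve_map Fa n \<sigma>) i = Fo (vert A \<sigma> i)"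
  by (simp add: vert_def[of B])

lemma nerve_map_in [simp]:
  assumes "\<sigma> \<in> nerve_simp A n"
  shows "nerve_map Fa n \<sigma> \<in> nerve_simp B n"
proof -
  have "nerve_map Fa n \<sigma> \<in> tri n \<rightarrow>\<^sub>E Arr B"
    using assms by (auto simp: nerve_map_def tri_def)
  moreover have "Fa (\<sigma> (j, k)) \<cdot>\<^bsub>B\<^esub> Fa (\<sigma> (i, j)) = Fa (\<sigma> (i, k))" if "i \<le> j" "j \<le> k" "k \<le> n" for i j k
    using Fa_Comp_simp[of "\<sigma> (i, j)" "\<sigma> (j, k)"] assms that by (simp add: nerve_simp_Comp)
  ultimately show ?thesis
    using assms by (auto simp: nerve_simp_def[of _ n] hom_def nerve_simp_Ide intro!: Fa_Ide A.vert_Obj[OF assms])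
qed

end

section \<open>The total category of a simplicial category\<close>

text \<open>The Grothendieck construction: an arrow \<open>(m, u, \<theta>, n, z)\<close> from \<open>(m, y)\<close> to \<open>(n, z)\<close> is a map
  \<open>\<theta>\<close> from \<open>[m]\<close> to \<open>[n]\<close> with an arrow \<open>u : y \<rightarrow> \<theta> z\<close> of level \<open>m\<close>. It absorbs all coherence
  isomorphisms: the category laws are the coherence laws of the pseudofunctor.\<close>

definition total :: "('o, 'a) scat \<Rightarrow> (nat \<times> 'o, nat \<times> 'a \<times> (nat \<Rightarrow> nat) \<times> nat \<times> 'o) cat" where
  "total E =
     \<lparr>Obj = {(n, x). x \<in> Obj (lev E n)},
      Arr = {(m, u, \<theta>, n, z). \<theta> \<in> Delta m n \<and> z \<in> Obj (lev E n) \<and>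
               u \<in> Arr (lev E m) \<and> Cod (lev E m) u = opo E m n \<theta> z},
      Dom = (\<lambda>(m, u, \<theta>, n, z). (m, Dom (lev E m) u)),
      Cod = (\<lambda>(m, u, \<theta>, n, z). (n, z)),
      Ide = (\<lambda>(n, x). (n, unt E n x, id_map n, n, x)),
      Comp = (\<lambda>(m, v, \<theta>, n, z) (l, u, \<tau>, _, _).
        (l, cmp E l m n \<tau> \<theta> z \<cdot>\<^bsub>lev E l\<^esub> opa E l m \<tau> v \<cdot>\<^bsub>lev E l\<^esub> u, compose {..l} \<theta> \<tau>, n, z))\<rparr>"

lemma total_simps:
  "(n, x) \<in> Obj (total E) \<longleftrightarrow> x \<in> Obj (lev E n)"
  "(m, u, \<theta>, n, z) \<in> Arr (total E) \<longleftrightarrow> \<theta> \<in> Delta m n \<and> z \<in> Obj (lev E n) \<and>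
     u \<in> Arr (lev E m) \<and> Cod (lev E m) u = opo E m n \<theta> z"
  "Dom (total E) (m, u, \<theta>, n, z) = (m, Dom (lev E m) u)"
  "Cod (total E) (m, u, \<theta>, n, z) = (n, z)"
  "Ide (total E) (n, x) = (n, unt E n x, id_map n, n, x)"
  "(m, v, \<theta>, n, z) \<cdot>\<^bsub>total E\<^esub> (l, u, \<tau>, m', z') =
     (l, cmp E l m n \<tau> \<theta> z \<cdot>\<^bsub>lev E l\<^esub> opa E l m \<tau> v \<cdot>\<^bsub>lev E l\<^esub> u, compose {..l} \<theta> \<tau>, n, z)"
  by (simp_all add: total_def)

definition base :: "nat \<times> 'a \<times> (nat \<Rightarrow> nat) \<times> nat \<times> 'o \<Rightarrow> nat \<Rightarrow> nat" where
  "base = (\<lambda>(m, u, \<theta>, n, z). \<theta>)"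

text \<open>The vertical arrow given by \<open>f\<close>. The unit isomorphism appears because the
  identity of [n] acts only up to isomorphism, so the fibre over [n] is not literally the
  level.\<close>

definition lift :: "('o, 'a) scat \<Rightarrow> nat \<Rightarrow> 'a \<Rightarrow> nat \<times> 'a \<times> (nat \<Rightarrow> nat) \<times> nat \<times> 'o" where
  "lift E n f = (n, unt E n (Cod (lev E n) f) \<cdot>\<^bsub>lev E n\<^esub> f, id_map n, n, Cod (lev E n) f)"

text \<open>The standard cartesian arrow with target \<open>z\<close> over \<theta>;
  \<open>total_factor\<close> and \<open>cart_cancel\<close> are its existence and uniqueness
  properties.\<close>

definition cart :: "('o, 'a) scat \<Rightarrow> nat \<Rightarrow> nat \<Rightarrow> (nat \<Rightarrow> nat) \<Rightarrow> 'o \<Rightarrow>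
    nat \<times> 'a \<times> (nat \<Rightarrow> nat) \<times> nat \<times> 'o" where
  "cart E m n \<theta> z = (m, Ide (lev E m) (opo E m n \<theta> z), \<theta>, n, z)"

text \<open>The cartesian arrow (n, s^n x) -> (0, x): the standard one over the map to [0], with its
  source changed along \<open>degen_iso\<close>. Arrows of level n into s^n x thereby become arrows
  into (0, x).\<close>

definition point :: "('o, 'a) scat \<Rightarrow> nat \<Rightarrow> 'o \<Rightarrow> nat \<times> 'a \<times> (nat \<Rightarrow> nat) \<times> nat \<times> 'o" where
  "point E n x = cart E n 0 (terminal_map n) x \<cdot>\<^bsub>total E\<^esub> lift E n (degen_iso E n x)"

text \<open>The comparison (m, s^m x) -> (n, s^n x) over \<theta>. Inverting
  \<open>const_iso\<close> puts s^m x itself at the source, so that these arrows are strictly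
  functorial in \<theta>.\<close>

definition kappa :: "('o, 'a) scat \<Rightarrow> nat \<Rightarrow> nat \<Rightarrow> (nat \<Rightarrow> nat) \<Rightarrow> 'o \<Rightarrow>
    nat \<times> 'a \<times> (nat \<Rightarrow> nat) \<times> nat \<times> 'o" where
  "kappa E m n \<theta> x = cart E m n \<theta> (degen_o E n x) \<cdot>\<^bsub>total E\<^esub>
     lift E m (inv_arrow (lev E m) (const_iso E m n \<theta> x))"

context simplicial_category
begin

sublocale lev: category "lev E n" for n
  by (rule lev_category)

lemma op_simps [simp]:
  assumes "\<theta> \<in> Delta m n"
  shows opo_Obj: "x \<in> Obj (lev E n) \<Longrightarrow> opo E m n \<theta> x \<in> Obj (lev E m)"
    and opa_Arr: "f \<in> Arr (lev E n) \<Longrightarrow> opa E m n \<theta> f \<in> Arr (lev E m)"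
    and Dom_opa: "f \<in> Arr (lev E n) \<Longrightarrow> Dom (lev E m) (opa E m n \<theta> f) = opo E m n \<theta> (Dom (lev E n) f)"
    and Cod_opa: "f \<in> Arr (lev E n) \<Longrightarrow> Cod (lev E m) (opa E m n \<theta> f) = opo E m n \<theta> (Cod (lev E n) f)"
    and opa_Ide: "x \<in> Obj (lev E n) \<Longrightarrow> opa E m n \<theta> (Ide (lev E n) x) = Ide (lev E m) (opo E m n \<theta> x)"
    and opa_Comp: "f \<in> Arr (lev E n) \<Longrightarrow> g \<in> Arr (lev E n) \<Longrightarrow> Dom (lev E n) g = Cod (lev E n) f \<Longrightarrow>
      opa E m n \<theta> (g \<cdot>\<^bsub>lev E n\<^esub> f) = opa E m n \<theta> g \<cdot>\<^bsub>lev E m\<^esub> opa E m n \<theta> f"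
    and opa_iso: "iso_arrow (lev E n) f \<Longrightarrow> iso_arrow (lev E m) (opa E m n \<theta> f)"
proof -
  interpret F: is_functor "lev E n" "lev E m" "opo E m n \<theta>" "opa E m n \<theta>"
    by (rule op_functor[OF assms])
  show "x \<in> Obj (lev E n) \<Longrightarrow> opo E m n \<theta> x \<in> Obj (lev E m)"
    and "f \<in> Arr (lev E n) \<Longrightarrow> opa E m n \<theta> f \<in> Arr (lev E m)"
    and "f \<in> Arr (lev E n) \<Longrightarrow> Dom (lev E m) (opa E m n \<theta> f) = opo E m n \<theta> (Dom (lev E n) f)"
    and "f \<in> Arr (lev E n) \<Longrightarrow> Cod (lev E m) (opa E m n \<theta> f) = opo E m n \<theta> (Cod (lev E n) f)"
    and "x \<in> Obj (lev E n) \<Longrightarrow> opa E m n \<theta> (Ide (lev E n) x) = Ide (lev E m) (opo E m n \<theta> x)"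
    and "f \<in> Arr (lev E n) \<Longrightarrow> g \<in> Arr (lev E n) \<Longrightarrow> Dom (lev E n) g = Cod (lev E n) f \<Longrightarrow>
      opa E m n \<theta> (g \<cdot>\<^bsub>lev E n\<^esub> f) = opa E m n \<theta> g \<cdot>\<^bsub>lev E m\<^esub> opa E m n \<theta> f"
    and "iso_arrow (lev E n) f \<Longrightarrow> iso_arrow (lev E m) (opa E m n \<theta> f)"
    by (fact F.Fo_in F.Fa_simps F.Fa_Ide F.Fa_Comp_simp F.iso_Fa)+
qed

lemma cmp_simps [simp]:
  assumes "\<tau> \<in> Delta l m" "\<theta> \<in> Delta m n" "x \<in> Obj (lev E n)"
  shows "cmp E l m n \<tau> \<theta> x \<in> Arr (lev E l)"
    and "Dom (lev E l) (cmp E l m n \<tau> \<theta> x) = opo E l m \<tau> (opo E m n \<theta> x)"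
    and "Cod (lev E l) (cmp E l m n \<tau> \<theta> x) = opo E l n (compose {..l} \<theta> \<tau>) x"
    and "iso_arrow (lev E l) (cmp E l m n \<tau> \<theta> x)"
  using cmp_in[OF assms] cmp_iso[OF assms] by (auto simp: hom_def)

lemma unt_simps [simp]:
  assumes "x \<in> Obj (lev E n)"
  shows "unt E n x \<in> Arr (lev E n)" "Dom (lev E n) (unt E n x) = x"
    and "Cod (lev E n) (unt E n x) = opo E n n (id_map n) x"
    and "iso_arrow (lev E n) (unt E n x)"
  using unt_in[OF assms] unt_iso[OF assms] by (auto simp: hom_def)

lemma cmp_natural':
  assumes "\<tau> \<in> Delta l m" "\<theta> \<in> Delta m n" "f \<in> Arr (lev E n)"
  shows "cmp E l m n \<tau> \<theta> (Cod (lev E n) f) \<cdot>\<^bsub>lev E l\<^esub> opa E l m \<tau> (opa E m n \<theta> f)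
      = opa E l n (compose {..l} \<theta> \<tau>) f \<cdot>\<^bsub>lev E l\<^esub> cmp E l m n \<tau> \<theta> (Dom (lev E n) f)"
  using assms by (intro cmp_natural) (auto simp: hom_def)

lemma unt_natural': "f \<in> Arr (lev E n) \<Longrightarrow>
  unt E n (Cod (lev E n) f) \<cdot>\<^bsub>lev E n\<^esub> f = opa E n n (id_map n) f \<cdot>\<^bsub>lev E n\<^esub> unt E n (Dom (lev E n) f)"
  by (rule unt_natural) (auto simp: hom_def)

lemma cmp_unt_left':
  assumes "\<theta> \<in> Delta m n" "x \<in> Obj (lev E n)" "u \<in> Arr (lev E m)" "Cod (lev E m) u = opo E m n \<theta> x"
  shows "cmp E m m n (id_map m) \<theta> x \<cdot>\<^bsub>lev E m\<^esub> unt E m (opo E m n \<theta> x) \<cdot>\<^bsub>lev E m\<^esub> u = u"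
  using lev.Comp_assoc_right[of u m "unt E m (opo E m n \<theta> x)" "cmp E m m n (id_map m) \<theta> x"]
  by (simp add: assms cmp_unt_left)

lemma cmp_unt_right':
  assumes "\<theta> \<in> Delta m n" "x \<in> Obj (lev E n)" "u \<in> Arr (lev E m)" "Cod (lev E m) u = opo E m n \<theta> x"
  shows "cmp E m n n \<theta> (id_map n) x \<cdot>\<^bsub>lev E m\<^esub> opa E m n \<theta> (unt E n x) \<cdot>\<^bsub>lev E m\<^esub> u = u"
  using lev.Comp_assoc_right[of u m "opa E m n \<theta> (unt E n x)" "cmp E m n n \<theta> (id_map n) x"]
  by (simp add: assms cmp_unt_right)

text \<open>The identity laws are the two unit laws of the pseudofunctor, one of them after
  naturality of \<open>unt\<close>; associativity is naturality of \<open>cmp\<close> followed by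
  its cocycle law.\<close>

lemma category_total: "category (total E)"
proof (unfold_locales, goal_cases)
  case (1 f) then show ?case by (cases f) (auto simp: total_simps)
next
  case (2 f) then show ?case by (cases f) (auto simp: total_simps)
next
  case (3 x) then show ?case by (cases x) (auto simp: total_simps hom_def)
next
  case (4 f x y g z)
  obtain l u \<tau> m y' where f: "f = (l, u, \<tau>, m, y')" by (cases f)
  obtain m' v \<theta> n z' where g: "g = (m', v, \<theta>, n, z')" by (cases g)
  have "m' = m" "\<tau> \<in> Delta l m" "\<theta> \<in> Delta m n" "y' \<in> Obj (lev E m)" "z' \<in> Obj (lev E n)"
    "u \<in> Arr (lev E l)" "Cod (lev E l) u = opo E l m \<tau> y'" "x = (l, Dom (lev E l) u)"
    "v \<in> Arr (lev E m)" "Dom (lev E m) v = y'" "Cod (lev E m) v = opo E m n \<theta> z'" "z = (n, z')"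
    using 4 by (auto simp: f g hom_def total_simps)
  then show ?case
    by (simp add: f g hom_def total_simps)
next
  case (5 f x y)
  then show ?case
  proof (cases f)
    case (fields m u \<theta> n z)
    with 5 have *: "x = (m, Dom (lev E m) u)" "y = (n, z)" "\<theta> \<in> Delta m n" "z \<in> Obj (lev E n)"
      "u \<in> Arr (lev E m)" "Cod (lev E m) u = opo E m n \<theta> z"
      by (auto simp: total_simps hom_def)
    have "opa E m m (id_map m) u \<cdot>\<^bsub>lev E m\<^esub> unt E m (Dom (lev E m) u)
      = unt E m (opo E m n \<theta> z) \<cdot>\<^bsub>lev E m\<^esub> u"
      using unt_natural'[OF *(5)] *(6) by simp
    with *(3) show ?thesis
      by (simp add: fields total_simps *(1,2,4-) cmp_unt_left')
  qed
next
  case (6 f x y)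
  then show ?case
  proof (cases f)
    case (fields m u \<theta> n z)
    with 6 have *: "x = (m, Dom (lev E m) u)" "y = (n, z)" "\<theta> \<in> Delta m n" "z \<in> Obj (lev E n)"
      "u \<in> Arr (lev E m)" "Cod (lev E m) u = opo E m n \<theta> z"
      by (auto simp: total_simps hom_def)
    then show ?thesis
      by (simp add: fields total_simps cmp_unt_right')
  qed
next
  case (7 a w x b y c z)
  obtain k u \<rho> l x' where a: "a = (k, u, \<rho>, l, x')" by (cases a)
  obtain l' v \<tau> m y' where b: "b = (l', v, \<tau>, m, y')" by (cases b)
  obtain m' w' \<theta> n z' where c: "c = (m', w', \<theta>, n, z')" by (cases c)
  have eq: "l' = l" "m' = m" and \<rho>: "\<rho> \<in> Delta k l" and \<tau>: "\<tau> \<in> Delta l m" and \<theta>: "\<theta> \<in> Delta m n"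
    and o: "x' \<in> Obj (lev E l)" "y' \<in> Obj (lev E m)" "z' \<in> Obj (lev E n)"
    and u: "u \<in> Arr (lev E k)" "Cod (lev E k) u = opo E k l \<rho> x'"
    and v: "v \<in> Arr (lev E l)" "Dom (lev E l) v = x'" "Cod (lev E l) v = opo E l m \<tau> y'"
    and w: "w' \<in> Arr (lev E m)" "Dom (lev E m) w' = y'" "Cod (lev E m) w' = opo E m n \<theta> z'"
    using 7 by (auto simp: a b c hom_def total_simps)
  let ?r = "opa E k l \<rho> v \<cdot>\<^bsub>lev E k\<^esub> u"
  \<comment> \<open>The rest \<open>?r\<close> of the chain stays fixed: naturality of
    \<open>cmp\<close> exchanges it with the image of \<open>w'\<close>, after which
    \<open>cmp_assoc\<close> regroups the two comparisons.\<close>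
  have "cmp E k m n (compose {..k} \<tau> \<rho>) \<theta> z' \<cdot>\<^bsub>lev E k\<^esub> opa E k m (compose {..k} \<tau> \<rho>) w'
      \<cdot>\<^bsub>lev E k\<^esub> cmp E k l m \<rho> \<tau> y' \<cdot>\<^bsub>lev E k\<^esub> ?r
    = cmp E k m n (compose {..k} \<tau> \<rho>) \<theta> z' \<cdot>\<^bsub>lev E k\<^esub> cmp E k l m \<rho> \<tau> (opo E m n \<theta> z')
      \<cdot>\<^bsub>lev E k\<^esub> opa E k l \<rho> (opa E l m \<tau> w') \<cdot>\<^bsub>lev E k\<^esub> ?r"
    using cmp_natural'[OF \<rho> \<tau> w(1)] \<rho> \<tau> \<theta> o u v w
    by (intro arg_cong[where f = "Comp (lev E k) _"] lev.Comp_eq_right) simp_all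
  also have "\<dots> = cmp E k l n \<rho> (compose {..l} \<theta> \<tau>) z' \<cdot>\<^bsub>lev E k\<^esub> opa E k l \<rho> (cmp E l m n \<tau> \<theta> z')
      \<cdot>\<^bsub>lev E k\<^esub> opa E k l \<rho> (opa E l m \<tau> w') \<cdot>\<^bsub>lev E k\<^esub> ?r"
    using cmp_assoc[OF \<rho> \<tau> \<theta> o(3)] \<rho> \<tau> \<theta> o u v w Delta_assoc[OF \<rho> \<tau> \<theta>]
    by (intro lev.Comp_eq_right) simp_all
  finally show ?case
    using \<rho> \<tau> \<theta> o u v w Delta_assoc[OF \<rho> \<tau> \<theta>] by (simp add: a b c eq total_simps)
qed

sublocale T: category "total E"
  by (rule category_total)

abbreviation tcomp (infixr "\<bullet>" 70) where
  "tcomp \<equiv> Comp (total E)"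

lemma base_Comp:
  "a \<in> Arr (total E) \<Longrightarrow> Dom (total E) a = (m, y) \<Longrightarrow> base (b \<bullet> a) = compose {..m} (base b) (base a)"
  by (cases a; cases b) (auto simp: base_def total_simps)

lemma base_Delta:
  "a \<in> Arr (total E) \<Longrightarrow> Dom (total E) a = (m, y) \<Longrightarrow> Cod (total E) a = (n, z) \<Longrightarrow> base a \<in> Delta m n"
  by (cases a) (auto simp: base_def total_simps)

section \<open>Vertical and cartesian arrows\<close>

lemma lift_simps [simp]:
  assumes "f \<in> Arr (lev E n)"
  shows "lift E n f \<in> Arr (total E)" "Dom (total E) (lift E n f) = (n, Dom (lev E n) f)"
    and "Cod (total E) (lift E n f) = (n, Cod (lev E n) f)" "base (lift E n f) = id_map n"
  using assms by (auto simp: lift_def total_simps base_def)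

lemma cart_simps [simp]:
  assumes "\<theta> \<in> Delta m n" "z \<in> Obj (lev E n)"
  shows "cart E m n \<theta> z \<in> Arr (total E)" "Dom (total E) (cart E m n \<theta> z) = (m, opo E m n \<theta> z)"
    and "Cod (total E) (cart E m n \<theta> z) = (n, z)" "base (cart E m n \<theta> z) = \<theta>"
  using assms by (auto simp: cart_def total_simps base_def)

lemma Obj_total [simp]: "(n, x) \<in> Obj (total E) \<longleftrightarrow> x \<in> Obj (lev E n)"
  by (simp add: total_simps)

lemma lift_Ide [simp]: "x \<in> Obj (lev E n) \<Longrightarrow> lift E n (Ide (lev E n) x) = Ide (total E) (n, x)"
  by (simp add: lift_def total_simps)

text \<open>Composition inserts only a unit, which \<open>cmp_unt_left'\<close> removes. Every arrow
  of the total category is therefore a vertical arrow followed by a standard cartesian one, and the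
  vertical part is its second component.\<close>

lemma cart_lift:
  assumes "\<theta> \<in> Delta m n" "z \<in> Obj (lev E n)" "u \<in> Arr (lev E m)" "Cod (lev E m) u = opo E m n \<theta> z"
  shows "cart E m n \<theta> z \<bullet> lift E m u = (m, u, \<theta>, n, z)"
  using assms by (simp add: cart_def lift_def total_simps cmp_unt_left')

lemma cart_lift_cancel:
  assumes "cart E m n \<theta> z \<bullet> lift E m u = cart E m n \<theta> z \<bullet> lift E m v" "\<theta> \<in> Delta m n" "z \<in> Obj (lev E n)"
    "u \<in> Arr (lev E m)" "Cod (lev E m) u = opo E m n \<theta> z"
    "v \<in> Arr (lev E m)" "Cod (lev E m) v = opo E m n \<theta> z"
  shows "u = v"
  using assms by (simp add: cart_lift)

lemma total_factor:
  assumes "a \<in> Arr (total E)" "Dom (total E) a = (m, y)" "Cod (total E) a = (n, z)"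
  obtains u where "u \<in> Arr (lev E m)" "Dom (lev E m) u = y" "Cod (lev E m) u = opo E m n (base a) z"
    "a = cart E m n (base a) z \<bullet> lift E m u"
  using assms by (cases a) (auto simp: total_simps base_def cart_lift)

text \<open>The functor \<open>opa\<close> is reindexing along cartesian arrows. This is how faces
  of arrows in a level become composites in the total category.\<close>

lemma lift_cart:
  assumes "\<theta> \<in> Delta m n" "f \<in> Arr (lev E n)"
  shows "lift E n f \<bullet> cart E m n \<theta> (Dom (lev E n) f) = cart E m n \<theta> (Cod (lev E n) f) \<bullet> lift E m (opa E m n \<theta> f)"
  using assms by (simp add: cart_lift) (simp add: cart_def lift_def total_simps cmp_unt_right')

lemma lift_eq_iff:
  assumes "u \<in> Arr (lev E n)" "v \<in> Arr (lev E n)" "Cod (lev E n) u = Cod (lev E n) v"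
  shows "lift E n u = lift E n v \<longleftrightarrow> u = v"
proof
  assume "lift E n u = lift E n v"
  then have "unt E n (Cod (lev E n) v) \<cdot>\<^bsub>lev E n\<^esub> u = unt E n (Cod (lev E n) v) \<cdot>\<^bsub>lev E n\<^esub> v"
    by (simp add: lift_def assms(3))
  then show "u = v"
    by (rule lev.iso_cancel[rotated]) (simp_all add: assms)
qed simp

lemma lift_Comp [simp]:
  assumes "f \<in> Arr (lev E n)" "g \<in> Arr (lev E n)" "Dom (lev E n) g = Cod (lev E n) f"
  shows "lift E n (g \<cdot>\<^bsub>lev E n\<^esub> f) = lift E n g \<bullet> lift E n f"
proof -
  have "opa E n n (id_map n) g \<cdot>\<^bsub>lev E n\<^esub> unt E n (Cod (lev E n) f) \<cdot>\<^bsub>lev E n\<^esub> f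
    = unt E n (Cod (lev E n) g) \<cdot>\<^bsub>lev E n\<^esub> g \<cdot>\<^bsub>lev E n\<^esub> f"
    using assms unt_natural'[of g n] by (intro lev.Comp_eq_right) auto
  then show ?thesis
    using assms by (simp add: lift_def total_simps cmp_unt_right')
qed

text \<open>Standard cartesian arrows compose only up to \<open>cmp\<close>; here the weakness of
  the simplicial category remains visible.\<close>

lemma cart_cart:
  assumes "\<tau> \<in> Delta l m" "\<theta> \<in> Delta m n" "z \<in> Obj (lev E n)"
  shows "cart E m n \<theta> z \<bullet> cart E l m \<tau> (opo E m n \<theta> z)
    = cart E l n (compose {..l} \<theta> \<tau>) z \<bullet> lift E l (cmp E l m n \<tau> \<theta> z)"
  using assms by (simp add: cart_lift) (simp add: cart_def total_simps)

section \<open>Iterated degeneracies in the total category\<close>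

lemma degen_simps [simp]:
  shows degen_o_Obj: "x \<in> Obj (lev E 0) \<Longrightarrow> degen_o E n x \<in> Obj (lev E n)"
    and degen_a_Arr: "f \<in> Arr (lev E 0) \<Longrightarrow> degen_a E n f \<in> Arr (lev E n)"
    and Dom_degen_a: "f \<in> Arr (lev E 0) \<Longrightarrow> Dom (lev E n) (degen_a E n f) = degen_o E n (Dom (lev E 0) f)"
    and Cod_degen_a: "f \<in> Arr (lev E 0) \<Longrightarrow> Cod (lev E n) (degen_a E n f) = degen_o E n (Cod (lev E 0) f)"
    and degen_a_Ide: "x \<in> Obj (lev E 0) \<Longrightarrow> degen_a E n (Ide (lev E 0) x) = Ide (lev E n) (degen_o E n x)"
  by (induction n) simp_all

lemma degen_a_Comp [simp]:
  "f \<in> Arr (lev E 0) \<Longrightarrow> g \<in> Arr (lev E 0) \<Longrightarrow> Dom (lev E 0) g = Cod (lev E 0) f \<Longrightarrow>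
    degen_a E n (g \<cdot>\<^bsub>lev E 0\<^esub> f) = degen_a E n g \<cdot>\<^bsub>lev E n\<^esub> degen_a E n f"
  by (induction n) simp_all

declare degen_o.simps(2) [simp del] degen_a.simps(2) [simp del]

text \<open>The simplifier turns \<open>{..0}\<close> into \<open>{0}\<close>, so this is the shape
  in which the identity of [0] appears in the target of \<open>unt\<close> at level 0.\<close>

lemma terminal_0: "restrict id {0} = terminal_map 0"
  by (auto simp: terminal_map_def)

lemma degen_iso_simps [simp]:
  assumes "x \<in> Obj (lev E 0)"
  shows degen_iso_Arr: "degen_iso E n x \<in> Arr (lev E n)"
    and degen_iso_iso: "iso_arrow (lev E n) (degen_iso E n x)"
    and Dom_degen_iso: "Dom (lev E n) (degen_iso E n x) = degen_o E n x"
    and Cod_degen_iso: "Cod (lev E n) (degen_iso E n x) = opo E n 0 (terminal_map n) x"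
proof (induction n)
  case 0
  { case 1 show ?case using assms by simp }
  { case 2 show ?case using assms by simp }
  { case 3 show ?case using assms by simp }
  { case 4 show ?case using assms by (simp add: terminal_0) }
next
  case (Suc n)
  { case 1 show ?case using assms Suc by simp }
  { case 2 show ?case using assms Suc by (simp add: lev.iso_Comp) }
  { case 3 show ?case using assms Suc by (simp add: degen_o.simps) }
  { case 4 show ?case using assms Suc by simp }
qed

lemma degen_iso_natural:
  assumes "f \<in> Arr (lev E 0)"
  shows "degen_iso E n (Cod (lev E 0) f) \<cdot>\<^bsub>lev E n\<^esub> degen_a E n f
    = opa E n 0 (terminal_map n) f \<cdot>\<^bsub>lev E n\<^esub> degen_iso E n (Dom (lev E 0) f)"
proof (induction n)
  case 0
  then show ?case using unt_natural'[OF assms] by (simp add: terminal_0)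
next
  case (Suc n)
  let ?c = "codegen n 0" and ?t = "terminal_map n"
  have "opa E (Suc n) n ?c (degen_iso E n (Cod (lev E 0) f)) \<cdot>\<^bsub>lev E (Suc n)\<^esub> opa E (Suc n) n ?c (degen_a E n f)
    = opa E (Suc n) n ?c (opa E n 0 ?t f) \<cdot>\<^bsub>lev E (Suc n)\<^esub> opa E (Suc n) n ?c (degen_iso E n (Dom (lev E 0) f))"
    using arg_cong[OF Suc, of "opa E (Suc n) n ?c"] assms by simp
  moreover have "cmp E (Suc n) n 0 ?c ?t (Cod (lev E 0) f) \<cdot>\<^bsub>lev E (Suc n)\<^esub>
      opa E (Suc n) n ?c (opa E n 0 ?t f) \<cdot>\<^bsub>lev E (Suc n)\<^esub> opa E (Suc n) n ?c (degen_iso E n (Dom (lev E 0) f))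
    = opa E (Suc n) 0 (terminal_map (Suc n)) f \<cdot>\<^bsub>lev E (Suc n)\<^esub> cmp E (Suc n) n 0 ?c ?t (Dom (lev E 0) f)
      \<cdot>\<^bsub>lev E (Suc n)\<^esub> opa E (Suc n) n ?c (degen_iso E n (Dom (lev E 0) f))"
    using cmp_natural'[of ?c "Suc n" n ?t 0 f] assms by (intro lev.Comp_eq_right) simp_all
  ultimately show ?case
    using assms by (simp add: degen_a.simps)
qed

lemma point_simps [simp]:
  assumes "x \<in> Obj (lev E 0)"
  shows "point E n x \<in> Arr (total E)" "Dom (total E) (point E n x) = (n, degen_o E n x)"
    and "Cod (total E) (point E n x) = (0, x)"
  using assms by (simp_all add: point_def)

lemma point_natural:
  assumes "f \<in> Arr (lev E 0)"
  shows "point E n (Cod (lev E 0) f) \<bullet> lift E n (degen_a E n f)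
    = lift E 0 f \<bullet> point E n (Dom (lev E 0) f)"
proof -
  let ?t = "terminal_map n"
  have "point E n (Cod (lev E 0) f) \<bullet> lift E n (degen_a E n f)
    = cart E n 0 ?t (Cod (lev E 0) f) \<bullet> lift E n (opa E n 0 ?t f) \<bullet> lift E n (degen_iso E n (Dom (lev E 0) f))"
    using arg_cong[OF degen_iso_natural[OF assms, of n], of "lift E n"] assms by (simp add: point_def)
  also have "\<dots> = lift E 0 f \<bullet> cart E n 0 ?t (Dom (lev E 0) f) \<bullet> lift E n (degen_iso E n (Dom (lev E 0) f))"
    using lift_cart[of ?t n 0 f] assms by (intro T.Comp_eq_right) simp_all
  finally show ?thesis by (simp add: point_def)
qed

lemma point_cart:
  assumes "x \<in> Obj (lev E 0)" "\<theta> \<in> Delta m n"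
  shows "point E n x \<bullet> cart E m n \<theta> (degen_o E n x)
    = cart E m 0 (terminal_map m) x \<bullet>
      lift E m (cmp E m n 0 \<theta> (terminal_map n) x \<cdot>\<^bsub>lev E m\<^esub> opa E m n \<theta> (degen_iso E n x))"
proof -
  have "point E n x \<bullet> cart E m n \<theta> (degen_o E n x)
    = cart E n 0 (terminal_map n) x \<bullet> cart E m n \<theta> (opo E n 0 (terminal_map n) x)
      \<bullet> lift E m (opa E m n \<theta> (degen_iso E n x))"
    using lift_cart[of \<theta> m n "degen_iso E n x"] assms by (simp add: point_def)
  also have "\<dots> = cart E m 0 (terminal_map m) x \<bullet> lift E m (cmp E m n 0 \<theta> (terminal_map n) x)
      \<bullet> lift E m (opa E m n \<theta> (degen_iso E n x))"
    using cart_cart[of \<theta> m n "terminal_map n" 0 x] assms by (intro T.Comp_eq_right) simp_all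
  finally show ?thesis using assms by simp
qed

text \<open>Both arrows split over their common base, and after \<open>point\<close> their vertical
  parts are followed by the same invertible arrow \<open>?i\<close>. Identities of arrows into s^n x
  can thus be proved by composing with \<open>point\<close>, where the degeneracies
  collapse.\<close>

lemma point_cancel:
  assumes "point E n x \<bullet> a = point E n x \<bullet> b" "base a = base b" "x \<in> Obj (lev E 0)"
    "a \<in> Arr (total E)" "b \<in> Arr (total E)" "Dom (total E) a = (m, y)" "Dom (total E) b = (m, y)"
    "Cod (total E) a = (n, degen_o E n x)" "Cod (total E) b = (n, degen_o E n x)"
  shows "a = b"
proof -
  define \<theta> where "\<theta> = base a"
  have \<theta>: "\<theta> \<in> Delta m n" unfolding \<theta>_def using assms by (intro base_Delta)
  obtain u where u: "u \<in> Arr (lev E m)" "Cod (lev E m) u = opo E m n \<theta> (degen_o E n x)"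
    "a = cart E m n \<theta> (degen_o E n x) \<bullet> lift E m u"
    using total_factor[of a m y n "degen_o E n x"] assms unfolding \<theta>_def by metis
  obtain v where v: "v \<in> Arr (lev E m)" "Cod (lev E m) v = opo E m n \<theta> (degen_o E n x)"
    "b = cart E m n \<theta> (degen_o E n x) \<bullet> lift E m v"
    using total_factor[of b m y n "degen_o E n x"] assms unfolding \<theta>_def by metis
  let ?i = "cmp E m n 0 \<theta> (terminal_map n) x \<cdot>\<^bsub>lev E m\<^esub> opa E m n \<theta> (degen_iso E n x)"
  have i: "iso_arrow (lev E m) ?i"
    using assms(3) \<theta> by (intro lev.iso_Comp) simp_all
  have *: "point E n x \<bullet> cart E m n \<theta> (degen_o E n x) \<bullet> lift E m w
    = cart E m 0 (terminal_map m) x \<bullet> lift E m (?i \<cdot>\<^bsub>lev E m\<^esub> w)"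
    if "w \<in> Arr (lev E m)" "Cod (lev E m) w = opo E m n \<theta> (degen_o E n x)" for w
    using T.Comp_eq_right[OF point_cart[OF assms(3) \<theta>], of "lift E m w"] assms(3) \<theta> that by simp
  have "?i \<cdot>\<^bsub>lev E m\<^esub> u = ?i \<cdot>\<^bsub>lev E m\<^esub> v"
    using assms(1) *[OF u(1,2)] *[OF v(1,2)] assms(3) \<theta> u(1,2) v(1,2)
    unfolding u(3) v(3) by (intro cart_lift_cancel[of m 0 "terminal_map m" x]) simp_all
  then have "u = v"
    by (rule lev.iso_cancel[OF i]) (use assms(3) \<theta> u v in simp_all)
  then show ?thesis by (simp add: u v)
qed

lemma point_lift_cancel:
  assumes "point E n x \<bullet> lift E n u = point E n x \<bullet> lift E n v" "x \<in> Obj (lev E 0)"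
    "u \<in> Arr (lev E n)" "v \<in> Arr (lev E n)" "Dom (lev E n) u = Dom (lev E n) v"
    "Cod (lev E n) u = degen_o E n x" "Cod (lev E n) v = degen_o E n x"
  shows "u = v"
proof -
  have "lift E n u = lift E n v"
    using assms by (intro point_cancel[OF assms(1)]) simp_all
  then show ?thesis using assms by (simp add: lift_eq_iff)
qed

text \<open>There is only one map to [0], so the base is forced, and the inverse of
  \<open>degen_iso\<close> moves the target of the vertical part to s^n x. Together with
  \<open>point_lift_cancel\<close> this gives a bijection.\<close>

lemma point_factor:
  assumes "a \<in> Arr (total E)" "Dom (total E) a = (n, y)" "Cod (total E) a = (0, x)"
  obtains u where "u \<in> Arr (lev E n)" "Dom (lev E n) u = y" "Cod (lev E n) u = degen_o E n x"
    "a = point E n x \<bullet> lift E n u"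
proof -
  have x: "x \<in> Obj (lev E 0)"
    using T.Cod_in[OF assms(1)] assms(3) by simp
  have b: "base a = terminal_map n"
    using base_Delta[OF assms] by (rule terminal_unique)
  obtain u where u: "u \<in> Arr (lev E n)" "Dom (lev E n) u = y" "Cod (lev E n) u = opo E n 0 (terminal_map n) x"
    "a = cart E n 0 (terminal_map n) x \<bullet> lift E n u"
    using total_factor[OF assms] unfolding b by blast
  let ?u = "inv_arrow (lev E n) (degen_iso E n x) \<cdot>\<^bsub>lev E n\<^esub> u"
  have "lift E n (degen_iso E n x) \<bullet> lift E n ?u = lift E n u"
    using x u by (simp flip: lift_Comp)
  then have "a = point E n x \<bullet> lift E n ?u"
    using x u by (simp add: point_def)
  then show ?thesis
    using that[of ?u] x u by simp
qed

lemma const_iso_simps [simp]: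
  assumes "x \<in> Obj (lev E 0)" "\<theta> \<in> Delta m n"
  shows const_iso_Arr: "const_iso E m n \<theta> x \<in> Arr (lev E m)"
    and const_iso_iso: "iso_arrow (lev E m) (const_iso E m n \<theta> x)"
    and Dom_const_iso: "Dom (lev E m) (const_iso E m n \<theta> x) = opo E m n \<theta> (degen_o E n x)"
    and Cod_const_iso: "Cod (lev E m) (const_iso E m n \<theta> x) = degen_o E m x"
  using assms by (simp_all add: const_iso_def lev.iso_Comp lev.iso_inv_arrow)

text \<open>This equation characterises \<open>const_iso\<close> as the comparison of two cartesian
  arrows into (0, x) over the same map.\<close>

lemma point_const_iso:
  assumes "x \<in> Obj (lev E 0)" "\<theta> \<in> Delta m n"
  shows "point E m x \<bullet> lift E m (const_iso E m n \<theta> x) = point E n x \<bullet> cart E m n \<theta> (degen_o E n x)"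
proof -
  have "lift E m (degen_iso E m x) \<bullet> lift E m (const_iso E m n \<theta> x)
    = lift E m (cmp E m n 0 \<theta> (terminal_map n) x \<cdot>\<^bsub>lev E m\<^esub> opa E m n \<theta> (degen_iso E n x))"
    using assms by (subst lift_Comp[symmetric]) (simp_all add: const_iso_def del: lift_Comp)
  then show ?thesis
    using assms by (simp add: point_cart) (simp add: point_def)
qed

lemma lift_iso [simp]:
  assumes "iso_arrow (lev E n) f" "f \<in> Arr (lev E n)"
  shows "lift E n f \<bullet> lift E n (inv_arrow (lev E n) f) = Ide (total E) (n, Cod (lev E n) f)"
    and "lift E n (inv_arrow (lev E n) f) \<bullet> lift E n f = Ide (total E) (n, Dom (lev E n) f)"
  using assms by (simp_all flip: lift_Comp)

section \<open>The constant diagram as a strict functor\<close>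

lemma kappa_simps [simp]:
  assumes "x \<in> Obj (lev E 0)" "\<theta> \<in> Delta m n"
  shows "kappa E m n \<theta> x \<in> Arr (total E)" "Dom (total E) (kappa E m n \<theta> x) = (m, degen_o E m x)"
    and "Cod (total E) (kappa E m n \<theta> x) = (n, degen_o E n x)"
    and "base (kappa E m n \<theta> x) = \<theta>"
  using assms by (simp_all add: kappa_def base_Comp)

lemma kappa_const_iso:
  assumes "x \<in> Obj (lev E 0)" "\<theta> \<in> Delta m n"
  shows "kappa E m n \<theta> x \<bullet> lift E m (const_iso E m n \<theta> x) = cart E m n \<theta> (degen_o E n x)"
  using assms by (simp add: kappa_def)

lemma point_kappa [simp]:
  assumes "x \<in> Obj (lev E 0)" "\<theta> \<in> Delta m n"
  shows "point E n x \<bullet> kappa E m n \<theta> x = point E m x"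
proof -
  have "point E n x \<bullet> kappa E m n \<theta> x
    = point E m x \<bullet> lift E m (const_iso E m n \<theta> x) \<bullet> lift E m (inv_arrow (lev E m) (const_iso E m n \<theta> x))"
    unfolding kappa_def using assms by (intro T.Comp_eq_right) (simp_all add: point_const_iso)
  then show ?thesis using assms by simp
qed

text \<open>Both sides have the same base, and both become \<open>point E l x\<close> after
  composition with \<open>point E n x\<close>.\<close>

lemma kappa_compose:
  assumes "x \<in> Obj (lev E 0)" "\<tau> \<in> Delta l m" "\<theta> \<in> Delta m n"
  shows "kappa E m n \<theta> x \<bullet> kappa E l m \<tau> x = kappa E l n (compose {..l} \<theta> \<tau>) x"
proof (rule point_cancel)
  have "point E n x \<bullet> kappa E m n \<theta> x \<bullet> kappa E l m \<tau> x = (point E n x \<bullet> kappa E m n \<theta> x) \<bullet> kappa E l m \<tau> x"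
    using assms by (simp del: point_kappa)
  then show "point E n x \<bullet> kappa E m n \<theta> x \<bullet> kappa E l m \<tau> x
      = point E n x \<bullet> kappa E l n (compose {..l} \<theta> \<tau>) x"
    using assms by (simp del: T.Comp_assoc_right)
qed (use assms in \<open>simp_all add: base_Comp\<close>)

lemma kappa_id: "x \<in> Obj (lev E 0) \<Longrightarrow> kappa E n n (id_map n) x = Ide (total E) (n, degen_o E n x)"
  by (rule point_cancel[of n x]) (simp_all, simp add: base_def total_simps)

text \<open>After composition with \<open>point\<close> both sides become \<open>lift E 0 f\<close>
  preceded by \<open>point E m\<close>, because \<open>point\<close> is natural in its
  object.\<close>

lemma kappa_natural:
  assumes "f \<in> Arr (lev E 0)" "\<theta> \<in> Delta m n"
  shows "kappa E m n \<theta> (Cod (lev E 0) f) \<bullet> lift E m (degen_a E m f)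
    = lift E n (degen_a E n f) \<bullet> kappa E m n \<theta> (Dom (lev E 0) f)"
proof (rule point_cancel)
  let ?x = "Dom (lev E 0) f" and ?y = "Cod (lev E 0) f"
  have "point E n ?y \<bullet> kappa E m n \<theta> ?y \<bullet> lift E m (degen_a E m f)
    = (point E n ?y \<bullet> kappa E m n \<theta> ?y) \<bullet> lift E m (degen_a E m f)"
    using assms by (simp del: point_kappa)
  also have "\<dots> = lift E 0 f \<bullet> point E n ?x \<bullet> kappa E m n \<theta> ?x"
    using assms by (simp add: point_natural)
  also have "\<dots> = point E n ?y \<bullet> lift E n (degen_a E n f) \<bullet> kappa E m n \<theta> ?x"
    using assms by (intro T.Comp_eq_right) (simp_all add: point_natural)
  finally show "point E n ?y \<bullet> kappa E m n \<theta> ?y \<bullet> lift E m (degen_a E m f)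
    = point E n ?y \<bullet> lift E n (degen_a E n f) \<bullet> kappa E m n \<theta> ?x" .
qed (use assms in \<open>simp_all add: base_Comp\<close>)

end

section \<open>Universal extensions in the total category\<close>

lemma coface_le [simp]: "k \<le> n \<Longrightarrow> coface (Suc n) j k \<le> Suc n"
  by (rule Delta_le[OF coface_Delta])

context simplicial_category
begin

text \<open>Uniqueness for arbitrary, not only vertical, arrows in front of a cartesian one: the two
  nested reindexings differ from a single one by the invertible \<open>cmp\<close>.\<close>

lemma cart_cancel:
  assumes "cart E m n \<theta> z \<bullet> a = cart E m n \<theta> z \<bullet> b" "base a = base b" "\<theta> \<in> Delta m n" "z \<in> Obj (lev E n)"
    "a \<in> Arr (total E)" "b \<in> Arr (total E)" "Dom (total E) a = (l, y)" "Dom (total E) b = (l, y)"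
    "Cod (total E) a = (m, opo E m n \<theta> z)" "Cod (total E) b = (m, opo E m n \<theta> z)"
  shows "a = b"
proof -
  define \<tau> where "\<tau> = base a"
  let ?z = "opo E m n \<theta> z"
  have \<tau>: "\<tau> \<in> Delta l m" unfolding \<tau>_def using assms by (intro base_Delta)
  obtain u where u: "u \<in> Arr (lev E l)" "Cod (lev E l) u = opo E l m \<tau> ?z" "a = cart E l m \<tau> ?z \<bullet> lift E l u"
    using total_factor[of a l y m ?z] assms unfolding \<tau>_def by metis
  obtain v where v: "v \<in> Arr (lev E l)" "Cod (lev E l) v = opo E l m \<tau> ?z" "b = cart E l m \<tau> ?z \<bullet> lift E l v"
    using total_factor[of b l y m ?z] assms unfolding \<tau>_def by metis
  let ?i = "cmp E l m n \<tau> \<theta> z"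
  have *: "cart E m n \<theta> z \<bullet> cart E l m \<tau> ?z \<bullet> lift E l w
    = cart E l n (compose {..l} \<theta> \<tau>) z \<bullet> lift E l (?i \<cdot>\<^bsub>lev E l\<^esub> w)"
    if "w \<in> Arr (lev E l)" "Cod (lev E l) w = opo E l m \<tau> ?z" for w
    using T.Comp_eq_right[OF cart_cart[OF \<tau> assms(3,4)], of "lift E l w"] assms(3,4) \<tau> that by simp
  have "?i \<cdot>\<^bsub>lev E l\<^esub> u = ?i \<cdot>\<^bsub>lev E l\<^esub> v"
    using assms(1) *[OF u(1,2)] *[OF v(1,2)] assms(3,4) \<tau> u(1,2) v(1,2)
    unfolding u(3) v(3) by (intro cart_lift_cancel[of l n "compose {..l} \<theta> \<tau>" z]) simp_all
  then have "u = v"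
    using assms(3,4) \<tau> u v by (intro lev.iso_cancel[of l ?i u v]) simp_all
  then show ?thesis by (simp add: u v)
qed

text \<open>A double coface has two factorisations, and \<open>face_swap\<close> is the quotient of
  the two corresponding \<open>cmp\<close> isomorphisms. In the total category it is thus the arrow
  by which the two paths of cartesian arrows differ.\<close>

lemma face_swap_cart:
  assumes "i < j" "j \<le> Suc (Suc n)" "z \<in> Obj (lev E (Suc (Suc n)))"
  defines "d \<equiv> coface (Suc (Suc n))" and "d' \<equiv> coface (Suc n)"
  shows "cart E (Suc n) (Suc (Suc n)) (d i) z \<bullet>
      cart E n (Suc n) (d' (j - 1)) (opo E (Suc n) (Suc (Suc n)) (d i) z) \<bullet> lift E n (face_swap E (Suc (Suc n)) i j z)
    = cart E (Suc n) (Suc (Suc n)) (d j) z \<bullet> cart E n (Suc n) (d' i) (opo E (Suc n) (Suc (Suc n)) (d j) z)"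
    and "face_swap E (Suc (Suc n)) i j z \<in> Arr (lev E n)"
    and "Dom (lev E n) (face_swap E (Suc (Suc n)) i j z)
      = opo E n (Suc n) (d' i) (opo E (Suc n) (Suc (Suc n)) (d j) z)"
    and "Cod (lev E n) (face_swap E (Suc (Suc n)) i j z)
      = opo E n (Suc n) (d' (j - 1)) (opo E (Suc n) (Suc (Suc n)) (d i) z)"
proof -
  let ?c = "cmp E n (Suc n) (Suc (Suc n)) (d' (j - 1)) (d i) z"
  let ?e = "cmp E n (Suc n) (Suc (Suc n)) (d' i) (d j) z"
  have fs: "face_swap E (Suc (Suc n)) i j z = inv_arrow (lev E n) ?c \<cdot>\<^bsub>lev E n\<^esub> ?e"
    by (simp add: face_swap_def d_def d'_def)
  have D: "d k \<in> Delta (Suc n) (Suc (Suc n))" "d' k \<in> Delta n (Suc n)" for k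
    by (simp_all add: d_def d'_def)
  define c where "c = compose {..n} (d i) (d' (j - 1))"
  have eq: "compose {..n} (d j) (d' i) = c" "compose {..n} (d i) (d' (j - Suc 0)) = c"
    unfolding c_def d_def d'_def using coface_coface[OF assms(1,2)] by simp_all
  have c: "c \<in> Delta n (Suc (Suc n))"
    unfolding c_def by (rule compose_Delta[OF D(2,1)])
  show "face_swap E (Suc (Suc n)) i j z \<in> Arr (lev E n)"
    "Dom (lev E n) (face_swap E (Suc (Suc n)) i j z)
      = opo E n (Suc n) (d' i) (opo E (Suc n) (Suc (Suc n)) (d j) z)"
    "Cod (lev E n) (face_swap E (Suc (Suc n)) i j z)
      = opo E n (Suc n) (d' (j - 1)) (opo E (Suc n) (Suc (Suc n)) (d i) z)"
    unfolding fs using assms(3) D eq by simp_all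
  have "cart E (Suc n) (Suc (Suc n)) (d i) z \<bullet>
      cart E n (Suc n) (d' (j - 1)) (opo E (Suc n) (Suc (Suc n)) (d i) z) \<bullet> lift E n (inv_arrow (lev E n) ?c \<cdot>\<^bsub>lev E n\<^esub> ?e)
    = cart E n (Suc (Suc n)) c z \<bullet> lift E n ?c \<bullet> lift E n (inv_arrow (lev E n) ?c \<cdot>\<^bsub>lev E n\<^esub> ?e)"
    using assms(3) D eq c by (intro T.Comp_eq_right) (simp_all add: cart_cart)
  also have "\<dots> = cart E n (Suc (Suc n)) c z \<bullet> lift E n ?e"
    using assms(3) D eq c by (subst lift_Comp[symmetric]) (simp_all del: lift_Comp)
  also have "\<dots> = cart E (Suc n) (Suc (Suc n)) (d j) z \<bullet> cart E n (Suc n) (d' i) (opo E (Suc n) (Suc (Suc n)) (d j) z)"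
    using assms(3) D eq by (simp add: cart_cart)
  finally show "cart E (Suc n) (Suc (Suc n)) (d i) z \<bullet>
      cart E n (Suc n) (d' (j - 1)) (opo E (Suc n) (Suc (Suc n)) (d i) z) \<bullet> lift E n (face_swap E (Suc (Suc n)) i j z)
    = cart E (Suc n) (Suc (Suc n)) (d j) z \<bullet> cart E n (Suc n) (d' i) (opo E (Suc n) (Suc (Suc n)) (d j) z)"
    unfolding fs .
qed

lemma total_factor_compose:
  assumes "a \<in> Arr (total E)" "Dom (total E) a = (l, y)" "Cod (total E) a = (n, z)"
    "base a = compose {..l} \<theta> \<tau>" "\<tau> \<in> Delta l m" "\<theta> \<in> Delta m n"
  obtains u where "u \<in> hom (lev E l) y (opo E l m \<tau> (opo E m n \<theta> z))"
    "a = cart E m n \<theta> z \<bullet> cart E l m \<tau> (opo E m n \<theta> z) \<bullet> lift E l u"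
proof -
  have z: "z \<in> Obj (lev E n)"
    using T.Cod_in[OF assms(1)] assms(3) by simp
  obtain v where v: "v \<in> Arr (lev E l)" "Dom (lev E l) v = y"
    "Cod (lev E l) v = opo E l n (compose {..l} \<theta> \<tau>) z" "a = cart E l n (compose {..l} \<theta> \<tau>) z \<bullet> lift E l v"
    using total_factor[OF assms(1-3)] unfolding assms(4) by metis
  let ?c = "cmp E l m n \<tau> \<theta> z"
  let ?u = "inv_arrow (lev E l) ?c \<cdot>\<^bsub>lev E l\<^esub> v"
  have u: "?u \<in> Arr (lev E l)" "Dom (lev E l) ?u = y" "Cod (lev E l) ?u = opo E l m \<tau> (opo E m n \<theta> z)"
    using v assms(5,6) z by simp_all
  have "cart E m n \<theta> z \<bullet> cart E l m \<tau> (opo E m n \<theta> z) \<bullet> lift E l ?u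
    = cart E l n (compose {..l} \<theta> \<tau>) z \<bullet> lift E l ?c \<bullet> lift E l ?u"
    using u assms(5,6) z by (intro T.Comp_eq_right cart_cart) (simp_all del: lift_Comp)
  also have "lift E l ?c \<bullet> lift E l ?u = lift E l v"
    using v assms(5,6) z by (subst lift_Comp[symmetric]) (simp_all del: lift_Comp)
  finally show ?thesis
    using that[of ?u] u v(4) by (simp add: hom_def)
qed

text \<open>The universal property inside level n + 1 extends to targets in every level, since an
  arrow into (N, z) over \<omega> is an arrow of level n + 1 into \<omega> z. The comparisons
  \<theta> are taken to be identities, as they are for companions.\<close>

lemma universal_total:
  assumes U: "universal_extension E (Suc n) x Y f \<theta> y \<phi>"
    and \<theta>: "\<And>i j. 1 \<le> n \<Longrightarrow> i < j \<Longrightarrow> j \<le> Suc n \<Longrightarrow> \<theta> i j = Ide (lev E (n - 1)) (face_o E n i (Y j))"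
    and x: "x \<in> Obj (lev E (Suc n))" and Y: "\<And>j. j \<le> Suc n \<Longrightarrow> Y j \<in> Obj (lev E n)"
    and h: "h \<in> hom (total E) (Suc n, x) (N, z)"
    and g: "\<And>j. j \<le> Suc n \<Longrightarrow> g j \<in> hom (total E) (n, Y j) (N, z)"
    and hg: "\<And>j. j \<le> Suc n \<Longrightarrow> h \<bullet> cart E n (Suc n) (coface (Suc n) j) x = g j \<bullet> lift E n (f j)"
    and gg: "\<And>i j k. n = Suc k \<Longrightarrow> i < j \<Longrightarrow> j \<le> Suc n \<Longrightarrow>
      g j \<bullet> cart E k n (coface n i) (Y j) = g i \<bullet> cart E k n (coface n (j - 1)) (Y i)"
  shows "\<exists>!u. u \<in> hom (total E) (Suc n, y) (N, z) \<and> u \<bullet> lift E (Suc n) \<phi> = h \<and>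
    (\<forall>j\<le>Suc n. u \<bullet> cart E n (Suc n) (coface (Suc n) j) y = g j)"
proof -
  let ?d = "coface (Suc n)"
  have \<phi>: "\<phi> \<in> Arr (lev E (Suc n))" "Dom (lev E (Suc n)) \<phi> = x" "Cod (lev E (Suc n)) \<phi> = y"
    and y: "y \<in> Obj (lev E (Suc n))"
    using U by (auto simp: universal_extension_def hom_def)
  have yY: "opo E n (Suc n) (?d j) y = Y j" and \<phi>f: "opa E n (Suc n) (?d j) \<phi> = f j" if "j \<le> Suc n" for j
    using U that by (auto simp: universal_extension_def)
  have f: "f j \<in> Arr (lev E n)" "Dom (lev E n) (f j) = opo E n (Suc n) (?d j) x" "Cod (lev E n) (f j) = Y j"
    if "j \<le> Suc n" for j
    using \<phi> yY[OF that] by (simp_all flip: \<phi>f[OF that])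
  define \<omega> where "\<omega> = base h"
  have hT: "h \<in> Arr (total E)" "Dom (total E) h = (Suc n, x)" "Cod (total E) h = (N, z)"
    using h by (auto simp: hom_def)
  have gT: "g j \<in> Arr (total E)" "Dom (total E) (g j) = (n, Y j)" "Cod (total E) (g j) = (N, z)"
    if "j \<le> Suc n" for j
    using g[OF that] by (auto simp: hom_def)
  have z: "z \<in> Obj (lev E N)"
    using T.Cod_in[OF hT(1)] hT(3) by simp
  have \<omega>: "\<omega> \<in> Delta (Suc n) N"
    unfolding \<omega>_def using base_Delta hT by blast
  let ?z = "opo E (Suc n) N \<omega> z"
  obtain h0 where h0: "h0 \<in> Arr (lev E (Suc n))" "Dom (lev E (Suc n)) h0 = x"
    "Cod (lev E (Suc n)) h0 = ?z" "h = cart E (Suc n) N \<omega> z \<bullet> lift E (Suc n) h0"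
    using total_factor[OF hT] unfolding \<omega>_def by blast
  \<comment> \<open>Nothing was assumed about the base of \<open>g j\<close>. As
    \<open>lift E n (f j)\<close> is vertical, comparing bases in \<open>hg\<close> determines
    it.\<close>
  have base_g: "base (g j) = compose {..n} \<omega> (?d j)" if "j \<le> Suc n" for j
  proof -
    have "base (g j) \<in> Delta n N"
      using base_Delta gT[OF that] by blast
    then have "base (g j \<bullet> lift E n (f j)) = base (g j)"
      using f[OF that] base_Comp[of "lift E n (f j)" n] by simp
    moreover have "base (h \<bullet> cart E n (Suc n) (?d j) x) = compose {..n} \<omega> (?d j)"
      using x base_Comp[of "cart E n (Suc n) (?d j) x" n] by (simp add: \<omega>_def)
    ultimately show ?thesis using hg[OF that] by simp
  qed
  have "\<exists>u. u \<in> hom (lev E n) (Y j) (opo E n (Suc n) (?d j) ?z) \<and>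
      g j = cart E (Suc n) N \<omega> z \<bullet> cart E n (Suc n) (?d j) ?z \<bullet> lift E n u" if "j \<le> Suc n" for j
    by (rule total_factor_compose[OF gT[OF that] base_g[OF that] coface_Delta \<omega>]) blast
  then obtain g0 where g0: "\<And>j. j \<le> Suc n \<Longrightarrow> g0 j \<in> hom (lev E n) (Y j) (opo E n (Suc n) (?d j) ?z)"
    and g_eq: "\<And>j. j \<le> Suc n \<Longrightarrow> g j = cart E (Suc n) N \<omega> z \<bullet> cart E n (Suc n) (?d j) ?z \<bullet> lift E n (g0 j)"
    by metis
  have g0': "g0 j \<in> Arr (lev E n)" "Dom (lev E n) (g0 j) = Y j"
    "Cod (lev E n) (g0 j) = opo E n (Suc n) (?d j) ?z" if "j \<le> Suc n" for j
    using g0[OF that] by (auto simp: hom_def)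
  have lift_d: "lift E (Suc n) v \<bullet> cart E n (Suc n) (?d j) (Dom (lev E (Suc n)) v)
      = cart E n (Suc n) (?d j) ?z \<bullet> lift E n (opa E n (Suc n) (?d j) v)"
    if "v \<in> Arr (lev E (Suc n))" "Cod (lev E (Suc n)) v = ?z" for v j
    using lift_cart[of "?d j" n "Suc n" v] that by simp
  have cancel: "a = b" if "cart E (Suc n) N \<omega> z \<bullet> cart E n (Suc n) (?d j) ?z \<bullet> lift E n a
      = cart E (Suc n) N \<omega> z \<bullet> cart E n (Suc n) (?d j) ?z \<bullet> lift E n b"
    "a \<in> Arr (lev E n)" "b \<in> Arr (lev E n)" "Dom (lev E n) a = Dom (lev E n) b"
    "Cod (lev E n) a = opo E n (Suc n) (?d j) ?z" "Cod (lev E n) b = opo E n (Suc n) (?d j) ?z" for a b j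
  proof -
    have "cart E n (Suc n) (?d j) ?z \<bullet> lift E n a = cart E n (Suc n) (?d j) ?z \<bullet> lift E n b"
      using that \<omega> z by (intro cart_cancel[OF that(1)]) (simp_all add: base_Comp)
    then show ?thesis
      by (rule cart_lift_cancel) (use that \<omega> z in simp_all)
  qed
  have face_h: "opa E n (Suc n) (?d j) h0 = g0 j \<cdot>\<^bsub>lev E n\<^esub> f j" if j: "j \<le> Suc n" for j
  proof (rule cancel[of j])
    have "cart E (Suc n) N \<omega> z \<bullet> cart E n (Suc n) (?d j) ?z \<bullet> lift E n (opa E n (Suc n) (?d j) h0)
      = h \<bullet> cart E n (Suc n) (?d j) x"
      using h0 \<omega> z x lift_d[of h0 j] by simp
    also have "\<dots> = cart E (Suc n) N \<omega> z \<bullet> cart E n (Suc n) (?d j) ?z \<bullet> lift E n (g0 j \<cdot>\<^bsub>lev E n\<^esub> f j)"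
      using hg[OF j] g_eq[OF j] g0'[OF j] f[OF j] \<omega> z by simp
    finally show "cart E (Suc n) N \<omega> z \<bullet> cart E n (Suc n) (?d j) ?z \<bullet> lift E n (opa E n (Suc n) (?d j) h0)
      = cart E (Suc n) N \<omega> z \<bullet> cart E n (Suc n) (?d j) ?z \<bullet> lift E n (g0 j \<cdot>\<^bsub>lev E n\<^esub> f j)" .
  qed (use h0 g0'[OF j] f[OF j] \<omega> z in simp_all)
  \<comment> \<open>The strict condition \<open>gg\<close> becomes the matching condition inside the
    level: \<open>face_swap_cart\<close> replaces one path of cartesian arrows into \<omega> z by
    the other, and three cancellations remove the cartesian arrows.\<close>
  have swap: "face_swap E (Suc n) i j ?z \<cdot>\<^bsub>lev E k\<^esub> opa E k n (coface n i) (g0 j)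
      = opa E k n (coface n (j - 1)) (g0 i) \<cdot>\<^bsub>lev E k\<^esub> \<theta> i j"
    if k: "n = Suc k" and ij: "i < j" "j \<le> Suc n" for i j k
  proof -
    let ?e = "coface n"
    have e: "?e l \<in> Delta k n" for l using k by simp
    have i: "i \<le> Suc n" using ij by simp
    have z': "?z \<in> Obj (lev E (Suc (Suc k)))" using \<omega> z k by simp
    note fs = face_swap_cart[OF ij(1) ij(2)[unfolded k] z', folded k]
    have fsy: "face_swap E (Suc n) i j y = \<theta> i j"
      using U ij k by (auto simp: universal_extension_def)
    \<comment> \<open>The arrow \<open>face_swap\<close> of \<open>y\<close> is the identity
      \<open>\<theta> i j\<close>, so its source and its target, which are these two double faces,
      coincide.\<close>
    have Yij: "opo E k n (?e i) (Y j) = opo E k n (?e (j - 1)) (Y i)"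
      using face_swap_cart(3,4)[OF ij(1) ij(2)[unfolded k], of y] y fsy \<theta>[of i j] ij k yY[OF i] yY[OF ij(2)] Y[OF ij(2)] e
      by simp
    have gi: "lift E n (g0 l) \<bullet> cart E k n (?e l') (Y l)
        = cart E k n (?e l') (opo E n (Suc n) (?d l) ?z) \<bullet> lift E k (opa E k n (?e l') (g0 l))"
      if "l \<le> Suc n" for l l'
      using lift_cart[OF e, of "g0 l" l'] g0'[OF that] by simp
    let ?w = "opo E n (Suc n) (?d i) ?z"
    have w: "?w \<in> Obj (lev E n)" using \<omega> z by simp
    have g: "opa E k n (?e l') (g0 l) \<in> Arr (lev E k)"
      "Dom (lev E k) (opa E k n (?e l') (g0 l)) = opo E k n (?e l') (Y l)"
      "Cod (lev E k) (opa E k n (?e l') (g0 l)) = opo E k n (?e l') (opo E n (Suc n) (?d l) ?z)"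
      if "l \<le> Suc n" for l l'
      using g0'[OF that] e by simp_all
    have "cart E (Suc n) N \<omega> z \<bullet> cart E n (Suc n) (?d i) ?z \<bullet> cart E k n (?e (j - 1)) ?w \<bullet>
        lift E k (face_swap E (Suc n) i j ?z) \<bullet> lift E k (opa E k n (?e i) (g0 j))
      = cart E (Suc n) N \<omega> z \<bullet> (cart E n (Suc n) (?d i) ?z \<bullet> cart E k n (?e (j - 1)) ?w \<bullet>
        lift E k (face_swap E (Suc n) i j ?z)) \<bullet> lift E k (opa E k n (?e i) (g0 j))"
      using e \<omega> z fs(2,3,4) g[OF ij(2)] w by simp
    also have "\<dots> = cart E (Suc n) N \<omega> z \<bullet> cart E n (Suc n) (?d j) ?z \<bullet> lift E n (g0 j) \<bullet> cart E k n (?e i) (Y j)"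
      unfolding fs(1) gi[OF ij(2)] using e \<omega> z g[OF ij(2)] by simp
    also have "\<dots> = g j \<bullet> cart E k n (?e i) (Y j)"
      using e \<omega> z g0'[OF ij(2)] Y[OF ij(2)] g_eq[OF ij(2)] by simp
    also have "\<dots> = g i \<bullet> cart E k n (?e (j - 1)) (Y i)"
      by (rule gg[OF k ij])
    also have "\<dots> = cart E (Suc n) N \<omega> z \<bullet> cart E n (Suc n) (?d i) ?z \<bullet> lift E n (g0 i) \<bullet> cart E k n (?e (j - 1)) (Y i)"
      using e \<omega> z g0'[OF i] Y[OF i] g_eq[OF i] by simp
    also have "\<dots> = cart E (Suc n) N \<omega> z \<bullet> cart E n (Suc n) (?d i) ?z \<bullet> cart E k n (?e (j - 1)) ?w \<bullet>
        lift E k (opa E k n (?e (j - 1)) (g0 i))"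
      unfolding gi[OF i] ..
    finally have "cart E n (Suc n) (?d i) ?z \<bullet> cart E k n (?e (j - 1)) ?w \<bullet>
        lift E k (face_swap E (Suc n) i j ?z) \<bullet> lift E k (opa E k n (?e i) (g0 j))
      = cart E n (Suc n) (?d i) ?z \<bullet> cart E k n (?e (j - 1)) ?w \<bullet> lift E k (opa E k n (?e (j - 1)) (g0 i))"
      by (rule cart_cancel) (use e[of i] e[of "j - 1"] \<omega> z fs(2,3,4) g[OF ij(2)] g[OF i] w Yij in \<open>simp_all add: base_Comp\<close>)
    then have "cart E k n (?e (j - 1)) ?w \<bullet>
        lift E k (face_swap E (Suc n) i j ?z) \<bullet> lift E k (opa E k n (?e i) (g0 j))
      = cart E k n (?e (j - 1)) ?w \<bullet> lift E k (opa E k n (?e (j - 1)) (g0 i))"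
      by (rule cart_cancel) (use e[of i] e[of "j - 1"] \<omega> z fs(2,3,4) g[OF ij(2)] g[OF i] w Yij in \<open>simp_all add: base_Comp\<close>)
    then have "face_swap E (Suc n) i j ?z \<cdot>\<^bsub>lev E k\<^esub> opa E k n (?e i) (g0 j) = opa E k n (?e (j - 1)) (g0 i)"
      using e fs(2,3,4) g[OF ij(2)] g[OF i] w by (intro cart_lift_cancel[of k n "?e (j - 1)" ?w]) simp_all
    moreover have "opa E k n (?e (j - 1)) (g0 i) \<cdot>\<^bsub>lev E k\<^esub> \<theta> i j = opa E k n (?e (j - 1)) (g0 i)"
      using \<theta>[of i j] ij k g[OF i] Yij by simp
    ultimately show ?thesis using k by simp
  qed
  have "\<exists>!u0. u0 \<in> hom (lev E (Suc n)) y ?z \<and> h0 = u0 \<cdot>\<^bsub>lev E (Suc n)\<^esub> \<phi> \<and>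
      (\<forall>i\<le>Suc n. opa E n (Suc n) (?d i) u0 = g0 i)"
  proof -
    have "h0 \<in> hom (lev E (Suc n)) x ?z" using h0 by (simp add: hom_def)
    moreover have "\<forall>i j. 2 \<le> Suc n \<and> i < j \<and> j \<le> Suc n \<longrightarrow>
       face_swap E (Suc n) i j ?z \<cdot>\<^bsub>lev E (Suc n - 2)\<^esub> face_a E (Suc n - 1) i (g0 j)
           = face_a E (Suc n - 1) (j - 1) (g0 i) \<cdot>\<^bsub>lev E (Suc n - 2)\<^esub> \<theta> i j"
      using swap by (cases n) auto
    ultimately show ?thesis
      using U g0 face_h unfolding universal_extension_def diff_Suc_1 by blast
  qed
  then obtain u0 where u0: "u0 \<in> Arr (lev E (Suc n))" "Dom (lev E (Suc n)) u0 = y" "Cod (lev E (Suc n)) u0 = ?z"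
    "h0 = u0 \<cdot>\<^bsub>lev E (Suc n)\<^esub> \<phi>" "\<And>i. i \<le> Suc n \<Longrightarrow> opa E n (Suc n) (?d i) u0 = g0 i"
    and uniq: "\<And>v. v \<in> Arr (lev E (Suc n)) \<Longrightarrow> Dom (lev E (Suc n)) v = y \<Longrightarrow> Cod (lev E (Suc n)) v = ?z \<Longrightarrow>
      h0 = v \<cdot>\<^bsub>lev E (Suc n)\<^esub> \<phi> \<Longrightarrow> (\<And>i. i \<le> Suc n \<Longrightarrow> opa E n (Suc n) (?d i) v = g0 i) \<Longrightarrow> v = u0"
    unfolding hom_def by blast
  show ?thesis
  proof (rule ex1I)
    let ?u = "cart E (Suc n) N \<omega> z \<bullet> lift E (Suc n) u0"
    have "?u \<bullet> cart E n (Suc n) (?d j) y = g j" if "j \<le> Suc n" for j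
      using u0(1-3,5) that \<omega> z y g_eq[OF that] lift_d[of u0 j] by simp
    then show "?u \<in> hom (total E) (Suc n, y) (N, z) \<and> ?u \<bullet> lift E (Suc n) \<phi> = h \<and>
        (\<forall>j\<le>Suc n. ?u \<bullet> cart E n (Suc n) (?d j) y = g j)"
      using u0(1-4) \<omega> z h0(4) \<phi> by (auto simp: hom_def)
  next
    fix u
    assume u: "u \<in> hom (total E) (Suc n, y) (N, z) \<and> u \<bullet> lift E (Suc n) \<phi> = h \<and>
        (\<forall>j\<le>Suc n. u \<bullet> cart E n (Suc n) (?d j) y = g j)"
    then have uT: "u \<in> Arr (total E)" "Dom (total E) u = (Suc n, y)" "Cod (total E) u = (N, z)"
      by (auto simp: hom_def)
    have "base u = \<omega>"
      using u \<phi> base_Delta[OF uT] base_Comp[of "lift E (Suc n) \<phi>" "Suc n" x u] by (simp add: \<omega>_def)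
    then obtain v where v: "v \<in> Arr (lev E (Suc n))" "Dom (lev E (Suc n)) v = y" "Cod (lev E (Suc n)) v = ?z"
      "u = cart E (Suc n) N \<omega> z \<bullet> lift E (Suc n) v"
      using total_factor[OF uT] by metis
    have "v = u0"
    proof (rule uniq[OF v(1-3)])
      show "h0 = v \<cdot>\<^bsub>lev E (Suc n)\<^esub> \<phi>"
        using u v \<phi> h0 \<omega> z by (intro cart_lift_cancel[of "Suc n" N \<omega> z]) auto
      show "opa E n (Suc n) (?d j) v = g0 j" if j: "j \<le> Suc n" for j
      proof (rule cancel[of j])
        have "g j = u \<bullet> cart E n (Suc n) (?d j) y" using u j by simp
        also have "\<dots> = cart E (Suc n) N \<omega> z \<bullet> cart E n (Suc n) (?d j) ?z \<bullet> lift E n (opa E n (Suc n) (?d j) v)"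
          using v \<omega> z y lift_d[of v j] by simp
        finally show "cart E (Suc n) N \<omega> z \<bullet> cart E n (Suc n) (?d j) ?z \<bullet> lift E n (opa E n (Suc n) (?d j) v)
          = cart E (Suc n) N \<omega> z \<bullet> cart E n (Suc n) (?d j) ?z \<bullet> lift E n (g0 j)"
          using g_eq[OF j] by simp
      qed (use v g0'[OF j] yY[OF j] in simp_all)
    qed
    then show "u = cart E (Suc n) N \<omega> z \<bullet> lift E (Suc n) u0" using v by simp
  qed
qed

end

section \<open>Companions in the total category\<close>

text \<open>These are the clauses on companions that do not mention structure arrows. They serve
  twice: for the companions under construction, where the structure is still to be found, and for an
  arbitrary given companion.\<close>

locale companion_data = simplicial_category E for E :: "('o, 'a) scat" +
  fixes C :: "nat \<Rightarrow> (nat \<times> nat \<Rightarrow> 'a) \<Rightarrow> 'o" and \<phi> :: "nat \<Rightarrow> (nat \<times> nat \<Rightarrow> 'a) \<Rightarrow> 'a"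
  assumes companion_0: "\<forall>\<sigma> \<in> nerve_simp (lev E 0) 0.
        C 0 \<sigma> = vert (lev E 0) \<sigma> 0 \<and> \<phi> 0 \<sigma> = Ide (lev E 0) (vert (lev E 0) \<sigma> 0)"
    and companion_ext: "\<forall>n\<ge>1. \<forall>\<sigma> \<in> nerve_simp (lev E 0) n.
        universal_extension E n (degen_o E n (vert (lev E 0) \<sigma> 0))
          (\<lambda>i. C (n - 1) (nerve_act (n - 1) (coface n i) \<sigma>))
          (companion_leg E \<phi> n \<sigma>)
          (\<lambda>i j. Ide (lev E (n - 2))
             (face_o E (n - 1) i (C (n - 1) (nerve_act (n - 1) (coface n j) \<sigma>))))
          (C n \<sigma>) (\<phi> n \<sigma>)"
begin

abbreviation N where "N \<equiv> nerve_simp (lev E 0)"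
abbreviation V where "V \<equiv> vert (lev E 0)"
abbreviation d where "d n j \<sigma> \<equiv> nerve_act n (coface (Suc n) j) \<sigma>"

abbreviation edge where "edge m k \<sigma> \<equiv> lift E m (degen_a E m (\<sigma> (0, k)))"

lemma ext_Suc:
  assumes "\<sigma> \<in> N (Suc n)"
  shows "universal_extension E (Suc n) (degen_o E (Suc n) (V \<sigma> 0)) (\<lambda>i. C n (d n i \<sigma>))
    (companion_leg E \<phi> (Suc n) \<sigma>) (\<lambda>i j. Ide (lev E (n - 1)) (face_o E n i (C n (d n j \<sigma>)))) (C (Suc n) \<sigma>) (\<phi> (Suc n) \<sigma>)"
  using companion_ext assms by (metis Suc_1 diff_Suc_1 diff_Suc_Suc le_add1 plus_1_eq_Suc)

lemma companion_simps [simp]: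
  assumes "\<sigma> \<in> N n"
  shows C_Obj: "C n \<sigma> \<in> Obj (lev E n)"
    and phi_Arr: "\<phi> n \<sigma> \<in> Arr (lev E n)"
    and Dom_phi: "Dom (lev E n) (\<phi> n \<sigma>) = degen_o E n (V \<sigma> 0)"
    and Cod_phi: "Cod (lev E n) (\<phi> n \<sigma>) = C n \<sigma>"
proof -
  have "C n \<sigma> \<in> Obj (lev E n) \<and> \<phi> n \<sigma> \<in> hom (lev E n) (degen_o E n (V \<sigma> 0)) (C n \<sigma>)"
  proof (cases n)
    case 0
    with assms companion_0 show ?thesis by (simp add: hom_def)
  next
    case (Suc n')
    with assms ext_Suc[of \<sigma> n'] show ?thesis by (simp add: universal_extension_def)
  qed
  then show "C n \<sigma> \<in> Obj (lev E n)" "\<phi> n \<sigma> \<in> Arr (lev E n)"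
    "Dom (lev E n) (\<phi> n \<sigma>) = degen_o E n (V \<sigma> 0)" "Cod (lev E n) (\<phi> n \<sigma>) = C n \<sigma>"
    by (auto simp: hom_def)
qed

lemma companion_face [simp]:
  assumes "\<sigma> \<in> N (Suc n)" "j \<le> Suc n"
  shows "opo E n (Suc n) (coface (Suc n) j) (C (Suc n) \<sigma>) = C n (d n j \<sigma>)"
  using ext_Suc[OF assms(1)] assms(2) by (auto simp: universal_extension_def)

lemma face_face:
  assumes "i < j" "j \<le> Suc (Suc n)"
  shows "d n i (d (Suc n) j \<sigma>) = d n (j - 1) (d (Suc n) i \<sigma>)"
  using coface_coface[OF assms] by simp

text \<open>The case split of \<open>companion_leg\<close> is absorbed by the value of the coface at
  0: it is 1 for j = 0, which gives the first edge of \<sigma>, and 0 otherwise, which gives an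
  identity.\<close>

lemma companion_leg_eq:
  assumes "\<sigma> \<in> N (Suc n)" "j \<le> Suc n"
  shows "companion_leg E \<phi> (Suc n) \<sigma> j = \<phi> n (d n j \<sigma>) \<cdot>\<^bsub>lev E n\<^esub>
    degen_a E n (\<sigma> (0, coface (Suc n) j 0)) \<cdot>\<^bsub>lev E n\<^esub> const_iso E n (Suc n) (coface (Suc n) j) (V \<sigma> 0)"
proof (cases "j = 0")
  case True
  moreover have "coface (Suc n) 0 0 = 1" by (simp add: coface_def)
  ultimately show ?thesis using assms by (simp add: companion_leg_def)
next
  case False
  moreover have "coface (Suc n) j 0 = 0" using False by (simp add: coface_def)
  ultimately show ?thesis
    using assms by (simp add: companion_leg_def nerve_simp_Ide[of \<sigma>])
qed

text \<open>The prescribed faces of \<phi>, with \<open>const_iso\<close> absorbed into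
  \<open>kappa\<close>. This is the coface case of the compatibility between structure arrows and
  \<phi>.\<close>

lemma phi_face:
  assumes "\<sigma> \<in> N (Suc n)" "j \<le> Suc n"
  shows "lift E (Suc n) (\<phi> (Suc n) \<sigma>) \<bullet> kappa E n (Suc n) (coface (Suc n) j) (V \<sigma> 0)
    = cart E n (Suc n) (coface (Suc n) j) (C (Suc n) \<sigma>) \<bullet> lift E n (\<phi> n (d n j \<sigma>)) \<bullet> edge n (coface (Suc n) j 0) \<sigma>"
proof -
  let ?d = "coface (Suc n) j"
  have "opa E n (Suc n) ?d (\<phi> (Suc n) \<sigma>) = companion_leg E \<phi> (Suc n) \<sigma> j"
    using ext_Suc[OF assms(1)] assms(2) by (auto simp: universal_extension_def)
  then have "lift E (Suc n) (\<phi> (Suc n) \<sigma>) \<bullet> cart E n (Suc n) ?d (degen_o E (Suc n) (V \<sigma> 0))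
    = cart E n (Suc n) ?d (C (Suc n) \<sigma>) \<bullet> lift E n (\<phi> n (d n j \<sigma>) \<cdot>\<^bsub>lev E n\<^esub>
    degen_a E n (\<sigma> (0, ?d 0)) \<cdot>\<^bsub>lev E n\<^esub> const_iso E n (Suc n) ?d (V \<sigma> 0))"
    using lift_cart[of ?d n "Suc n" "\<phi> (Suc n) \<sigma>"] assms by (simp add: companion_leg_eq del: lift_Comp)
  then have "lift E (Suc n) (\<phi> (Suc n) \<sigma>) \<bullet> kappa E n (Suc n) ?d (V \<sigma> 0)
    = (cart E n (Suc n) ?d (C (Suc n) \<sigma>) \<bullet> lift E n (\<phi> n (d n j \<sigma>) \<cdot>\<^bsub>lev E n\<^esub>
    degen_a E n (\<sigma> (0, ?d 0)) \<cdot>\<^bsub>lev E n\<^esub> const_iso E n (Suc n) ?d (V \<sigma> 0))) \<bullet>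
      lift E n (inv_arrow (lev E n) (const_iso E n (Suc n) ?d (V \<sigma> 0)))"
    unfolding kappa_def using assms by (subst T.Comp_assoc_right[symmetric]) (simp_all del: lift_Comp T.Comp_assoc_right)
  then show ?thesis
    using assms by simp
qed

text \<open>In the extension that defines a companion the prescribed comparison of double faces is
  an identity, so the simplicial identity for cofaces holds strictly for its cartesian
  arrows.\<close>

lemma companion_face_swap:
  assumes "\<sigma> \<in> N (Suc (Suc n))" "i < j" "j \<le> Suc (Suc n)"
  shows "cart E (Suc n) (Suc (Suc n)) (coface (Suc (Suc n)) j) (C (Suc (Suc n)) \<sigma>) \<bullet>
      cart E n (Suc n) (coface (Suc n) i) (C (Suc n) (d (Suc n) j \<sigma>))
    = cart E (Suc n) (Suc (Suc n)) (coface (Suc (Suc n)) i) (C (Suc (Suc n)) \<sigma>) \<bullet>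
      cart E n (Suc n) (coface (Suc n) (j - 1)) (C (Suc n) (d (Suc n) i \<sigma>))"
proof -
  have "face_swap E (Suc (Suc n)) i j (C (Suc (Suc n)) \<sigma>) = Ide (lev E n) (C n (d n i (d (Suc n) j \<sigma>)))"
    using ext_Suc[OF assms(1)] assms by (simp add: universal_extension_def)
  then show ?thesis
    using face_swap_cart(1)[OF assms(2,3), of "C (Suc (Suc n)) \<sigma>"] assms coface_coface[OF assms(2,3)]
    by simp
qed

text \<open>The form of \<open>universal_total\<close> for companions. The leg is unfolded into
  \<phi>, an edge and \<open>const_iso\<close>, and \<open>kappa\<close> absorbs the latter, so that
  no coherence isomorphism of the constant object is left in the hypotheses.\<close>

lemma companion_universal:
  assumes \<sigma>: "\<sigma> \<in> N (Suc n)"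
    and h: "h \<in> hom (total E) (Suc n, degen_o E (Suc n) (V \<sigma> 0)) (M, z)"
    and g: "\<And>j. j \<le> Suc n \<Longrightarrow> g j \<in> hom (total E) (n, C n (d n j \<sigma>)) (M, z)"
    and hg: "\<And>j. j \<le> Suc n \<Longrightarrow> h \<bullet> kappa E n (Suc n) (coface (Suc n) j) (V \<sigma> 0)
      = g j \<bullet> lift E n (\<phi> n (d n j \<sigma>)) \<bullet> edge n (coface (Suc n) j 0) \<sigma>"
    and gg: "\<And>i j k. n = Suc k \<Longrightarrow> i < j \<Longrightarrow> j \<le> Suc n \<Longrightarrow>
      g j \<bullet> cart E k n (coface n i) (C n (d n j \<sigma>)) = g i \<bullet> cart E k n (coface n (j - 1)) (C n (d n i \<sigma>))"
  shows "\<exists>!u. u \<in> hom (total E) (Suc n, C (Suc n) \<sigma>) (M, z) \<and> u \<bullet> lift E (Suc n) (\<phi> (Suc n) \<sigma>) = h \<and>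
    (\<forall>j\<le>Suc n. u \<bullet> cart E n (Suc n) (coface (Suc n) j) (C (Suc n) \<sigma>) = g j)"
proof (rule universal_total[OF ext_Suc[OF \<sigma>] refl _ _ h g _ gg])
  show "degen_o E (Suc n) (V \<sigma> 0) \<in> Obj (lev E (Suc n))"
    using \<sigma> by simp
  show "C n (d n j \<sigma>) \<in> Obj (lev E n)" for j
    using \<sigma> by simp
  show "h \<bullet> cart E n (Suc n) (coface (Suc n) j) (degen_o E (Suc n) (V \<sigma> 0))
    = g j \<bullet> lift E n (companion_leg E \<phi> (Suc n) \<sigma> j)" if j: "j \<le> Suc n" for j
  proof -
    have hT: "h \<in> Arr (total E)" "Dom (total E) h = (Suc n, degen_o E (Suc n) (V \<sigma> 0))"
      "g j \<in> Arr (total E)" "Dom (total E) (g j) = (n, C n (d n j \<sigma>))"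
      using h g[OF j] by (auto simp: hom_def)
    let ?i = "const_iso E n (Suc n) (coface (Suc n) j) (V \<sigma> 0)"
    have "h \<bullet> cart E n (Suc n) (coface (Suc n) j) (degen_o E (Suc n) (V \<sigma> 0))
      = (h \<bullet> kappa E n (Suc n) (coface (Suc n) j) (V \<sigma> 0)) \<bullet> lift E n ?i"
      using \<sigma> hT by (simp add: kappa_const_iso)
    also have "\<dots> = g j \<bullet> lift E n (companion_leg E \<phi> (Suc n) \<sigma> j)"
      unfolding hg[OF j] using \<sigma> j hT by (simp add: companion_leg_eq)
    finally show ?thesis .
  qed
qed auto

text \<open>Uniqueness is applied to the data obtained from \<open>u\<close> itself, which match by
  \<open>phi_face\<close> and \<open>companion_face_swap\<close>. Later equations between arrows out
  of a companion are checked on \<phi> and on faces.\<close>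

lemma companion_eqI:
  assumes \<sigma>: "\<sigma> \<in> N (Suc n)"
    and u: "u \<in> hom (total E) (Suc n, C (Suc n) \<sigma>) (M, z)" and v: "v \<in> hom (total E) (Suc n, C (Suc n) \<sigma>) (M, z)"
    and eq: "u \<bullet> lift E (Suc n) (\<phi> (Suc n) \<sigma>) = v \<bullet> lift E (Suc n) (\<phi> (Suc n) \<sigma>)"
    "\<And>j. j \<le> Suc n \<Longrightarrow> u \<bullet> cart E n (Suc n) (coface (Suc n) j) (C (Suc n) \<sigma>)
      = v \<bullet> cart E n (Suc n) (coface (Suc n) j) (C (Suc n) \<sigma>)"
  shows "u = v"
proof -
  have uT: "u \<in> Arr (total E)" "Dom (total E) u = (Suc n, C (Suc n) \<sigma>)" "Cod (total E) u = (M, z)"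
    using u by (auto simp: hom_def)
  let ?h = "u \<bullet> lift E (Suc n) (\<phi> (Suc n) \<sigma>)"
  let ?g = "\<lambda>j. u \<bullet> cart E n (Suc n) (coface (Suc n) j) (C (Suc n) \<sigma>)"
  have "\<exists>!w. w \<in> hom (total E) (Suc n, C (Suc n) \<sigma>) (M, z) \<and> w \<bullet> lift E (Suc n) (\<phi> (Suc n) \<sigma>) = ?h \<and>
    (\<forall>j\<le>Suc n. w \<bullet> cart E n (Suc n) (coface (Suc n) j) (C (Suc n) \<sigma>) = ?g j)"
  proof (rule companion_universal[OF \<sigma>])
    show "?h \<in> hom (total E) (Suc n, degen_o E (Suc n) (V \<sigma> 0)) (M, z)"
      using uT \<sigma> by (simp add: hom_def)
    show "?g j \<in> hom (total E) (n, C n (d n j \<sigma>)) (M, z)" if "j \<le> Suc n" for j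
      using uT \<sigma> that by (simp add: hom_def)
    show "?h \<bullet> kappa E n (Suc n) (coface (Suc n) j) (V \<sigma> 0)
      = ?g j \<bullet> lift E n (\<phi> n (d n j \<sigma>)) \<bullet> edge n (coface (Suc n) j 0) \<sigma>" if "j \<le> Suc n" for j
      using uT \<sigma> that by (simp add: phi_face)
    show "?g j \<bullet> cart E k n (coface n i) (C n (d n j \<sigma>)) = ?g i \<bullet> cart E k n (coface n (j - 1)) (C n (d n i \<sigma>))"
      if "n = Suc k" "i < j" "j \<le> Suc n" for i j k
      using uT \<sigma> that companion_face_swap[of \<sigma> k i j] by (simp del: nerve_act_act)
  qed
  then show ?thesis
    using u v eq by (metis (no_types, lifting))
qed

end

section \<open>Existence of the oplax structure\<close>

context companion_data
begin

text \<open>The least missed value is a definite but arbitrary choice; the last clause of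
  \<open>psi_good\<close> shows that every other missed value leads to the same structure
  arrow.\<close>

definition missed :: "nat \<Rightarrow> (nat \<Rightarrow> nat) \<Rightarrow> nat" where
  "missed m \<theta> = (LEAST j. j \<notin> \<theta> ` {..m})"

definition cofactor :: "nat \<Rightarrow> nat \<Rightarrow> (nat \<Rightarrow> nat) \<Rightarrow> nat \<Rightarrow> nat" where
  "cofactor m n \<theta> = (THE \<tau>. \<tau> \<in> Delta m n \<and> \<theta> = compose {..m} (coface (Suc n) (missed m \<theta>)) \<tau>)"

text \<open>The first argument bounds the recursion depth; it is to be \<open>m + n\<close>. A map that is not
  surjective factors through a coface map, over which the structure arrow is cartesian; for a
  surjective map the universal property of the domain applies.\<close>

primrec psi_rec :: "nat \<Rightarrow> nat \<Rightarrow> nat \<Rightarrow> (nat \<Rightarrow> nat) \<Rightarrow> (nat \<times> nat \<Rightarrow> 'a) \<Rightarrow>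
    nat \<times> 'a \<times> (nat \<Rightarrow> nat) \<times> nat \<times> 'o" where
  "psi_rec 0 m n \<theta> \<sigma> = Ide (total E) (0, C 0 \<sigma>)"
| "psi_rec (Suc k) m n \<theta> \<sigma> =
    (if surj_map m n \<theta> then
       THE u. u \<in> hom (total E) (m, C m (nerve_act m \<theta> \<sigma>)) (n, C n \<sigma>) \<and>
         u \<bullet> lift E m (\<phi> m (nerve_act m \<theta> \<sigma>)) = lift E n (\<phi> n \<sigma>) \<bullet> kappa E m n \<theta> (V \<sigma> 0) \<and>
         (\<forall>j\<le>m. u \<bullet> cart E (m - 1) m (coface m j) (C m (nerve_act m \<theta> \<sigma>))
           = psi_rec k (m - 1) n (compose {..m - 1} \<theta> (coface m j)) \<sigma>)
     else cart E (n - 1) n (coface n (missed m \<theta>)) (C n \<sigma>) \<bullet>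
       psi_rec k m (n - 1) (cofactor m (n - 1) \<theta>) (nerve_act (n - 1) (coface n (missed m \<theta>)) \<sigma>))"

text \<open>For maps of the simplex category each recursive call lowers m or n by one together with
  the bound, so the base case is reached only at m = n = 0, where the only map is the
  identity.\<close>

definition Psi :: "nat \<Rightarrow> nat \<Rightarrow> (nat \<Rightarrow> nat) \<Rightarrow> (nat \<times> nat \<Rightarrow> 'a) \<Rightarrow>
    nat \<times> 'a \<times> (nat \<Rightarrow> nat) \<times> nat \<times> 'o" where
  "Psi m n = psi_rec (m + n) m n"

lemma Psi_surj:
  assumes "surj_map (Suc m) n \<theta>"
  shows "Psi (Suc m) n \<theta> \<sigma> =
    (THE u. u \<in> hom (total E) (Suc m, C (Suc m) (nerve_act (Suc m) \<theta> \<sigma>)) (n, C n \<sigma>) \<and>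
         u \<bullet> lift E (Suc m) (\<phi> (Suc m) (nerve_act (Suc m) \<theta> \<sigma>))
           = lift E n (\<phi> n \<sigma>) \<bullet> kappa E (Suc m) n \<theta> (V \<sigma> 0) \<and>
         (\<forall>j\<le>Suc m. u \<bullet> cart E m (Suc m) (coface (Suc m) j) (C (Suc m) (nerve_act (Suc m) \<theta> \<sigma>))
           = Psi m n (compose {..m} \<theta> (coface (Suc m) j)) \<sigma>))"
  using assms by (simp add: Psi_def)

lemma missed:
  assumes "\<theta> \<in> Delta m (Suc n)" "\<not> surj_map m (Suc n) \<theta>"
  shows "missed m \<theta> \<notin> \<theta> ` {..m}" "missed m \<theta> \<le> Suc n" "j \<notin> \<theta> ` {..m} \<Longrightarrow> missed m \<theta> \<le> j"
proof -
  obtain i where i: "i \<notin> \<theta> ` {..m}" "i \<le> Suc n"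
    using assms(2) by (auto simp: surj_map_def)
  show "missed m \<theta> \<notin> \<theta> ` {..m}"
    unfolding missed_def by (rule LeastI[of "\<lambda>j. j \<notin> \<theta> ` {..m}"]) (rule i)
  show le: "missed m \<theta> \<le> j" if "j \<notin> \<theta> ` {..m}" for j
    unfolding missed_def by (rule Least_le) (rule that)
  show "missed m \<theta> \<le> Suc n"
    using le[OF i(1)] i(2) by simp
qed

lemma cofactor:
  assumes "\<theta> \<in> Delta m (Suc n)" "\<not> surj_map m (Suc n) \<theta>"
  shows "cofactor m n \<theta> \<in> Delta m n" "compose {..m} (coface (Suc n) (missed m \<theta>)) (cofactor m n \<theta>) = \<theta>"
proof -
  obtain \<tau> where \<tau>: "\<tau> \<in> Delta m n" "\<theta> = compose {..m} (coface (Suc n) (missed m \<theta>)) \<tau>"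
    using coface_factor[OF assms(1) missed(1,2)[OF assms]] by blast
  have "cofactor m n \<theta> \<in> Delta m n \<and> \<theta> = compose {..m} (coface (Suc n) (missed m \<theta>)) (cofactor m n \<theta>)"
    unfolding cofactor_def
  proof (rule theI[of _ \<tau>])
    show "\<rho> = \<tau>" if "\<rho> \<in> Delta m n \<and> \<theta> = compose {..m} (coface (Suc n) (missed m \<theta>)) \<rho>" for \<rho>
      using that \<tau> coface_inj[of m n "missed m \<theta>" \<rho> \<tau>] by simp
  qed (use \<tau> in simp)
  then show "cofactor m n \<theta> \<in> Delta m n" "compose {..m} (coface (Suc n) (missed m \<theta>)) (cofactor m n \<theta>) = \<theta>"
    by simp_all
qed

lemma Psi_not_surj:
  assumes "\<not> surj_map m (Suc n) \<theta>"
  shows "Psi m (Suc n) \<theta> \<sigma> = cart E n (Suc n) (coface (Suc n) (missed m \<theta>)) (C (Suc n) \<sigma>) \<bullet>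
    Psi m n (cofactor m n \<theta>) (d n (missed m \<theta>) \<sigma>)"
  using assms by (simp add: Psi_def)

text \<open>The four clauses need each other in lower dimension. For a surjective map the second
  clause supplies the compatibility of \<phi> with the prescribed faces and the third their
  matching; for a map that misses a value the third clause uses the fourth, independence of the
  factorisation.\<close>

definition psi_good :: "nat \<Rightarrow> nat \<Rightarrow> bool" where
  "psi_good m n \<longleftrightarrow> (\<forall>\<theta> \<in> Delta m n. \<forall>\<sigma> \<in> N n.
     Psi m n \<theta> \<sigma> \<in> hom (total E) (m, C m (nerve_act m \<theta> \<sigma>)) (n, C n \<sigma>) \<and>
     Psi m n \<theta> \<sigma> \<bullet> lift E m (\<phi> m (nerve_act m \<theta> \<sigma>)) \<bullet> edge m (\<theta> 0) \<sigma>
       = lift E n (\<phi> n \<sigma>) \<bullet> kappa E m n \<theta> (V \<sigma> 0) \<and>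
     (\<forall>m' j. m = Suc m' \<longrightarrow> j \<le> m \<longrightarrow>
       Psi m n \<theta> \<sigma> \<bullet> cart E m' m (coface m j) (C m (nerve_act m \<theta> \<sigma>))
       = Psi m' n (compose {..m'} \<theta> (coface m j)) \<sigma>) \<and>
     (\<forall>n' j \<tau>. n = Suc n' \<longrightarrow> j \<le> n \<longrightarrow> \<tau> \<in> Delta m n' \<longrightarrow> \<theta> = compose {..m} (coface n j) \<tau> \<longrightarrow>
       Psi m n \<theta> \<sigma> = cart E n' n (coface n j) (C n \<sigma>) \<bullet> Psi m n' \<tau> (nerve_act n' (coface n j) \<sigma>)))"

lemma psi_goodD:
  assumes "psi_good m n" "\<theta> \<in> Delta m n" "\<sigma> \<in> N n"
  shows "Psi m n \<theta> \<sigma> \<in> Arr (total E)"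
    and "Dom (total E) (Psi m n \<theta> \<sigma>) = (m, C m (nerve_act m \<theta> \<sigma>))"
    and "Cod (total E) (Psi m n \<theta> \<sigma>) = (n, C n \<sigma>)"
    and "Psi m n \<theta> \<sigma> \<bullet> lift E m (\<phi> m (nerve_act m \<theta> \<sigma>)) \<bullet> edge m (\<theta> 0) \<sigma>
       = lift E n (\<phi> n \<sigma>) \<bullet> kappa E m n \<theta> (V \<sigma> 0)"
  using assms by (auto simp: psi_good_def hom_def)

lemma psi_good_right:
  assumes "psi_good (Suc m) n" "\<theta> \<in> Delta (Suc m) n" "\<sigma> \<in> N n" "j \<le> Suc m"
  shows "Psi (Suc m) n \<theta> \<sigma> \<bullet> cart E m (Suc m) (coface (Suc m) j) (C (Suc m) (nerve_act (Suc m) \<theta> \<sigma>))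
       = Psi m n (compose {..m} \<theta> (coface (Suc m) j)) \<sigma>"
  using assms by (auto simp: psi_good_def)

lemma psi_good_left:
  assumes "psi_good m (Suc n)" "\<tau> \<in> Delta m n" "\<sigma> \<in> N (Suc n)" "j \<le> Suc n"
  shows "Psi m (Suc n) (compose {..m} (coface (Suc n) j) \<tau>) \<sigma>
    = cart E n (Suc n) (coface (Suc n) j) (C (Suc n) \<sigma>) \<bullet> Psi m n \<tau> (d n j \<sigma>)"
  using assms compose_coface_Delta(2)[OF assms(2), of j] unfolding psi_good_def by blast

lemma psi_good_not_surj:
  assumes IH: "\<And>m' n'. m' + n' < m + Suc n \<Longrightarrow> psi_good m' n'"
    and \<theta>: "\<theta> \<in> Delta m (Suc n)" "\<not> surj_map m (Suc n) \<theta>" and \<sigma>: "\<sigma> \<in> N (Suc n)"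
  shows "Psi m (Suc n) \<theta> \<sigma> \<in> hom (total E) (m, C m (nerve_act m \<theta> \<sigma>)) (Suc n, C (Suc n) \<sigma>)"
    and "Psi m (Suc n) \<theta> \<sigma> \<bullet> lift E m (\<phi> m (nerve_act m \<theta> \<sigma>)) \<bullet> edge m (\<theta> 0) \<sigma>
       = lift E (Suc n) (\<phi> (Suc n) \<sigma>) \<bullet> kappa E m (Suc n) \<theta> (V \<sigma> 0)"
    and "\<And>m' j. m = Suc m' \<Longrightarrow> j \<le> m \<Longrightarrow>
       Psi m (Suc n) \<theta> \<sigma> \<bullet> cart E m' m (coface m j) (C m (nerve_act m \<theta> \<sigma>))
       = Psi m' (Suc n) (compose {..m'} \<theta> (coface m j)) \<sigma>"
    and "\<And>j \<tau>. j \<le> Suc n \<Longrightarrow> \<tau> \<in> Delta m n \<Longrightarrow> \<theta> = compose {..m} (coface (Suc n) j) \<tau> \<Longrightarrow>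
       Psi m (Suc n) \<theta> \<sigma> = cart E n (Suc n) (coface (Suc n) j) (C (Suc n) \<sigma>) \<bullet> Psi m n \<tau> (d n j \<sigma>)"
proof -
  define e where "e = missed m \<theta>"
  define \<tau> where "\<tau> = cofactor m n \<theta>"
  let ?d = "coface (Suc n) e" and ?\<sigma> = "d n e \<sigma>"
  have e: "e \<le> Suc n" and \<tau>: "\<tau> \<in> Delta m n" "compose {..m} ?d \<tau> = \<theta>"
    and Psi: "Psi m (Suc n) \<theta> \<sigma> = cart E n (Suc n) ?d (C (Suc n) \<sigma>) \<bullet> Psi m n \<tau> ?\<sigma>"
    using missed(2) cofactor \<theta> Psi_not_surj[OF \<theta>(2)] by (simp_all add: e_def \<tau>_def)
  have \<sigma>': "?\<sigma> \<in> N n" using \<sigma> by simp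
  have good: "psi_good m n" using IH by simp
  note P = psi_goodD[OF good \<tau>(1) \<sigma>']
  have act: "nerve_act m \<tau> ?\<sigma> = nerve_act m \<theta> \<sigma>"
    using \<tau> by simp
  have \<theta>0: "\<theta> 0 = ?d (\<tau> 0)" "\<theta> 0 \<le> Suc n" "\<tau> 0 \<le> n"
    using Delta_le[OF \<theta>(1)] Delta_le[OF \<tau>(1)] by (auto simp: compose_def simp flip: \<tau>(2))
  show "Psi m (Suc n) \<theta> \<sigma> \<in> hom (total E) (m, C m (nerve_act m \<theta> \<sigma>)) (Suc n, C (Suc n) \<sigma>)"
    using \<sigma> e P act unfolding Psi by (simp add: hom_def)
  show "Psi m (Suc n) \<theta> \<sigma> \<bullet> lift E m (\<phi> m (nerve_act m \<theta> \<sigma>)) \<bullet> edge m (\<theta> 0) \<sigma>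
       = lift E (Suc n) (\<phi> (Suc n) \<sigma>) \<bullet> kappa E m (Suc n) \<theta> (V \<sigma> 0)"
  proof -
    have mono: "?d 0 \<le> ?d (\<tau> 0)"
      using Delta_mono[OF coface_Delta, of 0 "\<tau> 0" n] \<theta>0(3) by simp
    \<comment> \<open>The initial edge splits at the vertex \<open>?d 0\<close>. The second piece is
      the initial edge of \<tau> in the face \<open>?\<sigma>\<close> and is covered by the
      induction hypothesis; \<open>kappa_natural\<close> moves the first piece to where
      \<open>phi_face\<close> applies.\<close>
    have "\<sigma> (0, \<theta> 0) = ?\<sigma> (0, \<tau> 0) \<cdot>\<^bsub>lev E 0\<^esub> \<sigma> (0, ?d 0)"
      using nerve_simp_Comp[OF \<sigma>, of 0 "?d 0" "?d (\<tau> 0)"] mono \<theta>0 by simp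
    then have edge: "edge m (\<theta> 0) \<sigma> = edge m (\<tau> 0) ?\<sigma> \<bullet> edge m (?d 0) \<sigma>"
      using \<sigma> \<theta>0 mono by simp
    have "Psi m (Suc n) \<theta> \<sigma> \<bullet> lift E m (\<phi> m (nerve_act m \<theta> \<sigma>)) \<bullet> edge m (\<theta> 0) \<sigma>
      = cart E n (Suc n) ?d (C (Suc n) \<sigma>) \<bullet>
        (Psi m n \<tau> ?\<sigma> \<bullet> lift E m (\<phi> m (nerve_act m \<tau> ?\<sigma>)) \<bullet> edge m (\<tau> 0) ?\<sigma>) \<bullet> edge m (?d 0) \<sigma>"
      unfolding Psi edge act using \<sigma> e P(1-3) act \<theta>(1) \<theta>0 mono by simp
    also have "\<dots> = cart E n (Suc n) ?d (C (Suc n) \<sigma>) \<bullet> lift E n (\<phi> n ?\<sigma>) \<bullet>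
        kappa E m n \<tau> (V \<sigma> (?d 0)) \<bullet> edge m (?d 0) \<sigma>"
      unfolding P(4) using \<sigma> e \<tau>(1) by simp
    also have "kappa E m n \<tau> (V \<sigma> (?d 0)) \<bullet> edge m (?d 0) \<sigma> = edge n (?d 0) \<sigma> \<bullet> kappa E m n \<tau> (V \<sigma> 0)"
      using kappa_natural[of "\<sigma> (0, ?d 0)" \<tau> m n] \<sigma> \<tau>(1) by simp
    also have "cart E n (Suc n) ?d (C (Suc n) \<sigma>) \<bullet> lift E n (\<phi> n ?\<sigma>) \<bullet> edge n (?d 0) \<sigma> \<bullet> kappa E m n \<tau> (V \<sigma> 0)
      = (lift E (Suc n) (\<phi> (Suc n) \<sigma>) \<bullet> kappa E n (Suc n) ?d (V \<sigma> 0)) \<bullet> kappa E m n \<tau> (V \<sigma> 0)"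
      unfolding phi_face[OF \<sigma> e] using \<sigma> e \<tau>(1) by simp
    also have "\<dots> = lift E (Suc n) (\<phi> (Suc n) \<sigma>) \<bullet> kappa E m (Suc n) \<theta> (V \<sigma> 0)"
      using \<sigma> e \<tau> by (simp add: kappa_compose)
    finally show ?thesis .
  qed
  show "Psi m (Suc n) \<theta> \<sigma> \<bullet> cart E m' m (coface m j) (C m (nerve_act m \<theta> \<sigma>))
       = Psi m' (Suc n) (compose {..m'} \<theta> (coface m j)) \<sigma>" if m: "m = Suc m'" and j: "j \<le> m" for m' j
  proof -
    have good': "psi_good m' (Suc n)" using IH m by simp
    let ?\<tau> = "compose {..m'} \<tau> (coface m j)"
    have \<tau>': "?\<tau> \<in> Delta m' n" "compose {..m'} ?d ?\<tau> = compose {..m'} \<theta> (coface m j)"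
      using \<tau> m Delta_assoc[of "coface m j" m' m \<tau> n ?d "Suc n"] by simp_all
    have "Psi m n \<tau> ?\<sigma> \<bullet> cart E m' m (coface m j) (C m (nerve_act m \<theta> \<sigma>)) = Psi m' n ?\<tau> ?\<sigma>"
      using psi_good_right[OF good[unfolded m] \<tau>(1)[unfolded m] \<sigma>'] j m act by simp
    then show ?thesis
      using psi_good_left[OF good' \<tau>'(1) \<sigma> e] \<tau>'(2) \<sigma> e P act \<theta>(1) m unfolding Psi by simp
  qed
  show "Psi m (Suc n) \<theta> \<sigma> = cart E n (Suc n) (coface (Suc n) j) (C (Suc n) \<sigma>) \<bullet> Psi m n \<tau>' (d n j \<sigma>)"
    if j: "j \<le> Suc n" and \<tau>': "\<tau>' \<in> Delta m n" and \<theta>\<tau>': "\<theta> = compose {..m} (coface (Suc n) j) \<tau>'" for j \<tau>'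
  proof (cases "e = j")
    case True
    then have "\<tau>' = \<tau>" using coface_inj[of m n j \<tau>' \<tau>] \<tau> \<tau>' \<theta>\<tau>' by simp
    then show ?thesis using Psi True by simp
  next
    case False
    moreover have "e \<le> j"
      unfolding e_def using missed(3)[OF \<theta>] coface_missed[OF \<tau>'] \<theta>\<tau>' by simp
    ultimately have ej: "e < j" by simp
    \<comment> \<open>The coface at \<open>j\<close> fixes \<open>e\<close>, because e < j. If
      \<tau>' took the value \<open>e\<close>, so would \<theta>.\<close>
    have e_missed: "e \<notin> \<tau>' ` {..m}"
    proof
      assume "e \<in> \<tau>' ` {..m}"
      then obtain k where k: "k \<le> m" "\<tau>' k = e" by auto
      then have "\<theta> k = e" using ej j Delta_le[OF \<tau>' k(1)] by (simp add: \<theta>\<tau>' compose_def coface_def)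
      then show False using missed(1)[OF \<theta>] k(1) unfolding e_def by (metis atMost_iff image_eqI)
    qed
    \<comment> \<open>For n = 0 the bound j \<le> 1 gives e = 0, and 0 is a value of
      \<tau>'.\<close>
    obtain n' where n': "n = Suc n'"
    proof (cases n)
      case 0
      then have "\<tau>' 0 = e" using ej j \<tau>' Delta_le[OF \<tau>', of 0] by simp
      then show ?thesis using e_missed by auto
    qed
    obtain \<rho> where \<rho>: "\<rho> \<in> Delta m n'" "\<tau>' = compose {..m} (coface n e) \<rho>"
      using coface_factor[of \<tau>' m n' e] e_missed \<tau>' ej j n' by auto
    have cc: "compose {..n'} (coface (Suc n) j) (coface n e) = compose {..n'} (coface (Suc n) e) (coface n (j - 1))"
      using coface_coface[OF ej, of n'] j n' by simp
    have cD: "coface n i \<in> Delta n' n" "coface (Suc n) i \<in> Delta n (Suc n)" for i using n' by simp_all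
    \<comment> \<open>Removing both missed values leaves the same map \<rho>. The exchange of
      cofaces and injectivity of the coface at \<open>e\<close> identify \<tau> with the coface at j
      - 1 after \<rho>; \<open>companion_face_swap\<close> is the matching exchange for
      companions.\<close>
    have "compose {..m} ?d (compose {..m} (coface n (j - 1)) \<rho>) = compose {..m} (coface (Suc n) j) \<tau>'"
      unfolding \<rho>(2) Delta_assoc[OF \<rho>(1) cD] cc ..
    then have "compose {..m} ?d \<tau> = compose {..m} ?d (compose {..m} (coface n (j - 1)) \<rho>)"
      by (simp only: \<tau>(2) \<theta>\<tau>'[symmetric])
    then have \<tau>_eq: "\<tau> = compose {..m} (coface n (j - 1)) \<rho>"
      by (rule coface_inj[OF _ \<tau>(1) compose_Delta[OF \<rho>(1) cD(1)]])
    have "Psi m n \<tau> ?\<sigma> = cart E n' n (coface n (j - 1)) (C n ?\<sigma>) \<bullet> Psi m n' \<rho> (nerve_act n' (coface n (j - 1)) ?\<sigma>)"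
      using psi_good_left[OF good[unfolded n'] \<rho>(1) \<sigma>'[unfolded n'], of "j - 1"] j
      unfolding \<tau>_eq n' by simp
    moreover have "Psi m n \<tau>' (d n j \<sigma>) = cart E n' n (coface n e) (C n (d n j \<sigma>)) \<bullet> Psi m n' \<rho> (nerve_act n' (coface n e) (d n j \<sigma>))"
      using psi_good_left[OF good[unfolded n'] \<rho>(1), of "d n j \<sigma>" e] j ej \<sigma>
      unfolding \<rho>(2) n' by simp
    moreover have faces: "nerve_act n' (coface n e) (d n j \<sigma>) = nerve_act n' (coface n (j - 1)) ?\<sigma>"
      using face_face[OF ej, of n' \<sigma>] j n' by simp
    let ?\<rho> = "nerve_act n' (coface n (j - 1)) ?\<sigma>"
    have \<rho>': "?\<rho> \<in> N n'" "psi_good m n'" using nerve_act_in[OF \<sigma>' cD(1)] IH n' by simp_all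
    have swap: "cart E n (Suc n) (coface (Suc n) j) (C (Suc n) \<sigma>) \<bullet> cart E n' n (coface n e) (C n (d n j \<sigma>))
      = cart E n (Suc n) ?d (C (Suc n) \<sigma>) \<bullet> cart E n' n (coface n (j - 1)) (C n ?\<sigma>)"
      using companion_face_swap[OF \<sigma>[unfolded n'] ej] j n' by simp
    have f1: "opo E n' n (coface n e) (C n (d n j \<sigma>)) = C n' ?\<rho>"
      using companion_face[of "d n j \<sigma>" n' e] ej j \<sigma> n' faces by simp
    have f2: "opo E n' n (coface n (j - 1)) (C n ?\<sigma>) = C n' ?\<rho>"
      using companion_face[of ?\<sigma> n' "j - 1"] ej j \<sigma>' n' by simp
    note P' = psi_goodD[OF \<rho>'(2) \<rho>(1) \<rho>'(1)]
    have "cart E n (Suc n) (coface (Suc n) j) (C (Suc n) \<sigma>) \<bullet> cart E n' n (coface n e) (C n (d n j \<sigma>)) \<bullet> Psi m n' \<rho> ?\<rho>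
      = cart E n (Suc n) ?d (C (Suc n) \<sigma>) \<bullet> cart E n' n (coface n (j - 1)) (C n ?\<sigma>) \<bullet> Psi m n' \<rho> ?\<rho>"
      using \<sigma> \<sigma>' j e cD f1 f2 P' by (intro T.Comp_eq_right[OF swap]) (simp_all del: nerve_act_act)
    then show ?thesis
      unfolding Psi calculation faces by simp
  qed
qed

text \<open>As \<theta> fixes 0, the restriction along \<phi> involves no edge, and the prescribed
  faces are structure arrows of smaller total dimension. They match by the exchange of cofaces, so
  the universal property justifies the definite description in \<open>Psi_surj\<close>.\<close>

lemma psi_good_surj:
  assumes IH: "\<And>m' n'. m' + n' < Suc m + n \<Longrightarrow> psi_good m' n'"
    and \<theta>: "\<theta> \<in> Delta (Suc m) n" "surj_map (Suc m) n \<theta>" and \<sigma>: "\<sigma> \<in> N n"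
  shows "Psi (Suc m) n \<theta> \<sigma> \<in> hom (total E) (Suc m, C (Suc m) (nerve_act (Suc m) \<theta> \<sigma>)) (n, C n \<sigma>)"
    and "Psi (Suc m) n \<theta> \<sigma> \<bullet> lift E (Suc m) (\<phi> (Suc m) (nerve_act (Suc m) \<theta> \<sigma>))
      = lift E n (\<phi> n \<sigma>) \<bullet> kappa E (Suc m) n \<theta> (V \<sigma> 0)"
    and "\<And>j. j \<le> Suc m \<Longrightarrow>
      Psi (Suc m) n \<theta> \<sigma> \<bullet> cart E m (Suc m) (coface (Suc m) j) (C (Suc m) (nerve_act (Suc m) \<theta> \<sigma>))
      = Psi m n (compose {..m} \<theta> (coface (Suc m) j)) \<sigma>"
proof -
  let ?\<sigma> = "nerve_act (Suc m) \<theta> \<sigma>"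
  let ?g = "\<lambda>j. Psi m n (compose {..m} \<theta> (coface (Suc m) j)) \<sigma>"
  have \<sigma>': "?\<sigma> \<in> N (Suc m)" using \<theta>(1) \<sigma> by simp
  have \<theta>0: "\<theta> 0 = 0" by (rule surj_zero[OF \<theta>])
  have good: "psi_good m n" using IH by simp
  have \<theta>j: "compose {..m} \<theta> (coface (Suc m) j) \<in> Delta m n" for j using \<theta>(1) by simp
  note P = psi_goodD[OF good \<theta>j \<sigma>]
  have act: "d m j ?\<sigma> = nerve_act m (compose {..m} \<theta> (coface (Suc m) j)) \<sigma>" for j
    by simp
  have "\<exists>!u. u \<in> hom (total E) (Suc m, C (Suc m) ?\<sigma>) (n, C n \<sigma>) \<and>
      u \<bullet> lift E (Suc m) (\<phi> (Suc m) ?\<sigma>) = lift E n (\<phi> n \<sigma>) \<bullet> kappa E (Suc m) n \<theta> (V \<sigma> 0) \<and>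
      (\<forall>j\<le>Suc m. u \<bullet> cart E m (Suc m) (coface (Suc m) j) (C (Suc m) ?\<sigma>) = ?g j)"
  proof (rule companion_universal[OF \<sigma>'])
    show "lift E n (\<phi> n \<sigma>) \<bullet> kappa E (Suc m) n \<theta> (V \<sigma> 0)
      \<in> hom (total E) (Suc m, degen_o E (Suc m) (V ?\<sigma> 0)) (n, C n \<sigma>)"
      using \<sigma> \<theta>(1) \<theta>0 by (simp add: hom_def)
    show "?g j \<in> hom (total E) (m, C m (d m j ?\<sigma>)) (n, C n \<sigma>)" for j
      using P by (simp add: hom_def)
    show "(lift E n (\<phi> n \<sigma>) \<bullet> kappa E (Suc m) n \<theta> (V \<sigma> 0)) \<bullet> kappa E m (Suc m) (coface (Suc m) j) (V ?\<sigma> 0)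
      = ?g j \<bullet> lift E m (\<phi> m (d m j ?\<sigma>)) \<bullet> edge m (coface (Suc m) j 0) ?\<sigma>" if "j \<le> Suc m" for j
      using P(4)[of j] \<sigma> \<theta>(1) \<theta>0 by (simp add: kappa_compose compose_def)
    show "?g j \<bullet> cart E k m (coface m i) (C m (d m j ?\<sigma>)) = ?g i \<bullet> cart E k m (coface m (j - 1)) (C m (d m i ?\<sigma>))"
      if k: "m = Suc k" and ij: "i < j" "j \<le> Suc m" for i j k
    proof -
      have cD: "coface m i' \<in> Delta k m" "coface (Suc m) i' \<in> Delta m (Suc m)" for i' using k by simp_all
      have "compose {..k} (compose {..m} \<theta> (coface (Suc m) j)) (coface m i)
        = compose {..k} (compose {..m} \<theta> (coface (Suc m) i)) (coface m (j - 1))"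
        using Delta_assoc[OF cD \<theta>(1)] coface_coface[OF ij(1), of k] ij(2) k by metis
      then show ?thesis
        using psi_good_right[OF good[unfolded k] \<theta>j[unfolded k] \<sigma>, of i j]
          psi_good_right[OF good[unfolded k] \<theta>j[unfolded k] \<sigma>, of "j - 1" i] ij
        unfolding act k by simp
    qed
  qed
  from theI'[OF this, folded Psi_surj[OF \<theta>(2)]]
  show "Psi (Suc m) n \<theta> \<sigma> \<in> hom (total E) (Suc m, C (Suc m) ?\<sigma>) (n, C n \<sigma>)"
    and "Psi (Suc m) n \<theta> \<sigma> \<bullet> lift E (Suc m) (\<phi> (Suc m) ?\<sigma>)
      = lift E n (\<phi> n \<sigma>) \<bullet> kappa E (Suc m) n \<theta> (V \<sigma> 0)"
    and "\<And>j. j \<le> Suc m \<Longrightarrow>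
      Psi (Suc m) n \<theta> \<sigma> \<bullet> cart E m (Suc m) (coface (Suc m) j) (C (Suc m) ?\<sigma>) = ?g j"
    by blast+
qed

lemma Psi_0: "Psi 0 0 \<theta> \<sigma> = Ide (total E) (0, C 0 \<sigma>)"
  by (simp add: Psi_def)

lemma Delta_0_0: "\<theta> \<in> Delta 0 0 \<Longrightarrow> \<theta> = id_map 0"
  using terminal_unique[of \<theta> 0] terminal_unique[OF id_Delta] by simp

lemma Psi_good: "psi_good m n"
proof (induction "m + n" arbitrary: m n rule: less_induct)
  case less
  have IH: "psi_good m' n'" if "m' + n' < m + n" for m' n'
    using less[OF that] by simp
  show ?case
    unfolding psi_good_def
  proof (intro ballI)
    fix \<theta> \<sigma> assume \<theta>: "\<theta> \<in> Delta m n" and \<sigma>: "\<sigma> \<in> N n"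
    show "Psi m n \<theta> \<sigma> \<in> hom (total E) (m, C m (nerve_act m \<theta> \<sigma>)) (n, C n \<sigma>) \<and>
     Psi m n \<theta> \<sigma> \<bullet> lift E m (\<phi> m (nerve_act m \<theta> \<sigma>)) \<bullet> edge m (\<theta> 0) \<sigma>
       = lift E n (\<phi> n \<sigma>) \<bullet> kappa E m n \<theta> (V \<sigma> 0) \<and>
     (\<forall>m' j. m = Suc m' \<longrightarrow> j \<le> m \<longrightarrow>
       Psi m n \<theta> \<sigma> \<bullet> cart E m' m (coface m j) (C m (nerve_act m \<theta> \<sigma>))
       = Psi m' n (compose {..m'} \<theta> (coface m j)) \<sigma>) \<and>
     (\<forall>n' j \<tau>. n = Suc n' \<longrightarrow> j \<le> n \<longrightarrow> \<tau> \<in> Delta m n' \<longrightarrow> \<theta> = compose {..m} (coface n j) \<tau> \<longrightarrow>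
       Psi m n \<theta> \<sigma> = cart E n' n (coface n j) (C n \<sigma>) \<bullet> Psi m n' \<tau> (nerve_act n' (coface n j) \<sigma>))"
    proof (cases "surj_map m n \<theta>")
      case False
      then obtain n' where n': "n = Suc n'"
        using \<theta> not_surj_factor by blast
      show ?thesis
        using psi_good_not_surj[OF IH[unfolded n'] \<theta>[unfolded n'] False[unfolded n'] \<sigma>[unfolded n']]
        unfolding n' by blast
    next
      case True
      \<comment> \<open>A surjective map does not factor through a coface, so the clause on
        factorisations is vacuous here.\<close>
      have left: "\<not> \<theta> = compose {..m} (coface n j) \<tau>" if "n = Suc n'" "j \<le> n" "\<tau> \<in> Delta m n'" for n' j \<tau>
        using True that coface_missed[OF that(3), of j] by (auto simp: surj_map_def)
      have \<theta>0: "\<theta> 0 = 0" by (rule surj_zero[OF \<theta> True])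
      show ?thesis
      proof (cases m)
        case 0
        then have n0: "n = 0" using surj_from_0[of \<theta> n] \<theta> True by simp
        have \<theta>id: "\<theta> = id_map 0" using Delta_0_0 \<theta> 0 n0 by simp
        have "nerve_act 0 \<theta> \<sigma> = \<sigma>" using nerve_act_id[of \<sigma> "lev E 0" 0] \<sigma> n0 unfolding \<theta>id by simp
        moreover have "kappa E 0 0 \<theta> (V \<sigma> 0) = Ide (total E) (0, V \<sigma> 0)"
          using \<sigma> n0 kappa_id[of "V \<sigma> 0" 0] by (simp add: \<theta>id)
        ultimately show ?thesis
          using \<sigma> n0 0 companion_0 by (simp add: Psi_0 \<theta>0 hom_def nerve_simp_Ide[of \<sigma>])
      next
        case (Suc m')
        have IH': "psi_good k k'" if "k + k' < Suc m' + n" for k k'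
          using IH that Suc by simp
        note S = psi_good_surj[OF IH' \<theta>[unfolded Suc] True[unfolded Suc] \<sigma>]
        have "edge m (\<theta> 0) \<sigma> = Ide (total E) (m, degen_o E m (V \<sigma> 0))"
          using \<sigma> \<theta>0 by (simp add: nerve_simp_Ide[of \<sigma>])
        moreover have "lift E m (\<phi> m (nerve_act m \<theta> \<sigma>)) \<bullet> Ide (total E) (m, degen_o E m (V \<sigma> 0))
          = lift E m (\<phi> m (nerve_act m \<theta> \<sigma>))"
          using \<sigma> \<theta> \<theta>0 by simp
        ultimately show ?thesis using S left unfolding Suc by simp
      qed
    qed
  qed
qed

section \<open>Functoriality of the constructed structure arrows\<close>

lemmas Psi_simps [simp] = psi_goodD(1-3)[OF Psi_good]
lemmas Psi_phi = psi_goodD(4)[OF Psi_good]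
lemmas Psi_right = psi_good_right[OF Psi_good]
lemmas Psi_left = psi_good_left[OF Psi_good]

lemma Psi_phi_0:
  assumes "\<theta> \<in> Delta m n" "\<sigma> \<in> N n" "\<theta> 0 = 0"
  shows "Psi m n \<theta> \<sigma> \<bullet> lift E m (\<phi> m (nerve_act m \<theta> \<sigma>)) = lift E n (\<phi> n \<sigma>) \<bullet> kappa E m n \<theta> (V \<sigma> 0)"
  using Psi_phi[OF assms(1,2)] assms by (simp add: nerve_simp_Ide[of \<sigma>])

text \<open>The identity law in dimension n is kept as a premise, because its proof in dimension n +
  1 already uses the value on cofaces out of [n].\<close>

lemma Psi_coface_aux:
  assumes "Psi n n (id_map n) (d n j \<sigma>) = Ide (total E) (n, C n (d n j \<sigma>))" "\<sigma> \<in> N (Suc n)" "j \<le> Suc n"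
  shows "Psi n (Suc n) (coface (Suc n) j) \<sigma> = cart E n (Suc n) (coface (Suc n) j) (C (Suc n) \<sigma>)"
  using Psi_left[OF id_Delta assms(2,3)] assms compose_id[OF coface_Delta, of n j] by simp

lemma Psi_id: "\<sigma> \<in> N n \<Longrightarrow> Psi n n (id_map n) \<sigma> = Ide (total E) (n, C n \<sigma>)"
proof (induction n arbitrary: \<sigma>)
  case 0
  then show ?case by (simp add: Psi_0)
next
  case (Suc n)
  note \<sigma> = \<open>\<sigma> \<in> N (Suc n)\<close>
  have id: "id_map (Suc n) \<in> Delta (Suc n) (Suc n)" by simp
  show ?case
  proof (rule companion_eqI[OF \<sigma>])
    show "Psi (Suc n) (Suc n) (id_map (Suc n)) \<sigma> \<in> hom (total E) (Suc n, C (Suc n) \<sigma>) (Suc n, C (Suc n) \<sigma>)"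
      using Psi_simps[OF id \<sigma>] \<sigma> by (simp add: hom_def del: Psi_simps)
    show "Psi (Suc n) (Suc n) (id_map (Suc n)) \<sigma> \<bullet> lift E (Suc n) (\<phi> (Suc n) \<sigma>)
      = Ide (total E) (Suc n, C (Suc n) \<sigma>) \<bullet> lift E (Suc n) (\<phi> (Suc n) \<sigma>)"
      using Psi_phi_0[OF id \<sigma>] \<sigma> kappa_id[of "V \<sigma> 0" "Suc n"] by simp
    show "Psi (Suc n) (Suc n) (id_map (Suc n)) \<sigma> \<bullet> cart E n (Suc n) (coface (Suc n) j) (C (Suc n) \<sigma>)
      = Ide (total E) (Suc n, C (Suc n) \<sigma>) \<bullet> cart E n (Suc n) (coface (Suc n) j) (C (Suc n) \<sigma>)" if "j \<le> Suc n" for j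
      using Psi_right[OF id \<sigma> that] \<sigma> that Psi_coface_aux[OF Suc.IH] id_compose[OF coface_Delta, of n j] by simp
  qed (use \<sigma> in \<open>simp add: T.Ide_in\<close>)
qed

lemma Psi_coface:
  "\<sigma> \<in> N (Suc n) \<Longrightarrow> j \<le> Suc n \<Longrightarrow>
    Psi n (Suc n) (coface (Suc n) j) \<sigma> = cart E n (Suc n) (coface (Suc n) j) (C (Suc n) \<sigma>)"
  by (rule Psi_coface_aux) (simp_all add: Psi_id)

text \<open>Induction on the sum of the three dimensions. A coface at the front of \<theta> is split
  off by \<open>Psi_left\<close>, and one at the front of \<tau> is shifted to \<theta> by
  \<open>Psi_right\<close>. If both maps are surjective, both sides have the same restriction along
  \<phi>, and their faces agree by induction.\<close>

lemma Psi_compose: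
  assumes "\<tau> \<in> Delta l m" "\<theta> \<in> Delta m n" "\<sigma> \<in> N n"
  shows "Psi l n (compose {..l} \<theta> \<tau>) \<sigma> = Psi m n \<theta> \<sigma> \<bullet> Psi l m \<tau> (nerve_act m \<theta> \<sigma>)"
  using assms
proof (induction "l + m + n" arbitrary: l m n \<tau> \<theta> \<sigma> rule: less_induct)
  case less
  note \<tau> = \<open>\<tau> \<in> Delta l m\<close> and \<theta> = \<open>\<theta> \<in> Delta m n\<close> and \<sigma> = \<open>\<sigma> \<in> N n\<close>
  have \<theta>\<tau>: "compose {..l} \<theta> \<tau> \<in> Delta l n" by (rule compose_Delta[OF \<tau> \<theta>])
  have \<theta>\<sigma>: "nerve_act m \<theta> \<sigma> \<in> N m" using \<theta> \<sigma> by simp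
  have act: "nerve_act l \<tau> (nerve_act m \<theta> \<sigma>) = nerve_act l (compose {..l} \<theta> \<tau>) \<sigma>" using \<tau> by simp
  consider (1) "\<not> surj_map m n \<theta>" | (2) "surj_map m n \<theta>" "\<not> surj_map l m \<tau>" | (3) "surj_map m n \<theta>" "surj_map l m \<tau>"
    by blast
  then show ?case
  proof cases
    case 1
    then obtain n' j \<theta>' where *: "n = Suc n'" "j \<le> Suc n'" "\<theta>' \<in> Delta m n'"
      "\<theta> = compose {..m} (coface (Suc n') j) \<theta>'"
      using not_surj_factor \<theta> by blast
    have \<sigma>': "\<sigma> \<in> N (Suc n')" using \<sigma> * by simp
    have **: "compose {..l} \<theta> \<tau> = compose {..l} (coface (Suc n') j) (compose {..l} \<theta>' \<tau>)"
      using Delta_assoc[OF \<tau> *(3) coface_Delta] * by simp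
    have "Psi l n' (compose {..l} \<theta>' \<tau>) (d n' j \<sigma>)
      = Psi m n' \<theta>' (d n' j \<sigma>) \<bullet> Psi l m \<tau> (nerve_act m \<theta>' (d n' j \<sigma>))"
      by (rule less.hyps) (use * \<tau> \<sigma>' in simp_all)
    moreover have "nerve_act m \<theta>' (d n' j \<sigma>) = nerve_act m \<theta> \<sigma>" using * by simp
    moreover have d: "d n' j \<sigma> \<in> N n'" using \<sigma>' by simp
    moreover have "compose {..l} \<theta>' \<tau> \<in> Delta l n'" by (rule compose_Delta[OF \<tau> *(3)])
    ultimately show ?thesis
      using Psi_left[OF _ \<sigma>' *(2), of "compose {..l} \<theta>' \<tau>" l] Psi_left[OF *(3) \<sigma>' *(2)]
        Psi_simps[OF *(3) d] Psi_simps[OF \<tau> \<theta>\<sigma>] \<sigma>' *(2)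
      unfolding ** *(1) by (simp add: *(4)[symmetric] del: Psi_simps)
  next
    case 2
    then obtain m' j \<tau>' where *: "m = Suc m'" "j \<le> Suc m'" "\<tau>' \<in> Delta l m'"
      "\<tau> = compose {..l} (coface (Suc m') j) \<tau>'"
      using not_surj_factor \<tau> by blast
    let ?\<theta> = "compose {..m'} \<theta> (coface (Suc m') j)"
    have \<theta>': "?\<theta> \<in> Delta m' n" "\<theta> \<in> Delta (Suc m') n" using \<theta> * by simp_all
    have **: "compose {..l} \<theta> \<tau> = compose {..l} ?\<theta> \<tau>'"
      using Delta_assoc[OF *(3) coface_Delta \<theta>'(2)] * by simp
    have \<theta>\<sigma>': "nerve_act (Suc m') \<theta> \<sigma> \<in> N (Suc m')" using \<theta>\<sigma> * by simp
    have d: "d m' j (nerve_act (Suc m') \<theta> \<sigma>) \<in> N m'" "d m' j (nerve_act (Suc m') \<theta> \<sigma>) = nerve_act m' ?\<theta> \<sigma>"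
      using \<theta>\<sigma>' by (simp_all del: nerve_act_act) simp
    have "Psi l n (compose {..l} ?\<theta> \<tau>') \<sigma> = Psi m' n ?\<theta> \<sigma> \<bullet> Psi l m' \<tau>' (nerve_act m' ?\<theta> \<sigma>)"
      by (rule less.hyps) (use * \<theta>' \<sigma> in simp_all)
    also have "\<dots> = (Psi (Suc m') n \<theta> \<sigma> \<bullet> cart E m' (Suc m') (coface (Suc m') j) (C (Suc m') (nerve_act (Suc m') \<theta> \<sigma>)))
      \<bullet> Psi l m' \<tau>' (d m' j (nerve_act (Suc m') \<theta> \<sigma>))"
      using Psi_right[OF \<theta>'(2) \<sigma> *(2)] d by simp
    also have "\<dots> = Psi (Suc m') n \<theta> \<sigma> \<bullet> Psi l (Suc m') \<tau> (nerve_act (Suc m') \<theta> \<sigma>)"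
      unfolding *(4) Psi_left[OF *(3) \<theta>\<sigma>' *(2)]
      using Psi_simps[OF \<theta>'(2) \<sigma>] Psi_simps[OF *(3) d(1)] \<theta>\<sigma>' *(2)
      by (simp del: Psi_simps nerve_act_act)
    finally show ?thesis unfolding ** unfolding *(1) .
  next
    case 3
    show ?thesis
    proof (cases l)
      case 0
      then have "m = 0" "n = 0" using 3 \<tau> \<theta> surj_from_0 by blast+
      then show ?thesis using 0 \<sigma> \<theta> \<theta>\<sigma> \<tau> Delta_0_0[of \<theta>] nerve_act_id[of \<sigma> "lev E 0" 0]
        by (simp add: Psi_0)
    next
      case (Suc l')
      let ?\<sigma> = "nerve_act l (compose {..l} \<theta> \<tau>) \<sigma>"
      have \<sigma>': "?\<sigma> \<in> N (Suc l')" using \<theta>\<tau> \<sigma> Suc by simp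
      have 00: "\<tau> 0 = 0" "\<theta> 0 = 0" "compose {..l} \<theta> \<tau> 0 = 0"
        using surj_zero[OF \<tau> 3(2)] surj_zero[OF \<theta> 3(1)] by (simp_all add: compose_def)
      note P = Psi_simps[OF \<theta> \<sigma>] Psi_simps[OF \<tau> \<theta>\<sigma>] Psi_simps[OF \<theta>\<tau> \<sigma>]
      show ?thesis
      proof (rule companion_eqI[OF \<sigma>'])
        show "Psi l n (compose {..l} \<theta> \<tau>) \<sigma> \<in> hom (total E) (Suc l', C (Suc l') ?\<sigma>) (n, C n \<sigma>)"
          using P Suc by (simp add: hom_def del: Psi_simps)
        show "Psi m n \<theta> \<sigma> \<bullet> Psi l m \<tau> (nerve_act m \<theta> \<sigma>) \<in> hom (total E) (Suc l', C (Suc l') ?\<sigma>) (n, C n \<sigma>)"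
          using P Suc act by (simp add: hom_def del: Psi_simps)
        have "Psi l n (compose {..l} \<theta> \<tau>) \<sigma> \<bullet> lift E l (\<phi> l ?\<sigma>)
          = lift E n (\<phi> n \<sigma>) \<bullet> kappa E m n \<theta> (V \<sigma> 0) \<bullet> kappa E l m \<tau> (V \<sigma> 0)"
          using Psi_phi_0[OF \<theta>\<tau> \<sigma> 00(3)] \<sigma> kappa_compose[OF _ \<tau> \<theta>] by simp
        also have "\<dots> = (Psi m n \<theta> \<sigma> \<bullet> lift E m (\<phi> m (nerve_act m \<theta> \<sigma>))) \<bullet> kappa E l m \<tau> (V \<sigma> 0)"
          unfolding Psi_phi_0[OF \<theta> \<sigma> 00(2)] using \<sigma> \<tau> \<theta> by simp
        also have "\<dots> = Psi m n \<theta> \<sigma> \<bullet> Psi l m \<tau> (nerve_act m \<theta> \<sigma>) \<bullet> lift E l (\<phi> l ?\<sigma>)"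
          using Psi_phi_0[OF \<tau> \<theta>\<sigma> 00(1)] \<sigma> \<tau> \<theta>\<sigma> P act 00 by (simp del: Psi_simps)
        finally show "Psi l n (compose {..l} \<theta> \<tau>) \<sigma> \<bullet> lift E (Suc l') (\<phi> (Suc l') ?\<sigma>)
          = (Psi m n \<theta> \<sigma> \<bullet> Psi l m \<tau> (nerve_act m \<theta> \<sigma>)) \<bullet> lift E (Suc l') (\<phi> (Suc l') ?\<sigma>)"
          using \<sigma>' P act Suc by (simp del: Psi_simps)
        fix j assume j: "j \<le> Suc l'"
        have \<tau>j: "\<tau> \<in> Delta (Suc l') m" "compose {..l'} \<tau> (coface (Suc l') j) \<in> Delta l' m" using \<tau> Suc by simp_all
        have "Psi (Suc l') n (compose {..l} \<theta> \<tau>) \<sigma> \<bullet> cart E l' (Suc l') (coface (Suc l') j) (C (Suc l') ?\<sigma>)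
          = Psi l' n (compose {..l'} (compose {..Suc l'} \<theta> \<tau>) (coface (Suc l') j)) \<sigma>"
          using Psi_right[OF _ \<sigma> j, of "compose {..Suc l'} \<theta> \<tau>"] \<theta>\<tau> Suc by simp
        also have "\<dots> = Psi l' n (compose {..l'} \<theta> (compose {..l'} \<tau> (coface (Suc l') j))) \<sigma>"
          using Delta_assoc[OF coface_Delta \<tau>j(1) \<theta>] by simp
        also have "\<dots> = Psi m n \<theta> \<sigma> \<bullet> Psi l' m (compose {..l'} \<tau> (coface (Suc l') j)) (nerve_act m \<theta> \<sigma>)"
          by (rule less.hyps) (use \<tau>j \<theta> \<sigma> Suc in simp_all)
        also have "\<dots> = Psi m n \<theta> \<sigma> \<bullet> Psi (Suc l') m \<tau> (nerve_act m \<theta> \<sigma>) \<bullet>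
          cart E l' (Suc l') (coface (Suc l') j) (C (Suc l') ?\<sigma>)"
          using Psi_right[OF \<tau>j(1) \<theta>\<sigma> j] act Suc by simp
        finally show "Psi l n (compose {..l} \<theta> \<tau>) \<sigma> \<bullet> cart E l' (Suc l') (coface (Suc l') j) (C (Suc l') ?\<sigma>)
          = (Psi m n \<theta> \<sigma> \<bullet> Psi l m \<tau> (nerve_act m \<theta> \<sigma>)) \<bullet> cart E l' (Suc l') (coface (Suc l') j) (C (Suc l') ?\<sigma>)"
          using \<sigma>' P act Suc j by (simp del: Psi_simps)
      qed
    qed
  qed
qed

end

section \<open>Comparison isomorphisms of constant objects inside a level\<close>

context simplicial_category
begin

text \<open>The matching condition of an equipment is stated inside the levels. This law and the
  next therefore translate naturality of \<open>point\<close> and composition of cartesian arrows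
  back from the total category.\<close>

lemma const_iso_natural:
  assumes "f \<in> Arr (lev E 0)" "\<theta> \<in> Delta m n"
  shows "const_iso E m n \<theta> (Cod (lev E 0) f) \<cdot>\<^bsub>lev E m\<^esub> opa E m n \<theta> (degen_a E n f)
    = degen_a E m f \<cdot>\<^bsub>lev E m\<^esub> const_iso E m n \<theta> (Dom (lev E 0) f)"
proof (rule point_lift_cancel)
  let ?x = "Dom (lev E 0) f" and ?y = "Cod (lev E 0) f"
  have "point E m ?y \<bullet> lift E m (const_iso E m n \<theta> ?y) \<bullet> lift E m (opa E m n \<theta> (degen_a E n f))
    = point E n ?y \<bullet> cart E m n \<theta> (degen_o E n ?y) \<bullet> lift E m (opa E m n \<theta> (degen_a E n f))"
    using assms by (intro T.Comp_eq_right) (simp_all add: point_const_iso)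
  also have "\<dots> = point E n ?y \<bullet> lift E n (degen_a E n f) \<bullet> cart E m n \<theta> (degen_o E n ?x)"
    using assms lift_cart[of \<theta> m n "degen_a E n f"] by simp
  also have "\<dots> = lift E 0 f \<bullet> point E n ?x \<bullet> cart E m n \<theta> (degen_o E n ?x)"
    using assms by (intro T.Comp_eq_right) (simp_all add: point_natural)
  also have "\<dots> = lift E 0 f \<bullet> point E m ?x \<bullet> lift E m (const_iso E m n \<theta> ?x)"
    using assms by (simp add: point_const_iso)
  also have "\<dots> = point E m ?y \<bullet> lift E m (degen_a E m f) \<bullet> lift E m (const_iso E m n \<theta> ?x)"
    using assms by (intro T.Comp_eq_right) (simp_all add: point_natural)
  finally show "point E m ?y \<bullet> lift E m (const_iso E m n \<theta> ?y \<cdot>\<^bsub>lev E m\<^esub> opa E m n \<theta> (degen_a E n f))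
    = point E m ?y \<bullet> lift E m (degen_a E m f \<cdot>\<^bsub>lev E m\<^esub> const_iso E m n \<theta> ?x)"
    using assms by simp
qed (use assms in simp_all)

lemma const_iso_compose:
  assumes "x \<in> Obj (lev E 0)" "\<tau> \<in> Delta l m" "\<theta> \<in> Delta m n"
  shows "const_iso E l m \<tau> x \<cdot>\<^bsub>lev E l\<^esub> opa E l m \<tau> (const_iso E m n \<theta> x)
    = const_iso E l n (compose {..l} \<theta> \<tau>) x \<cdot>\<^bsub>lev E l\<^esub> cmp E l m n \<tau> \<theta> (degen_o E n x)"
proof (rule point_lift_cancel)
  let ?c = "compose {..l} \<theta> \<tau>" and ?s = "degen_o E n x"
  have c: "?c \<in> Delta l n" using assms by simp
  have "point E l x \<bullet> lift E l (const_iso E l m \<tau> x) \<bullet> lift E l (opa E l m \<tau> (const_iso E m n \<theta> x))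
    = point E m x \<bullet> cart E l m \<tau> (degen_o E m x) \<bullet> lift E l (opa E l m \<tau> (const_iso E m n \<theta> x))"
    using assms by (intro T.Comp_eq_right) (simp_all add: point_const_iso)
  also have "\<dots> = point E m x \<bullet> lift E m (const_iso E m n \<theta> x) \<bullet> cart E l m \<tau> (opo E m n \<theta> ?s)"
    using assms lift_cart[of \<tau> l m "const_iso E m n \<theta> x"] by simp
  also have "\<dots> = point E n x \<bullet> cart E m n \<theta> ?s \<bullet> cart E l m \<tau> (opo E m n \<theta> ?s)"
    using assms by (intro T.Comp_eq_right) (simp_all add: point_const_iso)
  also have "\<dots> = point E n x \<bullet> cart E l n ?c ?s \<bullet> lift E l (cmp E l m n \<tau> \<theta> ?s)"
    using assms by (simp add: cart_cart)
  also have "\<dots> = point E l x \<bullet> lift E l (const_iso E l n ?c x) \<bullet> lift E l (cmp E l m n \<tau> \<theta> ?s)"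
    using assms c by (intro T.Comp_eq_right) (simp_all add: point_const_iso)
  finally show "point E l x \<bullet> lift E l (const_iso E l m \<tau> x \<cdot>\<^bsub>lev E l\<^esub> opa E l m \<tau> (const_iso E m n \<theta> x))
    = point E l x \<bullet> lift E l (const_iso E l n ?c x \<cdot>\<^bsub>lev E l\<^esub> cmp E l m n \<tau> \<theta> ?s)"
    using assms c by simp
qed (use assms in simp_all)

end

section \<open>Existence of companions\<close>

context equipment
begin

text \<open>The choice is made inside the recursion, since the extension chosen for \<sigma> depends
  on those chosen for its faces. A leg in dimension n + 1 evaluates \<phi> only in dimension n, so a
  family that ignores its dimension argument can be passed to \<open>companion_leg\<close>.\<close>

primrec chosen :: "nat \<Rightarrow> (nat \<times> nat \<Rightarrow> 'a) \<Rightarrow> 'o \<times> 'a" where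
  "chosen 0 \<sigma> = (vert (lev E 0) \<sigma> 0, Ide (lev E 0) (vert (lev E 0) \<sigma> 0))"
| "chosen (Suc n) \<sigma> = (SOME p. universal_extension E (Suc n) (degen_o E (Suc n) (vert (lev E 0) \<sigma> 0))
          (\<lambda>i. fst (chosen n (nerve_act n (coface (Suc n) i) \<sigma>)))
          (companion_leg E (\<lambda>_ \<tau>. snd (chosen n \<tau>)) (Suc n) \<sigma>)
          (\<lambda>i j. Ide (lev E (n - 1)) (face_o E n i (fst (chosen n (nerve_act n (coface (Suc n) j) \<sigma>)))))
          (fst p) (snd p))"

declare chosen.simps(2) [simp del]

abbreviation C where "C n \<sigma> \<equiv> fst (chosen n \<sigma>)"
abbreviation \<phi> where "\<phi> n \<sigma> \<equiv> snd (chosen n \<sigma>)"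

abbreviation N where "N \<equiv> nerve_simp (lev E 0)"
abbreviation V where "V \<equiv> vert (lev E 0)"
abbreviation d where "d n j \<sigma> \<equiv> nerve_act n (coface (Suc n) j) \<sigma>"

definition chosen_ok :: "nat \<Rightarrow> bool" where
  "chosen_ok n \<longleftrightarrow> (\<forall>\<sigma> \<in> N n. C n \<sigma> \<in> Obj (lev E n) \<and>
     \<phi> n \<sigma> \<in> hom (lev E n) (degen_o E n (V \<sigma> 0)) (C n \<sigma>) \<and>
     (\<forall>k. n = Suc k \<longrightarrow> universal_extension E n (degen_o E n (V \<sigma> 0)) (\<lambda>i. C k (d k i \<sigma>))
       (companion_leg E \<phi> n \<sigma>) (\<lambda>i j. Ide (lev E (k - 1)) (face_o E k i (C k (d k j \<sigma>)))) (C n \<sigma>) (\<phi> n \<sigma>)))"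

lemma companion_leg_Suc:
  assumes "\<sigma> \<in> N (Suc n)" "chosen_ok n"
  shows "companion_leg E \<phi> (Suc n) \<sigma> j = \<phi> n (d n j \<sigma>) \<cdot>\<^bsub>lev E n\<^esub>
    degen_a E n (\<sigma> (0, coface (Suc n) j 0)) \<cdot>\<^bsub>lev E n\<^esub> const_iso E n (Suc n) (coface (Suc n) j) (V \<sigma> 0)"
proof -
  have "d n j \<sigma> \<in> N n" using assms by simp
  then have *: "\<phi> n (d n j \<sigma>) \<in> Arr (lev E n)"
    "Dom (lev E n) (\<phi> n (d n j \<sigma>)) = degen_o E n (V \<sigma> (coface (Suc n) j 0))"
    using assms(2) by (auto simp: chosen_ok_def hom_def)
  have "coface (Suc n) j 0 = (if j = 0 then 1 else 0)" by (simp add: coface_def)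
  with * show ?thesis
    using assms(1) by (simp add: companion_leg_def nerve_simp_Ide[of \<sigma>] split: if_splits)
qed

lemma matching_leg:
  assumes "chosen_ok n" "chosen_ok (n - 1)" "\<sigma> \<in> N (Suc n)"
  shows "matching_family E (Suc n) (degen_o E (Suc n) (V \<sigma> 0)) (\<lambda>i. C n (d n i \<sigma>))
    (companion_leg E \<phi> (Suc n) \<sigma>) (\<lambda>i j. Ide (lev E (n - 1)) (face_o E n i (C n (d n j \<sigma>))))"
proof -
  note \<sigma> = assms(3)
  have C: "C n (d n j \<sigma>) \<in> Obj (lev E n)" "\<phi> n (d n j \<sigma>) \<in> Arr (lev E n)"
    "Dom (lev E n) (\<phi> n (d n j \<sigma>)) = degen_o E n (V \<sigma> (coface (Suc n) j 0))"
    "Cod (lev E n) (\<phi> n (d n j \<sigma>)) = C n (d n j \<sigma>)" for j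
    using assms(1) nerve_act_in[OF \<sigma> coface_Delta, of j] by (auto simp: chosen_ok_def hom_def)
  note leg = companion_leg_Suc[OF \<sigma> assms(1)]
  have 1: "degen_o E (Suc n) (V \<sigma> 0) \<in> Obj (lev E (Suc n))"
    using \<sigma> by simp
  have 2: "companion_leg E \<phi> (Suc n) \<sigma> i \<in> hom (lev E n) (face_o E (Suc n) i (degen_o E (Suc n) (V \<sigma> 0))) (C n (d n i \<sigma>))"
    if "i \<le> Suc n" for i
    unfolding leg using \<sigma> C by (simp add: hom_def)
  have face: "opo E k n (coface n i) (C n (d n j \<sigma>)) = C k (nerve_act k (coface n i) (d n j \<sigma>))"
    "C k (nerve_act k (coface n i) (d n j \<sigma>)) \<in> Obj (lev E k)"
    "opa E k n (coface n i) (\<phi> n (d n j \<sigma>)) = companion_leg E \<phi> n (d n j \<sigma>) i"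
    if "n = Suc k" "i \<le> n" for i j k
    using assms(1,2) nerve_act_in[OF \<sigma> coface_Delta, of j] that
    by (auto simp: chosen_ok_def universal_extension_def simp del: nerve_act_act)
  have swap: "nerve_act k (coface n i) (d n j \<sigma>) = nerve_act k (coface n (j - 1)) (d n i \<sigma>)"
    if "n = Suc k" "i < j" "j \<le> Suc n" for i j k
    using coface_coface[of i j k] that by simp
  have 3: "Ide (lev E k) (opo E k n (coface n i) (C n (d n j \<sigma>))) \<cdot>\<^bsub>lev E k\<^esub> opa E k n (coface n i) (companion_leg E \<phi> (Suc n) \<sigma> j)
      = opa E k n (coface n (j - 1)) (companion_leg E \<phi> (Suc n) \<sigma> i) \<cdot>\<^bsub>lev E k\<^esub> face_swap E (Suc n) i j (degen_o E (Suc n) (V \<sigma> 0))"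
    if k: "n = Suc k" and ij: "i < j" "j \<le> Suc n" for i j k
  proof -
    let ?x = "V \<sigma> 0" and ?s = "degen_o E (Suc n) (V \<sigma> 0)"
    have cD: "coface n a \<in> Delta k n" "coface (Suc n) b \<in> Delta n (Suc n)"
      "compose {..k} (coface (Suc n) b) (coface n a) \<in> Delta k (Suc n)" for a b
      using k by simp_all
    have ok: "chosen_ok k" using assms(2) k by simp
    \<comment> \<open>In this form the face of a leg depends on \<open>a\<close> and
      \<open>b\<close> only through the composite coface and the final \<open>cmp\<close>:
      naturality of \<open>const_iso\<close> brings the two edges together, and
      \<open>const_iso_compose\<close> merges the two comparisons.\<close>
    have main: "opa E k n (coface n a) (companion_leg E \<phi> (Suc n) \<sigma> b)
      = \<phi> k (nerve_act k (coface n a) (d n b \<sigma>)) \<cdot>\<^bsub>lev E k\<^esub>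
        degen_a E k (\<sigma> (0, coface (Suc n) b (coface n a 0))) \<cdot>\<^bsub>lev E k\<^esub>
        const_iso E k (Suc n) (compose {..k} (coface (Suc n) b) (coface n a)) ?x \<cdot>\<^bsub>lev E k\<^esub>
        cmp E k n (Suc n) (coface n a) (coface (Suc n) b) ?s" if ab: "a \<le> n" "b \<le> Suc n" for a b
    proof -
      let ?\<sigma> = "d n b \<sigma>" and ?a = "coface n a" and ?b = "coface (Suc n) b"
      have \<sigma>': "?\<sigma> \<in> N n" using \<sigma> by simp
      have \<sigma>k: "?\<sigma> \<in> N (Suc k)" using \<sigma>' k by simp
      have P: "\<phi> k (nerve_act k ?a ?\<sigma>) \<in> Arr (lev E k)"
        "Dom (lev E k) (\<phi> k (nerve_act k ?a ?\<sigma>)) = degen_o E k (V \<sigma> (?b (?a 0)))"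
        using ok nerve_act_in[OF \<sigma>' cD(1), of a] Delta_le[OF cD(1), of 0 a] by (auto simp: chosen_ok_def hom_def)
      have le: "?a 0 \<le> n" "?b (?a 0) \<le> Suc n" "?b 0 \<le> Suc n" "?b 0 \<le> ?b (?a 0)"
        using Delta_le[OF cD(1), of 0 a] Delta_le[OF cD(2), of "?a 0" b] Delta_mono[OF cD(2), of 0 "?a 0" b] by simp_all
      have e: "\<sigma> (0, ?b 0) \<in> Arr (lev E 0)" "Dom (lev E 0) (\<sigma> (0, ?b 0)) = ?x"
        "Cod (lev E 0) (\<sigma> (0, ?b 0)) = V \<sigma> (?b 0)" using \<sigma> le by simp_all
      have e': "?\<sigma> (0, ?a 0) = \<sigma> (?b 0, ?b (?a 0))" using le by simp
      have e2: "\<sigma> (?b 0, ?b (?a 0)) \<in> Arr (lev E 0)" "Dom (lev E 0) (\<sigma> (?b 0, ?b (?a 0))) = V \<sigma> (?b 0)"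
        "Cod (lev E 0) (\<sigma> (?b 0, ?b (?a 0))) = V \<sigma> (?b (?a 0))" using \<sigma> le by simp_all
      have ee: "\<sigma> (?b 0, ?b (?a 0)) \<cdot>\<^bsub>lev E 0\<^esub> \<sigma> (0, ?b 0) = \<sigma> (0, ?b (?a 0))"
        using nerve_simp_Comp[OF \<sigma>, of 0 "?b 0" "?b (?a 0)"] le by simp
      have V: "?x \<in> Obj (lev E 0)" "V \<sigma> (?b 0) \<in> Obj (lev E 0)" "V ?\<sigma> 0 = V \<sigma> (?b 0)" using \<sigma> le by simp_all
      let ?s' = "degen_a E n (\<sigma> (0, ?b 0))" and ?c = "const_iso E n (Suc n) ?b ?x"
      have "opa E k n ?a (companion_leg E \<phi> (Suc n) \<sigma> b)
        = opa E k n ?a (\<phi> n ?\<sigma>) \<cdot>\<^bsub>lev E k\<^esub> opa E k n ?a ?s' \<cdot>\<^bsub>lev E k\<^esub> opa E k n ?a ?c"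
        unfolding leg using C[of b] e V cD by simp
      also have "opa E k n ?a (\<phi> n ?\<sigma>) = \<phi> k (nerve_act k ?a ?\<sigma>) \<cdot>\<^bsub>lev E k\<^esub>
          degen_a E k (\<sigma> (?b 0, ?b (?a 0))) \<cdot>\<^bsub>lev E k\<^esub> const_iso E k n ?a (V \<sigma> (?b 0))"
        using face(3)[OF k ab(1)] companion_leg_Suc[OF \<sigma>k ok, of a] e' V k by (simp del: nerve_act_act nerve_act_apply)
      also have "(\<phi> k (nerve_act k ?a ?\<sigma>) \<cdot>\<^bsub>lev E k\<^esub> degen_a E k (\<sigma> (?b 0, ?b (?a 0))) \<cdot>\<^bsub>lev E k\<^esub> const_iso E k n ?a (V \<sigma> (?b 0)))
            \<cdot>\<^bsub>lev E k\<^esub> opa E k n ?a ?s' \<cdot>\<^bsub>lev E k\<^esub> opa E k n ?a ?c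
        = \<phi> k (nerve_act k ?a ?\<sigma>) \<cdot>\<^bsub>lev E k\<^esub> degen_a E k (\<sigma> (?b 0, ?b (?a 0))) \<cdot>\<^bsub>lev E k\<^esub>
            const_iso E k n ?a (V \<sigma> (?b 0)) \<cdot>\<^bsub>lev E k\<^esub> opa E k n ?a ?s' \<cdot>\<^bsub>lev E k\<^esub> opa E k n ?a ?c"
        using P e e2 V cD by (simp del: nerve_act_act)
      also have "const_iso E k n ?a (V \<sigma> (?b 0)) \<cdot>\<^bsub>lev E k\<^esub> opa E k n ?a ?s' \<cdot>\<^bsub>lev E k\<^esub> opa E k n ?a ?c
        = degen_a E k (\<sigma> (0, ?b 0)) \<cdot>\<^bsub>lev E k\<^esub> const_iso E k n ?a ?x \<cdot>\<^bsub>lev E k\<^esub> opa E k n ?a ?c"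
        using const_iso_natural[OF e(1) cD(1)] e V cD by (intro lev.Comp_eq_right) simp_all
      also have "const_iso E k n ?a ?x \<cdot>\<^bsub>lev E k\<^esub> opa E k n ?a ?c
        = const_iso E k (Suc n) (compose {..k} ?b ?a) ?x \<cdot>\<^bsub>lev E k\<^esub> cmp E k n (Suc n) ?a ?b ?s"
        by (rule const_iso_compose[OF V(1) cD(1,2)])
      also have "degen_a E k (\<sigma> (?b 0, ?b (?a 0))) \<cdot>\<^bsub>lev E k\<^esub> degen_a E k (\<sigma> (0, ?b 0)) \<cdot>\<^bsub>lev E k\<^esub>
          const_iso E k (Suc n) (compose {..k} ?b ?a) ?x \<cdot>\<^bsub>lev E k\<^esub> cmp E k n (Suc n) ?a ?b ?s
        = degen_a E k (\<sigma> (0, ?b (?a 0))) \<cdot>\<^bsub>lev E k\<^esub>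
          const_iso E k (Suc n) (compose {..k} ?b ?a) ?x \<cdot>\<^bsub>lev E k\<^esub> cmp E k n (Suc n) ?a ?b ?s"
        unfolding ee[symmetric] using e e2 V cD by simp
      finally show ?thesis .
    qed
    have ij': "i \<le> n" "j - 1 \<le> n" "i \<le> Suc n" using ij by simp_all
    have cc: "compose {..k} (coface (Suc n) j) (coface n i) = compose {..k} (coface (Suc n) i) (coface n (j - 1))"
      using coface_coface[OF ij(1), of k] ij k by simp
    have c0: "coface (Suc n) j (coface n i 0) = coface (Suc n) i (coface n (j - 1) 0)"
      using fun_cong[OF cc, of 0] by (simp add: compose_def)
    \<comment> \<open>Since \<open>face_swap\<close> is the quotient of these two \<open>cmp\<close>
      isomorphisms, it accounts for the only difference that \<open>main\<close> leaves between the
      two double faces.\<close>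
    have fs: "cmp E k n (Suc n) (coface n (j - 1)) (coface (Suc n) i) ?s \<cdot>\<^bsub>lev E k\<^esub> face_swap E (Suc n) i j ?s
      = cmp E k n (Suc n) (coface n i) (coface (Suc n) j) ?s"
      using 1 cD cc k unfolding face_swap_def by simp
    have fs': "face_swap E (Suc n) i j ?s \<in> Arr (lev E k)"
      "Cod (lev E k) (face_swap E (Suc n) i j ?s) = opo E k n (coface n (j - 1)) (opo E n (Suc n) (coface (Suc n) i) ?s)"
      using face_swap_cart(2,4)[OF ij(1), of k ?s] ij 1 k by simp_all
    let ?\<sigma> = "nerve_act k (coface n (j - 1)) (d n i \<sigma>)"
    have \<sigma>': "?\<sigma> \<in> N k" using nerve_act_in[OF nerve_act_in[OF \<sigma> cD(2)] cD(1)] .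
    have P: "\<phi> k ?\<sigma> \<in> Arr (lev E k)" "Cod (lev E k) (\<phi> k ?\<sigma>) = C k ?\<sigma>"
      "Dom (lev E k) (\<phi> k ?\<sigma>) = degen_o E k (V \<sigma> (coface (Suc n) i (coface n (j - 1) 0)))" "C k ?\<sigma> \<in> Obj (lev E k)"
      using ok \<sigma>' Delta_le[OF cD(1), of 0 "j - 1"] by (auto simp: chosen_ok_def hom_def)
    have le: "coface (Suc n) i (coface n (j - 1) 0) \<le> Suc n"
      using Delta_le[OF cD(1), of 0 "j - 1"] by simp
    have e: "\<sigma> (0, coface (Suc n) i (coface n (j - 1) 0)) \<in> Arr (lev E 0)"
      "Dom (lev E 0) (\<sigma> (0, coface (Suc n) i (coface n (j - 1) 0))) = ?x"
      "Cod (lev E 0) (\<sigma> (0, coface (Suc n) i (coface n (j - 1) 0))) = V \<sigma> (coface (Suc n) i (coface n (j - 1) 0))"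
      using \<sigma> le by simp_all
    have x: "?x \<in> Obj (lev E 0)" using \<sigma> by simp
    show ?thesis
      unfolding main[OF ij'(1) ij(2)] main[OF ij'(2,3)] face(1)[OF k ij'(1)] swap[OF k ij] cc c0
      using P e x fs fs' cD 1 cc by (simp del: nerve_act_act)
  qed
  have 4: "face_swap E n (j - 1) (k - 1) (C n (d n i \<sigma>)) \<cdot>\<^bsub>lev E l\<^esub>
          face_a E m (j - 1) (Ide (lev E m) (face_o E n i (C n (d n k \<sigma>)))) \<cdot>\<^bsub>lev E l\<^esub> face_swap E n i j (C n (d n k \<sigma>))
        = face_a E m (k - 2) (Ide (lev E m) (face_o E n i (C n (d n j \<sigma>)))) \<cdot>\<^bsub>lev E l\<^esub>
          face_swap E n i (k - 1) (C n (d n j \<sigma>)) \<cdot>\<^bsub>lev E l\<^esub> face_a E m i (Ide (lev E m) (face_o E n j (C n (d n k \<sigma>))))"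
    if ml: "n = Suc m" "m = Suc l" and ijk: "i < j" "j < k" "k \<le> Suc n" for i j k l m
  proof -
    have \<sigma>': "d n b \<sigma> \<in> N n" for b using \<sigma> by simp
    have \<sigma>'': "nerve_act m (coface n a) (d n b \<sigma>) \<in> N m" for a b
      using nerve_act_in[OF \<sigma>' , of "coface n a" m] ml by simp
    have fsw: "face_swap E n a b (C n (d n c \<sigma>)) = Ide (lev E l) (opo E l m (coface m a) (C m (nerve_act m (coface n b) (d n c \<sigma>))))"
      if "a < b" "b \<le> n" for a b c
      using assms(1) \<sigma>' that ml by (auto simp: chosen_ok_def universal_extension_def simp del: nerve_act_act)
    have Cm: "C m (nerve_act m (coface n a) (d n b \<sigma>)) \<in> Obj (lev E m)"
      "c \<le> m \<Longrightarrow> opo E l m (coface m c) (C m (nerve_act m (coface n a) (d n b \<sigma>)))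
        = C l (nerve_act l (coface m c) (nerve_act m (coface n a) (d n b \<sigma>)))" for a b c
      using assms(2) \<sigma>''[of a b] ml by (auto simp: chosen_ok_def universal_extension_def simp del: nerve_act_act)
    have cD: "coface m a \<in> Delta l m" for a using ml by simp
    have face2: "nerve_act l (coface m a) (nerve_act m (coface n b) \<rho>) = nerve_act l (coface m (b - 1)) (nerve_act m (coface n a) \<rho>)"
      if "a < b" "b \<le> n" for a b \<rho>
      using coface_coface[of a b l] that ml by simp
    \<comment> \<open>By the simplicial identities \<open>s\<close> and \<open>f\<close>, all six
      arrows of the hexagon are the identity of this one triple face.\<close>
    let ?W = "C l (nerve_act l (coface m i) (nerve_act m (coface n j) (d n k \<sigma>)))"
    have W: "?W \<in> Obj (lev E l)"
      using Cm(1)[of j k] Cm(2)[of i j k] cD[of i] ijk ml opo_Obj[OF cD[of i], of "C m (nerve_act m (coface n j) (d n k \<sigma>))"] by simp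
    have s: "nerve_act m (coface n i) (d n j \<sigma>) = nerve_act m (coface n (j - 1)) (d n i \<sigma>)"
      "nerve_act m (coface n i) (d n k \<sigma>) = nerve_act m (coface n (k - 1)) (d n i \<sigma>)"
      "nerve_act m (coface n j) (d n k \<sigma>) = nerve_act m (coface n (k - 1)) (d n j \<sigma>)"
      using swap[OF ml(1), of i j] swap[OF ml(1), of i k] swap[OF ml(1), of j k] ijk by simp_all
    have f: "nerve_act l (coface m i) (nerve_act m (coface n j) (d n k \<sigma>)) = nerve_act l (coface m (j - 1)) (nerve_act m (coface n i) (d n k \<sigma>))"
      "nerve_act l (coface m i) (nerve_act m (coface n (k - 1)) (d n j \<sigma>)) = nerve_act l (coface m (k - 2)) (nerve_act m (coface n i) (d n j \<sigma>))"
      using face2[of i j "d n k \<sigma>"] face2[of i "k - 1" "d n j \<sigma>"] ijk ml by (simp_all add: numeral_2_eq_2)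
    have A: "face_swap E n (j - 1) (k - 1) (C n (d n i \<sigma>)) = Ide (lev E l) ?W"
      using fsw[of "j - 1" "k - 1" i] Cm(2)[of "j - 1" "k - 1" i] f(1) s(2) ijk ml by (simp del: nerve_act_act)
    have B: "face_a E m (j - 1) (Ide (lev E m) (face_o E n i (C n (d n k \<sigma>)))) = Ide (lev E l) ?W"
      using face(1)[OF ml(1), of i k] Cm(1)[of i k] Cm(2)[of "j - 1" i k] f(1) ijk ml by (simp del: nerve_act_act)
    have C': "face_swap E n i j (C n (d n k \<sigma>)) = Ide (lev E l) ?W"
      using fsw[of i j k] Cm(2)[of i j k] ijk ml by (simp del: nerve_act_act)
    have D: "face_a E m (k - 2) (Ide (lev E m) (face_o E n i (C n (d n j \<sigma>)))) = Ide (lev E l) ?W"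
      using face(1)[OF ml(1), of i j] Cm(1)[of i j] Cm(2)[of "k - 2" i j] f(2) s(3) ijk ml by (simp del: nerve_act_act)
    have E: "face_swap E n i (k - 1) (C n (d n j \<sigma>)) = Ide (lev E l) ?W"
      using fsw[of i "k - 1" j] Cm(2)[of i "k - 1" j] s(3) ijk ml by (simp del: nerve_act_act)
    have F: "face_a E m i (Ide (lev E m) (face_o E n j (C n (d n k \<sigma>)))) = Ide (lev E l) ?W"
      using face(1)[OF ml(1), of j k] Cm(1)[of j k] Cm(2)[of i j k] ijk ml by (simp del: nerve_act_act)
    show ?thesis unfolding A B C' D E F using W by simp
  qed
  show ?thesis
    unfolding matching_family_def
  proof (intro conjI allI impI)
    show "degen_o E (Suc n) (V \<sigma> 0) \<in> Obj (lev E (Suc n))" by (rule 1)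
    show "companion_leg E \<phi> (Suc n) \<sigma> i \<in> hom (lev E (Suc n - 1)) (face_o E (Suc n) i (degen_o E (Suc n) (V \<sigma> 0))) (C n (d n i \<sigma>))"
      if "i \<le> Suc n" for i using 2[OF that] by simp
  next
    fix i j assume ij: "2 \<le> Suc n \<and> i < j \<and> j \<le> Suc n"
    then obtain k where k: "n = Suc k" by (cases n) auto
    have le: "i \<le> n" "j - 1 \<le> n" "i < j" "j \<le> Suc n" using ij by auto
    have fi: "opo E k n (coface n i) (C n (d n j \<sigma>)) \<in> Obj (lev E k)"
      using face(1,2)[OF k, of i j] ij by simp
    show "coherence_arrow E (Suc n - 2) (Ide (lev E (n - 1)) (face_o E n i (C n (d n j \<sigma>))))"
      using fi k by (auto intro: coherence_arrow.ide)
    show "Ide (lev E (n - 1)) (face_o E n i (C n (d n j \<sigma>))) \<in> hom (lev E (Suc n - 2))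
        (face_o E (Suc n - 1) i (C n (d n j \<sigma>))) (face_o E (Suc n - 1) (j - 1) (C n (d n i \<sigma>)))"
      using fi face(1)[OF k le(1), of j] face(1)[OF k le(2), of i] swap[OF k le(3,4)] k
      by (simp add: hom_def del: nerve_act_act)
    show "Ide (lev E (n - 1)) (face_o E n i (C n (d n j \<sigma>))) \<cdot>\<^bsub>lev E (Suc n - 2)\<^esub>
        face_a E (Suc n - 1) i (companion_leg E \<phi> (Suc n) \<sigma> j)
      = face_a E (Suc n - 1) (j - 1) (companion_leg E \<phi> (Suc n) \<sigma> i) \<cdot>\<^bsub>lev E (Suc n - 2)\<^esub>
        face_swap E (Suc n) i j (degen_o E (Suc n) (V \<sigma> 0))"
      using 3[OF k, of i j] ij k by simp
  next
    fix i j k assume ijk: "3 \<le> Suc n \<and> i < j \<and> j < k \<and> k \<le> Suc n"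
    then obtain m l where ml: "n = Suc m" "m = Suc l"
      by (metis Suc_le_D Suc_le_mono numeral_3_eq_3)
    show "face_swap E (Suc n - 1) (j - 1) (k - 1) (C n (d n i \<sigma>)) \<cdot>\<^bsub>lev E (Suc n - 3)\<^esub>
          face_a E (Suc n - 2) (j - 1) (Ide (lev E (n - 1)) (face_o E n i (C n (d n k \<sigma>)))) \<cdot>\<^bsub>lev E (Suc n - 3)\<^esub>
          face_swap E (Suc n - 1) i j (C n (d n k \<sigma>))
        = face_a E (Suc n - 2) (k - 2) (Ide (lev E (n - 1)) (face_o E n i (C n (d n j \<sigma>)))) \<cdot>\<^bsub>lev E (Suc n - 3)\<^esub>
          face_swap E (Suc n - 1) i (k - 1) (C n (d n j \<sigma>)) \<cdot>\<^bsub>lev E (Suc n - 3)\<^esub>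
          face_a E (Suc n - 2) i (Ide (lev E (n - 1)) (face_o E n j (C n (d n k \<sigma>))))"
    proof -
      have "Suc n - 1 = n" "Suc n - 2 = m" "Suc n - 3 = l" "n - 1 = m"
        using ml by simp_all
      then show ?thesis
        using 4[OF ml, of i j k] ijk by (simp only:)
    qed
  qed
qed

lemma chosen_Suc:
  assumes "chosen_ok n" "chosen_ok (n - 1)" "\<sigma> \<in> N (Suc n)"
  shows "universal_extension E (Suc n) (degen_o E (Suc n) (V \<sigma> 0)) (\<lambda>i. C n (d n i \<sigma>))
    (companion_leg E \<phi> (Suc n) \<sigma>) (\<lambda>i j. Ide (lev E (n - 1)) (face_o E n i (C n (d n j \<sigma>))))
    (C (Suc n) \<sigma>) (\<phi> (Suc n) \<sigma>)"
proof -
  have leg: "companion_leg E (\<lambda>_ \<tau>. snd (chosen n \<tau>)) (Suc n) \<sigma> = companion_leg E \<phi> (Suc n) \<sigma>"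
    by (simp add: companion_leg_def fun_eq_iff)
  obtain y f where "universal_extension E (Suc n) (degen_o E (Suc n) (V \<sigma> 0)) (\<lambda>i. C n (d n i \<sigma>))
    (companion_leg E \<phi> (Suc n) \<sigma>) (\<lambda>i j. Ide (lev E (n - 1)) (face_o E n i (C n (d n j \<sigma>)))) y f"
    using extension[OF _ matching_leg[OF assms]] by auto
  then show ?thesis
    unfolding chosen.simps(2) leg
    by (intro someI[where x = "(y, f)" and P = "\<lambda>p. universal_extension E (Suc n) (degen_o E (Suc n) (V \<sigma> 0))
      (\<lambda>i. C n (d n i \<sigma>)) (companion_leg E \<phi> (Suc n) \<sigma>)
      (\<lambda>i j. Ide (lev E (n - 1)) (face_o E n i (C n (d n j \<sigma>)))) (fst p) (snd p)"]) simp
qed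

lemma chosen_ok: "chosen_ok n"
proof (induction n rule: less_induct)
  case (less n)
  show ?case
  proof (cases n)
    case 0
    then show ?thesis by (auto simp: chosen_ok_def hom_def)
  next
    case (Suc k)
    \<comment> \<open>For k = 0 the truncated difference k - 1 is again 0, so the induction
      hypothesis still covers it.\<close>
    have "chosen_ok k" "chosen_ok (k - 1)" using less Suc by simp_all
    note U = chosen_Suc[OF this]
    then show ?thesis
      unfolding chosen_ok_def Suc by (auto simp: universal_extension_def simp del: chosen.simps)
  qed
qed

lemma companion_data_chosen: "companion_data E C \<phi>"
proof
  show "\<forall>\<sigma>\<in>N 0. C 0 \<sigma> = V \<sigma> 0 \<and> \<phi> 0 \<sigma> = Ide (lev E 0) (V \<sigma> 0)"
    by simp
  show "\<forall>n\<ge>1. \<forall>\<sigma>\<in>N n. universal_extension E n (degen_o E n (V \<sigma> 0))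
      (\<lambda>i. C (n - 1) (nerve_act (n - 1) (coface n i) \<sigma>)) (companion_leg E \<phi> n \<sigma>)
      (\<lambda>i j. Ide (lev E (n - 2)) (face_o E (n - 1) i (C (n - 1) (nerve_act (n - 1) (coface n j) \<sigma>))))
      (C n \<sigma>) (\<phi> n \<sigma>)"
  proof (intro allI ballI impI)
    fix n :: nat and \<sigma> assume "1 \<le> n" "\<sigma> \<in> N n"
    then obtain k where k: "n = Suc k" "\<sigma> \<in> N (Suc k)" by (cases n) auto
    have *: "Suc k - 1 = k" "Suc k - 2 = k - 1" by simp_all
    show "universal_extension E n (degen_o E n (V \<sigma> 0))
      (\<lambda>i. C (n - 1) (nerve_act (n - 1) (coface n i) \<sigma>)) (companion_leg E \<phi> n \<sigma>)
      (\<lambda>i j. Ide (lev E (n - 2)) (face_o E (n - 1) i (C (n - 1) (nerve_act (n - 1) (coface n j) \<sigma>))))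
      (C n \<sigma>) (\<phi> n \<sigma>)"
      unfolding k(1) * by (rule chosen_Suc[OF chosen_ok chosen_ok k(2)])
  qed
qed

end

section \<open>Reading the oplax structure off the total category\<close>

context companion_data
begin

definition psi :: "nat \<Rightarrow> nat \<Rightarrow> (nat \<Rightarrow> nat) \<Rightarrow> (nat \<times> nat \<Rightarrow> 'a) \<Rightarrow> 'a" where
  "psi m n \<theta> \<sigma> = fst (snd (Psi m n \<theta> \<sigma>))"

text \<open>Hom sets of the total category do not record the base, so it has to be recovered that
  \<open>Psi\<close> lies over \<theta>: in \<open>Psi_phi\<close> the other factors on the left are
  vertical, while the right side has base \<theta>.\<close>

lemma Psi_psi:
  assumes "\<theta> \<in> Delta m n" "\<sigma> \<in> N n"
  shows "Psi m n \<theta> \<sigma> = (m, psi m n \<theta> \<sigma>, \<theta>, n, C n \<sigma>)"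
    and "psi m n \<theta> \<sigma> \<in> hom (lev E m) (C m (nerve_act m \<theta> \<sigma>)) (opo E m n \<theta> (C n \<sigma>))"
proof -
  note P = Psi_simps[OF assms]
  have le: "\<theta> 0 \<le> n" using Delta_le[OF assms(1)] by simp
  let ?r = "lift E m (\<phi> m (nerve_act m \<theta> \<sigma>)) \<bullet> edge m (\<theta> 0) \<sigma>"
  have "base (lift E n (\<phi> n \<sigma>) \<bullet> kappa E m n \<theta> (V \<sigma> 0)) = \<theta>"
    using base_Comp[of "kappa E m n \<theta> (V \<sigma> 0)" m] assms by simp
  moreover have "base (Psi m n \<theta> \<sigma> \<bullet> ?r) = base (Psi m n \<theta> \<sigma>)"
  proof -
    have "base ?r = id_map m"
      using base_Comp[of "edge m (\<theta> 0) \<sigma>" m] assms le by simp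
    moreover have "base (Psi m n \<theta> \<sigma>) \<in> Delta m n"
      using base_Delta[OF P] .
    ultimately show ?thesis
      using base_Comp[of ?r m "degen_o E m (V \<sigma> 0)"] assms le by simp
  qed
  ultimately have b: "base (Psi m n \<theta> \<sigma>) = \<theta>"
    using Psi_phi[OF assms] by simp
  then show eq: "Psi m n \<theta> \<sigma> = (m, psi m n \<theta> \<sigma>, \<theta>, n, C n \<sigma>)"
    using P by (cases "Psi m n \<theta> \<sigma>") (auto simp: psi_def base_def total_simps)
  show "psi m n \<theta> \<sigma> \<in> hom (lev E m) (C m (nerve_act m \<theta> \<sigma>)) (opo E m n \<theta> (C n \<sigma>))"
    using P unfolding eq by (auto simp: total_simps hom_def)
qed

lemma psi_cart:
  assumes "\<theta> \<in> Delta m n" "\<sigma> \<in> N n"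
  shows "Psi m n \<theta> \<sigma> = cart E m n \<theta> (C n \<sigma>) \<bullet> lift E m (psi m n \<theta> \<sigma>)"
  using Psi_psi[OF assms] assms by (auto simp: cart_lift hom_def)

text \<open>The oplax laws are \<open>Psi_id\<close> and \<open>Psi_compose\<close> read on second
  components. The clause on degeneracies is \<open>Psi_phi_0\<close> for a codegeneracy, which fixes
  0, with \<open>kappa\<close> turned back into \<open>const_iso\<close>.\<close>

lemma is_companion_psi: "is_companion E C \<phi> psi"
proof -
  have oplax: "oplax_diagram E (lev E 0) C psi"
    unfolding oplax_diagram_def
  proof (intro conjI allI ballI)
    show "C n \<sigma> \<in> Obj (lev E n)" if "\<sigma> \<in> N n" for n \<sigma>
      using that by simp
    show "psi m n \<theta> \<sigma> \<in> hom (lev E m) (C m (nerve_act m \<theta> \<sigma>)) (opo E m n \<theta> (C n \<sigma>))"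
      if "\<theta> \<in> Delta m n" "\<sigma> \<in> N n" for m n \<theta> \<sigma>
      by (rule Psi_psi[OF that])
    show "psi n n (id_map n) \<sigma> = unt E n (C n \<sigma>)" if "\<sigma> \<in> N n" for n \<sigma>
      using Psi_id[OF that] Psi_psi(1)[OF id_Delta that] by (simp add: total_simps)
    show "psi l n (compose {..l} \<theta> \<tau>) \<sigma> = cmp E l m n \<tau> \<theta> (C n \<sigma>) \<cdot>\<^bsub>lev E l\<^esub> opa E l m \<tau> (psi m n \<theta> \<sigma>)
          \<cdot>\<^bsub>lev E l\<^esub> psi l m \<tau> (nerve_act m \<theta> \<sigma>)" if "\<tau> \<in> Delta l m" "\<theta> \<in> Delta m n" "\<sigma> \<in> N n" for l m n \<tau> \<theta> \<sigma>
      using Psi_compose[OF that] Psi_psi(1)[OF compose_Delta[OF that(1,2)] that(3)]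
        Psi_psi(1)[OF that(2,3)] Psi_psi(1)[OF that(1) nerve_act_in[OF that(3,2)]]
      by (simp add: total_simps)
  qed
  have face: "psi (n - 1) n (coface n i) \<sigma> = Ide (lev E (n - 1)) (face_o E n i (C n \<sigma>))"
    if "1 \<le> n" "\<sigma> \<in> N n" "i \<le> n" for n \<sigma> i
  proof -
    have "n \<noteq> 0" using that(1) by simp
    then obtain k where k: "n = Suc k" using not0_implies_Suc by blast
    show ?thesis
      using Psi_coface[of \<sigma> k i] Psi_psi(1)[OF coface_Delta, of \<sigma> k i] that unfolding k by (simp add: cart_def)
  qed
  have degen: "psi (Suc n) n (codegen n i) \<sigma> \<cdot>\<^bsub>lev E (Suc n)\<^esub> \<phi> (Suc n) (nerve_act (Suc n) (codegen n i) \<sigma>)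
          \<cdot>\<^bsub>lev E (Suc n)\<^esub> const_iso E (Suc n) n (codegen n i) (V \<sigma> 0)
        = opa E (Suc n) n (codegen n i) (\<phi> n \<sigma>)" if \<sigma>: "\<sigma> \<in> N n" and i: "i \<le> n" for n \<sigma> i
  proof (rule cart_lift_cancel[of "Suc n" n "codegen n i" "C n \<sigma>"])
    let ?s = "codegen n i"
    have s: "?s \<in> Delta (Suc n) n" using i by simp
    have s0: "?s 0 = 0" by (simp add: codegen_def)
    have \<psi>: "psi (Suc n) n ?s \<sigma> \<in> Arr (lev E (Suc n))"
      "Dom (lev E (Suc n)) (psi (Suc n) n ?s \<sigma>) = C (Suc n) (nerve_act (Suc n) ?s \<sigma>)"
      "Cod (lev E (Suc n)) (psi (Suc n) n ?s \<sigma>) = opo E (Suc n) n ?s (C n \<sigma>)"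
      using Psi_psi(2)[OF s \<sigma>] by (auto simp: hom_def)
    show "psi (Suc n) n ?s \<sigma> \<cdot>\<^bsub>lev E (Suc n)\<^esub> \<phi> (Suc n) (nerve_act (Suc n) ?s \<sigma>)
          \<cdot>\<^bsub>lev E (Suc n)\<^esub> const_iso E (Suc n) n ?s (V \<sigma> 0) \<in> Arr (lev E (Suc n))"
      "Cod (lev E (Suc n)) (psi (Suc n) n ?s \<sigma> \<cdot>\<^bsub>lev E (Suc n)\<^esub> \<phi> (Suc n) (nerve_act (Suc n) ?s \<sigma>)
          \<cdot>\<^bsub>lev E (Suc n)\<^esub> const_iso E (Suc n) n ?s (V \<sigma> 0)) = opo E (Suc n) n ?s (C n \<sigma>)"
      using s s0 \<sigma> \<psi> by simp_all
    have "cart E (Suc n) n ?s (C n \<sigma>) \<bullet> lift E (Suc n) (opa E (Suc n) n ?s (\<phi> n \<sigma>))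
      = lift E n (\<phi> n \<sigma>) \<bullet> cart E (Suc n) n ?s (degen_o E n (V \<sigma> 0))"
      using lift_cart[OF s, of "\<phi> n \<sigma>"] \<sigma> by simp
    also have "\<dots> = (lift E n (\<phi> n \<sigma>) \<bullet> kappa E (Suc n) n ?s (V \<sigma> 0)) \<bullet> lift E (Suc n) (const_iso E (Suc n) n ?s (V \<sigma> 0))"
      using s \<sigma> by (simp add: kappa_const_iso)
    also have "\<dots> = (Psi (Suc n) n ?s \<sigma> \<bullet> lift E (Suc n) (\<phi> (Suc n) (nerve_act (Suc n) ?s \<sigma>)))
        \<bullet> lift E (Suc n) (const_iso E (Suc n) n ?s (V \<sigma> 0))"
      by (simp only: Psi_phi_0[OF s \<sigma> s0])
    also have "\<dots> = cart E (Suc n) n ?s (C n \<sigma>) \<bullet> lift E (Suc n) (psi (Suc n) n ?s \<sigma> \<cdot>\<^bsub>lev E (Suc n)\<^esub>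
        \<phi> (Suc n) (nerve_act (Suc n) ?s \<sigma>) \<cdot>\<^bsub>lev E (Suc n)\<^esub> const_iso E (Suc n) n ?s (V \<sigma> 0))"
      unfolding psi_cart[OF s \<sigma>] using s s0 \<sigma> \<psi> by simp
    finally show "cart E (Suc n) n ?s (C n \<sigma>) \<bullet> lift E (Suc n) (psi (Suc n) n ?s \<sigma> \<cdot>\<^bsub>lev E (Suc n)\<^esub>
        \<phi> (Suc n) (nerve_act (Suc n) ?s \<sigma>) \<cdot>\<^bsub>lev E (Suc n)\<^esub> const_iso E (Suc n) n ?s (V \<sigma> 0))
      = cart E (Suc n) n ?s (C n \<sigma>) \<bullet> lift E (Suc n) (opa E (Suc n) n ?s (\<phi> n \<sigma>))" ..
  qed (use \<sigma> i in simp_all)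
  show ?thesis
    unfolding is_companion_def using companion_0 companion_ext oplax face degen by blast
qed

end

lemma (in equipment) ex_companion: "\<exists>C \<phi> \<psi>. is_companion E C \<phi> \<psi>"
  using companion_data.is_companion_psi[OF companion_data_chosen] by blast

section \<open>Double colimits of companion diagrams\<close>

text \<open>Here \<psi> is an arbitrary admissible structure and not the constructed
  \<open>psi\<close>, because the comparison of colimits is to hold for every choice of
  companions.\<close>

locale companion = simplicial_category E for E :: "('o, 'a) scat" +
  fixes C :: "nat \<Rightarrow> (nat \<times> nat \<Rightarrow> 'a) \<Rightarrow> 'o" and \<phi> :: "nat \<Rightarrow> (nat \<times> nat \<Rightarrow> 'a) \<Rightarrow> 'a"
    and \<psi> :: "nat \<Rightarrow> nat \<Rightarrow> (nat \<Rightarrow> nat) \<Rightarrow> (nat \<times> nat \<Rightarrow> 'a) \<Rightarrow> 'a"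
  assumes is_companion: "is_companion E C \<phi> \<psi>"
begin

sublocale companion_data E C \<phi>
  using is_companion by unfold_locales (simp_all add: is_companion_def)

text \<open>As arrows of the total category the structure arrows lose \<open>unt\<close> and
  \<open>cmp\<close> from their laws: oplaxness becomes strict functoriality, \<open>str_id\<close>
  and \<open>str_compose\<close>.\<close>

definition str :: "nat \<Rightarrow> nat \<Rightarrow> (nat \<Rightarrow> nat) \<Rightarrow> (nat \<times> nat \<Rightarrow> 'a) \<Rightarrow> nat \<times> 'a \<times> (nat \<Rightarrow> nat) \<times> nat \<times> 'o" where
  "str m n \<theta> \<sigma> = (m, \<psi> m n \<theta> \<sigma>, \<theta>, n, C n \<sigma>)"

lemma oplax: "oplax_diagram E (lev E 0) C \<psi>"
  using is_companion by (simp add: is_companion_def)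

lemma psi_simps [simp]:
  assumes "\<theta> \<in> Delta m n" "\<sigma> \<in> N n"
  shows "\<psi> m n \<theta> \<sigma> \<in> Arr (lev E m)" "Dom (lev E m) (\<psi> m n \<theta> \<sigma>) = C m (nerve_act m \<theta> \<sigma>)"
    and "Cod (lev E m) (\<psi> m n \<theta> \<sigma>) = opo E m n \<theta> (C n \<sigma>)"
  using oplax assms by (auto simp: oplax_diagram_def hom_def)

lemma str_simps [simp]:
  assumes "\<theta> \<in> Delta m n" "\<sigma> \<in> N n"
  shows "str m n \<theta> \<sigma> \<in> Arr (total E)" "Dom (total E) (str m n \<theta> \<sigma>) = (m, C m (nerve_act m \<theta> \<sigma>))"
    and "Cod (total E) (str m n \<theta> \<sigma>) = (n, C n \<sigma>)"
  using assms by (simp_all add: str_def total_simps)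

lemma str_id: "\<sigma> \<in> N n \<Longrightarrow> str n n (id_map n) \<sigma> = Ide (total E) (n, C n \<sigma>)"
  using oplax by (auto simp: str_def total_simps oplax_diagram_def)

lemma str_compose:
  "\<tau> \<in> Delta l m \<Longrightarrow> \<theta> \<in> Delta m n \<Longrightarrow> \<sigma> \<in> N n \<Longrightarrow>
    str l n (compose {..l} \<theta> \<tau>) \<sigma> = str m n \<theta> \<sigma> \<bullet> str l m \<tau> (nerve_act m \<theta> \<sigma>)"
  using oplax by (auto simp: str_def total_simps oplax_diagram_def)

lemma str_cart: "\<theta> \<in> Delta m n \<Longrightarrow> \<sigma> \<in> N n \<Longrightarrow> str m n \<theta> \<sigma> = cart E m n \<theta> (C n \<sigma>) \<bullet> lift E m (\<psi> m n \<theta> \<sigma>)"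
  by (simp add: cart_lift) (simp add: str_def)

lemma str_coface:
  assumes "\<sigma> \<in> N (Suc n)" "j \<le> Suc n"
  shows "str n (Suc n) (coface (Suc n) j) \<sigma> = cart E n (Suc n) (coface (Suc n) j) (C (Suc n) \<sigma>)"
proof -
  have "1 \<le> Suc n \<longrightarrow> \<psi> (Suc n - 1) (Suc n) (coface (Suc n) j) \<sigma> = Ide (lev E (Suc n - 1)) (face_o E (Suc n) j (C (Suc n) \<sigma>))"
    using is_companion assms unfolding is_companion_def by blast
  then show ?thesis by (simp add: str_def cart_def)
qed

lemma str_codegen:
  assumes "\<sigma> \<in> N n" "i \<le> n"
  shows "str (Suc n) n (codegen n i) \<sigma> \<bullet> lift E (Suc n) (\<phi> (Suc n) (nerve_act (Suc n) (codegen n i) \<sigma>))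
    = lift E n (\<phi> n \<sigma>) \<bullet> kappa E (Suc n) n (codegen n i) (V \<sigma> 0)"
proof -
  let ?s = "codegen n i" and ?\<sigma> = "nerve_act (Suc n) (codegen n i) \<sigma>"
  let ?c = "const_iso E (Suc n) n ?s (V \<sigma> 0)"
  have s: "?s \<in> Delta (Suc n) n" using assms by simp
  have s0: "?s 0 = 0" by (simp add: codegen_def)
  have eq: "\<psi> (Suc n) n ?s \<sigma> \<cdot>\<^bsub>lev E (Suc n)\<^esub> \<phi> (Suc n) ?\<sigma> \<cdot>\<^bsub>lev E (Suc n)\<^esub> ?c = opa E (Suc n) n ?s (\<phi> n \<sigma>)"
    using is_companion assms unfolding is_companion_def by blast
  let ?i = "inv_arrow (lev E (Suc n)) ?c"
  have "lift E n (\<phi> n \<sigma>) \<bullet> kappa E (Suc n) n ?s (V \<sigma> 0)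
    = (lift E n (\<phi> n \<sigma>) \<bullet> cart E (Suc n) n ?s (degen_o E n (V \<sigma> 0))) \<bullet> lift E (Suc n) ?i"
    using assms s by (simp add: kappa_def)
  also have "\<dots> = (cart E (Suc n) n ?s (C n \<sigma>) \<bullet> lift E (Suc n) (\<psi> (Suc n) n ?s \<sigma> \<cdot>\<^bsub>lev E (Suc n)\<^esub> \<phi> (Suc n) ?\<sigma> \<cdot>\<^bsub>lev E (Suc n)\<^esub> ?c)) \<bullet> lift E (Suc n) ?i"
    using lift_cart[OF s(1), of "\<phi> n \<sigma>"] assms s eq by simp
  also have "\<dots> = str (Suc n) n ?s \<sigma> \<bullet> lift E (Suc n) (\<phi> (Suc n) ?\<sigma>)"
    unfolding str_cart[OF s(1) assms(1)] using assms s s0 by simp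
  finally show ?thesis ..
qed

text \<open>On generators the law is \<open>phi_face\<close> and \<open>str_codegen\<close>. Under
  composition the initial edge of the composite map splits into those of the two factors, and
  \<open>kappa_natural\<close> moves one of them into place.\<close>

lemma str_phi:
  assumes "\<theta> \<in> Delta m n" "\<sigma> \<in> N n"
  shows "str m n \<theta> \<sigma> \<bullet> lift E m (\<phi> m (nerve_act m \<theta> \<sigma>)) \<bullet> edge m (\<theta> 0) \<sigma>
    = lift E n (\<phi> n \<sigma>) \<bullet> kappa E m n \<theta> (V \<sigma> 0)"
  using assms
proof (induction arbitrary: \<sigma> rule: Delta_induct)
  case (id n)
  have e: "edge n (id_map n 0) \<sigma> = Ide (total E) (n, degen_o E n (V \<sigma> 0))"
    using id by (simp add: nerve_simp_Ide[of \<sigma>])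
  have "V \<sigma> 0 \<in> Obj (lev E 0)" using id by simp
  then show ?case
    unfolding e str_id[OF id] nerve_act_id[OF id] kappa_id[OF \<open>V \<sigma> 0 \<in> Obj (lev E 0)\<close>] using id by simp
next
  case (coface n i)
  then show ?case by (simp add: str_coface phi_face)
next
  case (codegen n i)
  have s: "codegen n i \<in> Delta (Suc n) n" using codegen by simp
  have s0: "codegen n i 0 = 0" by (simp add: codegen_def)
  have e: "edge (Suc n) (codegen n i 0) \<sigma> = Ide (total E) (Suc n, degen_o E (Suc n) (V \<sigma> 0))"
    using codegen s0 by (simp add: nerve_simp_Ide[of \<sigma>])
  have "lift E (Suc n) (\<phi> (Suc n) (nerve_act (Suc n) (codegen n i) \<sigma>)) \<bullet> edge (Suc n) (codegen n i 0) \<sigma>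
    = lift E (Suc n) (\<phi> (Suc n) (nerve_act (Suc n) (codegen n i) \<sigma>))"
    unfolding e using codegen s s0 by simp
  then show ?case using str_codegen[OF codegen(2,1)] by simp
next
  case (compose l m n \<tau> \<theta>)
  note \<tau> = compose(1) and \<theta> = compose(2) and \<sigma> = \<open>\<sigma> \<in> N n\<close>
  let ?\<sigma> = "nerve_act m \<theta> \<sigma>"
  have \<sigma>': "?\<sigma> \<in> N m" using \<theta> \<sigma> by simp
  have le: "\<tau> 0 \<le> m" "\<theta> 0 \<le> n" "\<theta> (\<tau> 0) \<le> n" "\<theta> 0 \<le> \<theta> (\<tau> 0)"
    using Delta_le[OF \<tau>] Delta_le[OF \<theta>] Delta_mono[OF \<theta>, of 0 "\<tau> 0"] by simp_all
  have act: "nerve_act l \<tau> ?\<sigma> = nerve_act l (compose {..l} \<theta> \<tau>) \<sigma>" using \<tau> by simp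
  have "\<sigma> (0, compose {..l} \<theta> \<tau> 0) = ?\<sigma> (0, \<tau> 0) \<cdot>\<^bsub>lev E 0\<^esub> \<sigma> (0, \<theta> 0)"
    using nerve_simp_Comp[OF \<sigma>, of 0 "\<theta> 0" "\<theta> (\<tau> 0)"] le by (simp add: compose_def)
  then have e: "edge l (compose {..l} \<theta> \<tau> 0) \<sigma> = edge l (\<tau> 0) ?\<sigma> \<bullet> edge l (\<theta> 0) \<sigma>"
    using \<sigma> le by simp
  have \<tau>': "str l m \<tau> ?\<sigma> \<in> Arr (total E)" "Dom (total E) (str l m \<tau> ?\<sigma>) = (l, C l (nerve_act l (compose {..l} \<theta> \<tau>) \<sigma>))"
    "Cod (total E) (str l m \<tau> ?\<sigma>) = (m, C m ?\<sigma>)" using str_simps[OF \<tau> \<sigma>'] act by simp_all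
  have c: "compose {..l} \<theta> \<tau> \<in> Delta l n" by (rule compose_Delta[OF \<tau> \<theta>])
  have "str l n (compose {..l} \<theta> \<tau>) \<sigma> \<bullet> lift E l (\<phi> l (nerve_act l (compose {..l} \<theta> \<tau>) \<sigma>)) \<bullet> edge l (compose {..l} \<theta> \<tau> 0) \<sigma>
    = str m n \<theta> \<sigma> \<bullet> (str l m \<tau> ?\<sigma> \<bullet> lift E l (\<phi> l (nerve_act l \<tau> ?\<sigma>)) \<bullet> edge l (\<tau> 0) ?\<sigma>) \<bullet> edge l (\<theta> 0) \<sigma>"
    unfolding str_compose[OF \<tau> \<theta> \<sigma>] e act using \<tau> \<theta> \<sigma> str_simps[OF \<theta> \<sigma>] \<tau>' le c by (simp add: compose_def del: str_simps)
  also have "\<dots> = str m n \<theta> \<sigma> \<bullet> lift E m (\<phi> m ?\<sigma>) \<bullet> kappa E l m \<tau> (V \<sigma> (\<theta> 0)) \<bullet> edge l (\<theta> 0) \<sigma>"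
    unfolding compose(3)[OF \<sigma>'] using \<tau> \<theta> \<sigma> le by simp
  also have "kappa E l m \<tau> (V \<sigma> (\<theta> 0)) \<bullet> edge l (\<theta> 0) \<sigma> = edge m (\<theta> 0) \<sigma> \<bullet> kappa E l m \<tau> (V \<sigma> 0)"
    using kappa_natural[of "\<sigma> (0, \<theta> 0)" \<tau> l m] \<sigma> \<tau> le by simp
  also have "str m n \<theta> \<sigma> \<bullet> lift E m (\<phi> m ?\<sigma>) \<bullet> edge m (\<theta> 0) \<sigma> \<bullet> kappa E l m \<tau> (V \<sigma> 0)
    = (str m n \<theta> \<sigma> \<bullet> lift E m (\<phi> m ?\<sigma>) \<bullet> edge m (\<theta> 0) \<sigma>) \<bullet> kappa E l m \<tau> (V \<sigma> 0)"
    using \<tau> \<theta> \<sigma> le by simp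
  also have "\<dots> = lift E n (\<phi> n \<sigma>) \<bullet> kappa E l n (compose {..l} \<theta> \<tau>) (V \<sigma> 0)"
    unfolding compose(4)[OF \<sigma>] using \<tau> \<theta> \<sigma> by (simp add: kappa_compose)
  finally show ?case .
qed

lemma str_phi_0:
  assumes "\<theta> \<in> Delta m n" "\<sigma> \<in> N n" "\<theta> 0 = 0"
  shows "str m n \<theta> \<sigma> \<bullet> lift E m (\<phi> m (nerve_act m \<theta> \<sigma>)) = lift E n (\<phi> n \<sigma>) \<bullet> kappa E m n \<theta> (V \<sigma> 0)"
  using str_phi[OF assms(1,2)] assms by (simp add: nerve_simp_Ide[of \<sigma>])

end

text \<open>A lax cocone is the common form of a cocone on the companion diagram, which it determines by
  restriction along the arrows \<open>\<phi>\<close>, and of a cowedge defining the homotopy colimit.\<close>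

definition lax_cocone :: "('o, 'a) scat \<Rightarrow> ('j, 'k) cat \<Rightarrow> ('j \<Rightarrow> 'o) \<Rightarrow> ('k \<Rightarrow> 'a) \<Rightarrow> 'o \<Rightarrow>
    (nat \<Rightarrow> (nat \<times> nat \<Rightarrow> 'k) \<Rightarrow> nat \<times> 'a \<times> (nat \<Rightarrow> nat) \<times> nat \<times> 'o) \<Rightarrow> bool" where
  "lax_cocone E J Fo Fa c h \<longleftrightarrow> c \<in> Obj (lev E 0) \<and>
     (\<forall>n. \<forall>\<sigma> \<in> nerve_simp J n. h n \<sigma> \<in> hom (total E) (n, degen_o E n (Fo (vert J \<sigma> 0))) (0, c)) \<and>
     (\<forall>m n. \<forall>\<theta> \<in> Delta m n. \<forall>\<sigma> \<in> nerve_simp J n.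
        h m (nerve_act m \<theta> \<sigma>) \<cdot>\<^bsub>total E\<^esub> lift E m (degen_a E m (Fa (\<sigma> (0, \<theta> 0))))
        = h n \<sigma> \<cdot>\<^bsub>total E\<^esub> kappa E m n \<theta> (Fo (vert J \<sigma> 0)))"

definition lax_colimit :: "('o, 'a) scat \<Rightarrow> ('j, 'k) cat \<Rightarrow> ('j \<Rightarrow> 'o) \<Rightarrow> ('k \<Rightarrow> 'a) \<Rightarrow> 'o \<Rightarrow> bool" where
  "lax_colimit E J Fo Fa D \<longleftrightarrow> (\<exists>h. lax_cocone E J Fo Fa D h \<and>
     (\<forall>c h'. lax_cocone E J Fo Fa c h' \<longrightarrow>
        (\<exists>!f. f \<in> hom (lev E 0) D c \<and>
          (\<forall>n. \<forall>\<sigma> \<in> nerve_simp J n. lift E 0 f \<cdot>\<^bsub>total E\<^esub> h n \<sigma> = h' n \<sigma>))))"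

section \<open>Cocones on the companion diagram of a functor\<close>

locale companion_diagram = companion E C \<phi> \<psi> + F: is_functor J "lev E 0" Fo Fa
  for E :: "('o, 'a) scat" and C \<phi> \<psi> and J :: "('j, 'k) cat" and Fo Fa
begin

abbreviation F where "F \<equiv> nerve_map Fa"
abbreviation NJ where "NJ \<equiv> nerve_simp J"
abbreviation G where "G \<equiv> companion_diagram_obj C Fa"
abbreviation \<psi>' where "\<psi>' \<equiv> companion_diagram_str \<psi> Fa"

text \<open>Cocones in which the objects s^n c are replaced by the single object (0, c);
  compatibility then contains no trace of \<open>const_iso\<close>.\<close>

definition total_cocone :: "'o \<Rightarrow> (nat \<Rightarrow> (nat \<times> nat \<Rightarrow> 'k) \<Rightarrow> nat \<times> 'a \<times> (nat \<Rightarrow> nat) \<times> nat \<times> 'o) \<Rightarrow> bool" where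
  "total_cocone c u \<longleftrightarrow> c \<in> Obj (lev E 0) \<and>
     (\<forall>n. \<forall>\<sigma> \<in> NJ n. u n \<sigma> \<in> hom (total E) (n, C n (F n \<sigma>)) (0, c)) \<and>
     (\<forall>m n. \<forall>\<theta> \<in> Delta m n. \<forall>\<sigma> \<in> NJ n. u m (nerve_act m \<theta> \<sigma>) = u n \<sigma> \<bullet> str m n \<theta> (F n \<sigma>))"

lemma oplax_diagram: "oplax_diagram E J G \<psi>'"
  using oplax F.nerve_map_in
  by (simp add: oplax_diagram_def companion_diagram_obj_def companion_diagram_str_def flip: nerve_act_map)

text \<open>Composing with \<open>point\<close> turns \<open>const_iso\<close> into a cartesian
  arrow, \<open>lift_cart\<close> moves the reindexed \<open>e\<close> past it, and the cartesian
  arrow joins with \<psi> to form \<open>str\<close>.\<close>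

lemma point_const_str:
  assumes "c \<in> Obj (lev E 0)" "\<theta> \<in> Delta m n" "\<sigma> \<in> N n"
    "e \<in> Arr (lev E n)" "Dom (lev E n) e = C n \<sigma>" "Cod (lev E n) e = degen_o E n c"
  shows "point E m c \<bullet> lift E m (const_iso E m n \<theta> c \<cdot>\<^bsub>lev E m\<^esub> opa E m n \<theta> e \<cdot>\<^bsub>lev E m\<^esub> \<psi> m n \<theta> \<sigma>)
    = (point E n c \<bullet> lift E n e) \<bullet> str m n \<theta> \<sigma>"
proof -
  have "point E m c \<bullet> lift E m (const_iso E m n \<theta> c) \<bullet> lift E m (opa E m n \<theta> e \<cdot>\<^bsub>lev E m\<^esub> \<psi> m n \<theta> \<sigma>)
    = point E n c \<bullet> cart E m n \<theta> (degen_o E n c) \<bullet> lift E m (opa E m n \<theta> e \<cdot>\<^bsub>lev E m\<^esub> \<psi> m n \<theta> \<sigma>)"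
    using assms by (intro T.Comp_eq_right) (simp_all add: point_const_iso del: lift_Comp)
  also have "\<dots> = point E n c \<bullet> (cart E m n \<theta> (degen_o E n c) \<bullet> lift E m (opa E m n \<theta> e)) \<bullet> lift E m (\<psi> m n \<theta> \<sigma>)"
    using assms by simp
  also have "cart E m n \<theta> (degen_o E n c) \<bullet> lift E m (opa E m n \<theta> e) = lift E n e \<bullet> cart E m n \<theta> (C n \<sigma>)"
    using lift_cart[OF assms(2,4)] assms by simp
  finally show ?thesis
    using assms by (simp add: str_cart)
qed

lemma point_lift_iff:
  assumes "x \<in> Obj (lev E 0)"
    "u \<in> Arr (lev E n)" "v \<in> Arr (lev E n)" "Dom (lev E n) u = Dom (lev E n) v"
    "Cod (lev E n) u = degen_o E n x" "Cod (lev E n) v = degen_o E n x"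
  shows "u = v \<longleftrightarrow> point E n x \<bullet> lift E n u = point E n x \<bullet> lift E n v"
  using point_lift_cancel[OF _ assms] by blast

lemma diagram_cocone_iff:
  "diagram_cocone E J G \<psi>' c \<eta> \<longleftrightarrow> (\<forall>n. \<forall>\<sigma> \<in> NJ n. \<eta> n \<sigma> \<in> hom (lev E n) (C n (F n \<sigma>)) (degen_o E n c)) \<and>
    total_cocone c (\<lambda>n \<sigma>. point E n c \<bullet> lift E n (\<eta> n \<sigma>))" (is "?L \<longleftrightarrow> ?H \<and> ?R")
proof (cases "c \<in> Obj (lev E 0) \<and> ?H")
  case False
  then show ?thesis
    unfolding diagram_cocone_def total_cocone_def companion_diagram_obj_def by blast
next
  case True
  then have c: "c \<in> Obj (lev E 0)" by simp
  have \<eta>: "\<eta> n \<sigma> \<in> Arr (lev E n)" "Dom (lev E n) (\<eta> n \<sigma>) = C n (F n \<sigma>)" "Cod (lev E n) (\<eta> n \<sigma>) = degen_o E n c"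
    if "\<sigma> \<in> NJ n" for n \<sigma>
    using True that by (auto simp: hom_def)
  have "\<eta> m (nerve_act m \<theta> \<sigma>) = const_iso E m n \<theta> c \<cdot>\<^bsub>lev E m\<^esub> opa E m n \<theta> (\<eta> n \<sigma>) \<cdot>\<^bsub>lev E m\<^esub> \<psi> m n \<theta> (F n \<sigma>) \<longleftrightarrow>
      point E m c \<bullet> lift E m (\<eta> m (nerve_act m \<theta> \<sigma>)) = (point E n c \<bullet> lift E n (\<eta> n \<sigma>)) \<bullet> str m n \<theta> (F n \<sigma>)"
    if \<theta>: "\<theta> \<in> Delta m n" and \<sigma>: "\<sigma> \<in> NJ n" for m n \<theta> \<sigma>
  proof -
    have F\<sigma>: "F n \<sigma> \<in> N n" and \<theta>\<sigma>: "nerve_act m \<theta> \<sigma> \<in> NJ m" using \<theta> \<sigma> by simp_all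
    let ?r = "const_iso E m n \<theta> c \<cdot>\<^bsub>lev E m\<^esub> opa E m n \<theta> (\<eta> n \<sigma>) \<cdot>\<^bsub>lev E m\<^esub> \<psi> m n \<theta> (F n \<sigma>)"
    have "\<eta> m (nerve_act m \<theta> \<sigma>) = ?r \<longleftrightarrow> point E m c \<bullet> lift E m (\<eta> m (nerve_act m \<theta> \<sigma>)) = point E m c \<bullet> lift E m ?r"
      by (rule point_lift_iff) (use c \<theta> F\<sigma> \<eta>[OF \<sigma>] \<eta>[OF \<theta>\<sigma>] in \<open>simp_all add: nerve_act_map\<close>)
    then show ?thesis
      unfolding point_const_str[OF c \<theta> F\<sigma> \<eta>[OF \<sigma>]] .
  qed
  then show ?thesis
    using True c \<eta> unfolding diagram_cocone_def total_cocone_def companion_diagram_obj_def companion_diagram_str_def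
    by (auto simp: hom_def)
qed

lemma total_cocone_point:
  assumes "total_cocone c u"
  obtains \<eta> where "diagram_cocone E J G \<psi>' c \<eta>" "\<And>n \<sigma>. \<sigma> \<in> NJ n \<Longrightarrow> u n \<sigma> = point E n c \<bullet> lift E n (\<eta> n \<sigma>)"
proof -
  have ex: "\<exists>e. e \<in> hom (lev E n) (C n (F n \<sigma>)) (degen_o E n c) \<and> u n \<sigma> = point E n c \<bullet> lift E n e" if "\<sigma> \<in> NJ n" for n \<sigma>
  proof -
    have "u n \<sigma> \<in> Arr (total E)" "Dom (total E) (u n \<sigma>) = (n, C n (F n \<sigma>))" "Cod (total E) (u n \<sigma>) = (0, c)"
      using assms that by (auto simp: total_cocone_def hom_def)
    from point_factor[OF this] show ?thesis unfolding hom_def by blast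
  qed
  define \<eta> where "\<eta> n \<sigma> = (SOME e. e \<in> hom (lev E n) (C n (F n \<sigma>)) (degen_o E n c) \<and> u n \<sigma> = point E n c \<bullet> lift E n e)"
    for n \<sigma>
  have \<eta>: "\<eta> n \<sigma> \<in> hom (lev E n) (C n (F n \<sigma>)) (degen_o E n c)" "u n \<sigma> = point E n c \<bullet> lift E n (\<eta> n \<sigma>)"
    if "\<sigma> \<in> NJ n" for n \<sigma>
    using someI_ex[OF ex[OF that], folded \<eta>_def] by blast+
  have "total_cocone c (\<lambda>n \<sigma>. point E n c \<bullet> lift E n (\<eta> n \<sigma>))"
    unfolding total_cocone_def
  proof (intro conjI allI ballI)
    show "c \<in> Obj (lev E 0)" using assms by (simp add: total_cocone_def)
    show "point E n c \<bullet> lift E n (\<eta> n \<sigma>) \<in> hom (total E) (n, C n (F n \<sigma>)) (0, c)" if "\<sigma> \<in> NJ n" for n \<sigma>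
      unfolding \<eta>(2)[OF that, symmetric] using assms that by (simp add: total_cocone_def)
    show "point E m c \<bullet> lift E m (\<eta> m (nerve_act m \<theta> \<sigma>)) = (point E n c \<bullet> lift E n (\<eta> n \<sigma>)) \<bullet> str m n \<theta> (F n \<sigma>)"
      if "\<theta> \<in> Delta m n" "\<sigma> \<in> NJ n" for m n \<theta> \<sigma>
      unfolding \<eta>(2)[OF that(2), symmetric] \<eta>(2)[OF nerve_act_in[OF that(2,1)], symmetric]
      using assms that by (simp add: total_cocone_def)
  qed
  then show ?thesis
    using that \<eta> diagram_cocone_iff by blast
qed

text \<open>Restriction along \<phi>. The relation \<open>str_phi\<close> is what produces the
  initial edge in the law of a lax cocone.\<close>

lemma total_cocone_phi:
  assumes "total_cocone c u"
  shows "lax_cocone E J Fo Fa c (\<lambda>n \<sigma>. u n \<sigma> \<bullet> lift E n (\<phi> n (F n \<sigma>)))"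
proof -
  have c: "c \<in> Obj (lev E 0)" using assms by (simp add: total_cocone_def)
  have u: "u n \<sigma> \<in> Arr (total E)" "Dom (total E) (u n \<sigma>) = (n, C n (F n \<sigma>))" "Cod (total E) (u n \<sigma>) = (0, c)"
    if "\<sigma> \<in> NJ n" for n \<sigma>
    using assms that by (auto simp: total_cocone_def hom_def)
  have "(u m (nerve_act m \<theta> \<sigma>) \<bullet> lift E m (\<phi> m (F m (nerve_act m \<theta> \<sigma>)))) \<bullet> lift E m (degen_a E m (Fa (\<sigma> (0, \<theta> 0))))
    = (u n \<sigma> \<bullet> lift E n (\<phi> n (F n \<sigma>))) \<bullet> kappa E m n \<theta> (Fo (vert J \<sigma> 0))"
    if \<theta>: "\<theta> \<in> Delta m n" and \<sigma>: "\<sigma> \<in> NJ n" for m n \<theta> \<sigma>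
  proof -
    have F\<sigma>: "F n \<sigma> \<in> N n" using \<sigma> by simp
    have le: "\<theta> 0 \<le> n" using Delta_le[OF \<theta>] by simp
    have e: "Fa (\<sigma> (0, \<theta> 0)) = F n \<sigma> (0, \<theta> 0)" using le by simp
    have act: "F m (nerve_act m \<theta> \<sigma>) = nerve_act m \<theta> (F n \<sigma>)" by (rule nerve_act_map[OF \<theta>, symmetric])
    have V: "Fo (vert J \<sigma> 0) = V (F n \<sigma>) 0" using \<sigma> by simp
    have um: "u m (nerve_act m \<theta> \<sigma>) = u n \<sigma> \<bullet> str m n \<theta> (F n \<sigma>)"
      using assms \<theta> \<sigma> by (simp add: total_cocone_def)
    have "((u n \<sigma> \<bullet> str m n \<theta> (F n \<sigma>)) \<bullet> lift E m (\<phi> m (nerve_act m \<theta> (F n \<sigma>)))) \<bullet> edge m (\<theta> 0) (F n \<sigma>)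
      = u n \<sigma> \<bullet> str m n \<theta> (F n \<sigma>) \<bullet> lift E m (\<phi> m (nerve_act m \<theta> (F n \<sigma>))) \<bullet> edge m (\<theta> 0) (F n \<sigma>)"
      using u[OF \<sigma>] F\<sigma> \<theta> le by (simp del: nerve_map_apply F.vert_nerve_map)
    also have "\<dots> = (u n \<sigma> \<bullet> lift E n (\<phi> n (F n \<sigma>))) \<bullet> kappa E m n \<theta> (V (F n \<sigma>) 0)"
      unfolding str_phi[OF \<theta> F\<sigma>] using u[OF \<sigma>] F\<sigma> \<theta> by (simp del: nerve_map_apply F.vert_nerve_map)
    finally show ?thesis
      unfolding e act V um .
  qed
  then show ?thesis
    unfolding lax_cocone_def using c u by (simp add: hom_def)
qed

section \<open>Unique extension of a lax cocone over the companions\<close>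

context
  fixes c h
  assumes lax: "lax_cocone E J Fo Fa c h"
begin

lemma h_simps:
  assumes "\<sigma> \<in> NJ n"
  shows "h n \<sigma> \<in> Arr (total E)" "Dom (total E) (h n \<sigma>) = (n, degen_o E n (V (F n \<sigma>) 0))"
    "Cod (total E) (h n \<sigma>) = (0, c)"
  using lax assms by (auto simp: lax_cocone_def hom_def)

lemma h_act:
  assumes "\<theta> \<in> Delta m n" "\<sigma> \<in> NJ n"
  shows "h m (nerve_act m \<theta> \<sigma>) \<bullet> edge m (\<theta> 0) (F n \<sigma>) = h n \<sigma> \<bullet> kappa E m n \<theta> (V (F n \<sigma>) 0)"
  using lax assms Delta_le[OF assms(1), of 0] by (simp add: lax_cocone_def)

lemma h_act_0:
  assumes "\<theta> \<in> Delta m n" "\<sigma> \<in> NJ n" "\<theta> 0 = 0"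
  shows "h m (nerve_act m \<theta> \<sigma>) = h n \<sigma> \<bullet> kappa E m n \<theta> (V (F n \<sigma>) 0)"
proof -
  have "edge m (\<theta> 0) (F n \<sigma>) = Ide (total E) (m, degen_o E m (V (F n \<sigma>) 0))"
    using assms nerve_simp_Ide[OF F.nerve_map_in[OF assms(2)], of 0]
      lev.vert_Obj[OF F.nerve_map_in[OF assms(2)], of 0] by (simp del: nerve_map_apply F.vert_nerve_map)
  moreover have "nerve_act m \<theta> \<sigma> \<in> NJ m" using assms by simp
  ultimately show ?thesis
    using h_act[OF assms(1,2)] h_simps[of "nerve_act m \<theta> \<sigma>" m] assms by simp
qed

text \<open>The condition ranges over all maps into [n] and not only the identity. This makes it
  stable under the simplicial action, so that uniqueness on lower simplices yields the matching of
  faces.\<close>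

definition extends :: "nat \<Rightarrow> (nat \<times> nat \<Rightarrow> 'k) \<Rightarrow> nat \<times> 'a \<times> (nat \<Rightarrow> nat) \<times> nat \<times> 'o \<Rightarrow> bool" where
  "extends n \<sigma> u \<longleftrightarrow> u \<in> hom (total E) (n, C n (F n \<sigma>)) (0, c) \<and>
    (\<forall>m. \<forall>\<theta> \<in> Delta m n. u \<bullet> str m n \<theta> (F n \<sigma>) \<bullet> lift E m (\<phi> m (nerve_act m \<theta> (F n \<sigma>))) = h m (nerve_act m \<theta> \<sigma>))"

lemma extendsD:
  assumes "extends n \<sigma> u" "\<sigma> \<in> NJ n"
  shows "u \<in> Arr (total E)" "Dom (total E) u = (n, C n (F n \<sigma>))" "Cod (total E) u = (0, c)"
    "\<theta> \<in> Delta m n \<Longrightarrow> u \<bullet> str m n \<theta> (F n \<sigma>) \<bullet> lift E m (\<phi> m (nerve_act m \<theta> (F n \<sigma>))) = h m (nerve_act m \<theta> \<sigma>)"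
    "u \<bullet> lift E n (\<phi> n (F n \<sigma>)) = h n \<sigma>"
proof -
  show u: "u \<in> Arr (total E)" "Dom (total E) u = (n, C n (F n \<sigma>))" "Cod (total E) u = (0, c)"
    and *: "\<theta> \<in> Delta m n \<Longrightarrow> u \<bullet> str m n \<theta> (F n \<sigma>) \<bullet> lift E m (\<phi> m (nerve_act m \<theta> (F n \<sigma>))) = h m (nerve_act m \<theta> \<sigma>)" for m \<theta>
    using assms by (auto simp: extends_def hom_def)
  show "u \<bullet> lift E n (\<phi> n (F n \<sigma>)) = h n \<sigma>"
    using *[of "id_map n" n] u assms(2) F.nerve_map_in[OF assms(2)] nerve_act_id[OF F.nerve_map_in[OF assms(2)]]
    by (simp add: str_id)
qed

lemma extends_act:
  assumes u: "extends n \<sigma> u" and \<sigma>: "\<sigma> \<in> NJ n" and \<theta>: "\<theta> \<in> Delta m n"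
  shows "extends m (nerve_act m \<theta> \<sigma>) (u \<bullet> str m n \<theta> (F n \<sigma>))"
  unfolding extends_def
proof (intro conjI allI ballI)
  have F\<sigma>: "F n \<sigma> \<in> N n" using \<sigma> by simp
  have act: "F m (nerve_act m \<theta> \<sigma>) = nerve_act m \<theta> (F n \<sigma>)" by (rule nerve_act_map[OF \<theta>, symmetric])
  note uD = extendsD[OF u \<sigma>]
  show "u \<bullet> str m n \<theta> (F n \<sigma>) \<in> hom (total E) (m, C m (F m (nerve_act m \<theta> \<sigma>))) (0, c)"
    using uD(1-3) F\<sigma> \<theta> act by (simp add: hom_def)
  fix l \<tau> assume \<tau>: "\<tau> \<in> Delta l m"
  have \<theta>\<tau>: "compose {..l} \<theta> \<tau> \<in> Delta l n" by (rule compose_Delta[OF \<tau> \<theta>])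
  have \<theta>\<sigma>: "nerve_act m \<theta> (F n \<sigma>) \<in> N m" using F\<sigma> \<theta> by simp
  have "h l (nerve_act l \<tau> (nerve_act m \<theta> \<sigma>))
    = u \<bullet> str l n (compose {..l} \<theta> \<tau>) (F n \<sigma>) \<bullet> lift E l (\<phi> l (nerve_act l (compose {..l} \<theta> \<tau>) (F n \<sigma>)))"
    using uD(4)[OF \<theta>\<tau>] \<tau> by simp
  also have "\<dots> = (u \<bullet> str m n \<theta> (F n \<sigma>)) \<bullet> str l m \<tau> (nerve_act m \<theta> (F n \<sigma>)) \<bullet> lift E l (\<phi> l (nerve_act l \<tau> (nerve_act m \<theta> (F n \<sigma>))))"
    unfolding str_compose[OF \<tau> \<theta> F\<sigma>] nerve_act_act[OF \<tau>, symmetric]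
    using uD(1-3) str_simps[OF \<theta> F\<sigma>] str_simps[OF \<tau> \<theta>\<sigma>] companion_simps[OF nerve_act_in[OF \<theta>\<sigma> \<tau>]]
    by (simp del: nerve_act_act str_simps companion_simps)
  finally show "(u \<bullet> str m n \<theta> (F n \<sigma>)) \<bullet> str l m \<tau> (F m (nerve_act m \<theta> \<sigma>)) \<bullet> lift E l (\<phi> l (nerve_act l \<tau> (F m (nerve_act m \<theta> \<sigma>))))
    = h l (nerve_act l \<tau> (nerve_act m \<theta> \<sigma>))"
    unfolding act ..
qed

text \<open>No edge intervenes for a map that fixes 0, so the condition at \<theta> follows from the
  one at the identity by composing with \<open>kappa\<close>.\<close>

lemma extends_0:
  assumes "\<theta> \<in> Delta m n" "\<sigma> \<in> NJ n" "\<theta> 0 = 0" "u \<in> Arr (total E)" "Dom (total E) u = (n, C n (F n \<sigma>))"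
    "u \<bullet> lift E n (\<phi> n (F n \<sigma>)) = h n \<sigma>"
  shows "u \<bullet> str m n \<theta> (F n \<sigma>) \<bullet> lift E m (\<phi> m (nerve_act m \<theta> (F n \<sigma>))) = h m (nerve_act m \<theta> \<sigma>)"
proof -
  have F\<sigma>: "F n \<sigma> \<in> N n" using assms by simp
  have "u \<bullet> lift E n (\<phi> n (F n \<sigma>)) \<bullet> kappa E m n \<theta> (V (F n \<sigma>) 0)
    = (u \<bullet> lift E n (\<phi> n (F n \<sigma>))) \<bullet> kappa E m n \<theta> (V (F n \<sigma>) 0)"
    using assms(1-5) F\<sigma> by (simp del: F.vert_nerve_map F.nerve_map_in)
  then show ?thesis
    unfolding str_phi_0[OF assms(1) F\<sigma> assms(3)] h_act_0[OF assms(1-3)] assms(6) .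
qed

text \<open>The universal property of the companion is fed with \<open>h\<close> on \<sigma> and the
  unique extensions over the faces. For the resulting arrow, the condition at \<theta> comes from
  \<phi> when \<theta> is surjective and from a face otherwise.\<close>

lemma ex1_extends: "\<sigma> \<in> NJ n \<Longrightarrow> \<exists>!u. extends n \<sigma> u"
proof (induction n arbitrary: \<sigma> rule: less_induct)
  case (less n)
  note \<sigma> = \<open>\<sigma> \<in> NJ n\<close>
  have F\<sigma>: "F n \<sigma> \<in> N n" using \<sigma> by simp
  show ?case
  proof (cases n)
    case 0
    \<comment> \<open>In dimension 0 the arrow \<phi> is an identity, so \<open>h\<close> itself is
      the only candidate. Every map into [0] fixes 0, and \<open>extends_0\<close> covers them
      all.\<close>
    have \<phi>: "\<phi> 0 (F 0 \<sigma>) = Ide (lev E 0) (V (F 0 \<sigma>) 0)" "C 0 (F 0 \<sigma>) = V (F 0 \<sigma>) 0"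
      using companion_0 F\<sigma> 0 by simp_all
    note h = h_simps[OF \<sigma>]
    have \<phi>': "u \<bullet> lift E n (\<phi> n (F n \<sigma>)) = u" if "u \<in> Arr (total E)" "Dom (total E) u = (n, C n (F n \<sigma>))" for u
      using \<phi> F\<sigma> 0 that by (simp del: F.vert_nerve_map)
    have hD: "Dom (total E) (h n \<sigma>) = (n, C n (F n \<sigma>))"
      using h \<phi> 0 by simp
    show ?thesis
    proof (rule ex1I[of _ "h n \<sigma>"])
      show "extends n \<sigma> (h n \<sigma>)"
        unfolding extends_def
      proof (intro conjI allI ballI)
        show "h n \<sigma> \<in> hom (total E) (n, C n (F n \<sigma>)) (0, c)"
          using h hD by (simp add: hom_def)
        fix m \<theta> assume \<theta>: "\<theta> \<in> Delta m n"
        have "\<theta> 0 = 0" using Delta_le[OF \<theta>, of 0] 0 by simp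
        then show "h n \<sigma> \<bullet> str m n \<theta> (F n \<sigma>) \<bullet> lift E m (\<phi> m (nerve_act m \<theta> (F n \<sigma>))) = h m (nerve_act m \<theta> \<sigma>)"
          using extends_0[OF \<theta> \<sigma> _ h(1) hD] \<phi>'[OF h(1) hD] by simp
      qed
      show "u = h n \<sigma>" if "extends n \<sigma> u" for u
        using extendsD[OF that \<sigma>] \<phi>' by metis
    qed
  next
    case (Suc k)
    have \<sigma>': "\<sigma> \<in> NJ (Suc k)" "F (Suc k) \<sigma> \<in> N (Suc k)" using \<sigma> F\<sigma> Suc by simp_all
    let ?F = "F (Suc k) \<sigma>"
    have act: "d k j ?F = F k (d k j \<sigma>)" for j
      by (rule nerve_act_map[OF coface_Delta])
    have d\<sigma>: "d k j \<sigma> \<in> NJ k" for j using \<sigma>' by simp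
    have "\<exists>!u. extends k (d k j \<sigma>) u" for j
      using less.IH[OF _ d\<sigma>] Suc by simp
    then obtain g where g: "\<And>j. extends k (d k j \<sigma>) (g j)" and
      g_uniq: "\<And>j u. extends k (d k j \<sigma>) u \<Longrightarrow> u = g j"
      by metis
    note gD = extendsD[OF g d\<sigma>]
    have "\<exists>!u. u \<in> hom (total E) (Suc k, C (Suc k) ?F) (0, c) \<and> u \<bullet> lift E (Suc k) (\<phi> (Suc k) ?F) = h (Suc k) \<sigma> \<and>
      (\<forall>j\<le>Suc k. u \<bullet> cart E k (Suc k) (coface (Suc k) j) (C (Suc k) ?F) = g j)"
    proof (rule companion_universal[OF \<sigma>'(2)])
      show "h (Suc k) \<sigma> \<in> hom (total E) (Suc k, degen_o E (Suc k) (V ?F 0)) (0, c)"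
        using h_simps[OF \<sigma>'(1)] by (simp add: hom_def)
      show "g j \<in> hom (total E) (k, C k (d k j ?F)) (0, c)" for j
        unfolding act using gD(1-3) by (simp add: hom_def)
      show "h (Suc k) \<sigma> \<bullet> kappa E k (Suc k) (coface (Suc k) j) (V ?F 0)
        = g j \<bullet> lift E k (\<phi> k (d k j ?F)) \<bullet> edge k (coface (Suc k) j 0) ?F" if "j \<le> Suc k" for j
      proof -
        have Fd: "F k (d k j \<sigma>) \<in> N k" using d\<sigma> by simp
        have D: "Dom (lev E k) (\<phi> k (F k (d k j \<sigma>))) = degen_o E k (V ?F (coface (Suc k) j 0))"
          unfolding act[symmetric] using \<sigma>'(2) by (simp del: F.vert_nerve_map)
        have "g j \<bullet> lift E k (\<phi> k (F k (d k j \<sigma>))) \<bullet> edge k (coface (Suc k) j 0) ?F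
          = (g j \<bullet> lift E k (\<phi> k (F k (d k j \<sigma>)))) \<bullet> edge k (coface (Suc k) j 0) ?F"
          using gD(1-3) Fd D \<sigma>'(2) by (simp del: F.vert_nerve_map nerve_map_apply)
        then show ?thesis
          unfolding act gD(5) h_act[OF coface_Delta \<sigma>'(1), symmetric] by simp
      qed
      show "g j \<bullet> cart E l k (coface k i) (C k (d k j ?F)) = g i \<bullet> cart E l k (coface k (j - 1)) (C k (d k i ?F))"
        if k: "k = Suc l" and ij: "i < j" "j \<le> Suc k" for i j l
      proof -
        have cart: "cart E l k (coface k i') (C k (d k j' ?F)) = str l k (coface k i') (F k (d k j' \<sigma>))"
          if "i' \<le> k" for i' j'
          unfolding act using str_coface[of "F k (d k j' \<sigma>)" l i'] d\<sigma>[of j'] that k by simp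
        have cD: "coface k i' \<in> Delta l k" for i' using k by simp
        have eq: "nerve_act l (coface k i) (d k j \<sigma>) = nerve_act l (coface k (j - 1)) (d k i \<sigma>)"
          using face_face[of i j l] coface_coface[OF ij(1), of l] ij(2) k by simp
        \<comment> \<open>Both composites extend \<open>h\<close> over the same double face, so
          uniqueness in dimension \<open>l\<close> identifies them. This is the matching
          condition.\<close>
        have "extends l (nerve_act l (coface k i) (d k j \<sigma>)) (g j \<bullet> str l k (coface k i) (F k (d k j \<sigma>)))"
          by (rule extends_act[OF g d\<sigma> cD])
        moreover have "extends l (nerve_act l (coface k i) (d k j \<sigma>)) (g i \<bullet> str l k (coface k (j - 1)) (F k (d k i \<sigma>)))"
          unfolding eq by (rule extends_act[OF g d\<sigma> cD])
        moreover have "l < n" "nerve_act l (coface k i) (d k j \<sigma>) \<in> NJ l"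
          using Suc k nerve_act_in[OF d\<sigma> cD] by simp_all
        ultimately have "g j \<bullet> str l k (coface k i) (F k (d k j \<sigma>)) = g i \<bullet> str l k (coface k (j - 1)) (F k (d k i \<sigma>))"
          using less.IH by metis
        then show ?thesis using cart ij by simp
      qed
    qed
    then obtain u where uu: "u \<in> hom (total E) (Suc k, C (Suc k) ?F) (0, c)"
      "u \<bullet> lift E (Suc k) (\<phi> (Suc k) ?F) = h (Suc k) \<sigma>"
      "\<forall>j\<le>Suc k. u \<bullet> cart E k (Suc k) (coface (Suc k) j) (C (Suc k) ?F) = g j"
      by blast
    then have u: "u \<in> Arr (total E)" "Dom (total E) u = (Suc k, C (Suc k) ?F)" "Cod (total E) u = (0, c)"
      "u \<bullet> lift E (Suc k) (\<phi> (Suc k) ?F) = h (Suc k) \<sigma>"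
      "j \<le> Suc k \<Longrightarrow> u \<bullet> str k (Suc k) (coface (Suc k) j) ?F = g j" for j
      using str_coface[OF \<sigma>'(2)] by (simp_all add: hom_def)
    show ?thesis
      unfolding Suc
    proof (rule ex1I[of _ u])
      show "extends (Suc k) \<sigma> u"
        unfolding extends_def
      proof (intro conjI allI ballI)
        show "u \<in> hom (total E) (Suc k, C (Suc k) ?F) (0, c)"
          using u by (simp add: hom_def)
        fix m \<theta> assume \<theta>: "\<theta> \<in> Delta m (Suc k)"
        show "u \<bullet> str m (Suc k) \<theta> ?F \<bullet> lift E m (\<phi> m (nerve_act m \<theta> ?F)) = h m (nerve_act m \<theta> \<sigma>)"
        proof (cases "surj_map m (Suc k) \<theta>")
          case True
          then show ?thesis
            using extends_0[OF \<theta> \<sigma>'(1) surj_zero[OF \<theta> True] u(1,2,4)] by simp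
        next
          case False
          obtain k' j \<tau> where "Suc k = Suc k'" "j \<le> Suc k'" "\<tau> \<in> Delta m k'"
            "\<theta> = compose {..m} (coface (Suc k') j) \<tau>"
            by (rule not_surj_factor[OF \<theta> False])
          then have j: "j \<le> Suc k" and \<tau>: "\<tau> \<in> Delta m k" and \<theta>\<tau>: "\<theta> = compose {..m} (coface (Suc k) j) \<tau>"
            by simp_all
          have acts: "nerve_act m \<tau> (d k j ?F) = nerve_act m \<theta> ?F" "nerve_act m \<tau> (d k j \<sigma>) = nerve_act m \<theta> \<sigma>"
            using \<tau> \<theta>\<tau> by simp_all
          have dF: "d k j ?F \<in> N k" using \<sigma>'(2) by simp
          have "str m (Suc k) \<theta> ?F = str k (Suc k) (coface (Suc k) j) ?F \<bullet> str m k \<tau> (d k j ?F)"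
            unfolding \<theta>\<tau> by (rule str_compose[OF \<tau> coface_Delta \<sigma>'(2)])
          then have "u \<bullet> str m (Suc k) \<theta> ?F \<bullet> lift E m (\<phi> m (nerve_act m \<theta> ?F))
            = (u \<bullet> str k (Suc k) (coface (Suc k) j) ?F) \<bullet> str m k \<tau> (d k j ?F) \<bullet> lift E m (\<phi> m (nerve_act m \<tau> (d k j ?F)))"
            unfolding acts(1)[symmetric]
            using u(1-3) str_simps[OF coface_Delta \<sigma>'(2), of j] str_simps[OF \<tau> dF] companion_simps[OF nerve_act_in[OF dF \<tau>]]
            by (simp del: nerve_act_act str_simps companion_simps)
          also have "\<dots> = h m (nerve_act m \<tau> (d k j \<sigma>))"
            unfolding u(5)[OF j] using gD(4)[OF \<tau>] act by simp
          finally show ?thesis using acts by simp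
        qed
      qed
      fix v assume v: "extends (Suc k) \<sigma> v"
      note vD = extendsD[OF v \<sigma>'(1)]
      show "v = u"
      proof (rule companion_eqI[OF \<sigma>'(2)])
        show "v \<in> hom (total E) (Suc k, C (Suc k) ?F) (0, c)" "u \<in> hom (total E) (Suc k, C (Suc k) ?F) (0, c)"
          using vD(1-3) u(1-3) by (simp_all add: hom_def)
        show "v \<bullet> lift E (Suc k) (\<phi> (Suc k) ?F) = u \<bullet> lift E (Suc k) (\<phi> (Suc k) ?F)"
          using vD(5) u(4) by simp
        show "v \<bullet> cart E k (Suc k) (coface (Suc k) j) (C (Suc k) ?F) = u \<bullet> cart E k (Suc k) (coface (Suc k) j) (C (Suc k) ?F)"
          if "j \<le> Suc k" for j
          using g_uniq[OF extends_act[OF v \<sigma>'(1) coface_Delta, of j]] u(5)[OF that] str_coface[OF \<sigma>'(2) that] by simp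
      qed
    qed
  qed
qed

lemma total_cocone_extends:
  obtains u where "total_cocone c u" "\<And>n \<sigma>. \<sigma> \<in> NJ n \<Longrightarrow> u n \<sigma> \<bullet> lift E n (\<phi> n (F n \<sigma>)) = h n \<sigma>"
proof
  define u where "u n \<sigma> = (THE u. extends n \<sigma> u)" for n \<sigma>
  have u: "extends n \<sigma> (u n \<sigma>)" if "\<sigma> \<in> NJ n" for n \<sigma>
    unfolding u_def by (rule theI'[OF ex1_extends[OF that]])
  show "u n \<sigma> \<bullet> lift E n (\<phi> n (F n \<sigma>)) = h n \<sigma>" if "\<sigma> \<in> NJ n" for n \<sigma>
    by (rule extendsD(5)[OF u[OF that] that])
  have "u m (nerve_act m \<theta> \<sigma>) = u n \<sigma> \<bullet> str m n \<theta> (F n \<sigma>)" if "\<theta> \<in> Delta m n" "\<sigma> \<in> NJ n" for m n \<theta> \<sigma>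
    using u ex1_extends nerve_act_in[OF that(2,1)] extends_act[OF u[OF that(2)] that(2,1)] by metis
  moreover have "u n \<sigma> \<in> hom (total E) (n, C n (F n \<sigma>)) (0, c)" if "\<sigma> \<in> NJ n" for n \<sigma>
    using u[OF that] by (simp add: extends_def)
  ultimately show "total_cocone c u"
    using lax by (simp add: total_cocone_def lax_cocone_def)
qed

end

text \<open>By compatibility with \<open>str\<close>, each component of a cocone satisfies the full
  condition \<open>extends\<close> for its restriction along \<phi>. Equal restrictions thus lead to
  the same unique extension.\<close>

lemma total_cocone_eqI:
  assumes u: "total_cocone c u" and v: "total_cocone c v"
    and eq: "\<And>n \<sigma>. \<sigma> \<in> NJ n \<Longrightarrow> u n \<sigma> \<bullet> lift E n (\<phi> n (F n \<sigma>)) = v n \<sigma> \<bullet> lift E n (\<phi> n (F n \<sigma>))"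
    and \<sigma>: "\<sigma> \<in> NJ n"
  shows "u n \<sigma> = v n \<sigma>"
proof -
  let ?h = "\<lambda>n \<sigma>. u n \<sigma> \<bullet> lift E n (\<phi> n (F n \<sigma>))"
  have lax: "lax_cocone E J Fo Fa c ?h" by (rule total_cocone_phi[OF u])
  have "extends c ?h n \<sigma> (w n \<sigma>)"
    if w: "total_cocone c w" "\<And>n \<sigma>. \<sigma> \<in> NJ n \<Longrightarrow> ?h n \<sigma> = w n \<sigma> \<bullet> lift E n (\<phi> n (F n \<sigma>))" for w
    unfolding extends_def[OF lax]
  proof (intro conjI allI ballI)
    show w': "w n \<sigma> \<in> hom (total E) (n, C n (F n \<sigma>)) (0, c)"
      using w(1) \<sigma> by (simp add: total_cocone_def)
    fix m \<theta> assume \<theta>: "\<theta> \<in> Delta m n"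
    have F\<sigma>: "F n \<sigma> \<in> N n" using \<sigma> by simp
    have "?h m (nerve_act m \<theta> \<sigma>) = (w n \<sigma> \<bullet> str m n \<theta> (F n \<sigma>)) \<bullet> lift E m (\<phi> m (nerve_act m \<theta> (F n \<sigma>)))"
      using w(1) w(2)[OF nerve_act_in[OF \<sigma> \<theta>]] \<theta> \<sigma> by (simp add: total_cocone_def flip: nerve_act_map)
    then show "w n \<sigma> \<bullet> str m n \<theta> (F n \<sigma>) \<bullet> lift E m (\<phi> m (nerve_act m \<theta> (F n \<sigma>))) = ?h m (nerve_act m \<theta> \<sigma>)"
      using w' F\<sigma> \<theta> by (simp add: hom_def)
  qed
  from this[OF u refl] this[OF v eq] show ?thesis
    using ex1_extends[OF lax \<sigma>] by blast
qed

lemma total_cocone_lift: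
  assumes u: "total_cocone D u" and f: "f \<in> hom (lev E 0) D c"
  shows "total_cocone c (\<lambda>n \<sigma>. lift E 0 f \<bullet> u n \<sigma>)"
proof -
  have f': "f \<in> Arr (lev E 0)" "Dom (lev E 0) f = D" "Cod (lev E 0) f = c"
    using f by (auto simp: hom_def)
  have u': "u n \<sigma> \<in> Arr (total E)" "Dom (total E) (u n \<sigma>) = (n, C n (F n \<sigma>))" "Cod (total E) (u n \<sigma>) = (0, D)"
    if "\<sigma> \<in> NJ n" for n \<sigma>
    using u that by (auto simp: total_cocone_def hom_def)
  have "c \<in> Obj (lev E 0)" using f' lev.Cod_in by blast
  then show ?thesis
    using u f' u' by (auto simp: total_cocone_def hom_def)
qed

text \<open>Passage to (0, c) and restriction along \<phi> are both injective and commute with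
  postcomposition by \<open>f\<close>. A mediating arrow can therefore be tested on either kind of
  cocone.\<close>

lemma degen_eq_iff:
  assumes \<eta>: "diagram_cocone E J G \<psi>' D \<eta>" and \<eta>': "diagram_cocone E J G \<psi>' c \<eta>'" and f: "f \<in> hom (lev E 0) D c"
  shows "(\<forall>n. \<forall>\<sigma> \<in> NJ n. degen_a E n f \<cdot>\<^bsub>lev E n\<^esub> \<eta> n \<sigma> = \<eta>' n \<sigma>) \<longleftrightarrow>
    (\<forall>n. \<forall>\<sigma> \<in> NJ n. lift E 0 f \<bullet> (point E n D \<bullet> lift E n (\<eta> n \<sigma>)) \<bullet> lift E n (\<phi> n (F n \<sigma>))
      = (point E n c \<bullet> lift E n (\<eta>' n \<sigma>)) \<bullet> lift E n (\<phi> n (F n \<sigma>)))" (is "?L \<longleftrightarrow> ?R")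
proof -
  have f': "f \<in> Arr (lev E 0)" "Dom (lev E 0) f = D" "Cod (lev E 0) f = c"
    using f by (auto simp: hom_def)
  have Dc: "D \<in> Obj (lev E 0)" "c \<in> Obj (lev E 0)"
    using \<eta> \<eta>' by (auto simp: diagram_cocone_def)
  note u = diagram_cocone_iff[THEN iffD1, OF \<eta>] and u' = diagram_cocone_iff[THEN iffD1, OF \<eta>']
  have e: "\<eta> n \<sigma> \<in> Arr (lev E n)" "Dom (lev E n) (\<eta> n \<sigma>) = C n (F n \<sigma>)" "Cod (lev E n) (\<eta> n \<sigma>) = degen_o E n D"
    "\<eta>' n \<sigma> \<in> Arr (lev E n)" "Dom (lev E n) (\<eta>' n \<sigma>) = C n (F n \<sigma>)" "Cod (lev E n) (\<eta>' n \<sigma>) = degen_o E n c"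
    if "\<sigma> \<in> NJ n" for n \<sigma>
    using u u' that by (auto simp: hom_def)
  have *: "lift E 0 f \<bullet> point E n D \<bullet> lift E n (\<eta> n \<sigma>) = point E n c \<bullet> lift E n (degen_a E n f \<cdot>\<^bsub>lev E n\<^esub> \<eta> n \<sigma>)"
    if "\<sigma> \<in> NJ n" for n \<sigma>
    using T.Comp_eq_right[OF point_natural[OF f'(1), of n], of "lift E n (\<eta> n \<sigma>)"] f' Dc e[OF that] by simp
  have "?L \<longleftrightarrow> (\<forall>n. \<forall>\<sigma> \<in> NJ n. lift E 0 f \<bullet> point E n D \<bullet> lift E n (\<eta> n \<sigma>) = point E n c \<bullet> lift E n (\<eta>' n \<sigma>))"
  proof -
    have "degen_a E n f \<cdot>\<^bsub>lev E n\<^esub> \<eta> n \<sigma> = \<eta>' n \<sigma> \<longleftrightarrow>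
      point E n c \<bullet> lift E n (degen_a E n f \<cdot>\<^bsub>lev E n\<^esub> \<eta> n \<sigma>) = point E n c \<bullet> lift E n (\<eta>' n \<sigma>)"
      if "\<sigma> \<in> NJ n" for n \<sigma>
      by (rule point_lift_iff) (use f' Dc e[OF that] in simp_all)
    then show ?thesis using * by simp
  qed
  also have "\<dots> \<longleftrightarrow> ?R"
  proof
    assume L: "\<forall>n. \<forall>\<sigma> \<in> NJ n. lift E 0 f \<bullet> point E n D \<bullet> lift E n (\<eta> n \<sigma>) = point E n c \<bullet> lift E n (\<eta>' n \<sigma>)"
    show ?R
    proof (intro allI ballI)
      fix n \<sigma> assume \<sigma>: "\<sigma> \<in> NJ n"
      have "lift E 0 f \<bullet> (point E n D \<bullet> lift E n (\<eta> n \<sigma>)) \<bullet> lift E n (\<phi> n (F n \<sigma>))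
        = (lift E 0 f \<bullet> point E n D \<bullet> lift E n (\<eta> n \<sigma>)) \<bullet> lift E n (\<phi> n (F n \<sigma>))"
        using e[OF \<sigma>] Dc f' F.nerve_map_in[OF \<sigma>] by simp
      then show "lift E 0 f \<bullet> (point E n D \<bullet> lift E n (\<eta> n \<sigma>)) \<bullet> lift E n (\<phi> n (F n \<sigma>))
        = (point E n c \<bullet> lift E n (\<eta>' n \<sigma>)) \<bullet> lift E n (\<phi> n (F n \<sigma>))"
        using L \<sigma> by simp
    qed
  next
    assume R: ?R
    show "\<forall>n. \<forall>\<sigma> \<in> NJ n. lift E 0 f \<bullet> point E n D \<bullet> lift E n (\<eta> n \<sigma>) = point E n c \<bullet> lift E n (\<eta>' n \<sigma>)"
    proof (intro allI ballI)
      fix n \<sigma> assume \<sigma>: "\<sigma> \<in> NJ n"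
      show "lift E 0 f \<bullet> point E n D \<bullet> lift E n (\<eta> n \<sigma>) = point E n c \<bullet> lift E n (\<eta>' n \<sigma>)"
      proof (rule total_cocone_eqI[OF total_cocone_lift[OF conjunct2[OF u] f] conjunct2[OF u'] _ \<sigma>])
        fix m \<tau> assume \<tau>: "\<tau> \<in> NJ m"
        have "(lift E 0 f \<bullet> point E m D \<bullet> lift E m (\<eta> m \<tau>)) \<bullet> lift E m (\<phi> m (F m \<tau>))
          = lift E 0 f \<bullet> (point E m D \<bullet> lift E m (\<eta> m \<tau>)) \<bullet> lift E m (\<phi> m (F m \<tau>))"
          using e[OF \<tau>] Dc f' F.nerve_map_in[OF \<tau>] by simp
        then show "(lift E 0 f \<bullet> point E m D \<bullet> lift E m (\<eta> m \<tau>)) \<bullet> lift E m (\<phi> m (F m \<tau>))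
          = (point E m c \<bullet> lift E m (\<eta>' m \<tau>)) \<bullet> lift E m (\<phi> m (F m \<tau>))"
          using R \<tau> by simp
      qed
    qed
  qed
  finally show ?thesis .
qed

text \<open>Restriction along \<phi> and extension over the companions make the two kinds of cocone
  correspond, and \<open>degen_eq_iff\<close> identifies their mediating arrows; so universality
  passes in both directions.\<close>

lemma dcolim_iff_lax_colimit: "is_dcolim E J G \<psi>' D \<longleftrightarrow> lax_colimit E J Fo Fa D"
proof
  assume "is_dcolim E J G \<psi>' D"
  then obtain \<eta> where \<eta>: "diagram_cocone E J G \<psi>' D \<eta>"
    and univ: "\<And>c \<eta>'. diagram_cocone E J G \<psi>' c \<eta>' \<Longrightarrow> \<exists>!f. f \<in> hom (lev E 0) D c \<and>
             (\<forall>n. \<forall>\<sigma> \<in> NJ n. degen_a E n f \<cdot>\<^bsub>lev E n\<^esub> \<eta> n \<sigma> = \<eta>' n \<sigma>)"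
    unfolding is_dcolim_def by blast
  let ?h = "\<lambda>n \<sigma>. (point E n D \<bullet> lift E n (\<eta> n \<sigma>)) \<bullet> lift E n (\<phi> n (F n \<sigma>))"
  show "lax_colimit E J Fo Fa D"
    unfolding lax_colimit_def
  proof (intro exI[of _ ?h] conjI allI impI)
    show "lax_cocone E J Fo Fa D ?h"
      using total_cocone_phi diagram_cocone_iff \<eta> by blast
    fix c h' assume h': "lax_cocone E J Fo Fa c h'"
    obtain u' where u': "total_cocone c u'" "\<And>n \<sigma>. \<sigma> \<in> NJ n \<Longrightarrow> u' n \<sigma> \<bullet> lift E n (\<phi> n (F n \<sigma>)) = h' n \<sigma>"
      using total_cocone_extends[OF h'] by blast
    obtain \<eta>' where \<eta>': "diagram_cocone E J G \<psi>' c \<eta>'" "\<And>n \<sigma>. \<sigma> \<in> NJ n \<Longrightarrow> u' n \<sigma> = point E n c \<bullet> lift E n (\<eta>' n \<sigma>)"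
      using total_cocone_point[OF u'(1)] by blast
    have "f \<in> hom (lev E 0) D c \<and> (\<forall>n. \<forall>\<sigma> \<in> NJ n. degen_a E n f \<cdot>\<^bsub>lev E n\<^esub> \<eta> n \<sigma> = \<eta>' n \<sigma>) \<longleftrightarrow>
      f \<in> hom (lev E 0) D c \<and> (\<forall>n. \<forall>\<sigma> \<in> NJ n. lift E 0 f \<bullet> ?h n \<sigma> = h' n \<sigma>)" for f
      using degen_eq_iff[OF \<eta> \<eta>'(1), of f] by (auto simp: u'(2)[symmetric] \<eta>'(2))
    then show "\<exists>!f. f \<in> hom (lev E 0) D c \<and> (\<forall>n. \<forall>\<sigma> \<in> NJ n. lift E 0 f \<bullet> ?h n \<sigma> = h' n \<sigma>)"
      using univ[OF \<eta>'(1)] by simp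
  qed
next
  assume "lax_colimit E J Fo Fa D"
  then obtain h where h: "lax_cocone E J Fo Fa D h"
    and univ: "\<And>c h'. lax_cocone E J Fo Fa c h' \<Longrightarrow>
        \<exists>!f. f \<in> hom (lev E 0) D c \<and> (\<forall>n. \<forall>\<sigma> \<in> NJ n. lift E 0 f \<bullet> h n \<sigma> = h' n \<sigma>)"
    unfolding lax_colimit_def by blast
  obtain u where u: "total_cocone D u" "\<And>n \<sigma>. \<sigma> \<in> NJ n \<Longrightarrow> u n \<sigma> \<bullet> lift E n (\<phi> n (F n \<sigma>)) = h n \<sigma>"
    using total_cocone_extends[OF h] by blast
  obtain \<eta> where \<eta>: "diagram_cocone E J G \<psi>' D \<eta>" "\<And>n \<sigma>. \<sigma> \<in> NJ n \<Longrightarrow> u n \<sigma> = point E n D \<bullet> lift E n (\<eta> n \<sigma>)"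
    using total_cocone_point[OF u(1)] by blast
  show "is_dcolim E J G \<psi>' D"
    unfolding is_dcolim_def
  proof (intro exI[of _ \<eta>] conjI allI impI oplax_diagram \<eta>(1))
    fix c \<eta>' assume \<eta>': "diagram_cocone E J G \<psi>' c \<eta>'"
    let ?h' = "\<lambda>n \<sigma>. (point E n c \<bullet> lift E n (\<eta>' n \<sigma>)) \<bullet> lift E n (\<phi> n (F n \<sigma>))"
    have "lax_cocone E J Fo Fa c ?h'"
      using total_cocone_phi diagram_cocone_iff \<eta>' by blast
    note ex1 = univ[OF this]
    have "f \<in> hom (lev E 0) D c \<and> (\<forall>n. \<forall>\<sigma> \<in> NJ n. degen_a E n f \<cdot>\<^bsub>lev E n\<^esub> \<eta> n \<sigma> = \<eta>' n \<sigma>) \<longleftrightarrow>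
      f \<in> hom (lev E 0) D c \<and> (\<forall>n. \<forall>\<sigma> \<in> NJ n. lift E 0 f \<bullet> h n \<sigma> = ?h' n \<sigma>)" for f
      using degen_eq_iff[OF \<eta>(1) \<eta>', of f] by (auto simp: u(2)[symmetric] \<eta>(2))
    then show "\<exists>!f. f \<in> hom (lev E 0) D c \<and> (\<forall>n. \<forall>\<sigma> \<in> NJ n. degen_a E n f \<cdot>\<^bsub>lev E n\<^esub> \<eta> n \<sigma> = \<eta>' n \<sigma>)"
      using ex1 by simp
  qed
qed

end

section \<open>Simplices of coslices\<close>

lemma coslice_simps:
  "(j, f) \<in> Obj (coslice J i) \<longleftrightarrow> f \<in> hom J i j"
  "((j, f), u, (k, g)) \<in> Arr (coslice J i) \<longleftrightarrow> f \<in> hom J i j \<and> g \<in> hom J i k \<and> u \<in> hom J j k \<and> u \<cdot>\<^bsub>J\<^esub> f = g"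
  "Dom (coslice J i) (x, u, y) = x"
  "Cod (coslice J i) (x, u, y) = y"
  "Ide (coslice J i) (j, f) = ((j, f), Ide J j, (j, f))"
  "(b, v, c) \<cdot>\<^bsub>coslice J i\<^esub> (a, u, b') = (a, v \<cdot>\<^bsub>J\<^esub> u, c)"
  by (auto simp: coslice_def)

text \<open>The structure arrows are forced by the first one: over vertex p it has to be
  \<open>f\<close> followed by \<sigma> (0, p).\<close>

definition coslice_simplex :: "('j, 'k) cat \<Rightarrow> nat \<Rightarrow> 'k \<Rightarrow> (nat \<times> nat \<Rightarrow> 'k) \<Rightarrow> nat \<times> nat \<Rightarrow> ('j \<times> 'k) \<times> 'k \<times> ('j \<times> 'k)" where
  "coslice_simplex J n f \<sigma> = (\<lambda>(p, q) \<in> tri n. ((vert J \<sigma> p, \<sigma> (0, p) \<cdot>\<^bsub>J\<^esub> f), \<sigma> (p, q), (vert J \<sigma> q, \<sigma> (0, q) \<cdot>\<^bsub>J\<^esub> f)))"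

lemma coslice_simplex_apply: "p \<le> q \<Longrightarrow> q \<le> n \<Longrightarrow>
  coslice_simplex J n f \<sigma> (p, q) = ((vert J \<sigma> p, \<sigma> (0, p) \<cdot>\<^bsub>J\<^esub> f), \<sigma> (p, q), (vert J \<sigma> q, \<sigma> (0, q) \<cdot>\<^bsub>J\<^esub> f))"
  by (simp add: coslice_simplex_def tri_def)

context category
begin

lemma coslice_simplex_in:
  assumes \<sigma>: "\<sigma> \<in> nerve_simp C n" and f: "f \<in> hom C i (vert C \<sigma> 0)"
  shows "coslice_simplex C n f \<sigma> \<in> nerve_simp (coslice C i) n"
proof -
  have f': "f \<in> Arr C" "Dom C f = i" "Cod C f = vert C \<sigma> 0"
    using f by (auto simp: hom_def)
  have comp: "\<sigma> (p, q) \<cdot> \<sigma> (0, p) \<cdot> f = \<sigma> (0, q) \<cdot> f" if "p \<le> q" "q \<le> n" for p q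
    using Comp_assoc_right[of f "\<sigma> (0, p)" "\<sigma> (p, q)"] nerve_simp_Comp[OF \<sigma>, of 0 p q] \<sigma> f' that by simp
  have arr: "coslice_simplex C n f \<sigma> (p, q) \<in> Arr (coslice C i)" if "p \<le> q" "q \<le> n" for p q
    using \<sigma> f' that comp[OF that] by (simp add: coslice_simplex_apply coslice_simps hom_def)
  have vert: "vert (coslice C i) (coslice_simplex C n f \<sigma>) p = (vert C \<sigma> p, \<sigma> (0, p) \<cdot> f)" if "p \<le> n" for p
    using that by (simp add: vert_def[of "coslice C i"] coslice_simplex_apply coslice_simps)
  have "coslice_simplex C n f \<sigma> \<in> extensional (tri n)"
    by (simp add: coslice_simplex_def)
  moreover have "coslice_simplex C n f \<sigma> \<in> tri n \<rightarrow> Arr (coslice C i)"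
    using arr by (auto simp: tri_def)
  ultimately have "coslice_simplex C n f \<sigma> \<in> tri n \<rightarrow>\<^sub>E Arr (coslice C i)"
    by (simp add: PiE_def)
  moreover have "coslice_simplex C n f \<sigma> (p, q) \<in> hom (coslice C i) (vert (coslice C i) (coslice_simplex C n f \<sigma>) p) (vert (coslice C i) (coslice_simplex C n f \<sigma>) q)"
    if "p \<le> q" "q \<le> n" for p q
    using arr[OF that] that by (simp add: hom_def vert) (simp add: coslice_simplex_apply coslice_simps)
  moreover have "coslice_simplex C n f \<sigma> (p, p) = Ide (coslice C i) (vert (coslice C i) (coslice_simplex C n f \<sigma>) p)" if "p \<le> n" for p
    using that nerve_simp_Ide[OF \<sigma> that] by (simp add: vert coslice_simplex_apply coslice_simps)
  moreover have "coslice_simplex C n f \<sigma> (q, r) \<cdot>\<^bsub>coslice C i\<^esub> coslice_simplex C n f \<sigma> (p, q) = coslice_simplex C n f \<sigma> (p, r)"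
    if "p \<le> q" "q \<le> r" "r \<le> n" for p q r
    using that nerve_simp_Comp[OF \<sigma> that] by (simp add: coslice_simplex_apply coslice_simps)
  ultimately show ?thesis
    unfolding nerve_simp_def by blast
qed

lemma coslice_homE:
  assumes "f \<in> hom (coslice C i) x y"
  obtains j a u k b where "x = (j, a)" "y = (k, b)" "f = ((j, a), u, (k, b))"
    "a \<in> hom C i j" "b \<in> hom C i k" "u \<in> hom C j k" "u \<cdot> a = b"
proof -
  obtain j a u k b where f: "f = ((j, a), u, (k, b))" by (metis prod.exhaust)
  have xy: "x = (j, a)" "y = (k, b)" and "f \<in> Arr (coslice C i)"
    using assms unfolding hom_def f by (auto simp: coslice_simps)
  then show ?thesis
    using that[OF xy f] unfolding f coslice_simps by blast
qed

lemma coslice_homI: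
  "a \<in> hom C i j \<Longrightarrow> b \<in> hom C i k \<Longrightarrow> u \<in> hom C j k \<Longrightarrow> u \<cdot> a = b \<Longrightarrow>
    ((j, a), u, (k, b)) \<in> hom (coslice C i) (j, a) (k, b)"
  by (simp add: hom_def[of "coslice C i"] coslice_simps)

lemma category_coslice: "category (coslice C i)"
proof (unfold_locales, goal_cases)
  case (1 f)
  then show ?case by (cases f) (auto simp: coslice_simps)
next
  case (2 f)
  then show ?case by (cases f) (auto simp: coslice_simps)
next
  case (3 x)
  obtain j a where x: "x = (j, a)" by (cases x)
  then have a: "a \<in> hom C i j" using 3 by (simp add: coslice_simps)
  then have "j \<in> Obj C" using Cod_in by (auto simp: hom_def)
  then show ?case
    using coslice_homI[OF a a Ide_in Ide_Comp[OF a]] by (simp add: x coslice_simps)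
next
  case (4 f x y g z)
  obtain j a u k b where f: "x = (j, a)" "y = (k, b)" "f = ((j, a), u, (k, b))"
    "a \<in> hom C i j" "b \<in> hom C i k" "u \<in> hom C j k" "u \<cdot> a = b"
    using 4(1) by (rule coslice_homE)
  obtain v l c where g: "z = (l, c)" "g = ((k, b), v, (l, c))"
    "c \<in> hom C i l" "v \<in> hom C k l" "v \<cdot> b = c"
    using 4(2) f(2) by (auto elim: coslice_homE)
  have "(v \<cdot> u) \<cdot> a = c"
    using Comp_assoc[OF f(4,6) g(4)] f(7) g(5) by simp
  then show ?case
    using coslice_homI[OF f(4) g(3) Comp_in[OF f(6) g(4)]] by (simp add: f(1,3) g(1,2) coslice_simps)
next
  case (5 f x y)
  then show ?case by (elim coslice_homE) (simp add: coslice_simps Comp_Ide)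
next
  case (6 f x y)
  then show ?case by (elim coslice_homE) (simp add: coslice_simps Ide_Comp)
next
  case (7 f w x g y h z)
  then show ?case by (elim coslice_homE) (simp add: coslice_simps Comp_assoc)
qed

lemma forget_functor: "is_functor (coslice C i) C fst (\<lambda>a. fst (snd a))"
proof -
  interpret S: category "coslice C i" by (rule category_coslice)
  show ?thesis
  proof (unfold_locales, goal_cases)
    case (1 x)
    then show ?case using Cod_in by (cases x) (auto simp: coslice_simps hom_def)
  next
    case (2 f x y)
    then show ?case by (elim coslice_homE) simp
  next
    case (3 x)
    then show ?case by (cases x) (simp add: coslice_simps)
  next
    case (4 f x y g z)
    then show ?case by (elim coslice_homE) (simp add: coslice_simps)
  qed
qed

text \<open>The forgetful functor recovers \<sigma>, and the structure arrow of vertex 0 is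
  \<open>f\<close>. Commutativity of the triangles from vertex 0 determines the remaining structure
  arrows.\<close>

lemma coslice_simplex_cases:
  assumes a: "a \<in> nerve_simp (coslice C i) n"
  obtains \<sigma> f where "\<sigma> \<in> nerve_simp C n" "f \<in> hom C i (vert C \<sigma> 0)" "a = coslice_simplex C n f \<sigma>"
proof -
  interpret U: is_functor "coslice C i" C fst "\<lambda>a. fst (snd a)" by (rule forget_functor)
  let ?\<sigma> = "nerve_map (\<lambda>a. fst (snd a)) n a" and ?v = "vert (coslice C i) a"
  let ?f = "snd (?v 0)"
  have \<sigma>: "?\<sigma> \<in> nerve_simp C n" using a by simp
  have v: "vert C ?\<sigma> p = fst (?v p)" if "p \<le> n" for p using a that by simp
  have arr: "a (p, q) \<in> hom (coslice C i) (?v p) (?v q)" if "p \<le> q" "q \<le> n" for p q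
    using a that by (simp add: hom_def)
  have f: "?f \<in> hom C i (vert C ?\<sigma> 0)"
    using coslice_homE[OF arr[of 0 0]] v[of 0] by (metis fst_conv snd_conv le0)
  have "a = coslice_simplex C n ?f ?\<sigma>"
  proof (rule nerve_simp_eqI[OF a coslice_simplex_in[OF \<sigma> f]])
    fix p q assume pq: "p \<le> q" "q \<le> n"
    have "fst (snd (a (0, r))) \<cdot> ?f = snd (?v r)" if "r \<le> n" for r
      using coslice_homE[OF arr[of 0 r]] that by (metis fst_conv snd_conv le0)
    moreover have "a (p, q) = (?v p, fst (snd (a (p, q))), ?v q)"
      using coslice_homE[OF arr[OF pq]] by (metis fst_conv snd_conv)
    ultimately show "a (p, q) = coslice_simplex C n ?f ?\<sigma> (p, q)"
      using pq v by (simp add: coslice_simplex_apply)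
  qed
  with \<sigma> f show ?thesis using that by blast
qed

text \<open>Restriction along \<theta> moves the initial vertex from 0 to \<theta> 0, so
  \<open>f\<close> is followed by the edge between them. This is the origin of the initial edge on
  the side of the homotopy colimit.\<close>

lemma coslice_simplex_act:
  assumes "\<sigma> \<in> nerve_simp C n" "f \<in> hom C i (vert C \<sigma> 0)" "\<theta> \<in> Delta m n"
  shows "nerve_act m \<theta> (coslice_simplex C n f \<sigma>) = coslice_simplex C m (\<sigma> (0, \<theta> 0) \<cdot> f) (nerve_act m \<theta> \<sigma>)"
proof (rule ext)
  fix x :: "nat \<times> nat"
  obtain p q where x: "x = (p, q)" by (cases x)
  show "nerve_act m \<theta> (coslice_simplex C n f \<sigma>) x = coslice_simplex C m (\<sigma> (0, \<theta> 0) \<cdot> f) (nerve_act m \<theta> \<sigma>) x"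
  proof (cases "p \<le> q \<and> q \<le> m")
    case False
    then have "x \<notin> tri m" by (auto simp: x tri_def)
    then show ?thesis by (simp add: nerve_act_def coslice_simplex_def)
  next
    case True
    then have le: "\<theta> p \<le> \<theta> q" "\<theta> q \<le> n" "\<theta> 0 \<le> \<theta> p" "\<theta> 0 \<le> \<theta> q" "\<theta> p \<le> n" "\<theta> 0 \<le> n"
      using Delta_le[OF assms(3)] Delta_mono[OF assms(3)] by simp_all
    have "\<sigma> (\<theta> 0, r) \<cdot> \<sigma> (0, \<theta> 0) \<cdot> f = \<sigma> (0, r) \<cdot> f" if "\<theta> 0 \<le> r" "r \<le> n" for r
      using Comp_assoc_right[of f "\<sigma> (0, \<theta> 0)" "\<sigma> (\<theta> 0, r)"] nerve_simp_Comp[OF assms(1), of 0 "\<theta> 0" r] assms(1,2) le that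
      by (simp add: hom_def)
    then show ?thesis
      using True le by (simp add: x coslice_simplex_apply)
  qed
qed

lemma coslice_simplex_map:
  assumes "\<sigma> \<in> nerve_simp C n" "f \<in> hom C i (vert C \<sigma> 0)" "w \<in> hom C i' i"
  shows "nerve_map (coslice_map C w) n (coslice_simplex C n f \<sigma>) = coslice_simplex C n (f \<cdot> w) \<sigma>"
proof (rule ext)
  fix x :: "nat \<times> nat"
  obtain p q where x: "x = (p, q)" by (cases x)
  show "nerve_map (coslice_map C w) n (coslice_simplex C n f \<sigma>) x = coslice_simplex C n (f \<cdot> w) \<sigma> x"
  proof (cases "p \<le> q \<and> q \<le> n")
    case False
    then have "x \<notin> tri n" by (auto simp: x tri_def)
    then show ?thesis by (simp add: nerve_map_def coslice_simplex_def)
  next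
    case True
    have "(\<sigma> (0, r) \<cdot> f) \<cdot> w = \<sigma> (0, r) \<cdot> f \<cdot> w" if "r \<le> n" for r
      using assms that by (simp add: hom_def)
    then show ?thesis
      using True by (simp add: x coslice_simplex_apply coslice_map_def)
  qed
qed

lemma coslice_simplex_inverse:
  assumes "\<sigma> \<in> nerve_simp C n" "f \<in> hom C i (vert C \<sigma> 0)"
  shows "nerve_map (\<lambda>a. fst (snd a)) n (coslice_simplex C n f \<sigma>) = \<sigma>" "snd (fst (coslice_simplex C n f \<sigma> (0, 0))) = f"
proof -
  show "snd (fst (coslice_simplex C n f \<sigma> (0, 0))) = f"
    using assms by (simp add: coslice_simplex_apply nerve_simp_Ide[of \<sigma>] hom_def)
  have "\<sigma> \<in> extensional (tri n)" using assms(1) by (simp add: nerve_simp_def PiE_def)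
  then show "nerve_map (\<lambda>a. fst (snd a)) n (coslice_simplex C n f \<sigma>) = \<sigma>"
    by (auto simp: nerve_map_def coslice_simplex_def extensional_def fun_eq_iff)
qed

end

section \<open>Mapping spaces and tensors\<close>

text \<open>The record \<open>sset\<close> carries no axioms, so it has to be required separately
  that the operators preserve simplices.\<close>

definition act_closed :: "'k sset \<Rightarrow> bool" where
  "act_closed K \<longleftrightarrow> (\<forall>m n. \<forall>\<theta> \<in> Delta m n. \<forall>a \<in> simp K n. sact K m n \<theta> a \<in> simp K m)"

lemma act_closed_nerve: "act_closed (nerve C)"
  by (simp add: act_closed_def nerve_def)

context simplicial_category
begin

text \<open>Conjugation by \<open>const_iso\<close> in the mapping space becomes precomposition with
  \<open>kappa\<close> once \<open>point\<close> is applied, so simplicial maps into it obey a law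
  of the same shape as lax cocones.\<close>

lemma point_mapping_act:
  assumes "x \<in> Obj (lev E 0)" "y \<in> Obj (lev E 0)" "\<theta> \<in> Delta m n" "h \<in> simp (mapping_sset E x y) n"
  shows "point E m y \<bullet> lift E m (sact (mapping_sset E x y) m n \<theta> h) = point E n y \<bullet> lift E n h \<bullet> kappa E m n \<theta> x"
    and "sact (mapping_sset E x y) m n \<theta> h \<in> simp (mapping_sset E x y) m"
proof -
  have h: "h \<in> Arr (lev E n)" "Dom (lev E n) h = degen_o E n x" "Cod (lev E n) h = degen_o E n y"
    using assms(4) by (auto simp: mapping_sset_def hom_def)
  let ?i = "inv_arrow (lev E m) (const_iso E m n \<theta> x)"
  show "sact (mapping_sset E x y) m n \<theta> h \<in> simp (mapping_sset E x y) m"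
    using assms(1-3) h by (simp add: mapping_sset_def hom_def)
  have "point E m y \<bullet> lift E m (sact (mapping_sset E x y) m n \<theta> h)
    = point E m y \<bullet> lift E m (const_iso E m n \<theta> y) \<bullet> lift E m (opa E m n \<theta> h) \<bullet> lift E m ?i"
    using assms(1-3) h by (simp add: mapping_sset_def)
  also have "\<dots> = point E n y \<bullet> cart E m n \<theta> (degen_o E n y) \<bullet> lift E m (opa E m n \<theta> h) \<bullet> lift E m ?i"
    using assms(1-3) h by (intro T.Comp_eq_right) (simp_all add: point_const_iso)
  also have "cart E m n \<theta> (degen_o E n y) \<bullet> lift E m (opa E m n \<theta> h) \<bullet> lift E m ?i
    = lift E n h \<bullet> cart E m n \<theta> (degen_o E n x) \<bullet> lift E m ?i"
    using assms(1-3) h lift_cart[OF assms(3) h(1)] by (intro T.Comp_eq_right) simp_all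
  finally show "point E m y \<bullet> lift E m (sact (mapping_sset E x y) m n \<theta> h) = point E n y \<bullet> lift E n h \<bullet> kappa E m n \<theta> x"
    by (simp add: kappa_def)
qed

lemma sset_mapsI:
  assumes x: "x \<in> Obj (lev E 0)" and y: "y \<in> Obj (lev E 0)" and K: "act_closed K"
    and "\<And>n. p n \<in> extensional (simp K n)"
    and hom: "\<And>n a. a \<in> simp K n \<Longrightarrow> p n a \<in> hom (lev E n) (degen_o E n x) (degen_o E n y)"
    and act: "\<And>m n \<theta> a. \<theta> \<in> Delta m n \<Longrightarrow> a \<in> simp K n \<Longrightarrow>
      point E m y \<bullet> lift E m (p m (sact K m n \<theta> a)) = point E n y \<bullet> lift E n (p n a) \<bullet> kappa E m n \<theta> x"
  shows "p \<in> sset_maps K (mapping_sset E x y)"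
  unfolding sset_maps_def
proof (intro CollectI conjI allI ballI)
  have simp_p: "p n a \<in> simp (mapping_sset E x y) n" if "a \<in> simp K n" for n a
    using hom[OF that] by (simp add: mapping_sset_def)
  show "p n \<in> simp K n \<rightarrow>\<^sub>E simp (mapping_sset E x y) n" for n
    using assms(4) simp_p by (auto simp: PiE_def)
  fix m n \<theta> a assume \<theta>: "\<theta> \<in> Delta m n" and a: "a \<in> simp K n"
  have *: "p m (sact K m n \<theta> a) \<in> simp (mapping_sset E x y) m"
    using K \<theta> a simp_p by (simp add: act_closed_def)
  note ** = point_mapping_act[OF x y \<theta> simp_p[OF a]]
  show "p m (sact K m n \<theta> a) = sact (mapping_sset E x y) m n \<theta> (p n a)"
  proof (rule point_lift_cancel)
    show "point E m y \<bullet> lift E m (p m (sact K m n \<theta> a)) = point E m y \<bullet> lift E m (sact (mapping_sset E x y) m n \<theta> (p n a))"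
      using act[OF \<theta> a] **(1) by simp
  qed (use y * **(2) in \<open>auto simp: mapping_sset_def hom_def\<close>)
qed

lemma sset_mapsD:
  assumes p: "p \<in> sset_maps K (mapping_sset E x y)" and a: "a \<in> simp K n"
  shows "p n a \<in> Arr (lev E n)" "Dom (lev E n) (p n a) = degen_o E n x" "Cod (lev E n) (p n a) = degen_o E n y"
    and "x \<in> Obj (lev E 0) \<Longrightarrow> y \<in> Obj (lev E 0) \<Longrightarrow> \<theta> \<in> Delta m n \<Longrightarrow>
      point E m y \<bullet> lift E m (p m (sact K m n \<theta> a)) = point E n y \<bullet> lift E n (p n a) \<bullet> kappa E m n \<theta> x"
proof -
  have pa: "p n a \<in> simp (mapping_sset E x y) n" using assms by (auto simp: sset_maps_def)
  then show "p n a \<in> Arr (lev E n)" "Dom (lev E n) (p n a) = degen_o E n x" "Cod (lev E n) (p n a) = degen_o E n y"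
    by (auto simp: mapping_sset_def hom_def)
  show "point E m y \<bullet> lift E m (p m (sact K m n \<theta> a)) = point E n y \<bullet> lift E n (p n a) \<bullet> kappa E m n \<theta> x"
    if "x \<in> Obj (lev E 0)" "y \<in> Obj (lev E 0)" "\<theta> \<in> Delta m n"
    using point_mapping_act(1)[OF that pa] p a that by (simp add: sset_maps_def)
qed

lemma sset_maps_eqI:
  assumes "p \<in> sset_maps K L" "q \<in> sset_maps K L" "\<And>n a. a \<in> simp K n \<Longrightarrow> p n a = q n a"
  shows "p = q"
proof (rule ext)
  fix n
  have "p n \<in> simp K n \<rightarrow>\<^sub>E simp L n" "q n \<in> simp K n \<rightarrow>\<^sub>E simp L n"
    using assms(1,2) by (simp_all add: sset_maps_def)
  then show "p n = q n"
    using assms(3) by (intro extensionalityI[of _ "simp K n"]) (auto simp: PiE_def)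
qed

lemma tensorD:
  assumes "is_tensor E K x T \<Phi>"
  shows "T \<in> Obj (lev E 0)"
    and "f \<in> hom (lev E 0) T y \<Longrightarrow> \<Phi> y f \<in> sset_maps K (mapping_sset E x y)"
    and "f \<in> hom (lev E 0) T y \<Longrightarrow> g \<in> hom (lev E 0) T y \<Longrightarrow> \<Phi> y f = \<Phi> y g \<Longrightarrow> f = g"
    and "y \<in> Obj (lev E 0) \<Longrightarrow> p \<in> sset_maps K (mapping_sset E x y) \<Longrightarrow> \<exists>f \<in> hom (lev E 0) T y. \<Phi> y f = p"
    and "f \<in> hom (lev E 0) T y \<Longrightarrow> g \<in> hom (lev E 0) y z \<Longrightarrow> a \<in> simp K n \<Longrightarrow>
      \<Phi> z (g \<cdot>\<^bsub>lev E 0\<^esub> f) n a = degen_a E n g \<cdot>\<^bsub>lev E n\<^esub> \<Phi> y f n a"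
proof -
  show "T \<in> Obj (lev E 0)" using assms by (simp add: is_tensor_def)
  have y: "y \<in> Obj (lev E 0)" if "f \<in> hom (lev E 0) T y" for f y
    using that lev.Cod_in by (auto simp: hom_def)
  have bij: "bij_betw (\<Phi> y) (hom (lev E 0) T y) (sset_maps K (mapping_sset E x y))" if "y \<in> Obj (lev E 0)" for y
    using assms that by (simp add: is_tensor_def)
  show "\<Phi> y f \<in> sset_maps K (mapping_sset E x y)" if "f \<in> hom (lev E 0) T y"
    using bij[OF y[OF that]] that by (auto simp: bij_betw_def)
  show "f = g" if "f \<in> hom (lev E 0) T y" "g \<in> hom (lev E 0) T y" "\<Phi> y f = \<Phi> y g"
    using bij[OF y[OF that(1)]] that by (auto simp: bij_betw_def inj_on_def)
  show "\<exists>f \<in> hom (lev E 0) T y. \<Phi> y f = p" if "y \<in> Obj (lev E 0)" "p \<in> sset_maps K (mapping_sset E x y)"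
  proof -
    have "p \<in> \<Phi> y ` hom (lev E 0) T y" using bij[OF that(1)] that(2) by (simp add: bij_betw_def)
    then show ?thesis by blast
  qed
  show "\<Phi> z (g \<cdot>\<^bsub>lev E 0\<^esub> f) n a = degen_a E n g \<cdot>\<^bsub>lev E n\<^esub> \<Phi> y f n a"
    if "f \<in> hom (lev E 0) T y" "g \<in> hom (lev E 0) y z" "a \<in> simp K n"
    using assms that by (simp add: is_tensor_def)
qed

text \<open>A Yoneda argument justifies the definite description: the witness represents the image
  of the identity of \<open>T'\<close>, the same instance gives uniqueness, and naturality in
  \<open>y\<close> extends the equation to every \<open>f\<close>.\<close>

lemma tensor_map:
  assumes T: "is_tensor E K x T \<Phi>" and T': "is_tensor E K' x' T' \<Phi>'" and K: "act_closed K"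
    and p: "\<And>n a. a \<in> simp K n \<Longrightarrow> p n a \<in> simp K' n"
    and p_act: "\<And>m n \<theta> a. \<theta> \<in> Delta m n \<Longrightarrow> a \<in> simp K n \<Longrightarrow> p m (sact K m n \<theta> a) = sact K' m n \<theta> (p n a)"
    and b: "b \<in> hom (lev E 0) x x'"
  shows "tensor_map E K T \<Phi> T' \<Phi>' p b \<in> hom (lev E 0) T T'"
    and "f \<in> hom (lev E 0) T' y \<Longrightarrow> a \<in> simp K n \<Longrightarrow>
      \<Phi> y (f \<cdot>\<^bsub>lev E 0\<^esub> tensor_map E K T \<Phi> T' \<Phi>' p b) n a = \<Phi>' y f n (p n a) \<cdot>\<^bsub>lev E n\<^esub> degen_a E n b"
proof -
  have b': "b \<in> Arr (lev E 0)" "Dom (lev E 0) b = x" "Cod (lev E 0) b = x'"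
    using b by (auto simp: hom_def)
  then have x: "x \<in> Obj (lev E 0)" "x' \<in> Obj (lev E 0)" using lev.Dom_in lev.Cod_in by blast+
  have q_in: "(\<lambda>n. \<lambda>a \<in> simp K n. \<Phi>' y f n (p n a) \<cdot>\<^bsub>lev E n\<^esub> degen_a E n b) \<in> sset_maps K (mapping_sset E x y)"
    (is "?q \<in> _") if f: "f \<in> hom (lev E 0) T' y" for f y
  proof (rule sset_mapsI[OF x(1) _ K])
    show y: "y \<in> Obj (lev E 0)" using f lev.Cod_in by (auto simp: hom_def)
    have *: "\<Phi>' y f n (p n a) \<in> Arr (lev E n)" "Dom (lev E n) (\<Phi>' y f n (p n a)) = degen_o E n x'"
      "Cod (lev E n) (\<Phi>' y f n (p n a)) = degen_o E n y" if "a \<in> simp K n" for n a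
      using sset_mapsD(1-3)[OF tensorD(2)[OF T' f] p[OF that]] by simp_all
    show "?q n \<in> extensional (simp K n)" for n by simp
    show "?q n a \<in> hom (lev E n) (degen_o E n x) (degen_o E n y)" if "a \<in> simp K n" for n a
      using *[OF that] b' that by (simp add: hom_def)
    fix m n \<theta> a assume \<theta>: "\<theta> \<in> Delta m n" and a: "a \<in> simp K n"
    have \<theta>a: "sact K m n \<theta> a \<in> simp K m" using K \<theta> a by (simp add: act_closed_def)
    have "point E m y \<bullet> lift E m (?q m (sact K m n \<theta> a))
      = (point E m y \<bullet> lift E m (\<Phi>' y f m (sact K' m n \<theta> (p n a)))) \<bullet> lift E m (degen_a E m b)"
      using *[OF \<theta>a] \<theta>a b' x y by (simp add: p_act[OF \<theta> a])
    also have "\<dots> = point E n y \<bullet> lift E n (\<Phi>' y f n (p n a)) \<bullet> kappa E m n \<theta> x' \<bullet> lift E m (degen_a E m b)"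
      using sset_mapsD(4)[OF tensorD(2)[OF T' f] p[OF a] x(2) y \<theta>] *[OF a] b' x y \<theta> by simp
    also have "\<dots> = point E n y \<bullet> lift E n (?q n a) \<bullet> kappa E m n \<theta> x"
      using kappa_natural[OF b'(1) \<theta>] *[OF a] a b' x y \<theta> by simp
    finally show "point E m y \<bullet> lift E m (?q m (sact K m n \<theta> a)) = point E n y \<bullet> lift E n (?q n a) \<bullet> kappa E m n \<theta> x" .
  qed
  have T'_id: "Ide (lev E 0) T' \<in> hom (lev E 0) T' T'" by (rule lev.Ide_in[OF tensorD(1)[OF T']])
  obtain t where t: "t \<in> hom (lev E 0) T T'"
    "\<Phi> T' t = (\<lambda>n. \<lambda>a \<in> simp K n. \<Phi>' T' (Ide (lev E 0) T') n (p n a) \<cdot>\<^bsub>lev E n\<^esub> degen_a E n b)"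
    using tensorD(4)[OF T tensorD(1)[OF T'] q_in[OF T'_id]] by blast
  let ?P = "\<lambda>t. t \<in> hom (lev E 0) T T' \<and> (\<forall>y. \<forall>f \<in> hom (lev E 0) T' y. \<Phi> y (f \<cdot>\<^bsub>lev E 0\<^esub> t)
      = (\<lambda>n. \<lambda>a \<in> simp K n. \<Phi>' y f n (p n a) \<cdot>\<^bsub>lev E n\<^esub> degen_a E n b))"
  have "?P t"
  proof (intro conjI allI ballI t(1))
    fix y f assume f: "f \<in> hom (lev E 0) T' y"
    show "\<Phi> y (f \<cdot>\<^bsub>lev E 0\<^esub> t) = (\<lambda>n. \<lambda>a \<in> simp K n. \<Phi>' y f n (p n a) \<cdot>\<^bsub>lev E n\<^esub> degen_a E n b)"
    proof (rule sset_maps_eqI[OF tensorD(2)[OF T lev.Comp_in[OF t(1) f]] q_in[OF f]])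
      fix n a assume a: "a \<in> simp K n"
      have *: "\<Phi>' T' (Ide (lev E 0) T') n (p n a) \<in> Arr (lev E n)"
        "Dom (lev E n) (\<Phi>' T' (Ide (lev E 0) T') n (p n a)) = degen_o E n x'"
        "Cod (lev E n) (\<Phi>' T' (Ide (lev E 0) T') n (p n a)) = degen_o E n T'"
        using sset_mapsD(1-3)[OF tensorD(2)[OF T' T'_id] p[OF a]] by simp_all
      have f': "f \<in> Arr (lev E 0)" "Dom (lev E 0) f = T'" using f by (auto simp: hom_def)
      have "\<Phi> y (f \<cdot>\<^bsub>lev E 0\<^esub> t) n a = (degen_a E n f \<cdot>\<^bsub>lev E n\<^esub> \<Phi>' T' (Ide (lev E 0) T') n (p n a)) \<cdot>\<^bsub>lev E n\<^esub> degen_a E n b"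
        using tensorD(5)[OF T t(1) f a] t(2) a * f' b' by simp
      also have "\<dots> = \<Phi>' y f n (p n a) \<cdot>\<^bsub>lev E n\<^esub> degen_a E n b"
        using tensorD(5)[OF T' T'_id f p[OF a]] f' by simp
      finally show "\<Phi> y (f \<cdot>\<^bsub>lev E 0\<^esub> t) n a = (\<lambda>a \<in> simp K n. \<Phi>' y f n (p n a) \<cdot>\<^bsub>lev E n\<^esub> degen_a E n b) a"
        using a by simp
    qed
  qed
  moreover have "s = t" if s: "?P s" for s
  proof (rule tensorD(3)[OF T _ t(1)])
    show "s \<in> hom (lev E 0) T T'" using s by blast
    moreover have "\<Phi> T' (Ide (lev E 0) T' \<cdot>\<^bsub>lev E 0\<^esub> s)
      = (\<lambda>n. \<lambda>a \<in> simp K n. \<Phi>' T' (Ide (lev E 0) T') n (p n a) \<cdot>\<^bsub>lev E n\<^esub> degen_a E n b)"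
      using s T'_id by blast
    ultimately show "\<Phi> T' s = \<Phi> T' t" using t(2) by (simp add: hom_def)
  qed
  ultimately have P: "?P (tensor_map E K T \<Phi> T' \<Phi>' p b)"
    unfolding tensor_map_def by (rule theI)
  then show "tensor_map E K T \<Phi> T' \<Phi>' p b \<in> hom (lev E 0) T T'" by blast
  show "\<Phi> y (f \<cdot>\<^bsub>lev E 0\<^esub> tensor_map E K T \<Phi> T' \<Phi>' p b) n a = \<Phi>' y f n (p n a) \<cdot>\<^bsub>lev E n\<^esub> degen_a E n b"
    if "f \<in> hom (lev E 0) T' y" "a \<in> simp K n"
    using P that by simp
qed

end

section \<open>Homotopy colimits\<close>

locale tensored_diagram = simplicial_category E + F: is_functor J "lev E 0" Fo Fa
  for E :: "('o, 'a) scat" and J :: "('j, 'k) cat" and Fo Fa +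
  fixes T :: "'j \<Rightarrow> 'j \<Rightarrow> 'o"
    and \<Phi> :: "'j \<Rightarrow> 'j \<Rightarrow> 'o \<Rightarrow> 'a \<Rightarrow> nat \<Rightarrow> (nat \<times> nat \<Rightarrow> ('j \<times> 'k) \<times> 'k \<times> ('j \<times> 'k)) \<Rightarrow> 'a"
  assumes tensor: "i \<in> Obj J \<Longrightarrow> j \<in> Obj J \<Longrightarrow> is_tensor E (nerve (coslice J i)) (Fo j) (T i j) (\<Phi> i j)"
begin

abbreviation NJ where "NJ \<equiv> nerve_simp J"
abbreviation K where "K i \<equiv> nerve_simp (coslice J i)"
abbreviation PA where "PA \<equiv> \<lambda>u v. tensor_map E (nerve (coslice J (Cod J u)))
             (T (Cod J u) (Dom J v)) (\<Phi> (Cod J u) (Dom J v))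
             (T (Dom J u) (Cod J v)) (\<Phi> (Dom J u) (Cod J v))
             (nerve_map (coslice_map J u)) (Fa v)"

lemma PA:
  assumes u: "u \<in> hom J i i'" and v: "v \<in> hom J j j'"
  shows "PA u v \<in> hom (lev E 0) (T i' j) (T i j')"
    and "f \<in> hom (lev E 0) (T i j') y \<Longrightarrow> \<sigma> \<in> NJ n \<Longrightarrow> g \<in> hom J i' (vert J \<sigma> 0) \<Longrightarrow>
      \<Phi> i' j y (f \<cdot>\<^bsub>lev E 0\<^esub> PA u v) n (coslice_simplex J n g \<sigma>)
      = \<Phi> i j' y f n (coslice_simplex J n (g \<cdot>\<^bsub>J\<^esub> u) \<sigma>) \<cdot>\<^bsub>lev E n\<^esub> degen_a E n (Fa v)"
proof -
  have u': "u \<in> Arr J" "Dom J u = i" "Cod J u = i'" and v': "v \<in> Arr J" "Dom J v = j" "Cod J v = j'"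
    using u v by (auto simp: hom_def)
  then have o: "i \<in> Obj J" "i' \<in> Obj J" "j \<in> Obj J" "j' \<in> Obj J"
    using F.A.Dom_in F.A.Cod_in by blast+
  have 1: "nerve_map (coslice_map J u) n a \<in> simp (nerve (coslice J i)) n" if "a \<in> simp (nerve (coslice J i')) n" for n a
  proof -
    have "a \<in> K i' n" using that by (simp add: nerve_def)
    then obtain \<sigma> f where *: "\<sigma> \<in> NJ n" "f \<in> hom J i' (vert J \<sigma> 0)" "a = coslice_simplex J n f \<sigma>"
      by (rule F.A.coslice_simplex_cases)
    then show ?thesis
      using F.A.coslice_simplex_map[OF *(1,2) u] F.A.coslice_simplex_in[OF *(1), of "f \<cdot>\<^bsub>J\<^esub> u" i] F.A.Comp_in[OF u *(2)]
      by (simp add: nerve_def)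
  qed
  have 2: "nerve_map (coslice_map J u) m (sact (nerve (coslice J i')) m n \<theta> a)
    = sact (nerve (coslice J i)) m n \<theta> (nerve_map (coslice_map J u) n a)" if "\<theta> \<in> Delta m n" for m n \<theta> a
    by (simp add: nerve_def nerve_act_map[OF that])
  note tm = tensor_map[OF tensor[OF o(2,3)] tensor[OF o(1,4)] act_closed_nerve _ _ F.Fa_in[OF v],
      of "nerve_map (coslice_map J u)"]
  show "PA u v \<in> hom (lev E 0) (T i' j) (T i j')"
    unfolding u' v' by (rule tm(1)) (use 1 2 in blast)+
  show "\<Phi> i' j y (f \<cdot>\<^bsub>lev E 0\<^esub> PA u v) n (coslice_simplex J n g \<sigma>)
      = \<Phi> i j' y f n (coslice_simplex J n (g \<cdot>\<^bsub>J\<^esub> u) \<sigma>) \<cdot>\<^bsub>lev E n\<^esub> degen_a E n (Fa v)"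
    if f: "f \<in> hom (lev E 0) (T i j') y" and g: "\<sigma> \<in> NJ n" "g \<in> hom J i' (vert J \<sigma> 0)"
  proof -
    have "coslice_simplex J n g \<sigma> \<in> simp (nerve (coslice J i')) n"
      using F.A.coslice_simplex_in[OF g] by (simp add: nerve_def)
    then show ?thesis
      unfolding u' v' F.A.coslice_simplex_map[OF g u, symmetric] by (intro tm(2)[OF _ _ f]) (use 1 2 in blast)+
  qed
qed

section \<open>Cowedges on the tensors as lax cocones\<close>

abbreviation is_cowedge where "is_cowedge \<equiv> cowedge (lev E 0) J T PA"

text \<open>Evaluation at the identity structure arrow, as in the Yoneda lemma: the component at the
  initial vertex of \<sigma> is taken, and \<open>lam_leg\<close> recovers the values at all other
  structure arrows.\<close>

definition lam :: "'o \<Rightarrow> ('j \<Rightarrow> 'a) \<Rightarrow> nat \<Rightarrow> (nat \<times> nat \<Rightarrow> 'k) \<Rightarrow> nat \<times> 'a \<times> (nat \<Rightarrow> nat) \<times> nat \<times> 'o" where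
  "lam c w n \<sigma> = point E n c \<bullet> lift E n (\<Phi> (vert J \<sigma> 0) (vert J \<sigma> 0) c (w (vert J \<sigma> 0)) n (coslice_simplex J n (Ide J (vert J \<sigma> 0)) \<sigma>))"

lemma component:
  assumes "w \<in> hom (lev E 0) (T i j) c" "i \<in> Obj J" "j \<in> Obj J" "\<sigma> \<in> NJ n" "f \<in> hom J i (vert J \<sigma> 0)"
  shows "\<Phi> i j c w n (coslice_simplex J n f \<sigma>) \<in> Arr (lev E n)"
    "Dom (lev E n) (\<Phi> i j c w n (coslice_simplex J n f \<sigma>)) = degen_o E n (Fo j)"
    "Cod (lev E n) (\<Phi> i j c w n (coslice_simplex J n f \<sigma>)) = degen_o E n c"
proof -
  have "coslice_simplex J n f \<sigma> \<in> simp (nerve (coslice J i)) n"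
    using F.A.coslice_simplex_in[OF assms(4,5)] by (simp add: nerve_def)
  from sset_mapsD(1-3)[OF tensorD(2)[OF tensor[OF assms(2,3)] assms(1)] this]
  show "\<Phi> i j c w n (coslice_simplex J n f \<sigma>) \<in> Arr (lev E n)"
    "Dom (lev E n) (\<Phi> i j c w n (coslice_simplex J n f \<sigma>)) = degen_o E n (Fo j)"
    "Cod (lev E n) (\<Phi> i j c w n (coslice_simplex J n f \<sigma>)) = degen_o E n c" .
qed

lemma tensor_eqI:
  assumes "w \<in> hom (lev E 0) (T i j) c" "w' \<in> hom (lev E 0) (T i j) c" "i \<in> Obj J" "j \<in> Obj J"
    and "\<And>n \<sigma> f. \<sigma> \<in> NJ n \<Longrightarrow> f \<in> hom J i (vert J \<sigma> 0) \<Longrightarrow>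
      \<Phi> i j c w n (coslice_simplex J n f \<sigma>) = \<Phi> i j c w' n (coslice_simplex J n f \<sigma>)"
  shows "w = w'"
proof (rule tensorD(3)[OF tensor[OF assms(3,4)] assms(1,2)])
  note t = tensorD(2)[OF tensor[OF assms(3,4)]]
  show "\<Phi> i j c w = \<Phi> i j c w'"
  proof (rule sset_maps_eqI[OF t[OF assms(1)] t[OF assms(2)]])
    fix n a assume "a \<in> simp (nerve (coslice J i)) n"
    then have "a \<in> K i n" by (simp add: nerve_def)
    then show "\<Phi> i j c w n a = \<Phi> i j c w' n a"
      by (rule F.A.coslice_simplex_cases) (use assms(5) in blast)
  qed
qed

text \<open>Arrows out of a tensor are determined by their values on simplices, and simplices of a
  coslice are pairs of \<sigma> and \<open>g\<close>. The rule \<open>PA\<close> evaluates both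
  sides of the cowedge equation on such pairs.\<close>

lemma cowedge_iff:
  "is_cowedge c w \<longleftrightarrow> c \<in> Obj (lev E 0) \<and> (\<forall>i \<in> Obj J. w i \<in> hom (lev E 0) (T i i) c) \<and>
    (\<forall>i i'. \<forall>u \<in> hom J i i'. \<forall>n. \<forall>\<sigma> \<in> NJ n. \<forall>g \<in> hom J i' (vert J \<sigma> 0).
      \<Phi> i i c (w i) n (coslice_simplex J n (g \<cdot>\<^bsub>J\<^esub> u) \<sigma>)
      = \<Phi> i' i' c (w i') n (coslice_simplex J n g \<sigma>) \<cdot>\<^bsub>lev E n\<^esub> degen_a E n (Fa u))"
proof (cases "\<forall>i \<in> Obj J. w i \<in> hom (lev E 0) (T i i) c")
  case False
  then show ?thesis unfolding cowedge_def by blast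
next
  case True
  have "w i \<cdot>\<^bsub>lev E 0\<^esub> PA u (Ide J i) = w i' \<cdot>\<^bsub>lev E 0\<^esub> PA (Ide J i') u \<longleftrightarrow>
    (\<forall>n. \<forall>\<sigma> \<in> NJ n. \<forall>g \<in> hom J i' (vert J \<sigma> 0).
      \<Phi> i i c (w i) n (coslice_simplex J n (g \<cdot>\<^bsub>J\<^esub> u) \<sigma>)
      = \<Phi> i' i' c (w i') n (coslice_simplex J n g \<sigma>) \<cdot>\<^bsub>lev E n\<^esub> degen_a E n (Fa u))" (is "?l = ?r \<longleftrightarrow> _")
    if u: "u \<in> hom J i i'" for i i' u
  proof -
    have o: "i \<in> Obj J" "i' \<in> Obj J" using u F.A.Dom_in F.A.Cod_in by (auto simp: hom_def)
    have id: "Ide J i \<in> hom J i i" "Ide J i' \<in> hom J i' i'" using o F.A.Ide_in by blast+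
    have w: "w i \<in> hom (lev E 0) (T i i) c" "w i' \<in> hom (lev E 0) (T i' i') c" using True o by blast+
    have l: "?l \<in> hom (lev E 0) (T i' i) c" by (rule lev.Comp_in[OF PA(1)[OF u id(1)] w(1)])
    have r: "?r \<in> hom (lev E 0) (T i' i) c" by (rule lev.Comp_in[OF PA(1)[OF id(2) u] w(2)])
    have \<Phi>l: "\<Phi> i' i c ?l n (coslice_simplex J n g \<sigma>) = \<Phi> i i c (w i) n (coslice_simplex J n (g \<cdot>\<^bsub>J\<^esub> u) \<sigma>)"
      and \<Phi>r: "\<Phi> i' i c ?r n (coslice_simplex J n g \<sigma>) = \<Phi> i' i' c (w i') n (coslice_simplex J n g \<sigma>) \<cdot>\<^bsub>lev E n\<^esub> degen_a E n (Fa u)"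
      if \<sigma>: "\<sigma> \<in> NJ n" and g: "g \<in> hom J i' (vert J \<sigma> 0)" for n \<sigma> g
    proof -
      have gu: "g \<cdot>\<^bsub>J\<^esub> u \<in> hom J i (vert J \<sigma> 0)" by (rule F.A.Comp_in[OF u g])
      show "\<Phi> i' i c ?l n (coslice_simplex J n g \<sigma>) = \<Phi> i i c (w i) n (coslice_simplex J n (g \<cdot>\<^bsub>J\<^esub> u) \<sigma>)"
        unfolding PA(2)[OF u id(1) w(1) \<sigma> g] using component[OF w(1) o(1) o(1) \<sigma> gu] o F.Fo_in
        by (simp add: F.Fa_Ide)
      have "g \<cdot>\<^bsub>J\<^esub> Ide J i' = g" using g by (simp add: hom_def)
      then show "\<Phi> i' i c ?r n (coslice_simplex J n g \<sigma>) = \<Phi> i' i' c (w i') n (coslice_simplex J n g \<sigma>) \<cdot>\<^bsub>lev E n\<^esub> degen_a E n (Fa u)"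
        unfolding PA(2)[OF id(2) u w(2) \<sigma> g] by simp
    qed
    show ?thesis
    proof
      assume eq: "?l = ?r"
      show "\<forall>n. \<forall>\<sigma> \<in> NJ n. \<forall>g \<in> hom J i' (vert J \<sigma> 0).
        \<Phi> i i c (w i) n (coslice_simplex J n (g \<cdot>\<^bsub>J\<^esub> u) \<sigma>)
        = \<Phi> i' i' c (w i') n (coslice_simplex J n g \<sigma>) \<cdot>\<^bsub>lev E n\<^esub> degen_a E n (Fa u)"
        unfolding eq[symmetric] using \<Phi>l \<Phi>r eq by metis
    next
      assume "\<forall>n. \<forall>\<sigma> \<in> NJ n. \<forall>g \<in> hom J i' (vert J \<sigma> 0).
        \<Phi> i i c (w i) n (coslice_simplex J n (g \<cdot>\<^bsub>J\<^esub> u) \<sigma>)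
        = \<Phi> i' i' c (w i') n (coslice_simplex J n g \<sigma>) \<cdot>\<^bsub>lev E n\<^esub> degen_a E n (Fa u)"
      then show "?l = ?r"
        using \<Phi>l \<Phi>r by (intro tensor_eqI[OF l r o(2) o(1)]) simp
    qed
  qed
  then show ?thesis unfolding cowedge_def by blast
qed

lemma vert_hom: "\<sigma> \<in> NJ n \<Longrightarrow> Ide J (vert J \<sigma> 0) \<in> hom J (vert J \<sigma> 0) (vert J \<sigma> 0)"
  by (rule F.A.Ide_in) simp

context
  fixes c w
  assumes cowedge: "is_cowedge c w"
begin

lemma c_Obj: "c \<in> Obj (lev E 0)"
  using cowedge by (simp add: cowedge_def)

lemma w_hom: "i \<in> Obj J \<Longrightarrow> w i \<in> hom (lev E 0) (T i i) c"
  using cowedge by (simp add: cowedge_def)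

lemma lam_simps:
  assumes "\<sigma> \<in> NJ n"
  shows "lam c w n \<sigma> \<in> Arr (total E)" "Dom (total E) (lam c w n \<sigma>) = (n, degen_o E n (Fo (vert J \<sigma> 0)))"
    "Cod (total E) (lam c w n \<sigma>) = (0, c)"
proof -
  have v: "vert J \<sigma> 0 \<in> Obj J" using assms by simp
  show "lam c w n \<sigma> \<in> Arr (total E)" "Dom (total E) (lam c w n \<sigma>) = (n, degen_o E n (Fo (vert J \<sigma> 0)))"
    "Cod (total E) (lam c w n \<sigma>) = (0, c)"
    using component[OF w_hom[OF v] v v assms vert_hom[OF assms]] c_Obj by (simp_all add: lam_def)
qed

text \<open>This is the cowedge condition for the arrow \<open>f\<close> itself, evaluated at the
  identity structure arrow of the initial vertex.\<close>

lemma lam_leg: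
  assumes \<sigma>: "\<sigma> \<in> NJ n" and f: "f \<in> hom J i (vert J \<sigma> 0)"
  shows "point E n c \<bullet> lift E n (\<Phi> i i c (w i) n (coslice_simplex J n f \<sigma>)) = lam c w n \<sigma> \<bullet> lift E n (degen_a E n (Fa f))"
proof -
  have v: "vert J \<sigma> 0 \<in> Obj J" using \<sigma> by simp
  have f': "f \<in> Arr J" "Dom J f = i" "Cod J f = vert J \<sigma> 0" using f by (auto simp: hom_def)
  have "Ide J (vert J \<sigma> 0) \<cdot>\<^bsub>J\<^esub> f = f" using f' by simp
  then have "\<Phi> i i c (w i) n (coslice_simplex J n f \<sigma>)
    = \<Phi> (vert J \<sigma> 0) (vert J \<sigma> 0) c (w (vert J \<sigma> 0)) n (coslice_simplex J n (Ide J (vert J \<sigma> 0)) \<sigma>) \<cdot>\<^bsub>lev E n\<^esub> degen_a E n (Fa f)"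
    using cowedge_iff[THEN iffD1, OF cowedge] \<sigma> f vert_hom[OF \<sigma>] by metis
  then show ?thesis
    using component[OF w_hom[OF v] v v \<sigma> vert_hom[OF \<sigma>]] c_Obj f' by (simp add: lam_def)
qed

text \<open>The simplicial action sends the simplex with identity structure arrow to one with
  structure arrow \<sigma> (0, \<theta> 0), and \<open>lam_leg\<close> trades that arrow for the
  edge in the law of a lax cocone.\<close>

lemma lax_lam: "lax_cocone E J Fo Fa c (lam c w)"
proof -
  have "lam c w m (nerve_act m \<theta> \<sigma>) \<bullet> lift E m (degen_a E m (Fa (\<sigma> (0, \<theta> 0))))
    = lam c w n \<sigma> \<bullet> kappa E m n \<theta> (Fo (vert J \<sigma> 0))" if \<theta>: "\<theta> \<in> Delta m n" and \<sigma>: "\<sigma> \<in> NJ n" for m n \<theta> \<sigma>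
  proof -
    let ?i = "vert J \<sigma> 0"
    have i: "?i \<in> Obj J" "Fo ?i \<in> Obj (lev E 0)" using \<sigma> F.Fo_in[of ?i] by simp_all
    have le: "\<theta> 0 \<le> n" using Delta_le[OF \<theta>] by simp
    have e: "\<sigma> (0, \<theta> 0) \<in> hom J ?i (vert J (nerve_act m \<theta> \<sigma>) 0)" using \<sigma> le by (simp add: hom_def)
    have a: "coslice_simplex J n (Ide J ?i) \<sigma> \<in> simp (nerve (coslice J ?i)) n"
      using F.A.coslice_simplex_in[OF \<sigma> vert_hom[OF \<sigma>]] by (simp add: nerve_def)
    have act: "coslice_simplex J m (\<sigma> (0, \<theta> 0)) (nerve_act m \<theta> \<sigma>) = sact (nerve (coslice J ?i)) m n \<theta> (coslice_simplex J n (Ide J ?i) \<sigma>)"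
      using F.A.coslice_simplex_act[OF \<sigma> vert_hom[OF \<sigma>] \<theta>] \<sigma> le by (simp add: nerve_def)
    have "lam c w m (nerve_act m \<theta> \<sigma>) \<bullet> lift E m (degen_a E m (Fa (\<sigma> (0, \<theta> 0))))
      = point E m c \<bullet> lift E m (\<Phi> ?i ?i c (w ?i) m (coslice_simplex J m (\<sigma> (0, \<theta> 0)) (nerve_act m \<theta> \<sigma>)))"
      by (rule lam_leg[OF nerve_act_in[OF \<sigma> \<theta>] e, symmetric])
    also have "\<dots> = point E n c \<bullet> lift E n (\<Phi> ?i ?i c (w ?i) n (coslice_simplex J n (Ide J ?i) \<sigma>)) \<bullet> kappa E m n \<theta> (Fo ?i)"
      unfolding act by (rule sset_mapsD(4)[OF tensorD(2)[OF tensor[OF i(1) i(1)] w_hom[OF i(1)]] a i(2) c_Obj \<theta>])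
    also have "\<dots> = lam c w n \<sigma> \<bullet> kappa E m n \<theta> (Fo ?i)"
      using component[OF w_hom[OF i(1)] i(1) i(1) \<sigma> vert_hom[OF \<sigma>]] c_Obj i \<theta> by (simp add: lam_def)
    finally show ?thesis .
  qed
  then show ?thesis
    unfolding lax_cocone_def using c_Obj lam_simps by (simp add: hom_def)
qed

end

lemma lam_eqI:
  assumes w: "is_cowedge c w" and w': "is_cowedge c w'"
    and eq: "\<And>n \<sigma>. \<sigma> \<in> NJ n \<Longrightarrow> lam c w n \<sigma> = lam c w' n \<sigma>" and i: "i \<in> Obj J"
  shows "w i = w' i"
proof (rule tensor_eqI[OF w_hom[OF w i] w_hom[OF w' i] i i])
  fix n \<sigma> f assume \<sigma>: "\<sigma> \<in> NJ n" and f: "f \<in> hom J i (vert J \<sigma> 0)"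
  show "\<Phi> i i c (w i) n (coslice_simplex J n f \<sigma>) = \<Phi> i i c (w' i) n (coslice_simplex J n f \<sigma>)"
  proof (rule point_lift_cancel)
    show "point E n c \<bullet> lift E n (\<Phi> i i c (w i) n (coslice_simplex J n f \<sigma>)) = point E n c \<bullet> lift E n (\<Phi> i i c (w' i) n (coslice_simplex J n f \<sigma>))"
      unfolding lam_leg[OF w \<sigma> f] lam_leg[OF w' \<sigma> f] eq[OF \<sigma>] ..
  qed (use component[OF w_hom[OF w i] i i \<sigma> f] component[OF w_hom[OF w' i] i i \<sigma> f] c_Obj[OF w] in simp_all)
qed

lemma lam_Comp:
  assumes w: "is_cowedge c w" and t: "t \<in> hom (lev E 0) c c'"
  shows "is_cowedge c' (\<lambda>i. t \<cdot>\<^bsub>lev E 0\<^esub> w i)"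
    and "\<sigma> \<in> NJ n \<Longrightarrow> lam c' (\<lambda>i. t \<cdot>\<^bsub>lev E 0\<^esub> w i) n \<sigma> = lift E 0 t \<bullet> lam c w n \<sigma>"
proof -
  have t': "t \<in> Arr (lev E 0)" "Dom (lev E 0) t = c" "Cod (lev E 0) t = c'" using t by (auto simp: hom_def)
  have c': "c' \<in> Obj (lev E 0)" using t' lev.Cod_in by blast
  have assoc: "(t \<cdot>\<^bsub>lev E 0\<^esub> w j) \<cdot>\<^bsub>lev E 0\<^esub> p = t \<cdot>\<^bsub>lev E 0\<^esub> w j \<cdot>\<^bsub>lev E 0\<^esub> p"
    if "p \<in> hom (lev E 0) x (T j j)" "j \<in> Obj J" for p x j
    using that w_hom[OF w that(2)] t' by (simp add: hom_def)
  show "is_cowedge c' (\<lambda>i. t \<cdot>\<^bsub>lev E 0\<^esub> w i)"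
    unfolding cowedge_def
  proof (intro conjI ballI allI c')
    show "t \<cdot>\<^bsub>lev E 0\<^esub> w i \<in> hom (lev E 0) (T i i) c'" if "i \<in> Obj J" for i
      by (rule lev.Comp_in[OF w_hom[OF w that] t])
    fix i i' u assume u: "u \<in> hom J i i'"
    have o: "i \<in> Obj J" "i' \<in> Obj J" using u F.A.Dom_in F.A.Cod_in by (auto simp: hom_def)
    have id: "Ide J i \<in> hom J i i" "Ide J i' \<in> hom J i' i'" using o F.A.Ide_in by blast+
    have "w i \<cdot>\<^bsub>lev E 0\<^esub> PA u (Ide J i) = w i' \<cdot>\<^bsub>lev E 0\<^esub> PA (Ide J i') u"
      using w u unfolding cowedge_def by blast
    then show "(t \<cdot>\<^bsub>lev E 0\<^esub> w i) \<cdot>\<^bsub>lev E 0\<^esub> PA u (Ide J i) = (t \<cdot>\<^bsub>lev E 0\<^esub> w i') \<cdot>\<^bsub>lev E 0\<^esub> PA (Ide J i') u"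
      unfolding assoc[OF PA(1)[OF u id(1)] o(1)] assoc[OF PA(1)[OF id(2) u] o(2)] by simp
  qed
  show "lam c' (\<lambda>i. t \<cdot>\<^bsub>lev E 0\<^esub> w i) n \<sigma> = lift E 0 t \<bullet> lam c w n \<sigma>" if \<sigma>: "\<sigma> \<in> NJ n"
  proof -
    let ?i = "vert J \<sigma> 0" and ?a = "coslice_simplex J n (Ide J (vert J \<sigma> 0)) \<sigma>"
    have i: "?i \<in> Obj J" using \<sigma> by simp
    have a: "?a \<in> simp (nerve (coslice J ?i)) n"
      using F.A.coslice_simplex_in[OF \<sigma> vert_hom[OF \<sigma>]] by (simp add: nerve_def)
    note \<Phi> = component[OF w_hom[OF w i] i i \<sigma> vert_hom[OF \<sigma>]]
    have "lam c' (\<lambda>i. t \<cdot>\<^bsub>lev E 0\<^esub> w i) n \<sigma> = point E n c' \<bullet> lift E n (degen_a E n t) \<bullet> lift E n (\<Phi> ?i ?i c (w ?i) n ?a)"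
      using tensorD(5)[OF tensor[OF i i] w_hom[OF w i] t a] \<Phi> t' c' by (simp add: lam_def)
    also have "\<dots> = lift E 0 t \<bullet> point E n c \<bullet> lift E n (\<Phi> ?i ?i c (w ?i) n ?a)"
      using point_natural[OF t'(1)] \<Phi> t' c' c_Obj[OF w] by (intro T.Comp_eq_right) simp_all
    finally show ?thesis by (simp add: lam_def)
  qed
qed

text \<open>By \<open>lam_leg\<close> the value at \<sigma> and \<open>f\<close> has to be
  \<open>h n \<sigma>\<close> preceded by s^n (Fa f). The law of a lax cocone makes this choice
  simplicial, and functoriality of \<open>Fa\<close> makes it a cowedge.\<close>

lemma cowedge_lax:
  assumes lax: "lax_cocone E J Fo Fa c h"
  obtains w where "is_cowedge c w" "\<And>n \<sigma>. \<sigma> \<in> NJ n \<Longrightarrow> lam c w n \<sigma> = h n \<sigma>"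
proof -
  have c: "c \<in> Obj (lev E 0)" using lax by (simp add: lax_cocone_def)
  have h: "h n \<sigma> \<in> Arr (total E)" "Dom (total E) (h n \<sigma>) = (n, degen_o E n (Fo (vert J \<sigma> 0)))" "Cod (total E) (h n \<sigma>) = (0, c)"
    if "\<sigma> \<in> NJ n" for n \<sigma>
    using lax that by (auto simp: lax_cocone_def hom_def)
  \<comment> \<open>The forgetful functor reads \<sigma> off the simplex \<open>a\<close>, and its
    vertex 0 gives \<open>f\<close>. A suitable \<open>e\<close> exists by
    \<open>point_factor\<close>; the restriction to \<open>K i n\<close> supplies the extensionality
    that \<open>sset_maps\<close> demands.\<close>
  define p where "p i n = (\<lambda>a \<in> K i n. SOME e. e \<in> hom (lev E n) (degen_o E n (Fo i)) (degen_o E n c) \<and>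
    point E n c \<bullet> lift E n e = h n (nerve_map (\<lambda>a. fst (snd a)) n a) \<bullet> lift E n (degen_a E n (Fa (snd (fst (a (0, 0)))))))" for i n
  have p: "p i n (coslice_simplex J n f \<sigma>) \<in> hom (lev E n) (degen_o E n (Fo i)) (degen_o E n c)"
    "point E n c \<bullet> lift E n (p i n (coslice_simplex J n f \<sigma>)) = h n \<sigma> \<bullet> lift E n (degen_a E n (Fa f))"
    if \<sigma>: "\<sigma> \<in> NJ n" and f: "f \<in> hom J i (vert J \<sigma> 0)" for i n \<sigma> f
  proof -
    have f': "f \<in> Arr J" "Dom J f = i" "Cod J f = vert J \<sigma> 0" using f by (auto simp: hom_def)
    have "h n \<sigma> \<bullet> lift E n (degen_a E n (Fa f)) \<in> Arr (total E)"
      "Dom (total E) (h n \<sigma> \<bullet> lift E n (degen_a E n (Fa f))) = (n, degen_o E n (Fo i))"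
      "Cod (total E) (h n \<sigma> \<bullet> lift E n (degen_a E n (Fa f))) = (0, c)"
      using h[OF \<sigma>] f' by simp_all
    then obtain e where "e \<in> Arr (lev E n)" "Dom (lev E n) e = degen_o E n (Fo i)" "Cod (lev E n) e = degen_o E n c"
      "h n \<sigma> \<bullet> lift E n (degen_a E n (Fa f)) = point E n c \<bullet> lift E n e"
      by (rule point_factor)
    then have ex: "\<exists>e. e \<in> hom (lev E n) (degen_o E n (Fo i)) (degen_o E n c) \<and>
      point E n c \<bullet> lift E n e = h n \<sigma> \<bullet> lift E n (degen_a E n (Fa f))"
      by (intro exI[of _ e]) (simp add: hom_def)
    have "p i n (coslice_simplex J n f \<sigma>) = (SOME e. e \<in> hom (lev E n) (degen_o E n (Fo i)) (degen_o E n c) \<and>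
      point E n c \<bullet> lift E n e = h n \<sigma> \<bullet> lift E n (degen_a E n (Fa f)))"
      unfolding p_def using F.A.coslice_simplex_in[OF \<sigma> f] F.A.coslice_simplex_inverse[OF \<sigma> f] by simp
    with someI_ex[OF ex] show "p i n (coslice_simplex J n f \<sigma>) \<in> hom (lev E n) (degen_o E n (Fo i)) (degen_o E n c)"
      "point E n c \<bullet> lift E n (p i n (coslice_simplex J n f \<sigma>)) = h n \<sigma> \<bullet> lift E n (degen_a E n (Fa f))"
      by simp_all
  qed
  have p_in: "p i \<in> sset_maps (nerve (coslice J i)) (mapping_sset E (Fo i) c)" if i: "i \<in> Obj J" for i
  proof (rule sset_mapsI[OF F.Fo_in[OF i] c act_closed_nerve])
    show "p i n \<in> extensional (simp (nerve (coslice J i)) n)" for n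
      by (simp add: p_def nerve_def)
    show "p i n a \<in> hom (lev E n) (degen_o E n (Fo i)) (degen_o E n c)" if "a \<in> simp (nerve (coslice J i)) n" for n a
    proof -
      have "a \<in> K i n" using that by (simp add: nerve_def)
      then show ?thesis by (rule F.A.coslice_simplex_cases) (use p(1) in blast)
    qed
    fix m n \<theta> a assume \<theta>: "\<theta> \<in> Delta m n" and "a \<in> simp (nerve (coslice J i)) n"
    then have "a \<in> K i n" by (simp add: nerve_def)
    then obtain \<sigma> f where \<sigma>: "\<sigma> \<in> NJ n" and f: "f \<in> hom J i (vert J \<sigma> 0)" and a: "a = coslice_simplex J n f \<sigma>"
      by (rule F.A.coslice_simplex_cases)
    have f': "f \<in> Arr J" "Dom J f = i" "Cod J f = vert J \<sigma> 0" using f by (auto simp: hom_def)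
    have le: "\<theta> 0 \<le> n" using Delta_le[OF \<theta>] by simp
    have e: "\<sigma> (0, \<theta> 0) \<in> Arr J" "Dom J (\<sigma> (0, \<theta> 0)) = vert J \<sigma> 0" "Cod J (\<sigma> (0, \<theta> 0)) = vert J \<sigma> (\<theta> 0)"
      using \<sigma> le by simp_all
    have \<theta>\<sigma>: "nerve_act m \<theta> \<sigma> \<in> NJ m" using \<theta> \<sigma> by simp
    have v: "vert J (nerve_act m \<theta> \<sigma>) 0 = vert J \<sigma> (\<theta> 0)" by simp
    have ef: "\<sigma> (0, \<theta> 0) \<cdot>\<^bsub>J\<^esub> f \<in> hom J i (vert J (nerve_act m \<theta> \<sigma>) 0)"
      using e f' by (simp add: hom_def)
    note pp = p(1)[OF \<sigma> f, unfolded hom_def, simplified]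
    have "point E m c \<bullet> lift E m (p i m (sact (nerve (coslice J i)) m n \<theta> a))
      = point E m c \<bullet> lift E m (p i m (coslice_simplex J m (\<sigma> (0, \<theta> 0) \<cdot>\<^bsub>J\<^esub> f) (nerve_act m \<theta> \<sigma>)))"
      unfolding a by (simp add: nerve_def F.A.coslice_simplex_act[OF \<sigma> f \<theta>])
    also have "\<dots> = (h m (nerve_act m \<theta> \<sigma>) \<bullet> lift E m (degen_a E m (Fa (\<sigma> (0, \<theta> 0))))) \<bullet> lift E m (degen_a E m (Fa f))"
      unfolding p(2)[OF \<theta>\<sigma> ef] using h[OF \<theta>\<sigma>] e f' by (simp add: v)
    also have "h m (nerve_act m \<theta> \<sigma>) \<bullet> lift E m (degen_a E m (Fa (\<sigma> (0, \<theta> 0)))) = h n \<sigma> \<bullet> kappa E m n \<theta> (Fo (vert J \<sigma> 0))"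
      using lax \<theta> \<sigma> by (simp add: lax_cocone_def)
    also have "(h n \<sigma> \<bullet> kappa E m n \<theta> (Fo (vert J \<sigma> 0))) \<bullet> lift E m (degen_a E m (Fa f))
      = h n \<sigma> \<bullet> lift E n (degen_a E n (Fa f)) \<bullet> kappa E m n \<theta> (Fo i)"
      using kappa_natural[OF _ \<theta>, of "Fa f"] h[OF \<sigma>] \<sigma> \<theta> f' F.Fo_in[of "vert J \<sigma> 0"] by simp
    also have "\<dots> = (h n \<sigma> \<bullet> lift E n (degen_a E n (Fa f))) \<bullet> kappa E m n \<theta> (Fo i)"
      using h[OF \<sigma>] \<sigma> \<theta> f' F.Fo_in[OF i] by simp
    also have "\<dots> = point E n c \<bullet> lift E n (p i n a) \<bullet> kappa E m n \<theta> (Fo i)"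
      unfolding p(2)[OF \<sigma> f, symmetric] a using pp \<theta> c F.Fo_in[OF i] by simp
    finally show "point E m c \<bullet> lift E m (p i m (sact (nerve (coslice J i)) m n \<theta> a))
      = point E n c \<bullet> lift E n (p i n a) \<bullet> kappa E m n \<theta> (Fo i)" .
  qed
  define w where "w i = (SOME f. f \<in> hom (lev E 0) (T i i) c \<and> \<Phi> i i c f = p i)" for i
  have w: "w i \<in> hom (lev E 0) (T i i) c" "\<Phi> i i c (w i) = p i" if i: "i \<in> Obj J" for i
  proof -
    have "\<exists>f. f \<in> hom (lev E 0) (T i i) c \<and> \<Phi> i i c f = p i"
      using tensorD(4)[OF tensor[OF i i] c p_in[OF i]] by blast
    from someI_ex[OF this] show "w i \<in> hom (lev E 0) (T i i) c" "\<Phi> i i c (w i) = p i"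
      unfolding w_def by blast+
  qed
  have "is_cowedge c w"
    unfolding cowedge_iff
  proof (intro conjI ballI allI c)
    show "w i \<in> hom (lev E 0) (T i i) c" if "i \<in> Obj J" for i by (rule w[OF that])
    fix i i' u n \<sigma> g assume u: "u \<in> hom J i i'" and \<sigma>: "\<sigma> \<in> NJ n" and g: "g \<in> hom J i' (vert J \<sigma> 0)"
    have o: "i \<in> Obj J" "i' \<in> Obj J" using u F.A.Dom_in F.A.Cod_in by (auto simp: hom_def)
    have u': "u \<in> Arr J" "Dom J u = i" "Cod J u = i'" and g': "g \<in> Arr J" "Dom J g = i'" "Cod J g = vert J \<sigma> 0"
      using u g by (auto simp: hom_def)
    have gu: "g \<cdot>\<^bsub>J\<^esub> u \<in> hom J i (vert J \<sigma> 0)" by (rule F.A.Comp_in[OF u g])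
    have P: "p i n (coslice_simplex J n (g \<cdot>\<^bsub>J\<^esub> u) \<sigma>) \<in> Arr (lev E n)"
      "Dom (lev E n) (p i n (coslice_simplex J n (g \<cdot>\<^bsub>J\<^esub> u) \<sigma>)) = degen_o E n (Fo i)"
      "Cod (lev E n) (p i n (coslice_simplex J n (g \<cdot>\<^bsub>J\<^esub> u) \<sigma>)) = degen_o E n c"
      "p i' n (coslice_simplex J n g \<sigma>) \<in> Arr (lev E n)"
      "Dom (lev E n) (p i' n (coslice_simplex J n g \<sigma>)) = degen_o E n (Fo i')"
      "Cod (lev E n) (p i' n (coslice_simplex J n g \<sigma>)) = degen_o E n c"
      using p(1)[OF \<sigma> gu] p(1)[OF \<sigma> g] by (auto simp: hom_def)
    have "p i n (coslice_simplex J n (g \<cdot>\<^bsub>J\<^esub> u) \<sigma>) = p i' n (coslice_simplex J n g \<sigma>) \<cdot>\<^bsub>lev E n\<^esub> degen_a E n (Fa u)"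
    proof (rule point_lift_cancel)
      have "point E n c \<bullet> lift E n (p i n (coslice_simplex J n (g \<cdot>\<^bsub>J\<^esub> u) \<sigma>))
        = (point E n c \<bullet> lift E n (p i' n (coslice_simplex J n g \<sigma>))) \<bullet> lift E n (degen_a E n (Fa u))"
        unfolding p(2)[OF \<sigma> gu] p(2)[OF \<sigma> g] using h[OF \<sigma>] u' g' by simp
      then show "point E n c \<bullet> lift E n (p i n (coslice_simplex J n (g \<cdot>\<^bsub>J\<^esub> u) \<sigma>))
        = point E n c \<bullet> lift E n (p i' n (coslice_simplex J n g \<sigma>) \<cdot>\<^bsub>lev E n\<^esub> degen_a E n (Fa u))"
        using P u' c by simp
    qed (use P u' c in simp_all)
    then show "\<Phi> i i c (w i) n (coslice_simplex J n (g \<cdot>\<^bsub>J\<^esub> u) \<sigma>)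
      = \<Phi> i' i' c (w i') n (coslice_simplex J n g \<sigma>) \<cdot>\<^bsub>lev E n\<^esub> degen_a E n (Fa u)"
      using w(2) o by simp
  qed
  moreover have "lam c w n \<sigma> = h n \<sigma>" if \<sigma>: "\<sigma> \<in> NJ n" for n \<sigma>
  proof -
    have i: "vert J \<sigma> 0 \<in> Obj J" using \<sigma> by simp
    show ?thesis
      using p(2)[OF \<sigma> vert_hom[OF \<sigma>]] h[OF \<sigma>] i F.Fo_in[OF i] by (simp add: lam_def w(2)[OF i] F.Fa_Ide)
  qed
  ultimately show ?thesis by (rule that)
qed

text \<open>Cowedges and lax cocones correspond by \<open>lax_lam\<close>,
  \<open>cowedge_lax\<close> and \<open>lam_eqI\<close>, and \<open>lam_Comp\<close> makes the
  correspondence compatible with postcomposition.\<close>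

lemma coend_iff_lax_colimit: "is_coend (lev E 0) J T PA H \<longleftrightarrow> lax_colimit E J Fo Fa H"
proof -
  have main: "t \<in> hom (lev E 0) H c \<and> (\<forall>i \<in> Obj J. t \<cdot>\<^bsub>lev E 0\<^esub> w i = w' i) \<longleftrightarrow>
      t \<in> hom (lev E 0) H c \<and> (\<forall>n. \<forall>\<sigma> \<in> NJ n. lift E 0 t \<bullet> lam H w n \<sigma> = lam c w' n \<sigma>)"
    if w: "is_cowedge H w" and w': "is_cowedge c w'" for c w w' t
  proof (cases "t \<in> hom (lev E 0) H c")
    case True
    note tw = lam_Comp[OF w True]
    have "(\<forall>i \<in> Obj J. t \<cdot>\<^bsub>lev E 0\<^esub> w i = w' i) \<longleftrightarrow>
      (\<forall>n. \<forall>\<sigma> \<in> NJ n. lam c (\<lambda>i. t \<cdot>\<^bsub>lev E 0\<^esub> w i) n \<sigma> = lam c w' n \<sigma>)"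
    proof
      assume "\<forall>i \<in> Obj J. t \<cdot>\<^bsub>lev E 0\<^esub> w i = w' i"
      then show "\<forall>n. \<forall>\<sigma> \<in> NJ n. lam c (\<lambda>i. t \<cdot>\<^bsub>lev E 0\<^esub> w i) n \<sigma> = lam c w' n \<sigma>"
        by (simp add: lam_def)
    next
      assume "\<forall>n. \<forall>\<sigma> \<in> NJ n. lam c (\<lambda>i. t \<cdot>\<^bsub>lev E 0\<^esub> w i) n \<sigma> = lam c w' n \<sigma>"
      then show "\<forall>i \<in> Obj J. t \<cdot>\<^bsub>lev E 0\<^esub> w i = w' i"
        using lam_eqI[OF tw(1) w'] by blast
    qed
    then show ?thesis using tw(2) True by simp
  qed simp
  show ?thesis
  proof
    assume "is_coend (lev E 0) J T PA H"
    then obtain w where w: "is_cowedge H w" and univ: "\<And>c w'. is_cowedge c w' \<Longrightarrow>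
        \<exists>!t. t \<in> hom (lev E 0) H c \<and> (\<forall>i \<in> Obj J. t \<cdot>\<^bsub>lev E 0\<^esub> w i = w' i)"
      unfolding is_coend_def by blast
    show "lax_colimit E J Fo Fa H"
      unfolding lax_colimit_def
    proof (intro exI[of _ "lam H w"] conjI allI impI lax_lam[OF w])
      fix c h' assume "lax_cocone E J Fo Fa c h'"
      then obtain w' where w': "is_cowedge c w'" "\<And>n \<sigma>. \<sigma> \<in> NJ n \<Longrightarrow> lam c w' n \<sigma> = h' n \<sigma>"
        using cowedge_lax by blast
      show "\<exists>!f. f \<in> hom (lev E 0) H c \<and> (\<forall>n. \<forall>\<sigma> \<in> NJ n. lift E 0 f \<bullet> lam H w n \<sigma> = h' n \<sigma>)"
        using univ[OF w'(1)] unfolding main[OF w w'(1)] by (simp add: w'(2))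
    qed
  next
    assume "lax_colimit E J Fo Fa H"
    then obtain h where h: "lax_cocone E J Fo Fa H h"
      and univ: "\<And>c h'. lax_cocone E J Fo Fa c h' \<Longrightarrow>
        \<exists>!f. f \<in> hom (lev E 0) H c \<and> (\<forall>n. \<forall>\<sigma> \<in> NJ n. lift E 0 f \<bullet> h n \<sigma> = h' n \<sigma>)"
      unfolding lax_colimit_def by blast
    obtain w where w: "is_cowedge H w" "\<And>n \<sigma>. \<sigma> \<in> NJ n \<Longrightarrow> lam H w n \<sigma> = h n \<sigma>"
      using cowedge_lax[OF h] by blast
    show "is_coend (lev E 0) J T PA H"
      unfolding is_coend_def
    proof (intro exI[of _ w] conjI allI impI w(1))
      fix c w' assume w': "is_cowedge c w'"
      show "\<exists>!t. t \<in> hom (lev E 0) H c \<and> (\<forall>i \<in> Obj J. t \<cdot>\<^bsub>lev E 0\<^esub> w i = w' i)"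
        using univ[OF lax_lam[OF w']] unfolding main[OF w(1) w'] by (simp add: w(2))
    qed
  qed
qed

end

section \<open>Comparison of the two colimits\<close>

context simplicial_category
begin

lemma lax_colimit_isomorphic:
  assumes D: "lax_colimit E J Fo Fa D" and H: "lax_colimit E J Fo Fa H"
  shows "isomorphic (lev E 0) D H"
proof -
  obtain h where h: "lax_cocone E J Fo Fa D h"
    and hu: "\<And>c h'. lax_cocone E J Fo Fa c h' \<Longrightarrow> \<exists>!f. f \<in> hom (lev E 0) D c \<and>
      (\<forall>n. \<forall>\<sigma> \<in> nerve_simp J n. lift E 0 f \<bullet> h n \<sigma> = h' n \<sigma>)"
    using D unfolding lax_colimit_def by blast
  obtain k where k: "lax_cocone E J Fo Fa H k"
    and ku: "\<And>c h'. lax_cocone E J Fo Fa c h' \<Longrightarrow> \<exists>!f. f \<in> hom (lev E 0) H c \<and>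
      (\<forall>n. \<forall>\<sigma> \<in> nerve_simp J n. lift E 0 f \<bullet> k n \<sigma> = h' n \<sigma>)"
    using H unfolding lax_colimit_def by blast
  have id: "lift E 0 (Ide (lev E 0) c) \<bullet> l n \<sigma> = l n \<sigma>" "c \<in> Obj (lev E 0)" "l n \<sigma> \<in> Arr (total E)" "Cod (total E) (l n \<sigma>) = (0, c)"
    if "lax_cocone E J Fo Fa c l" "\<sigma> \<in> nerve_simp J n" for c l n \<sigma>
    using that by (auto simp: lax_cocone_def hom_def)
  obtain f where f: "f \<in> hom (lev E 0) D H" "\<And>n \<sigma>. \<sigma> \<in> nerve_simp J n \<Longrightarrow> lift E 0 f \<bullet> h n \<sigma> = k n \<sigma>"
    using hu[OF k] by blast
  obtain g where g: "g \<in> hom (lev E 0) H D" "\<And>n \<sigma>. \<sigma> \<in> nerve_simp J n \<Longrightarrow> lift E 0 g \<bullet> k n \<sigma> = h n \<sigma>"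
    using ku[OF h] by blast
  have fg: "f \<in> Arr (lev E 0)" "Dom (lev E 0) f = D" "Cod (lev E 0) f = H"
    "g \<in> Arr (lev E 0)" "Dom (lev E 0) g = H" "Cod (lev E 0) g = D"
    using f(1) g(1) by (auto simp: hom_def)
  have O: "D \<in> Obj (lev E 0)" "H \<in> Obj (lev E 0)" using h k by (simp_all add: lax_cocone_def)
  have "lift E 0 (g \<cdot>\<^bsub>lev E 0\<^esub> f) \<bullet> h n \<sigma> = h n \<sigma>" if "\<sigma> \<in> nerve_simp J n" for n \<sigma>
    using f(2)[OF that] g(2)[OF that] id[OF h that] fg by simp
  then have "g \<cdot>\<^bsub>lev E 0\<^esub> f = Ide (lev E 0) D"
    using hu[OF h] id(1)[OF h] lev.Comp_in[OF f(1) g(1)] lev.Ide_in[OF O(1)] by blast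
  moreover have "lift E 0 (f \<cdot>\<^bsub>lev E 0\<^esub> g) \<bullet> k n \<sigma> = k n \<sigma>" if "\<sigma> \<in> nerve_simp J n" for n \<sigma>
    using f(2)[OF that] g(2)[OF that] id[OF k that] fg by simp
  then have "f \<cdot>\<^bsub>lev E 0\<^esub> g = Ide (lev E 0) H"
    using ku[OF k] id(1)[OF k] lev.Comp_in[OF g(1) f(1)] lev.Ide_in[OF O(2)] by blast
  ultimately have "inverse_arrows (lev E 0) f g"
    using fg by (simp add: inverse_arrows_def hom_def)
  then show ?thesis
    using f(1) unfolding isomorphic_def iso_arrow_def by blast
qed

lemma hocolim_lax_colimit:
  assumes F: "is_functor J (lev E 0) Fo Fa" and H: "is_hocolim E J Fo Fa H"
  shows "lax_colimit E J Fo Fa H"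
proof -
  obtain T \<Phi> where t: "\<forall>i \<in> Obj J. \<forall>j \<in> Obj J. is_tensor E (nerve (coslice J i)) (Fo j) (T i j) (\<Phi> i j)"
    and coend: "is_coend (lev E 0) J T (\<lambda>u v. tensor_map E (nerve (coslice J (Cod J u)))
             (T (Cod J u) (Dom J v)) (\<Phi> (Cod J u) (Dom J v)) (T (Dom J u) (Cod J v)) (\<Phi> (Dom J u) (Cod J v))
             (nerve_map (coslice_map J u)) (Fa v)) H"
    using H unfolding is_hocolim_def by blast
  interpret F: is_functor J "lev E 0" Fo Fa by (rule F)
  interpret tensored_diagram E J Fo Fa T \<Phi> by unfold_locales (use t in blast)
  show ?thesis using coend coend_iff_lax_colimit by blast
qed

text \<open>A homotopy colimit comprises a family of tensors, so one is chosen. Any choice works,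
  because the coend property is equivalent to one in which the tensors no longer occur.\<close>

lemma lax_colimit_hocolim:
  assumes F: "is_functor J (lev E 0) Fo Fa" and H: "lax_colimit E J Fo Fa H"
    and t: "\<forall>i \<in> Obj J. \<forall>j \<in> Obj J. \<exists>T \<Phi>. is_tensor E (nerve (coslice J i)) (Fo j) T \<Phi>"
  shows "is_hocolim E J Fo Fa H"
proof -
  define P where "P i j = (SOME p. is_tensor E (nerve (coslice J i)) (Fo j) (fst p) (snd p))" for i j
  have P: "is_tensor E (nerve (coslice J i)) (Fo j) (fst (P i j)) (snd (P i j))" if "i \<in> Obj J" "j \<in> Obj J" for i j
  proof -
    have "\<exists>p. is_tensor E (nerve (coslice J i)) (Fo j) (fst p) (snd p)"
      using t that by (metis fst_conv snd_conv)
    then show ?thesis unfolding P_def by (rule someI_ex)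
  qed
  interpret F: is_functor J "lev E 0" Fo Fa by (rule F)
  interpret tensored_diagram E J Fo Fa "\<lambda>i j. fst (P i j)" "\<lambda>i j. snd (P i j)" by unfold_locales (rule P)
  show ?thesis
    unfolding is_hocolim_def using P coend_iff_lax_colimit[of H] H
    by (intro exI[of _ "\<lambda>i j. fst (P i j)"] exI[of _ "\<lambda>i j. snd (P i j)"]) blast
qed

end

text \<open>Neither colimit is assumed to exist, so the isomorphism is expressed as isomorphism of
  any two candidates together with transfer of existence, for every choice of companions. Tensors
  are a condition in one direction because they are part of what a homotopy colimit is. Both notions
  reduce to \<open>lax_colimit\<close>, which determines its object up to isomorphism.\<close>

theorem theorem4:
  fixes E :: "('o, 'a) scat" and J :: "('j, 'k) cat"
    and Fo :: "'j \<Rightarrow> 'o" and Fa :: "'k \<Rightarrow> 'a"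
  assumes "equipment E"
    and "category J" 
    and "is_functor J (lev E 0) Fo Fa"
  shows "(\<exists>C \<phi> \<psi>. is_companion E C \<phi> \<psi>) \<and>
    (\<forall>C \<phi> \<psi>. is_companion E C \<phi> \<psi> \<longrightarrow>
       (\<forall>D H. is_dcolim E J (companion_diagram_obj C Fa) (companion_diagram_str \<psi> Fa) D \<and>
              is_hocolim E J Fo Fa H \<longrightarrow> isomorphic (lev E 0) D H) \<and>
       ((\<exists>H. is_hocolim E J Fo Fa H) \<longrightarrow>
          (\<exists>D. is_dcolim E J (companion_diagram_obj C Fa) (companion_diagram_str \<psi> Fa) D)) \<and>
       ((\<exists>D. is_dcolim E J (companion_diagram_obj C Fa) (companion_diagram_str \<psi> Fa) D) \<and>
        (\<forall>i \<in> Obj J. \<forall>j \<in> Obj J. \<exists>T \<Phi>. is_tensor E (nerve (coslice J i)) (Fo j) T \<Phi>) \<longrightarrow>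
          (\<exists>H. is_hocolim E J Fo Fa H)))"
proof (rule conjI)
  interpret simplicial_category E using assms(1) by (simp add: equipment_def)
  interpret F: is_functor J "lev E 0" Fo Fa by (rule assms(3))
  show "\<exists>C \<phi> \<psi>. is_companion E C \<phi> \<psi>" by (rule equipment.ex_companion[OF assms(1)])
  have dcolim: "is_dcolim E J (companion_diagram_obj C Fa) (companion_diagram_str \<psi> Fa) D \<longleftrightarrow> lax_colimit E J Fo Fa D"
    if "is_companion E C \<phi> \<psi>" for C \<phi> \<psi> D
  proof -
    interpret companion_diagram E C \<phi> \<psi> J Fo Fa by unfold_locales (rule that)
    show ?thesis by (rule dcolim_iff_lax_colimit)
  qed
  note hocolim = hocolim_lax_colimit[OF assms(3)] lax_colimit_hocolim[OF assms(3)]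
  show "\<forall>C \<phi> \<psi>. is_companion E C \<phi> \<psi> \<longrightarrow>
       (\<forall>D H. is_dcolim E J (companion_diagram_obj C Fa) (companion_diagram_str \<psi> Fa) D \<and>
              is_hocolim E J Fo Fa H \<longrightarrow> isomorphic (lev E 0) D H) \<and>
       ((\<exists>H. is_hocolim E J Fo Fa H) \<longrightarrow>
          (\<exists>D. is_dcolim E J (companion_diagram_obj C Fa) (companion_diagram_str \<psi> Fa) D)) \<and>
       ((\<exists>D. is_dcolim E J (companion_diagram_obj C Fa) (companion_diagram_str \<psi> Fa) D) \<and>
        (\<forall>i \<in> Obj J. \<forall>j \<in> Obj J. \<exists>T \<Phi>. is_tensor E (nerve (coslice J i)) (Fo j) T \<Phi>) \<longrightarrow>
          (\<exists>H. is_hocolim E J Fo Fa H))"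
    using dcolim hocolim lax_colimit_isomorphic by metis
qed

end
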